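(* Let $\phi$ be a smooth function on $[0,\infty)$ such that $\phi \equiv 1$ on a neighborhood of $0$ and $\phi(x)=0$ for $x>2$. Let $0<a<\frac{2}{9}$. Then there exist a constant $c=c(a)>0$ and a function $\eta(D)\to 0$ as $D\to\infty$ such that for every sufficiently large $D$ there is a fundamental discriminant $d$ with $4D\le |d|\le 8D$ satisfying \[ \sum_{n\ge 1}\frac{\chi_d(n)}{\sqrt{n}}\,\phi\!\left(\frac{n}{D^{a}}\right)\;\le\; -\exp\!\left((c(a)+\eta(D))\sqrt{\frac{\log D}{\log\log D}}\right). \]
   Context: For a fundamental discriminant $d$, $\chi_d$ denotes the associated real primitive quadratic character (Kronecker symbol $\left(\frac{d}{\cdot}\right)$). *)

theory Defs
  imports "HOL-Analysis.Analysis" "HOL-Number_Theory.Number_Theory"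
    "HOL-Computational_Algebra.Squarefree"
begin

text \<open>The value \<open>d = 1\<close> is included, following the usual convention.\<close>

definition fundamental_discriminant :: "int \<Rightarrow> bool" where
  "fundamental_discriminant d \<longleftrightarrow>
     (d mod 4 = 1 \<and> squarefree d) \<or>
     (\<exists>m. d = 4 * m \<and> (m mod 4 = 2 \<or> m mod 4 = 3) \<and> squarefree m)"

text \<open>At \<open>p = 2\<close> the Kronecker symbol is not \<^const>\<open>Legendre\<close>: it depends on \<open>d\<close> modulo 8.\<close>

definition kronecker_prime :: "int \<Rightarrow> nat \<Rightarrow> int" where
  "kronecker_prime d p =
     (if p = 2 then
        (if even d then 0 else if d mod 8 = 1 \<or> d mod 8 = 7 then 1 else -1)
      else Legendre d (int p))"

definition kronecker :: "int \<Rightarrow> nat \<Rightarrow> int" where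
  "kronecker d n =
     (if n = 0 then (if \<bar>d\<bar> = 1 then 1 else 0)
      else (\<Prod>p\<in>prime_factors n. kronecker_prime d p ^ multiplicity p n))"

text \<open>Infinite differentiability on \<open>S\<close>, witnessed by the sequence \<open>g\<close> of successive
  derivatives. The derivatives are taken within \<open>S\<close>, hence one-sided at boundary points
  of an interval.\<close>

definition smooth_real_on :: "real set \<Rightarrow> (real \<Rightarrow> real) \<Rightarrow> bool" where
  "smooth_real_on S f \<longleftrightarrow>
     (\<exists>g :: nat \<Rightarrow> real \<Rightarrow> real. (\<forall>x\<in>S. g 0 x = f x) \<and>
        (\<forall>k. \<forall>x\<in>S. (g k has_real_derivative g (Suc k) x) (at x within S)))"

end

theory Submission
  imports Defs "HOL-Real_Asymp.Real_Asymp"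
begin

text \<open>
  Only the discriminants \<open>d = 8 m\<close> with \<open>m\<close> odd and squarefree in \<open>(D/2, D]\<close> are used. By the
  Polya-Vinogradov inequality the values \<open>\<chi>\<^sub>d(p)\<close> behave like independent random signs \<open>f p\<close> when
  tested against short Dirichlet polynomials, and one argues with the expectation in this model.

  Write \<open>S\<close> for the sum in question, \<open>x = D\<^sup>a\<close>, and suppose \<open>S > - M\<close> for all \<open>d\<close>. Then
  \<open>E[W B\<^sup>2 (S + M)]\<close> is essentially nonnegative, where \<open>W = \<Prod>(1 - \<kappa> \<omega> f p / sqrt p)\<close> runs over the
  primes in \<open>(log D, (log D)\<^sup>2]\<close>, \<open>\<omega>\<^sup>2\<close> is a small multiple of \<open>log D / log log D\<close>, and
  \<open>B = 1 - \<Sum>\<plusminus> f p / sqrt p\<close> runs over primes \<open>p\<close> slightly below \<open>x\<close>. Expanding \<open>B\<^sup>2\<close> gives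
  \<open>\<Phi>(x) + M\<close> (up to a bounded factor) minus \<open>2 \<Sum>\<bar>\<Phi>(x/p)\<bar> / p\<close> for \<open>\<Phi>(u) = E[W S\<^sub>u]\<close>, if the signs are those of
  \<open>\<Phi>(x/p)\<close>. Now \<open>\<Phi>(x) = O(log D)\<close>, whereas for the much smaller \<open>u = x/p\<close> the number \<open>\<Phi>(u)\<close> is a
  polynomial in \<open>\<kappa>\<close> of degree \<open>J\<close> of the order of \<open>sqrt (log D / log log D)\<close> with a coefficient
  exceeding \<open>e\<^sup>c\<^sup>J\<close> for a large \<open>c\<close>; by Lagrange interpolation it is exponentially large at one of the nodes
  \<open>\<kappa> = i/J\<close>, and by pigeonhole one node serves a proportion \<open>1/(J+1)\<close> of the primes \<open>p\<close>. Hence \<open>M\<close> is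
  exponentially large in \<open>J\<close>.

  To apply the averaging, \<open>W\<close> is replaced by the square of a truncation of its square root, with an error
  controlled by Rankin's trick in the degree. The coefficients of the resulting polynomial sum to
  \<open>x\<^sup>3\<^sup>/\<^sup>2 D\<^sup>o\<^sup>(\<^sup>1\<^sup>)\<close> and its frequencies are at most \<open>x\<^sup>3 D\<^sup>o\<^sup>(\<^sup>1\<^sup>)\<close>, so the averaging error is
  \<open>x\<^sup>9\<^sup>/\<^sup>4 D\<^sup>1\<^sup>/\<^sup>2\<^sup>+\<^sup>o\<^sup>(\<^sup>1\<^sup>)\<close>, which is \<open>o(D)\<close> exactly when \<open>a < 2/9\<close>.
\<close>

section \<open>The Polya-Vinogradov inequality\<close>

text \<open>The factor \<open>B\<close> is forced by the behaviour of the tilt at length x. There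
  the mean of \<open>S\<close> against \<open>W\<close> is small, not very negative: the tilted
  coefficients have the Dirichlet series zeta(1 + 2z) times a short Euler product, and the sum has
  already settled to the contribution of the pole at 0. At the shorter lengths x/p it has not: at
  most \<open>J\<close> of the tilted primes fit below 2x/p, so the product is cut off in its
  alternating expansion and the sum is huge, with a sign that is not under control. Multiplying by
  \<open>f p\<close> moves weight from length x to length x/p, and the free sign of that term makes
  the unknown sign harmless.

  The constants form one chain. The spare exponent 1/2 - 9a/4 is cut into 12 parts \<theta>. The
  truncation degree \<theta> log D / log log D must dominate \<omega>^2, whence \<open>c0\<close> =
  \<theta>/100. Interpolation costs 24^J, where \<open>J\<close> is about six times the degree j of
  the large coefficient, whence the factor 24^6 in \<rho>. What is left is a gain exp(\<rho> s/3)
  with s = sqrt(log D / log log D), and \<open>M\<close> is chosen as its square root.\<close>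

lemma Legendre_values: "Legendre a p \<in> {-1, 0, 1}"
  by (auto simp: Legendre_def)

text \<open>Euler's criterion makes both sides congruent modulo \<open>p\<close>; they lie in {-1,
  0, 1}, so they differ by at most 2, which is less than \<open>p\<close>.\<close>

lemma Legendre_mult:
  fixes p :: nat
  assumes "prime p" "2 < p"
  shows "Legendre (a * b) p = Legendre a p * Legendre b p"
proof -
  let ?k = "(p - 1) div 2"
  have "[Legendre (a * b) p = (a * b) ^ ?k] (mod p)"
    by (rule euler_criterion[OF assms])
  moreover have "[Legendre a p * Legendre b p = a ^ ?k * b ^ ?k] (mod p)"
    by (intro cong_mult euler_criterion[OF assms])
  ultimately have "[Legendre (a * b) p = Legendre a p * Legendre b p] (mod p)"
    by (metis cong_sym cong_trans power_mult_distrib)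
  hence dvd: "int p dvd Legendre (a * b) p - Legendre a p * Legendre b p"
    by (simp add: cong_iff_dvd_diff)
  have "\<bar>Legendre (a * b) p - Legendre a p * Legendre b p\<bar> \<le> 2"
    using Legendre_values[of "a*b" p] Legendre_values[of a p] Legendre_values[of b p] by auto
  thus ?thesis using dvd dvd_imp_le_int[OF _ dvd] assms(2) by fastforce
qed

lemma Legendre_cong:
  assumes "[a = b] (mod p)"
  shows "Legendre a p = Legendre b p"
proof -
  have "[a = 0] (mod p) \<longleftrightarrow> [b = 0] (mod p)"
    using assms cong_sym cong_trans by blast
  moreover have "QuadRes p a \<longleftrightarrow> QuadRes p b"
    unfolding QuadRes_def using assms cong_sym cong_trans by blast
  ultimately show ?thesis by (simp add: Legendre_def)
qed

lemma Legendre_eq_0_iff: "Legendre a p = 0 \<longleftrightarrow> p dvd a"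
  by (auto simp: Legendre_def cong_0_iff)

lemma Legendre_1: "1 < p \<Longrightarrow> Legendre 1 p = 1"
  unfolding Legendre_def QuadRes_def
  by (auto simp: cong_0_iff intro!: exI[of _ 1])

text \<open>Without a nonresidue, squaring maps 1, ..., p - 1 onto itself modulo \<open>p\<close>
  and is therefore injective, although 1 and p - 1 have the same square. A nonresidue is what later
  makes the character modulo a squarefree number primitive.\<close>

lemma exists_nonresidue:
  fixes p :: nat
  assumes "prime p" "2 < p"
  shows "\<exists>a. Legendre a p = -1"
proof (rule ccontr)
  assume no: "\<nexists>a. Legendre a p = -1"
  define A where "A = {1..int p - 1}"
  define sq where "sq = (\<lambda>y::int. y ^ 2 mod int p)"
  have pp: "prime (int p)" using assms by simp
  have ndvd: "\<not> int p dvd y" if "y \<in> A" for y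
    using that zdvd_imp_le[of "int p" y] by (auto simp: A_def)
  have "sq ` A \<subseteq> A"
  proof
    fix z assume "z \<in> sq ` A"
    then obtain y where y: "y \<in> A" "z = sq y" by blast
    have "\<not> int p dvd y ^ 2" using ndvd[OF y(1)] pp prime_dvd_power by blast
    hence "z \<noteq> 0" using y by (auto simp: sq_def dvd_eq_mod_eq_0)
    moreover have "0 \<le> z" "z < int p" using assms y by (auto simp: sq_def)
    ultimately show "z \<in> A" by (auto simp: A_def)
  qed
  moreover have "A \<subseteq> sq ` A"
  proof
    fix z assume z: "z \<in> A"
    have "Legendre z p \<noteq> 0" using ndvd[OF z] by (simp add: Legendre_eq_0_iff)
    hence "Legendre z p = 1" using Legendre_values[of z p] no by auto
    hence "QuadRes (int p) z" by (auto simp: Legendre_def split: if_splits)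
    then obtain y where y: "[y^2 = z] (mod int p)" by (auto simp: QuadRes_def)
    have 1: "z mod int p = z" using z by (auto simp: A_def)
    define w where "w = y mod int p"
    have "\<not> int p dvd y"
    proof
      assume "int p dvd y"
      hence "int p dvd y^2" by (simp add: power2_eq_square)
      hence "int p dvd z" using y cong_dvd_iff by blast
      thus False using ndvd z by blast
    qed
    hence "w \<noteq> 0" by (auto simp: w_def dvd_eq_mod_eq_0)
    moreover have "0 \<le> w" "w < int p" using assms by (auto simp: w_def)
    ultimately have "w \<in> A" by (auto simp: A_def)
    moreover have "sq w = z" using y 1 by (simp add: sq_def w_def cong_def power_mod)
    ultimately show "z \<in> sq ` A" by blast
  qed
  ultimately have "sq ` A = A" by blast
  hence "inj_on sq A" by (intro eq_card_imp_inj_on) (auto simp: A_def)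
  moreover have "sq 1 = sq (int p - 1)"
  proof -
    have "(int p - 1)^2 = 1 + int p * (int p - 2)" by (simp add: power2_eq_square algebra_simps)
    thus ?thesis unfolding sq_def by (metis mod_mult_self2 power_one)
  qed
  moreover have "1 \<in> A" "int p - 1 \<in> A" using assms by (auto simp: A_def)
  ultimately have "1 = int p - 1" by (meson inj_onD)
  thus False using assms by linarith
qed

section \<open>Kronecker symbol: values, multiplicativity in both arguments, periodicity\<close>

lemma kronecker_prime_values: "kronecker_prime d p \<in> {-1, 0, 1}"
  using Legendre_values by (auto simp: kronecker_prime_def)

lemma kronecker_1 [simp]: "kronecker d (Suc 0) = 1"
  by (simp add: kronecker_def)

text \<open>Over a common set of primes products can be compared factor by factor; multiplicativity
  in the lower argument then reduces to additivity of multiplicities.\<close>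

lemma kronecker_eq_prod:
  assumes "n > 0" "finite P" "prime_factors n \<subseteq> P" "\<And>p. p \<in> P \<Longrightarrow> prime p"
  shows "kronecker d n = (\<Prod>p\<in>P. kronecker_prime d p ^ multiplicity p n)"
proof -
  have "(\<Prod>p\<in>P. kronecker_prime d p ^ multiplicity p n)
      = (\<Prod>p\<in>prime_factors n. kronecker_prime d p ^ multiplicity p n)"
  proof (rule prod.mono_neutral_right[OF assms(2,3)], safe)
    fix p assume p: "p \<in> P" "p \<notin># prime_factorization n"
    have "prime p" using p assms by blast
    hence "\<not> p dvd n" using p assms(1) by (auto simp: prime_factors_dvd)
    thus "kronecker_prime d p ^ multiplicity p n = 1" by (simp add: not_dvd_imp_multiplicity_0)
  qed
  thus ?thesis using assms by (simp add: kronecker_def)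
qed

lemma kronecker_mult_right:
  assumes "m > 0" "n > 0"
  shows "kronecker d (m * n) = kronecker d m * kronecker d n"
proof -
  let ?P = "prime_factors m \<union> prime_factors n"
  have P: "finite ?P" "\<And>p. p \<in> ?P \<Longrightarrow> prime p" by auto
  have 0: "prime_factors (m * n) = ?P" using assms by (simp add: prime_factors_product)
  have 1: "multiplicity p (m * n) = multiplicity p m + multiplicity p n" if "p \<in> ?P" for p
    using that assms by (intro prime_elem_multiplicity_mult_distrib) auto
  have "kronecker d (m * n) = (\<Prod>p\<in>?P. kronecker_prime d p ^ multiplicity p (m * n))"
    using assms P 0 by (intro kronecker_eq_prod) auto
  also have "\<dots> = (\<Prod>p\<in>?P. kronecker_prime d p ^ multiplicity p m * kronecker_prime d p ^ multiplicity p n)"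
    by (intro prod.cong refl) (simp add: 1 power_add)
  also have "\<dots> = kronecker d m * kronecker d n"
    unfolding prod.distrib
    using kronecker_eq_prod[of m ?P d] kronecker_eq_prod[of n ?P d] assms P by simp
  finally show ?thesis .
qed

lemma odd_prime_factor:
  assumes "odd (n::nat)" "p \<in> prime_factors n"
  shows "prime p" "2 < p"
proof -
  show p: "prime p" using assms by auto
  have "p \<noteq> 2" using assms by auto
  thus "2 < p" using p prime_ge_2_nat[of p] by linarith
qed

lemma kronecker_mult_left:
  assumes "odd n"
  shows "kronecker (d * e) n = kronecker d n * kronecker e n"
proof -
  have "n > 0" using assms by (cases n) auto
  have "kronecker_prime (d * e) p = kronecker_prime d p * kronecker_prime e p"
    if "p \<in> prime_factors n" for p
    using odd_prime_factor[OF assms that] Legendre_mult by (simp add: kronecker_prime_def)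
  thus ?thesis using \<open>n > 0\<close>
    by (simp add: kronecker_def power_mult_distrib prod.distrib flip: prod.distrib)
qed

lemma kronecker_values: "kronecker d n \<in> {-1, 0, 1}"
proof -
  have 1: "x ^ k \<in> {-1, 0, 1}" if "x \<in> {-1,0,1}" for x :: int and k
    using that by (induction k) auto
  have "prod f A \<in> {-1, 0, 1}" if "finite A" "\<And>x. x \<in> A \<Longrightarrow> f x \<in> {-1,0,1}"
    for f :: "nat \<Rightarrow> int" and A
    using that
  proof (induction A rule: finite_induct)
    case (insert x F)
    have "prod f F \<in> {-1,0,1}" "f x \<in> {-1,0,1}" using insert by blast+
    hence "f x * prod f F \<in> {-1,0,1}" by auto
    thus ?case by (simp only: prod.insert[OF insert(1,2)])
  qed auto
  from this[of "prime_factors n" "\<lambda>p. kronecker_prime d p ^ multiplicity p n"]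
  show ?thesis using 1 kronecker_prime_values by (auto simp: kronecker_def)
qed

lemma kronecker_eq_0_iff:
  assumes "odd n"
  shows "kronecker d n = 0 \<longleftrightarrow> \<not> coprime d (int n)"
proof -
  have n: "n > 0" using assms by (cases n) auto
  have "kronecker d n = 0 \<longleftrightarrow> (\<exists>p\<in>prime_factors n. int p dvd d)"
  proof -
    have "kronecker_prime d p ^ multiplicity p n = 0 \<longleftrightarrow> int p dvd d" if "p \<in> prime_factors n" for p
      using odd_prime_factor[OF assms that] that
      by (auto simp: kronecker_prime_def Legendre_eq_0_iff prime_factors_multiplicity)
    thus ?thesis using n by (simp add: kronecker_def)
  qed
  also have "\<dots> \<longleftrightarrow> \<not> coprime d (int n)"
  proof
    assume "\<exists>p\<in>prime_factors n. int p dvd d"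
    then obtain p where p: "p \<in> prime_factors n" "int p dvd d" by blast
    hence "prime p" "p dvd n" using n by auto
    hence "int p dvd d" "int p dvd int n" "\<not> is_unit (int p)" using p by auto
    thus "\<not> coprime d (int n)" using not_coprimeI by blast
  next
    assume "\<not> coprime d (int n)"
    hence g: "gcd d (int n) \<noteq> 1" by (simp add: coprime_iff_gcd_eq_1)
    moreover have "gcd d (int n) > 0" using n by simp
    ultimately have "nat (gcd d (int n)) \<noteq> 1" by linarith
    then obtain p where p: "prime p" "p dvd nat (gcd d (int n))" using prime_factor_nat by blast
    hence "int p dvd gcd d (int n)"
      by (metis \<open>gcd d (int n) > 0\<close> int_dvd_int_iff nat_0_le order_less_imp_le)
    hence "int p dvd d" "int p dvd int n" by auto
    thus "\<exists>p\<in>prime_factors n. int p dvd d" using p n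
      by (intro bexI[of _ p]) (auto simp: prime_factors_dvd)
  qed
  finally show ?thesis .
qed

text \<open>Each Legendre symbol depends on its argument modulo the prime only. Oddness excludes the
  prime 2, where the value depends on the argument modulo 8.\<close>

lemma kronecker_cong:
  assumes "odd n" "[d = e] (mod int n)"
  shows "kronecker d n = kronecker e n"
proof -
  have n: "n > 0" using assms by (cases n) auto
  have "kronecker_prime d p = kronecker_prime e p" if "p \<in> prime_factors n" for p
  proof -
    have "[d = e] (mod int p)" using that n assms(2) cong_dvd_modulus
      by (metis in_prime_factors_imp_dvd int_dvd_int_iff)
    thus ?thesis using odd_prime_factor[OF assms(1) that] Legendre_cong
      by (simp add: kronecker_prime_def)
  qed
  thus ?thesis using n by (simp add: kronecker_def)
qed

section \<open>Additive characters and their sums over intervals\<close>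

definition unit_exp :: "nat \<Rightarrow> int \<Rightarrow> complex" where
  "unit_exp s k = cis (2 * pi * real_of_int k / real s)"

lemma unit_exp_add: "unit_exp s (j + k) = unit_exp s j * unit_exp s k"
  by (simp add: unit_exp_def cis_mult distrib_left add_divide_distrib)

lemma unit_exp_0 [simp]: "unit_exp s 0 = 1"
  by (simp add: unit_exp_def)

lemma norm_unit_exp [simp]: "norm (unit_exp s k) = 1"
  by (simp add: unit_exp_def)

lemma unit_exp_eq_1_iff:
  assumes "s > 0"
  shows "unit_exp s k = 1 \<longleftrightarrow> int s dvd k"
proof
  assume "unit_exp s k = 1"
  hence "cos (2 * pi * real_of_int k / real s) = 1"
    by (simp add: unit_exp_def complex_eq_iff)
  then obtain j :: int where "2 * pi * real_of_int k / real s = of_int j * 2 * pi"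
    using cos_one_2pi_int by blast
  hence "real_of_int k = of_int (j * int s)" using assms by (simp add: field_simps)
  hence "k = j * int s" by linarith
  thus "int s dvd k" by simp
next
  assume "int s dvd k"
  then obtain j where "k = int s * j" by blast
  thus "unit_exp s k = 1" using assms
    using cos_int_2pin[of j] sin_int_2pin[of j]
    by (simp add: unit_exp_def complex_eq_iff mult_ac)
qed

lemma unit_exp_cong:
  assumes "s > 0" "[j = k] (mod int s)"
  shows "unit_exp s j = unit_exp s k"
proof -
  have "unit_exp s (j - k) = 1" using assms by (simp add: unit_exp_eq_1_iff cong_iff_dvd_diff)
  thus ?thesis using unit_exp_add[of s "j - k" k] by simp
qed

lemma unit_exp_minus: "unit_exp s (- k) = cnj (unit_exp s k)"
  by (simp add: unit_exp_def cis_cnj)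

lemma unit_exp_mult_nat: "unit_exp s (h * int j) = unit_exp s h ^ j"
proof (induction j)
  case (Suc j)
  have "h * int (Suc j) = h + h * int j" by (simp add: algebra_simps)
  thus ?case by (simp only: unit_exp_add Suc power_Suc)
qed simp

lemma sum_unit_exp_residues:
  assumes "s > 0"
  shows "(\<Sum>h\<in>{0..<int s}. unit_exp s (h * k)) = (if int s dvd k then of_nat s else 0)"
proof -
  have "(\<Sum>h\<in>{0..<int s}. unit_exp s (h * k)) = (\<Sum>h\<in>{0..<s}. unit_exp s (int h * k))"
    by (rule sum.reindex_bij_witness[of _ int nat]) auto
  also have "\<dots> = (\<Sum>h<s. unit_exp s k ^ h)"
    by (intro sum.cong) (auto simp: mult.commute[of _ k] unit_exp_mult_nat)
  also have "\<dots> = (if int s dvd k then of_nat s else 0)"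
  proof (cases "int s dvd k")
    case False
    hence "unit_exp s k \<noteq> 1" using unit_exp_eq_1_iff assms by simp
    hence "(\<Sum>h<s. unit_exp s k ^ h) = (unit_exp s k ^ s - 1) / (unit_exp s k - 1)"
      by (rule geometric_sum)
    moreover have "unit_exp s k ^ s = 1"
      using unit_exp_eq_1_iff[OF assms, of "k * int s"] by (simp add: unit_exp_mult_nat)
    ultimately show ?thesis using False by simp
  qed (use assms unit_exp_eq_1_iff[of s k] in simp)
  finally show ?thesis .
qed

text \<open>A geometric sum with ratio \<open>w\<close>, hence at most 2 / |w - 1| = 1 / |sin (pi h
  / s)|. Bounding by the sum of the contributions of \<open>h\<close> and \<open>s - h\<close>,
  instead of by the larger one, avoids a case distinction when the estimate is summed over
  \<open>h\<close>.\<close>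

lemma norm_sum_unit_exp_le:
  fixes h :: nat and a b :: int
  assumes "0 < h" "h < s"
  shows "norm (\<Sum>m\<in>{a<..b}. unit_exp s (- (int h * m))) \<le> (s / h + s / (s - h)) / 2"
proof -
  define w where "w = unit_exp s (- int h)"
  have wne: "w \<noteq> 1"
  proof
    assume "w = 1"
    hence "int s dvd int h" using assms by (simp add: w_def unit_exp_eq_1_iff)
    thus False using assms by (simp add: nat_dvd_not_less)
  qed
  have R: "0 \<le> real s / h + real s / (s - h)" by simp
  show ?thesis
  proof (cases "a < b")
    case True
    define n where "n = nat (b - a)"
    have "(\<Sum>m\<in>{a<..b}. unit_exp s (- (int h * m))) = (\<Sum>j<n. unit_exp s (- (int h * (a + 1 + int j))))"
      by (rule sum.reindex_bij_witness[of _ "\<lambda>j. a + 1 + int j" "\<lambda>m. nat (m - a - 1)"])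
         (use True in \<open>auto simp: n_def\<close>)
    also have "\<dots> = (\<Sum>j<n. unit_exp s (- (int h * (a + 1))) * w ^ j)"
    proof (intro sum.cong refl)
      fix j
      have "- (int h * (a + 1 + int j)) = - (int h * (a + 1)) + (- int h) * int j"
        by (simp add: algebra_simps)
      thus "unit_exp s (- (int h * (a + 1 + int j))) = unit_exp s (- (int h * (a + 1))) * w ^ j"
        unfolding w_def unit_exp_mult_nat[symmetric] unit_exp_add[symmetric] by simp
    qed
    also have "norm \<dots> = norm (\<Sum>j<n. w ^ j)"
      by (simp add: sum_distrib_left[symmetric] norm_mult)
    also have "\<dots> = norm (w ^ n - 1) / norm (w - 1)"
      by (simp add: geometric_sum[OF wne] norm_divide)
    also have "\<dots> \<le> 2 / norm (w - 1)"
    proof -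
      have "norm (w ^ n - 1) \<le> norm (w ^ n) + norm (1::complex)" by (rule norm_triangle_ineq4)
      also have "\<dots> = 2" by (simp add: w_def norm_power)
      finally show ?thesis by (simp add: divide_right_mono)
    qed
    also have "norm (w - 1) = 2 * \<bar>sin (pi * h / s)\<bar>"
    proof -
      have "w = cis (2 * (- pi * h / s))" by (simp add: w_def unit_exp_def mult.assoc)
      moreover have "norm (cis (2 * t) - 1) = 2 * \<bar>sin t\<bar>" for t
      proof -
        have "cis (2 * t) - 1 = cis t * (cis t - cis (- t))"
          by (simp add: right_diff_distrib cis_mult)
        moreover have "cis t - cis (- t) = Complex 0 (2 * sin t)"
          by (simp add: complex_eq_iff)
        moreover have "norm (Complex 0 (2 * sin t)) = 2 * \<bar>sin t\<bar>"
          by (simp add: cmod_def real_sqrt_mult)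
        ultimately show ?thesis by (simp only: norm_mult norm_cis)
      qed
      ultimately have "norm (w - 1) = 2 * \<bar>sin (- pi * h / s)\<bar>" by (simp only:)
      thus ?thesis by simp
    qed
    also have "2 / (2 * \<bar>sin (pi * h / s)\<bar>) = 1 / \<bar>sin (pi * h / s)\<bar>" by simp
    also have "\<dots> \<le> (s / h + s / (s - h)) / 2"
    proof -
      define t where "t = real h / real s"
      have t: "0 < t" "t < 1" using assms by (auto simp: t_def)
      \<comment> \<open>Concavity of the sine on [0, pi] puts it above its chord from 0 to
        pi/2.\<close>
      have jordan: "2 * y \<le> sin (pi * y)" if "0 < y" "y \<le> 1 / 2" for y
      proof -
        have "concave_on {0..pi} sin"
          by (intro f''_le0_imp_concave[of _ _ cos "\<lambda>x. - sin x"])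
             (auto intro!: derivative_eq_intros sin_ge_zero)
        from concave_onD[OF this, of "2*y" 0 "pi/2"] show ?thesis using that by (simp add: mult_ac)
      qed
      have s1: "2 * min t (1 - t) \<le> sin (pi * t)"
      proof (cases "t \<le> 1/2")
        case False
        have "sin (pi * (1 - t)) = sin (pi * t)" by (simp add: right_diff_distrib sin_diff)
        thus ?thesis using jordan[of "1 - t"] t False by auto
      qed (use jordan[of t] t in auto)
      have pos: "0 < min t (1 - t)" using t by auto
      have "1 / \<bar>sin (pi * t)\<bar> \<le> 1 / (2 * min t (1 - t))"
        using s1 pos by (intro divide_left_mono mult_pos_pos) auto
      also have "\<dots> \<le> (1 / t + 1 / (1 - t)) / 2"
      proof -
        have "0 < 1 / t" "0 < 1 / (1 - t)" using t by auto
        hence "1 / min t (1 - t) \<le> 1 / t + 1 / (1 - t)" by (cases "t \<le> 1 - t") (simp_all add: min_def)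
        thus ?thesis by simp
      qed
      also have "1 / t = s / h" by (simp add: t_def)
      also have "1 / (1 - t) = s / (s - h)" using assms
        by (simp add: t_def of_nat_diff field_simps)
      finally show ?thesis by (simp add: t_def)
    qed
    finally show ?thesis .
  qed (use R in simp)
qed

lemma harm_upper:
  assumes "n \<ge> 1"
  shows "harm n \<le> 1 + ln (real n)"
proof -
  obtain m where m: "n = Suc m" using assms by (cases n) auto
  have "harm (Suc m) - ln (real (Suc m)) \<le> harm (Suc 0) - ln (real (Suc 0))"
    using decseqD[OF decseq_harm_diff_ln, of 0 m] by simp
  thus ?thesis by (simp add: m harm_expand)
qed

text \<open>Hypothesis \<open>prim\<close> expresses that \<open>ch\<close> is primitive modulo \<open>s\<close>.\<close>

lemma polya_vinogradov_primitive:
  fixes ch :: "int \<Rightarrow> int" and s :: nat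
  assumes s: "s > 1"
    and cong: "\<And>m n. [m = n] (mod int s) \<Longrightarrow> ch m = ch n"
    and mult: "\<And>m n. ch (m * n) = ch m * ch n"
    and vals: "\<And>m. ch m \<in> {-1, 0, 1}" "\<And>m. ch m = 0 \<longleftrightarrow> \<not> coprime m (int s)"
    and prim: "\<And>p. prime p \<Longrightarrow> p dvd s \<Longrightarrow> \<exists>a. [a = 1] (mod (int (s div p))) \<and> ch a = -1"
  shows "\<bar>\<Sum>m\<in>{a<..b}. real_of_int (ch m)\<bar> \<le> sqrt s * (1 + ln s)"
proof -
  define R where "R = {0..<int s}"
  define G where "G = (\<lambda>h. \<Sum>m\<in>R. of_int (ch m) * unit_exp s (h * m))"
  have s0: "s > 0" using s by simp
  have finR [simp]: "finite R" by (simp add: R_def)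
  have bij: "bij_betw (\<lambda>m. (c * m) mod int s) R R" if "coprime c (int s)" for c
  proof -
    have "inj_on (\<lambda>m. (c * m) mod int s) R"
    proof (rule inj_onI)
      fix x y assume xy: "x \<in> R" "y \<in> R" "(c * x) mod int s = (c * y) mod int s"
      hence "[c * x = c * y] (mod int s)" by (simp add: cong_def)
      hence "[x = y] (mod int s)" using that cong_mult_lcancel coprime_commute by blast
      thus "x = y" using xy by (simp add: R_def cong_def)
    qed
    moreover have "(\<lambda>m. (c * m) mod int s) ` R \<subseteq> R" using s0 by (auto simp: R_def)
    ultimately show ?thesis
      unfolding bij_betw_def by (metis endo_inj_surj finR)
  qed
  \<comment> \<open>Replacing \<open>m\<close> by \<open>c * m\<close> permutes the residues, so the
    Gauss sums at \<open>h\<close> and at \<open>h * c\<close> differ by the factor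
    \<open>ch c\<close>.\<close>
  have shift: "G h = of_int (ch c) * G (h * c)" if "coprime c (int s)" for h c
  proof -
    have "G h = (\<Sum>m\<in>R. of_int (ch ((c * m) mod int s)) * unit_exp s (h * ((c * m) mod int s)))"
      unfolding G_def by (rule sum.reindex_bij_betw[OF bij[OF that], symmetric])
    also have "\<dots> = (\<Sum>m\<in>R. of_int (ch (c * m)) * unit_exp s (h * (c * m)))"
    proof (intro sum.cong refl arg_cong2[where f = "(*)"] arg_cong[where f = of_int])
      fix m
      show "ch ((c * m) mod int s) = ch (c * m)" by (intro cong) (simp add: cong_def)
      show "unit_exp s (h * ((c * m) mod int s)) = unit_exp s (h * (c * m))"
        by (intro unit_exp_cong s0 cong_scalar_left) (simp add: cong_def)
    qed
    also have "\<dots> = of_int (ch c) * G (h * c)"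
      by (simp add: G_def mult sum_distrib_left mult.assoc)
    finally show ?thesis .
  qed
  have G_cong: "G h = G h'" if "[h = h'] (mod int s)" for h h'
    unfolding G_def by (intro sum.cong refl arg_cong2[where f = "(*)"] unit_exp_cong s0 cong_scalar_right that)
  \<comment> \<open>Primitivity enters here. A \<open>c\<close> congruent to 1 modulo
    \<open>s div p\<close> satisfies \<open>h * c\<close> = \<open>h\<close> modulo \<open>s\<close>
    when \<open>p\<close> divides \<open>h\<close>, while \<open>ch c = -1\<close>; so the Gauss sum
    equals its own negative.\<close>
  have G0: "G h = 0" if "\<not> coprime h (int s)" for h
  proof -
    have "gcd h (int s) > 0" "gcd h (int s) \<noteq> 1"
      using s0 that by (auto simp: coprime_iff_gcd_eq_1)
    hence "nat (gcd h (int s)) \<noteq> 1" by linarith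
    then obtain p where p: "prime p" "p dvd nat (gcd h (int s))" using prime_factor_nat by blast
    hence "int p dvd gcd h (int s)"
      by (metis \<open>gcd h (int s) > 0\<close> int_dvd_int_iff nat_0_le order_less_imp_le)
    hence ph: "int p dvd h" and ps: "p dvd s" by auto
    obtain c where c: "[c = 1] (mod (int (s div p)))" "ch c = -1" using prim[OF p(1) ps] by blast
    have "coprime c (int s)" using vals(2)[of c] c by auto
    from shift[OF this, of h] have "G h = - G (h * c)" using c by simp
    moreover have "[h * c = h] (mod int s)"
    proof -
      obtain t where t: "c - 1 = int (s div p) * t" using c(1) by (auto simp: cong_iff_dvd_diff)
      obtain u where u: "h = int p * u" using ph by blast
      have "h * c - h = h * (c - 1)" by (simp add: algebra_simps)
      also have "\<dots> = (int p * int (s div p)) * (u * t)" by (simp add: t u)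
      also have "int p * int (s div p) = int s" using ps by (simp flip: of_nat_mult)
      finally show ?thesis by (simp add: cong_iff_dvd_diff)
    qed
    ultimately show ?thesis using G_cong[of "h * c" h] by simp
  qed
  have G1: "norm (G h) = norm (G 1)" if "coprime h (int s)" for h
  proof -
    have "\<bar>ch h\<bar> = 1" using vals that by (smt (verit) insertE singletonD)
    hence "norm (of_int (ch h) :: complex) = 1" by (metis norm_of_int of_int_1 of_int_abs)
    thus ?thesis using shift[OF that, of 1] by (simp add: norm_mult)
  qed
  define P where "P = {m\<in>R. coprime m (int s)}"
  have "1 \<in> P" using s by (auto simp: P_def R_def)
  hence cardP: "card P > 0" unfolding card_gt_0_iff by (auto simp: P_def)
  have cnjG: "cnj (G h) = (\<Sum>m\<in>R. of_int (ch m) * unit_exp s (- (h * m)))" for h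
    by (simp add: G_def unit_exp_minus)
  \<comment> \<open>Parseval takes the place of an evaluation of Gauss sums: the
    \<open>card P\<close> sums at \<open>h\<close> coprime to \<open>s\<close> share one absolute
    value, and the squares of all of them add up to \<open>s * card P\<close>.\<close>
  have parseval: "(\<Sum>h\<in>R. G h * cnj (G h)) = of_nat s * of_nat (card P)"
  proof -
    have "(\<Sum>h\<in>R. G h * cnj (G h)) = (\<Sum>h\<in>R. \<Sum>m\<in>R. \<Sum>n\<in>R. of_int (ch m) * of_int (ch n) * unit_exp s (h * (m - n)))"
      unfolding cnjG unfolding G_def sum_product
    proof (intro sum.cong refl)
      fix h m n :: int
      have "h * (m - n) = h * m + (- (h * n))" by (simp add: algebra_simps)
      hence "unit_exp s (h * (m - n)) = unit_exp s (h * m) * unit_exp s (- (h * n))"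
        by (simp only: unit_exp_add)
      thus "of_int (ch m) * unit_exp s (h * m) * (of_int (ch n) * unit_exp s (- (h * n))) =
         of_int (ch m) * of_int (ch n) * unit_exp s (h * (m - n))" by simp
    qed
    also have "\<dots> = (\<Sum>m\<in>R. \<Sum>n\<in>R. \<Sum>h\<in>R. of_int (ch m) * of_int (ch n) * unit_exp s (h * (m - n)))"
    proof -
      have "(\<Sum>h\<in>R. \<Sum>m\<in>R. \<Sum>n\<in>R. of_int (ch m) * of_int (ch n) * unit_exp s (h * (m - n)))
          = (\<Sum>m\<in>R. \<Sum>h\<in>R. \<Sum>n\<in>R. of_int (ch m) * of_int (ch n) * unit_exp s (h * (m - n)))"
        by (rule sum.swap)
      also have "\<dots> = (\<Sum>m\<in>R. \<Sum>n\<in>R. \<Sum>h\<in>R. of_int (ch m) * of_int (ch n) * unit_exp s (h * (m - n)))"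
        by (intro sum.cong refl sum.swap)
      finally show ?thesis .
    qed
    also have "\<dots> = (\<Sum>m\<in>R. \<Sum>n\<in>R. of_int (ch m) * of_int (ch n) * (if int s dvd m - n then of_nat s else 0))"
      using sum_unit_exp_residues[OF s0] unfolding R_def
      by (simp add: sum_distrib_left[symmetric])
    also have "\<dots> = (\<Sum>m\<in>R. \<Sum>n\<in>R. if n = m then of_int (ch m) * of_int (ch m) * of_nat s else 0)"
    proof (intro sum.cong refl)
      fix m n assume mn: "m \<in> R" "n \<in> R"
      have "int s dvd m - n \<longleftrightarrow> n = m"
        using mn by (auto simp: R_def cong_def simp flip: cong_iff_dvd_diff)
      thus "of_int (ch m) * of_int (ch n) * (if int s dvd m - n then of_nat s else 0) =
          (if n = m then of_int (ch m) * of_int (ch m) * of_nat s else (0::complex))" by auto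
    qed
    also have "\<dots> = (\<Sum>m\<in>R. of_int (ch m) * of_int (ch m) * of_nat s)"
      by simp
    also have "\<dots> = (\<Sum>m\<in>R. if coprime m (int s) then of_nat s else 0)"
    proof (intro sum.cong refl)
      fix m
      show "of_int (ch m) * of_int (ch m) * of_nat s = (if coprime m (int s) then of_nat s else (0::complex))"
        using vals(1)[of m] vals(2)[of m] by auto
    qed
    also have "\<dots> = of_nat s * of_nat (card P)"
      by (simp add: P_def sum.If_cases Int_def conj_commute)
    finally show ?thesis .
  qed
  have normG1: "norm (G 1) ^ 2 \<le> s"
  proof -
    have "complex_of_real (\<Sum>h\<in>R. norm (G h) ^ 2) = complex_of_real (real s * card P)"
      by (simp only: of_real_sum complex_norm_square parseval) simp
    hence eq: "(\<Sum>h\<in>R. norm (G h) ^ 2) = real s * card P" by (simp only: of_real_eq_iff)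
    have "(\<Sum>h\<in>P. norm (G h) ^ 2) = (\<Sum>h\<in>P. norm (G 1) ^ 2)"
      by (intro sum.cong refl arg_cong[where f = "\<lambda>x. x ^ 2"] G1) (simp add: P_def)
    hence "real (card P) * norm (G 1) ^ 2 = (\<Sum>h\<in>P. norm (G h) ^ 2)" by simp
    also have "\<dots> \<le> (\<Sum>h\<in>R. norm (G h) ^ 2)"
      by (intro sum_mono2) (auto simp: P_def)
    finally show ?thesis using cardP eq by (simp add: mult.commute)
  qed
  have normG: "norm (G h) \<le> sqrt s" for h
    using G0[of h] G1[of h] normG1 real_le_rsqrt by (cases "coprime h (int s)") auto
  have inv: "of_nat s * of_int (ch m) = (\<Sum>h\<in>R. G h * unit_exp s (- (h * m)))" for m
  proof -
    have "(\<Sum>h\<in>R. G h * unit_exp s (- (h * m))) = (\<Sum>h\<in>R. \<Sum>n\<in>R. of_int (ch n) * unit_exp s (h * (n - m)))"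
      unfolding G_def sum_distrib_right
    proof (intro sum.cong refl)
      fix h n :: int
      have "h * (n - m) = h * n + (- (h * m))" by (simp add: algebra_simps)
      thus "of_int (ch n) * unit_exp s (h * n) * unit_exp s (- (h * m)) = of_int (ch n) * unit_exp s (h * (n - m))"
        by (simp only: unit_exp_add mult.assoc)
    qed
    also have "\<dots> = (\<Sum>n\<in>R. of_int (ch n) * (\<Sum>h\<in>R. unit_exp s (h * (n - m))))"
      by (subst sum.swap) (simp add: sum_distrib_left)
    also have "\<dots> = (\<Sum>n\<in>R. if n = m mod int s then of_nat s * of_int (ch n) else 0)"
    proof (intro sum.cong refl)
      fix n assume n: "n \<in> R"
      have "int s dvd n - m \<longleftrightarrow> n = m mod int s"
        using n by (auto simp: R_def cong_def simp flip: cong_iff_dvd_diff)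
      thus "of_int (ch n) * (\<Sum>h\<in>R. unit_exp s (h * (n - m))) =
          (if n = m mod int s then of_nat s * of_int (ch n) else 0)"
        using sum_unit_exp_residues[OF s0, of "n - m"] by (simp add: R_def)
    qed
    also have "\<dots> = of_nat s * of_int (ch (m mod int s))"
      using s0 by (simp add: R_def)
    also have "ch (m mod int s) = ch m" by (intro cong) (simp add: cong_def)
    finally show ?thesis by simp
  qed
  have "of_nat s * complex_of_real (\<Sum>m\<in>{a<..b}. real_of_int (ch m)) = (\<Sum>m\<in>{a<..b}. \<Sum>h\<in>R. G h * unit_exp s (- (h * m)))"
    by (simp add: sum_distrib_left inv)
  also have "\<dots> = (\<Sum>h\<in>R. G h * (\<Sum>m\<in>{a<..b}. unit_exp s (- (h * m))))"
    by (subst sum.swap) (simp add: sum_distrib_left)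
  \<comment> \<open>The frequency 0, whose inner sum shows no cancellation, drops out: 0 is not
    coprime to \<open>s > 1\<close>, so \<open>G 0 = 0\<close>.\<close>
  also have "\<dots> = (\<Sum>h\<in>{1..<int s}. G h * (\<Sum>m\<in>{a<..b}. unit_exp s (- (h * m))))"
  proof (rule sum.mono_neutral_right)
    show "\<forall>h\<in>R - {1..<int s}. G h * (\<Sum>m\<in>{a<..b}. unit_exp s (- (h * m))) = 0"
    proof
      fix h assume "h \<in> R - {1..<int s}"
      hence "h = 0" by (auto simp: R_def)
      moreover have "G 0 = 0" using s by (intro G0) auto
      ultimately show "G h * (\<Sum>m\<in>{a<..b}. unit_exp s (- (h * m))) = 0" by simp
    qed
  qed (auto simp: R_def)
  also have "\<dots> = (\<Sum>h\<in>{1..<s}. G (int h) * (\<Sum>m\<in>{a<..b}. unit_exp s (- (int h * m))))"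
    by (rule sum.reindex_bij_witness[of _ int nat]) auto
  finally have eq: "of_nat s * complex_of_real (\<Sum>m\<in>{a<..b}. real_of_int (ch m)) =
      (\<Sum>h\<in>{1..<s}. G (int h) * (\<Sum>m\<in>{a<..b}. unit_exp s (- (int h * m))))" .
  have "real s * \<bar>\<Sum>m\<in>{a<..b}. real_of_int (ch m)\<bar> = norm (of_nat s * complex_of_real (\<Sum>m\<in>{a<..b}. real_of_int (ch m)))"
    by (simp only: norm_mult norm_of_nat norm_of_real)
  also have "\<dots> \<le> (\<Sum>h\<in>{1..<s}. sqrt s * ((s / h + s / (s - h)) / 2))"
    unfolding eq
  proof (rule sum_norm_le)
    fix h assume "h \<in> {1..<s}"
    thus "norm (G (int h) * (\<Sum>m\<in>{a<..b}. unit_exp s (- (int h * m)))) \<le> sqrt s * ((s / h + s / (s - h)) / 2)"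
      unfolding norm_mult by (intro mult_mono normG norm_sum_unit_exp_le) auto
  qed
  also have "\<dots> = sqrt s * s / 2 * ((\<Sum>h\<in>{1..<s}. 1 / h) + (\<Sum>h\<in>{1..<s}. 1 / (s - h)))"
    by (simp add: sum_distrib_left sum.distrib[symmetric] field_simps)
  also have "(\<Sum>h\<in>{1..<s}. 1 / real (s - h)) = (\<Sum>h\<in>{1..<s}. 1 / h)"
    by (rule sum.reindex_bij_witness[of _ "\<lambda>h. s - h" "\<lambda>h. s - h"]) auto
  also have "sqrt s * s / 2 * ((\<Sum>h\<in>{1..<s}. 1 / h) + (\<Sum>h\<in>{1..<s}. 1 / real h)) = s * (sqrt s * (\<Sum>h\<in>{1..<s}. 1 / h))"
    by simp
  also have "\<dots> \<le> s * (sqrt s * (1 + ln s))"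
  proof -
    have "(\<Sum>h\<in>{1..<s}. 1 / real h) \<le> (\<Sum>h\<in>{1..s}. 1 / real h)"
      by (intro sum_mono2) auto
    also have "\<dots> = harm s" by (simp add: harm_def inverse_eq_divide)
    also have "\<dots> \<le> 1 + ln s" using s harm_upper[of s] by simp
    finally show ?thesis by (intro mult_left_mono) auto
  qed
  finally show ?thesis using s0 by simp
qed

section \<open>Estimates of Chebyshev and Mertens\<close>

lemma finite_primes_le [simp]: "finite {p::nat. prime p \<and> p \<le> n}"
  by (rule finite_subset[of _ "{..n}"]) auto

lemma prod_primes_dvd:
  fixes c :: nat
  assumes "finite P" "\<And>p. p \<in> P \<Longrightarrow> prime p" "\<And>p. p \<in> P \<Longrightarrow> p dvd c"
  shows "\<Prod>P dvd c"
  using assms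
proof (induction P rule: finite_induct)
  case (insert p P)
  have "coprime p (\<Prod>P)"
  proof (rule prod_coprime_right)
    fix q assume "q \<in> P"
    thus "coprime p q" using insert primes_coprime[of p q] by auto
  qed
  thus ?case using insert by (simp add: divides_mult)
qed simp

text \<open>Erdos's induction. For \<open>n = 2 m + 1\<close> the primes above \<open>m + 1\<close>
  all divide the central binomial coefficient, which is at most 4^m because it occurs twice in a row
  of sum 2 * 4^m. For even \<open>n > 2\<close> no prime is added.\<close>

lemma primorial_le: "(\<Prod>p | prime p \<and> p \<le> n. p) \<le> (4::nat) ^ n"
proof (induction n rule: less_induct)
  case (less n)
  consider "n < 2" | "n = 2" | "n > 2" "even n" | "n > 2" "odd n" by linarith
  thus ?case
  proof cases
    case 1
    have e: "{p::nat. prime p \<and> p \<le> n} = {}" using 1 by (auto dest: prime_ge_2_nat)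
    show ?thesis unfolding e by simp
  next
    case 2
    have "p = 2" if "prime p" "p \<le> 2" for p :: nat
      using prime_ge_2_nat[OF that(1)] that(2) by simp
    hence e: "{p::nat. prime p \<and> p \<le> n} = {2}" using 2 two_is_prime_nat by blast
    show ?thesis by (subst e) (simp add: 2)
  next
    case 3
    hence "\<not> prime n" using prime_odd_nat by blast
    hence "prime p \<and> p \<le> n \<longleftrightarrow> prime p \<and> p \<le> n - 1" for p
      using 3(1) by (cases "p = n") auto
    hence e: "{p::nat. prime p \<and> p \<le> n} = {p. prime p \<and> p \<le> n - 1}" by (intro Collect_cong)
    have "(\<Prod>p | prime p \<and> p \<le> n - 1. p) \<le> (4::nat) ^ (n - 1)" using 3 by (intro less) auto
    also have "(4::nat) ^ (n - 1) \<le> 4 ^ n" by (rule power_increasing) auto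
    finally show ?thesis unfolding e .
  next
    case 4
    then obtain m where m: "n = 2 * m + 1" by (elim oddE)
    have m1: "m \<ge> 1" using 4 m by simp
    define P where "P = {p::nat. prime p \<and> m + 1 < p \<and> p \<le> 2 * m + 1}"
    have fP: "finite P" unfolding P_def by (rule finite_subset[of _ "{..2*m+1}"]) auto
    have split: "{p::nat. prime p \<and> p \<le> n} = {p. prime p \<and> p \<le> m + 1} \<union> P"
      using m by (auto simp: P_def)
    have "\<Prod>P dvd ((2 * m + 1) choose m)"
    proof (rule prod_primes_dvd[OF fP])
      fix p assume p: "p \<in> P"
      thus pp: "prime p" by (simp add: P_def)
      have eq: "fact m * fact (m + 1) * ((2 * m + 1) choose m) = (fact (2 * m + 1) :: nat)"
        using binomial_fact_lemma[of m "2 * m + 1"] by (simp add: mult_2)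
      have "p dvd fact (2 * m + 1)"
        using p pp prime_dvd_fact_iff[of p "2 * m + 1"] by (simp only: P_def mem_Collect_eq)
      hence "p dvd fact m * fact (m + 1) * ((2 * m + 1) choose m)" by (simp only: eq)
      moreover have "\<not> p dvd fact m" "\<not> p dvd fact (m + 1)"
        using p prime_dvd_fact_iff[OF pp, of m] prime_dvd_fact_iff[OF pp, of "m + 1"]
        unfolding P_def mem_Collect_eq by linarith+
      ultimately show "p dvd ((2 * m + 1) choose m)"
        using pp prime_dvd_mult_iff by blast
    qed
    hence "\<Prod>P \<le> ((2 * m + 1) choose m)" by (rule dvd_imp_le) simp
    also have "\<dots> \<le> 4 ^ m"
    proof -
      have "(\<Sum>k\<in>{m, m + 1}. (2 * m + 1) choose k) \<le> (\<Sum>k\<le>2 * m + 1. (2 * m + 1) choose k)"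
        by (intro sum_mono2) auto
      also have "\<dots> = 2 * 4 ^ m" by (simp only: choose_row_sum power_add power_mult) simp
      finally have "((2 * m + 1) choose m) + ((2 * m + 1) choose (m + 1)) \<le> 2 * 4 ^ m" by simp
      moreover have "((2 * m + 1) choose (m + 1)) = ((2 * m + 1) choose m)"
        using binomial_symmetric[of m "2 * m + 1"] by (simp add: mult_2)
      ultimately show ?thesis by linarith
    qed
    finally have 1: "\<Prod>P \<le> 4 ^ m" .
    have "(\<Prod>p | prime p \<and> p \<le> n. p) = (\<Prod>p | prime p \<and> p \<le> m + 1. p) * \<Prod>P"
      unfolding split by (rule prod.union_disjoint) (use fP in \<open>auto simp: P_def\<close>)
    also have "\<dots> \<le> 4 ^ (m + 1) * 4 ^ m"
      using m m1 by (intro mult_mono 1 less) auto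
    also have "\<dots> = 4 ^ n" by (simp add: m power_add[symmetric])
    finally show ?thesis .
  qed
qed

lemma theta_le:
  fixes n :: nat
  shows "(\<Sum>p | prime p \<and> p \<le> n. ln (real p)) \<le> n * ln 4"
proof -
  have "(\<Sum>p | prime p \<and> p \<le> n. ln (real p)) = ln (\<Prod>p | prime p \<and> p \<le> n. real p)"
    by (rule ln_prod[symmetric]) (auto simp: prime_gt_0_nat)
  also have "\<dots> \<le> ln (4 ^ n)"
  proof (subst ln_le_cancel_iff)
    show "0 < (\<Prod>p | prime p \<and> p \<le> n. real p)" by (intro prod_pos) (auto simp: prime_gt_0_nat)
    have "real (\<Prod>p | prime p \<and> p \<le> n. p) \<le> real (4 ^ n)" using primorial_le by (subst of_nat_le_iff)
    thus "(\<Prod>p | prime p \<and> p \<le> n. real p) \<le> 4 ^ n" by simp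
  qed simp
  finally show ?thesis by (simp add: ln_realpow)
qed

lemma card_multiples_atMost:
  fixes d :: nat
  assumes "d > 0"
  shows "card {m\<in>{1..n}. d dvd m} = n div d"
proof -
  have "{m\<in>{1..n}. d dvd m} = (*) d ` {1..n div d}"
  proof (intro equalityI subsetI)
    fix m assume m: "m \<in> {m\<in>{1..n}. d dvd m}"
    then obtain k where k: "m = d * k" by blast
    hence "k \<le> n div d" using m assms by (simp add: less_eq_div_iff_mult_less_eq mult.commute)
    moreover have "k \<ge> 1" using m k by (cases k) auto
    ultimately show "m \<in> (*) d ` {1..n div d}" using k by auto
  next
    fix m assume "m \<in> (*) d ` {1..n div d}"
    then obtain k where "m = d * k" "k \<in> {1..n div d}" by blast
    hence "m = d * k" "1 \<le> k" "k \<le> n div d" by auto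
    thus "m \<in> {m\<in>{1..n}. d dvd m}" using assms
      by (auto simp: less_eq_div_iff_mult_less_eq mult.commute)
  qed
  moreover have "inj_on ((*) d) {1..n div d}" using assms by (auto simp: inj_on_def)
  ultimately show ?thesis by (simp add: card_image)
qed

lemma multiplicity_eq_card:
  fixes p m :: nat
  assumes "prime p" "m > 0"
  shows "multiplicity p m = card {k\<in>{1..m}. p ^ k dvd m}"
proof -
  have le: "k \<le> m" if "p ^ k dvd m" for k
  proof -
    have "k < 2 ^ k" by simp
    also have "(2::nat) ^ k \<le> p ^ k" using assms by (intro power_mono) (auto simp: prime_ge_2_nat)
    also have "\<dots> \<le> m" using that assms by (auto dest: dvd_imp_le)
    finally show ?thesis by simp
  qed
  have "{k\<in>{1..m}. p ^ k dvd m} = {1..multiplicity p m}"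
  proof -
    have "p ^ k dvd m \<longleftrightarrow> k \<le> multiplicity p m" for k
      using assms by (intro power_dvd_iff_le_multiplicity) auto
    thus ?thesis using le by auto
  qed
  thus ?thesis by simp
qed

text \<open>Legendre's formula for the exponents in a factorial. The range up to \<open>n\<close> is
  long enough for every \<open>p\<close> because p^k > k; terms with p^k > n vanish.\<close>

lemma ln_fact_eq:
  "ln (fact n) = (\<Sum>p | prime p \<and> p \<le> n. ln (real p) * (\<Sum>k=1..n. real (n div p ^ k)))"
proof -
  let ?P = "{p. prime p \<and> p \<le> n}"
  have ln_eq: "ln (real m) = (\<Sum>p\<in>?P. real (multiplicity p m) * ln p)" if "m \<in> {1..n}" for m
  proof -
    have "real m = real (\<Prod>p\<in>prime_factors m. p ^ multiplicity p m)"
      using that by (subst prime_factorization_nat[symmetric]) auto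
    hence "ln (real m) = ln (\<Prod>p\<in>prime_factors m. real p ^ multiplicity p m)" by simp
    also have "\<dots> = (\<Sum>p\<in>prime_factors m. ln (real p ^ multiplicity p m))"
      by (rule ln_prod) (auto simp: prime_gt_0_nat in_prime_factors_imp_prime)
    also have "\<dots> = (\<Sum>p\<in>prime_factors m. real (multiplicity p m) * ln p)"
      by (intro sum.cong refl) (auto simp: ln_realpow prime_gt_0_nat in_prime_factors_imp_prime)
    also have "\<dots> = (\<Sum>p\<in>?P. real (multiplicity p m) * ln p)"
    proof (rule sum.mono_neutral_left)
      show "prime_factors m \<subseteq> ?P"
      proof
        fix p assume p: "p \<in> prime_factors m"
        hence "p \<le> m" using that by (intro dvd_imp_le) auto
        thus "p \<in> ?P" using p that by auto
      qed
      show "\<forall>p\<in>?P - prime_factors m. real (multiplicity p m) * ln p = 0"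
        using that by (auto simp: prime_factors_multiplicity)
    qed simp
    finally show ?thesis .
  qed
  have mult: "(\<Sum>m=1..n. multiplicity p m) = (\<Sum>k=1..n. n div p ^ k)" if "p \<in> ?P" for p
  proof -
    have p: "prime p" using that by simp
    have card_if: "card {k\<in>A. P k} = (\<Sum>k\<in>A. if P k then 1 else 0)" if "finite A" for A :: "nat set" and P
      using that by (simp add: sum.If_cases Int_def)
    have "(\<Sum>m=1..n. multiplicity p m) = (\<Sum>m=1..n. card {k\<in>{1..n}. p ^ k dvd m})"
    proof (intro sum.cong refl)
      fix m assume m: "m \<in> {1..n}"
      have "{k\<in>{1..m}. p ^ k dvd m} = {k\<in>{1..n}. p ^ k dvd m}"
      proof -
        have "k \<le> m" if "p ^ k dvd m" for k
        proof -
          have "k < 2 ^ k" by simp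
          also have "(2::nat) ^ k \<le> p ^ k" using p by (intro power_mono) (auto simp: prime_ge_2_nat)
          also have "\<dots> \<le> m" using that m by (auto dest: dvd_imp_le)
          finally show ?thesis by simp
        qed
        thus ?thesis using m by (auto intro: le_trans)
      qed
      thus "multiplicity p m = card {k\<in>{1..n}. p ^ k dvd m}"
        using multiplicity_eq_card[OF p, of m] m by simp
    qed
    also have "\<dots> = (\<Sum>m=1..n. \<Sum>k=1..n. if p ^ k dvd m then 1 else 0)"
      by (simp only: card_if finite_atLeastAtMost)
    also have "\<dots> = (\<Sum>k=1..n. \<Sum>m=1..n. if p ^ k dvd m then 1 else 0)"
      by (rule sum.swap)
    also have "\<dots> = (\<Sum>k=1..n. card {m\<in>{1..n}. p ^ k dvd m})"
      by (simp only: card_if finite_atLeastAtMost)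
    also have "\<dots> = (\<Sum>k=1..n. n div p ^ k)"
      using p by (intro sum.cong refl card_multiples_atMost) (simp add: prime_gt_0_nat)
    finally show ?thesis .
  qed
  have "ln (fact n) = ln (\<Prod>m=1..n. real m)" by (simp add: fact_prod)
  also have "\<dots> = (\<Sum>m=1..n. ln (real m))" by (rule ln_prod) auto
  also have "\<dots> = (\<Sum>m=1..n. \<Sum>p\<in>?P. real (multiplicity p m) * ln p)"
    by (intro sum.cong refl ln_eq)
  also have "\<dots> = (\<Sum>p\<in>?P. ln p * real (\<Sum>m=1..n. multiplicity p m))"
    by (subst sum.swap) (simp add: sum_distrib_left mult.commute)
  also have "\<dots> = (\<Sum>p\<in>?P. ln p * (\<Sum>k=1..n. real (n div p ^ k)))"
    by (intro sum.cong refl) (simp only: mult of_nat_sum)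
  finally show ?thesis .
qed

lemma ln_fact_ge: "n * ln n - n \<le> ln (fact n :: real)"
proof (induction n)
  case (Suc n)
  show ?case
  proof (cases "n = 0")
    case False
    have "ln (real (Suc n) / n) \<le> real (Suc n) / n - 1"
      using False by (intro ln_le_minus_one) auto
    hence "ln (Suc n) - ln n \<le> 1 / n" using False by (simp add: ln_div field_simps)
    hence "n * (ln (Suc n) - ln n) \<le> n * (1 / n)" by (intro mult_left_mono) auto
    hence "n * (ln (Suc n) - ln n) \<le> 1" using False by simp
    moreover have "ln (fact (Suc n) :: real) = ln (Suc n) + ln (fact n)"
      by (simp add: ln_mult del: of_nat_Suc)
    ultimately show ?thesis using Suc.IH by (simp add: algebra_simps)
  qed simp
qed simp

lemma ln_fact_le: "ln (fact n :: real) \<le> n * ln n"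
proof (cases "n = 0")
  case False
  have "(fact n :: real) \<le> real n ^ n" using fact_le_power[of n, where ?'a = real] by simp
  hence "ln (fact n :: real) \<le> ln (real n ^ n)" using False by (subst ln_le_cancel_iff) auto
  thus ?thesis using False by (simp add: ln_realpow)
qed simp

text \<open>The right-hand side is designed to telescope: the induction step amounts to (n + 1) (ln
  (n + 1) - ln n) \<le> 2, a consequence of ln (1 + 1/n) \<le> 1/n. It bounds the contribution of
  higher prime powers in the lower Mertens estimate.\<close>

lemma sum_ln_over_square_le: "n \<ge> 1 \<Longrightarrow> (\<Sum>m=2..n. ln (real m) / (m * (real m - 1))) \<le> 2 - (ln n + 2) / n"
proof (induction n rule: dec_induct)
  case (step n)
  have n: "real n \<ge> 1" using step by simp
  have "ln (real (Suc n) / n) \<le> real (Suc n) / n - 1" using n by (intro ln_le_minus_one) auto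
  hence "ln (Suc n) - ln n \<le> 1 / n" using n by (simp add: ln_div field_simps)
  hence "(real n + 1) * (ln (Suc n) - ln n) \<le> (real n + 1) * (1 / n)" by (intro mult_left_mono) auto
  also have "\<dots> \<le> 2" using n by (simp add: field_simps)
  finally have *: "(real n + 1) * (ln (Suc n) - ln n) \<le> 2" .
  have "(\<Sum>m=2..Suc n. ln (real m) / (m * (real m - 1)))
      = (\<Sum>m=2..n. ln (real m) / (m * (real m - 1))) + ln (Suc n) / (real (Suc n) * real n)"
    using step by (simp add: algebra_simps)
  also have "\<dots> \<le> 2 - (ln n + 2) / n + ln (Suc n) / (real (Suc n) * real n)" using step by simp
  also have "\<dots> \<le> 2 - (ln (Suc n) + 2) / Suc n"
  proof -
    have "(ln n + 2) / n - (ln (Suc n) + 2) / Suc n - ln (Suc n) / (real (Suc n) * real n)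
        = (2 - (real n + 1) * (ln (Suc n) - ln n)) / (real (Suc n) * real n)"
    proof -
      have "(ln n + 2) / n = (real (Suc n) * (ln n + 2)) / (real (Suc n) * real n)"
        by (rule mult_divide_mult_cancel_left[symmetric]) simp
      moreover have "(ln (Suc n) + 2) / Suc n = (real n * (ln (Suc n) + 2)) / (real n * real (Suc n))"
        by (rule mult_divide_mult_cancel_left[symmetric]) (use n in simp)
      moreover have "real n * real (Suc n) = real (Suc n) * real n" by (rule mult.commute)
      ultimately have "(ln n + 2) / n - (ln (Suc n) + 2) / Suc n - ln (Suc n) / (real (Suc n) * real n)
         = (real (Suc n) * (ln n + 2) - real n * (ln (Suc n) + 2) - ln (Suc n)) / (real (Suc n) * real n)"
        by (simp only: diff_divide_distrib of_nat_mult)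
      also have "real (Suc n) * (ln n + 2) - real n * (ln (Suc n) + 2) - ln (Suc n)
         = 2 - (real n + 1) * (ln (Suc n) - ln n)" by (simp add: algebra_simps)
      finally show ?thesis .
    qed
    also have "\<dots> \<ge> 0" using * by simp
    finally show ?thesis by linarith
  qed
  finally show ?case .
qed simp

text \<open>Only the term \<open>k = 1\<close> of Legendre's formula is kept, with
  \<open>n div p\<close> at least n/p - 1. Chebyshev's bound pays for the subtracted sum of ln p and
  is the source of \<open>ln 4\<close>.\<close>

lemma mertens_upper:
  fixes n :: nat
  assumes "n \<ge> 1"
  shows "(\<Sum>p | prime p \<and> p \<le> n. ln (real p) / p) \<le> ln n + ln 4"
proof -
  let ?P = "{p. prime p \<and> p \<le> n}"
  have "n * (\<Sum>p\<in>?P. ln (real p) / p) - (\<Sum>p\<in>?P. ln (real p)) = (\<Sum>p\<in>?P. ln (real p) * (n / p - 1))"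
    by (simp add: sum_distrib_left sum_subtractf algebra_simps)
  also have "\<dots> \<le> (\<Sum>p\<in>?P. ln (real p) * (\<Sum>k=1..n. real (n div p ^ k)))"
  proof (intro sum_mono mult_left_mono)
    fix p assume p: "p \<in> ?P"
    hence p0: "p > 0" by (simp add: prime_gt_0_nat)
    have "real n / p - 1 \<le> real (n div p)"
      using floor_divide_of_nat_eq[of n p, where ?'a = real] by linarith
    also have "\<dots> = (\<Sum>k=1..1. real (n div p ^ k))" by simp
    also have "\<dots> \<le> (\<Sum>k=1..n. real (n div p ^ k))" using assms by (intro sum_mono2) auto
    finally show "real n / p - 1 \<le> (\<Sum>k=1..n. real (n div p ^ k))" .
    show "0 \<le> ln (real p)" using p0 by simp
  qed
  also have "\<dots> \<le> n * ln n" using ln_fact_eq[of n] ln_fact_le[of n] by simp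
  finally have "n * (\<Sum>p\<in>?P. ln (real p) / p) \<le> n * (ln n + ln 4)"
    using theta_le[of n] by (simp add: algebra_simps)
  thus ?thesis using assms by simp
qed

text \<open>Here all prime powers are kept and the floors dropped; the geometric series gives n/(p -
  1) = n/p + n/(p (p - 1)). The 3 is 1 from the Stirling bound plus 2 from the convergent second
  part.\<close>

lemma mertens_lower:
  fixes n :: nat
  assumes "n \<ge> 1"
  shows "ln n - 3 \<le> (\<Sum>p | prime p \<and> p \<le> n. ln (real p) / p)"
proof -
  let ?P = "{p. prime p \<and> p \<le> n}"
  have "n * ln n - n \<le> (\<Sum>p\<in>?P. ln (real p) * (\<Sum>k=1..n. real (n div p ^ k)))"
    using ln_fact_eq[of n] ln_fact_ge[of n] by simp
  also have "\<dots> \<le> (\<Sum>p\<in>?P. ln (real p) * (n / p + n / (p * (real p - 1))))"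
  proof (intro sum_mono mult_left_mono)
    fix p assume p: "p \<in> ?P"
    hence p2: "p \<ge> 2" by (simp add: prime_ge_2_nat)
    have geo: "(\<Sum>k=1..N. (1 / real p) ^ k) \<le> 1 / (real p - 1)" for N
    proof -
      have "(\<Sum>k=1..N. (1 / real p) ^ k) = (1 - (1 / real p) ^ N) / (real p - 1)"
      proof (induction N)
        case (Suc N)
        define X where "X = (1 / real p) ^ Suc N"
        have "(1 / real p) ^ N = real p * X" using p2 by (simp add: X_def)
        hence "(\<Sum>k=1..Suc N. (1 / real p) ^ k) = (1 - real p * X) / (real p - 1) + X"
          using Suc by (simp add: X_def)
        also have "\<dots> = (1 - X) / (real p - 1)" using p2 by (simp add: divide_simps) (simp add: algebra_simps)
        finally show ?case by (simp add: X_def)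
      qed simp
      also have "\<dots> \<le> 1 / (real p - 1)" using p2 by (intro divide_right_mono) auto
      finally show ?thesis .
    qed
    have "(\<Sum>k=1..n. real (n div p ^ k)) \<le> (\<Sum>k=1..n. n * (1 / real p) ^ k)"
    proof (intro sum_mono)
      fix k
      have "real (n div p ^ k) \<le> real n / real (p ^ k)"
        using floor_divide_of_nat_eq[of n "p ^ k", where ?'a = real] by linarith
      thus "real (n div p ^ k) \<le> n * (1 / real p) ^ k" by (simp add: power_divide)
    qed
    also have "\<dots> = n * (\<Sum>k=1..n. (1 / real p) ^ k)" by (simp add: sum_distrib_left)
    also have "\<dots> \<le> n * (1 / (real p - 1))" by (intro mult_left_mono geo) auto
    also have "\<dots> = n / p + n / (p * (real p - 1))" using p2 by (simp add: field_simps of_nat_diff)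
    finally show "(\<Sum>k=1..n. real (n div p ^ k)) \<le> n / p + n / (p * (real p - 1))" .
    show "0 \<le> ln (real p)" using p2 by simp
  qed
  also have "\<dots> = n * ((\<Sum>p\<in>?P. ln (real p) / p) + (\<Sum>p\<in>?P. ln (real p) / (p * (real p - 1))))"
    by (simp add: sum_distrib_left sum.distrib algebra_simps)
  finally have 1: "n * ln n - n \<le> n * ((\<Sum>p\<in>?P. ln (real p) / p) + (\<Sum>p\<in>?P. ln (real p) / (p * (real p - 1))))" .
  have "(\<Sum>p\<in>?P. ln (real p) / (p * (real p - 1))) \<le> (\<Sum>m=2..n. ln (real m) / (m * (real m - 1)))"
    by (intro sum_mono2) (auto simp: prime_ge_2_nat)
  also have "\<dots> \<le> 2"
  proof -
    have "0 \<le> (ln (real n) + 2) / n" using assms by simp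
    thus ?thesis using sum_ln_over_square_le[OF assms] by linarith
  qed
  finally have "n * ((\<Sum>p\<in>?P. ln (real p) / p) + (\<Sum>p\<in>?P. ln (real p) / (p * (real p - 1)))) \<le>
      n * ((\<Sum>p\<in>?P. ln (real p) / p) + 2)" by (intro mult_left_mono add_left_mono) auto
  with 1 have "n * (ln n - 1) \<le> n * ((\<Sum>p\<in>?P. ln (real p) / p) + 2)"
    by (simp add: algebra_simps)
  thus ?thesis using assms by simp
qed

text \<open>A difference of two Mertens sums at integer parts. The 6 collects 3 from the lower
  bound, ln 4 \<le> 2 from the upper one, and ln 2 \<le> 1 for rounding an endpoint.\<close>

lemma mertens_interval:
  fixes y z :: real
  assumes "1 \<le> y" "y \<le> z"
  shows "ln (z / y) - 6 \<le> (\<Sum>p::nat | prime p \<and> y < p \<and> p \<le> z. ln (real p) / p)"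
    and "(\<Sum>p::nat | prime p \<and> y < p \<and> p \<le> z. ln (real p) / p) \<le> ln (z / y) + 6"
proof -
  define m where "m = nat \<lfloor>y\<rfloor>"
  define n where "n = nat \<lfloor>z\<rfloor>"
  have m: "m \<ge> 1" "real m \<le> y" "y < real m + 1" and n: "n \<ge> 1" "real n \<le> z" "z < real n + 1"
    using assms by (auto simp: m_def n_def) linarith+
  have mn: "m \<le> n" using assms by (auto simp: m_def n_def intro!: nat_mono floor_mono)
  have iff: "real p \<le> y \<longleftrightarrow> p \<le> m" "real p \<le> z \<longleftrightarrow> p \<le> n" for p :: nat
    using assms by (auto simp: m_def n_def le_nat_iff le_floor_iff)
  let ?f = "\<lambda>p::nat. ln (real p) / p"
  have iff2: "y < real p \<longleftrightarrow> \<not> p \<le> m" for p using iff(1)[of p] by linarith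
  have "{p::nat. prime p \<and> y < p \<and> p \<le> z} = {p. prime p \<and> p \<le> n} - {p. prime p \<and> p \<le> m}"
    unfolding iff iff2 by blast
  hence "(\<Sum>p::nat | prime p \<and> y < p \<and> p \<le> z. ?f p) = sum ?f ({p. prime p \<and> p \<le> n} - {p. prime p \<and> p \<le> m})"
    by (simp only:)
  also have "\<dots> = sum ?f {p. prime p \<and> p \<le> n} - sum ?f {p. prime p \<and> p \<le> m}"
    by (rule sum_diff) (use mn in auto)
  finally have eq: "(\<Sum>p::nat | prime p \<and> y < p \<and> p \<le> z. ?f p) =
    (\<Sum>p | prime p \<and> p \<le> n. ?f p) - (\<Sum>p | prime p \<and> p \<le> m. ?f p)" .
  define S1 where "S1 = (\<Sum>p | prime p \<and> p \<le> n. ?f p)"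
  define S2 where "S2 = (\<Sum>p | prime p \<and> p \<le> m. ?f p)"
  have bounds: "ln n - 3 \<le> S1" "S1 \<le> ln n + ln 4" "ln m - 3 \<le> S2" "S2 \<le> ln m + ln 4"
    unfolding S1_def S2_def
    by (rule mertens_lower[OF n(1)] mertens_upper[OF n(1)] mertens_lower[OF m(1)] mertens_upper[OF m(1)])+
  have ly: "ln y - ln 2 \<le> ln m" "ln m \<le> ln y"
  proof -
    have "y \<le> 2 * m" using m by linarith
    hence "ln y \<le> ln (2 * real m)" using assms by (subst ln_le_cancel_iff) auto
    thus "ln y - ln 2 \<le> ln m" using m by (simp add: ln_mult)
    show "ln m \<le> ln y" using m by simp
  qed
  have lz: "ln z - ln 2 \<le> ln n" "ln n \<le> ln z"
  proof -
    have "z \<le> 2 * n" using n by linarith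
    hence "ln z \<le> ln (2 * real n)" using assms by (subst ln_le_cancel_iff) auto
    thus "ln z - ln 2 \<le> ln n" using n by (simp add: ln_mult)
    show "ln n \<le> ln z" using n by simp
  qed
  have l2: "ln 2 \<le> (1::real)" using ln_2_less_1 by simp
  have l4: "ln 4 = 2 * ln (2::real)" using ln_realpow[of 2 2] by simp
  have lzy: "ln (z / y) = ln z - ln y" using assms by (simp add: ln_div)
  have "ln (z / y) - 6 \<le> S1 - S2" "S1 - S2 \<le> ln (z / y) + 6"
    using bounds ly lz l2 l4 lzy by linarith+
  thus "ln (z / y) - 6 \<le> (\<Sum>p::nat | prime p \<and> y < p \<and> p \<le> z. ?f p)"
    "(\<Sum>p::nat | prime p \<and> y < p \<and> p \<le> z. ?f p) \<le> ln (z / y) + 6"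
    unfolding eq S1_def S2_def .
qed

section \<open>Averages over the family of discriminants\<close>

lemma prod_dvd_iff_pairwise_coprime:
  fixes g :: "'a \<Rightarrow> int"
  assumes "finite L" "\<And>p q. p \<in> L \<Longrightarrow> q \<in> L \<Longrightarrow> p \<noteq> q \<Longrightarrow> coprime (g p) (g q)"
  shows "prod g L dvd m \<longleftrightarrow> (\<forall>p\<in>L. g p dvd m)"
  using assms
proof (induction L rule: finite_induct)
  case (insert p L)
  have "coprime (g p) (prod g L)"
    using insert by (intro prod_coprime_right) (metis insertCI)
  hence "g p * prod g L dvd m \<longleftrightarrow> g p dvd m \<and> prod g L dvd m"
    by (meson divides_mult dvd_mult_left dvd_mult_right)
  thus ?case using insert by simp
qed simp

text \<open>Expand the product of the factors 1 - [g p divides m]; pairwise coprimality turns joint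
  divisibility over \<open>L\<close> into divisibility by the product. It serves with squares of
  primes for squarefreeness and with primes for coprimality.\<close>

lemma inclusion_exclusion:
  fixes g :: "'a \<Rightarrow> int" and F :: "int \<Rightarrow> real"
  assumes "finite T" "\<And>p q. p \<in> T \<Longrightarrow> q \<in> T \<Longrightarrow> p \<noteq> q \<Longrightarrow> coprime (g p) (g q)" "finite I"
  shows "(\<Sum>m\<in>I. if \<exists>p\<in>T. g p dvd m then 0 else F m)
       = (\<Sum>L\<in>Pow T. (-1) ^ card L * (\<Sum>m | m \<in> I \<and> prod g L dvd m. F m))"
proof -
  have ind: "(if \<exists>p\<in>T. g p dvd m then 0 else F m)
     = (\<Sum>L\<in>Pow T. (-1) ^ card L * (if prod g L dvd m then F m else 0))" for m
  proof -
    have "(if \<exists>p\<in>T. g p dvd m then 0 else F m) = (\<Prod>p\<in>T. 1 - (if g p dvd m then 1 else 0)) * F m"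
    proof (cases "\<exists>p\<in>T. g p dvd m")
      case True
      then obtain p where "p \<in> T" "1 - (if g p dvd m then 1 else 0) = (0::real)" by auto
      hence "(\<Prod>p\<in>T. 1 - (if g p dvd m then 1 else 0)) = (0::real)"
        using assms(1) by (meson prod_zero)
      thus ?thesis using True by simp
    qed (use assms in simp)
    also have "(\<Prod>p\<in>T. 1 - (if g p dvd m then 1 else 0 :: real))
        = (\<Sum>L\<in>Pow T. (-1) ^ card L * (\<Prod>p\<in>L. if g p dvd m then 1 else 0) * (\<Prod>p\<in>T-L. 1))"
      by (rule prod_diff_conv_sum[OF assms(1)])
    also have "\<dots> = (\<Sum>L\<in>Pow T. (-1) ^ card L * (if prod g L dvd m then 1 else 0))"
    proof (intro sum.cong refl)
      fix L assume L: "L \<in> Pow T"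
      hence fin: "finite L" using assms(1) finite_subset by auto
      have "prod g L dvd m \<longleftrightarrow> (\<forall>p\<in>L. g p dvd m)"
        by (rule prod_dvd_iff_pairwise_coprime) (use L assms fin in auto)
      moreover have "(\<Prod>p\<in>L. if g p dvd m then 1 else 0 :: real) = (if \<forall>p\<in>L. g p dvd m then 1 else 0)"
        using fin by (induction L rule: finite_induct) auto
      ultimately show "(-1) ^ card L * (\<Prod>p\<in>L. if g p dvd m then 1 else 0) * (\<Prod>p\<in>T-L. 1)
          = (-1) ^ card L * (if prod g L dvd m then 1 else 0 :: real)" by simp
    qed
    also have "\<dots> * F m = (\<Sum>L\<in>Pow T. (-1) ^ card L * (if prod g L dvd m then F m else 0))"
      unfolding sum_distrib_right by (intro sum.cong refl) auto
    finally show ?thesis .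
  qed
  have "(\<Sum>m\<in>I. if \<exists>p\<in>T. g p dvd m then 0 else F m)
      = (\<Sum>L\<in>Pow T. \<Sum>m\<in>I. (-1) ^ card L * (if prod g L dvd m then F m else 0))"
    by (subst sum.swap) (simp only: ind)
  also have "\<dots> = (\<Sum>L\<in>Pow T. (-1) ^ card L * (\<Sum>m\<in>I. if prod g L dvd m then F m else 0))"
    by (simp only: sum_distrib_left)
  also have "\<dots> = (\<Sum>L\<in>Pow T. (-1) ^ card L * (\<Sum>m | m \<in> I \<and> prod g L dvd m. F m))"
    by (simp only: sum.inter_filter[OF assms(3)])
  finally show ?thesis .
qed

lemma multiples_in_interval:
  fixes e a b :: int
  assumes "e > 0"
  shows "{m. m \<in> {a<..b} \<and> e dvd m} = (*) e ` {a div e<..b div e}"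
proof (intro equalityI subsetI)
  have div1: "e * (x div e) \<le> x" and div2: "x < e * (x div e + 1)" for x
    using mult_div_mod_eq[of e x] pos_mod_sign[OF assms, of x] pos_mod_bound[OF assms, of x]
    by (simp_all only: distrib_left mult_1_right)
  fix m
  {
    assume "m \<in> {m. m \<in> {a<..b} \<and> e dvd m}"
    then obtain k where k: "m = e * k" "a < e * k" "e * k \<le> b" by auto
    have "a div e < k"
    proof (rule ccontr)
      assume "\<not> a div e < k"
      hence "e * k \<le> e * (a div e)" using assms by (intro mult_left_mono) auto
      thus False using k div1[of a] by linarith
    qed
    moreover have "k \<le> b div e"
    proof (rule ccontr)
      assume "\<not> k \<le> b div e"
      hence "e * (b div e + 1) \<le> e * k" using assms by (intro mult_left_mono) auto
      thus False using k div2[of b] by linarith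
    qed
    ultimately show "m \<in> (*) e ` {a div e<..b div e}" using k by auto
  }
  {
    assume "m \<in> (*) e ` {a div e<..b div e}"
    then obtain k where "m = e * k" "k \<in> {a div e<..b div e}" by blast
    hence k: "m = e * k" "a div e < k" "k \<le> b div e" by auto
    have "a < e * (a div e + 1)" by (rule div2)
    also have "\<dots> \<le> e * k" using k assms by (intro mult_left_mono) auto
    finally have "a < m" using k by simp
    moreover have "e * k \<le> e * (b div e)" using k assms by (intro mult_left_mono) auto
    moreover have "e * (b div e) \<le> b" by (rule div1)
    ultimately show "m \<in> {m. m \<in> {a<..b} \<and> e dvd m}" using k by auto
  }
qed

lemma sum_multiples_in_interval:
  fixes e a b :: int and F :: "int \<Rightarrow> real"
  assumes "e > 0"
  shows "(\<Sum>m | m \<in> {a<..b} \<and> e dvd m. F m) = (\<Sum>m\<in>{a div e<..b div e}. F (e * m))"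
  unfolding multiples_in_interval[OF assms]
  using assms by (subst sum.reindex) (auto simp: inj_on_def)

lemma prime_factors_prod_primes:
  assumes "finite L" "\<And>p. p \<in> L \<Longrightarrow> prime (p::nat)"
  shows "prime_factors (\<Prod>L) = L" "\<Prod>L > 0"
proof -
  show pos: "\<Prod>L > 0" using assms by (intro prod_pos) (auto simp: prime_gt_0_nat)
  have "prime_factors (\<Prod>L) = L \<and> \<Prod>L > 0" using assms
  proof (induction L rule: finite_induct)
    case (insert p L)
    hence "prime p" "prime_factors (\<Prod>L) = L" "\<Prod>L > 0" by auto
    moreover have "\<Prod>(insert p L) = p * \<Prod>L" using insert by simp
    moreover have "prime_factors (p * \<Prod>L) = prime_factors p \<union> prime_factors (\<Prod>L)"
      using \<open>prime p\<close> \<open>\<Prod>L > 0\<close> by (intro prime_factors_product) auto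
    ultimately show ?case by (simp add: prime_factorization_prime prime_gt_0_nat)
  qed simp
  thus "prime_factors (\<Prod>L) = L" by blast
qed

lemma two_power_card_le_prod_primes:
  assumes "finite L" "\<And>p. p \<in> L \<Longrightarrow> prime (p::nat)"
  shows "2 ^ card L \<le> \<Prod>L"
proof -
  have "(\<Prod>p\<in>L. 2) \<le> \<Prod>L" using assms by (intro prod_mono) (auto simp: prime_ge_2_nat)
  thus ?thesis by simp
qed

lemma kronecker_prime_eq: "prime p \<Longrightarrow> kronecker d p = kronecker_prime d p"
  by (simp add: kronecker_def prime_factorization_prime prime_gt_0_nat)

lemma kronecker_prod_primes:
  assumes "finite L" "\<And>p. p \<in> L \<Longrightarrow> prime p"
  shows "kronecker d (\<Prod>L) = (\<Prod>p\<in>L. kronecker_prime d p)"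
  using assms
proof (induction L rule: finite_induct)
  case (insert p L)
  have "\<Prod>L > 0" using insert prime_factors_prod_primes(2)[of L] by auto
  thus ?case using insert by (simp add: kronecker_mult_right kronecker_prime_eq prime_gt_0_nat)
qed simp

text \<open>Primitivity comes from the Chinese remainder theorem: a nonresidue modulo
  \<open>p\<close> is combined with 1 modulo the other primes, so that only the symbol at
  \<open>p\<close> becomes -1.\<close>

lemma polya_vinogradov_squarefree:
  fixes s :: nat
  assumes "finite P" "P \<noteq> {}" "\<And>p. p \<in> P \<Longrightarrow> prime p \<and> 2 < p" and s_def: "s = \<Prod>P"
  shows "\<bar>\<Sum>m\<in>{a<..b}. real_of_int (kronecker m s)\<bar> \<le> sqrt s * (1 + ln s)"
proof (rule polya_vinogradov_primitive)
  have prP: "prime p" if "p \<in> P" for p using that assms by auto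
  have pf: "prime_factors s = P" and s0: "s > 0"
    using prime_factors_prod_primes[OF assms(1) prP] by (auto simp: s_def)
  have odd: "odd s"
  proof
    assume "even s"
    hence "2 \<in> prime_factors s" using s0 by (simp add: prime_factors_dvd)
    hence "2 \<in> P" using pf by simp
    thus False using assms(3)[of 2] by simp
  qed
  show "s > 1"
  proof -
    obtain p where p: "p \<in> P" using assms by blast
    hence "p dvd s" unfolding s_def using assms(1) by (intro dvd_prodI) auto
    hence "p \<le> s" using s0 by (rule dvd_imp_le)
    thus ?thesis using assms(3)[OF p] by linarith
  qed
  show "kronecker m s = kronecker n s" if "[m = n] (mod int s)" for m n
    using kronecker_cong[OF odd that] .
  show "kronecker (m * n) s = kronecker m s * kronecker n s" for m n
    by (rule kronecker_mult_left[OF odd])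
  show "kronecker m s \<in> {-1, 0, 1}" for m by (rule kronecker_values)
  show "kronecker m s = 0 \<longleftrightarrow> \<not> coprime m (int s)" for m by (rule kronecker_eq_0_iff[OF odd])
  show "\<exists>c. [c = 1] (mod int (s div p)) \<and> kronecker c s = -1" if p: "prime p" "p dvd s" for p
  proof -
    have pP: "p \<in> P" using p s0 pf by (auto simp: prime_factors_dvd)
    define t where "t = \<Prod>(P - {p})"
    have st: "s = p * t" unfolding s_def t_def using assms(1) pP by (simp add: prod.remove)
    have pft: "prime_factors t = P - {p}" and t0: "t > 0"
      using prime_factors_prod_primes[of "P - {p}"] assms by (auto simp: t_def)
    have "\<not> p dvd t" using pft t0 p by (auto simp: prime_factors_dvd)
    hence "coprime p t" using p prime_imp_coprime by blast
    hence cop: "coprime (int p) (int t)" by simp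
    obtain r where r: "Legendre r (int p) = -1" using exists_nonresidue[of p] assms(3)[OF pP] by auto
    obtain c where c: "[c = r] (mod int p)" "[c = 1] (mod int t)"
      using binary_chinese_remainder_int[OF cop] by blast
    have "kronecker c p = -1"
      using r Legendre_cong[OF c(1)] assms(3)[OF pP] by (simp add: kronecker_prime_eq kronecker_prime_def)
    moreover have "odd t" using odd st by simp
    hence "kronecker c t = kronecker 1 t" using kronecker_cong c(2) by blast
    moreover have "kronecker 1 t = 1"
    proof -
      have "kronecker 1 t = (\<Prod>q\<in>P - {p}. kronecker_prime 1 q)"
        unfolding t_def using assms by (intro kronecker_prod_primes) auto
      also have "\<dots> = (\<Prod>q\<in>P - {p}. 1)"
      proof (intro prod.cong refl)
        fix q assume "q \<in> P - {p}"
        hence "2 < q" using assms(3) by auto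
        thus "kronecker_prime 1 q = 1" by (simp add: kronecker_prime_def Legendre_1)
      qed
      finally show ?thesis by simp
    qed
    moreover have "s div p = t" using st p by (simp add: prime_gt_0_nat)
    moreover have "kronecker c s = kronecker c p * kronecker c t"
      unfolding st using p t0 by (intro kronecker_mult_right) (auto simp: prime_gt_0_nat)
    ultimately show ?thesis using c by auto
  qed
qed

lemma square_if_even_multiplicities:
  fixes n :: nat
  assumes "n > 0" "\<And>p. p \<in> prime_factors n \<Longrightarrow> even (multiplicity p n)"
  shows "n = (\<Prod>p\<in>prime_factors n. p ^ (multiplicity p n div 2)) ^ 2"
proof -
  have "n = (\<Prod>p\<in>prime_factors n. p ^ multiplicity p n)"
    using assms by (subst prime_factorization_nat[symmetric]) auto
  also have "\<dots> = (\<Prod>p\<in>prime_factors n. (p ^ (multiplicity p n div 2)) ^ 2)"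
    using assms by (intro prod.cong refl) (simp add: power_mult[symmetric])
  finally show ?thesis by (simp add: prod_power_distrib)
qed

text \<open>The symbol with lower argument \<open>n\<close> is the primitive character modulo
  \<open>s\<close>, the product of the primes of odd exponent, cut down to arguments free of the
  primes in \<open>T\<close> of even exponent. Removing that restriction costs 2^|T| primitive sums;
  since 2^|T| is at most the product of \<open>T\<close>, and \<open>s\<close> times the square of
  this product is at most \<open>n\<close>, nothing is lost against the primitive case.\<close>

lemma polya_vinogradov:
  fixes n :: nat and a b :: int
  assumes "odd n" "\<nexists>k. n = k ^ 2"
  shows "\<bar>\<Sum>m\<in>{a<..b}. real_of_int (kronecker m n)\<bar> \<le> sqrt n * (1 + ln n)"
proof -
  have n0: "n > 0" using assms by (cases n) auto
  define P where "P = {p\<in>prime_factors n. odd (multiplicity p n)}"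
  define T where "T = {p\<in>prime_factors n. even (multiplicity p n)}"
  define s where "s = \<Prod>P"
  have fin: "finite P" "finite T" by (auto simp: P_def T_def)
  have PT: "P \<union> T = prime_factors n" "P \<inter> T = {}" by (auto simp: P_def T_def)
  have pr: "prime p \<and> 2 < p" if "p \<in> P \<union> T" for p
    using that odd_prime_factor[OF assms(1), of p] unfolding PT by auto
  \<comment> \<open>A nonsquare has a prime of odd exponent; otherwise the character would be
    principal and show no cancellation.\<close>
  have "P \<noteq> {}"
  proof
    assume "P = {}"
    hence "n = (\<Prod>p\<in>prime_factors n. p ^ (multiplicity p n div 2)) ^ 2"
      using n0 by (intro square_if_even_multiplicities) (auto simp: P_def)
    thus False using assms(2) by blast
  qed
  hence PV: "\<bar>\<Sum>m\<in>{a<..b}. real_of_int (kronecker m s)\<bar> \<le> sqrt s * (1 + ln s)" for a b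
    using fin pr by (intro polya_vinogradov_squarefree[of P]) (auto simp: s_def)
  have kr: "real_of_int (kronecker m n) = (if \<exists>p\<in>T. int p dvd m then 0 else real_of_int (kronecker m s))" for m
  proof -
    have "kronecker m n = (\<Prod>p\<in>P \<union> T. kronecker_prime m p ^ multiplicity p n)"
      using n0 by (simp add: kronecker_def PT)
    also have "\<dots> = (\<Prod>p\<in>P. kronecker_prime m p ^ multiplicity p n) * (\<Prod>p\<in>T. kronecker_prime m p ^ multiplicity p n)"
      using fin PT by (intro prod.union_disjoint) auto
    also have "(\<Prod>p\<in>P. kronecker_prime m p ^ multiplicity p n) = (\<Prod>p\<in>P. kronecker_prime m p)"
    proof (intro prod.cong refl)
      fix p assume "p \<in> P"
      hence "odd (multiplicity p n)" by (simp add: P_def)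
      moreover from this have "multiplicity p n > 0" by (rule odd_pos)
      ultimately show "kronecker_prime m p ^ multiplicity p n = kronecker_prime m p"
        using kronecker_prime_values[of m p] by auto
    qed
    also have "\<dots> = kronecker m s"
      unfolding s_def using fin pr by (intro kronecker_prod_primes[symmetric]) auto
    also have "(\<Prod>p\<in>T. kronecker_prime m p ^ multiplicity p n) = (\<Prod>p\<in>T. if int p dvd m then 0 else 1)"
    proof (intro prod.cong refl)
      fix p assume p: "p \<in> T"
      hence "even (multiplicity p n)" "multiplicity p n > 0" by (auto simp: T_def prime_factors_multiplicity)
      moreover have "kronecker_prime m p = 0 \<longleftrightarrow> int p dvd m"
        using pr[of p] p by (auto simp: kronecker_prime_def Legendre_eq_0_iff)
      ultimately show "kronecker_prime m p ^ multiplicity p n = (if int p dvd m then 0 else 1)"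
        using kronecker_prime_values[of m p] by auto
    qed
    also have "\<dots> = (if \<exists>p\<in>T. int p dvd m then 0 else 1)"
      using fin(2) by (induction T rule: finite_induct) auto
    finally show ?thesis by simp
  qed
  have s0: "s > 0" and odds: "odd s"
  proof -
    show s0: "s > 0" using fin pr by (auto simp: s_def intro!: prod_pos prime_gt_0_nat)
    have pfs: "prime_factors s = P" using prime_factors_prod_primes[of P] fin pr by (auto simp: s_def)
    show "odd s"
    proof
      assume "even s"
      hence "2 \<in> prime_factors s" using s0 by (simp add: prime_factors_dvd)
      thus False using pfs pr[of 2] by auto
    qed
  qed
  have sT: "s * (\<Prod>T)^2 \<le> n"
  proof -
    have "s * (\<Prod>T)^2 = (\<Prod>p\<in>P. p) * (\<Prod>p\<in>T. p ^ 2)" by (simp add: s_def prod_power_distrib)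
    also have "\<dots> \<le> (\<Prod>p\<in>P. p ^ multiplicity p n) * (\<Prod>p\<in>T. p ^ multiplicity p n)"
    proof (intro mult_mono prod_mono conjI)
      fix p assume "p \<in> P"
      hence "multiplicity p n \<ge> 1" "p \<ge> 1" using pr[of p] by (auto simp: P_def prime_factors_multiplicity)
      thus "p \<le> p ^ multiplicity p n" using power_increasing[of 1 "multiplicity p n" p] by simp
    next
      fix p assume p: "p \<in> T"
      hence "even (multiplicity p n)" "multiplicity p n > 0" by (auto simp: T_def prime_factors_multiplicity)
      hence "multiplicity p n \<ge> 2" by presburger
      moreover have "p \<ge> 1" using pr[of p] p by auto
      ultimately show "p ^ 2 \<le> p ^ multiplicity p n" by (intro power_increasing) auto
    qed auto
    also have "\<dots> = (\<Prod>p\<in>P \<union> T. p ^ multiplicity p n)"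
      using fin PT by (intro prod.union_disjoint[symmetric]) auto
    also have "\<dots> = n" unfolding PT using n0 by (subst prime_factorization_nat[symmetric]) auto
    finally show ?thesis .
  qed
  have "(\<Sum>m\<in>{a<..b}. real_of_int (kronecker m n)) = (\<Sum>m\<in>{a<..b}. if \<exists>p\<in>T. int p dvd m then 0 else real_of_int (kronecker m s))"
    by (simp add: kr)
  also have "\<dots> = (\<Sum>L\<in>Pow T. (-1) ^ card L * (\<Sum>m | m \<in> {a<..b} \<and> prod int L dvd m. real_of_int (kronecker m s)))"
    using fin pr by (intro inclusion_exclusion) (auto intro!: primes_coprime)
  finally have eq: "(\<Sum>m\<in>{a<..b}. real_of_int (kronecker m n)) = \<dots>" .
  have "\<bar>\<Sum>m\<in>{a<..b}. real_of_int (kronecker m n)\<bar> \<le> (\<Sum>L\<in>Pow T. sqrt s * (1 + ln s))"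
    unfolding eq
  proof (rule order.trans[OF sum_abs sum_mono])
    fix L assume L: "L \<in> Pow T"
    have e0: "prod int L > 0" using L pr by (intro prod_pos) (auto dest!: subsetD prime_gt_0_nat)
    have "(\<Sum>m | m \<in> {a<..b} \<and> prod int L dvd m. real_of_int (kronecker m s))
        = real_of_int (kronecker (prod int L) s) * (\<Sum>m\<in>{a div prod int L<..b div prod int L}. real_of_int (kronecker m s))"
      unfolding sum_multiples_in_interval[OF e0] by (simp add: kronecker_mult_left[OF odds] sum_distrib_left)
    hence "\<bar>(-1) ^ card L * (\<Sum>m | m \<in> {a<..b} \<and> prod int L dvd m. real_of_int (kronecker m s))\<bar>
       = \<bar>real_of_int (kronecker (prod int L) s)\<bar> * \<bar>\<Sum>m\<in>{a div prod int L<..b div prod int L}. real_of_int (kronecker m s)\<bar>"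
      by (simp add: abs_mult)
    also have "\<dots> \<le> 1 * (sqrt s * (1 + ln s))"
      using kronecker_values[of "prod int L" s] by (intro mult_mono PV) auto
    finally show "\<bar>(-1) ^ card L * (\<Sum>m | m \<in> {a<..b} \<and> prod int L dvd m. real_of_int (kronecker m s))\<bar>
       \<le> sqrt s * (1 + ln s)" by simp
  qed
  also have "\<dots> = real (2 ^ card T) * (sqrt s * (1 + ln s))" using fin by (simp add: card_Pow)
  also have "\<dots> \<le> real (\<Prod>T) * (sqrt s * (1 + ln n))"
  proof (intro mult_mono)
    have "2 ^ card T \<le> \<Prod>T" using fin pr by (intro two_power_card_le_prod_primes) auto
    thus "real (2 ^ card T) \<le> real (\<Prod>T)" by (simp only: of_nat_le_iff)
    have "\<Prod>T > 0" using pr by (intro prod_pos) (auto simp: prime_gt_0_nat)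
    hence "s * 1 \<le> s * (\<Prod>T)^2" by (intro mult_left_mono) auto
    hence "s \<le> n" using sT by linarith
    thus "1 + ln (real s) \<le> 1 + ln (real n)" using s0 n0 by simp
  qed (use s0 in \<open>auto intro!: prod_nonneg\<close>)
  also have "\<dots> = sqrt (real (s * (\<Prod>T)^2)) * (1 + ln n)"
    by (simp add: real_sqrt_mult abs_mult prod_nonneg del: of_nat_prod)
  also have "\<dots> \<le> sqrt n * (1 + ln n)"
  proof (intro mult_right_mono)
    show "sqrt (real (s * (\<Prod>T)^2)) \<le> sqrt n" using sT by (simp only: real_sqrt_le_iff of_nat_le_iff)
  qed (use n0 in simp)
  finally show ?thesis .
qed

lemma sum_inverse_squares_le:
  fixes A :: "nat set" and Y :: nat
  assumes "finite A" "\<And>k. k \<in> A \<Longrightarrow> Y < k" "Y \<ge> 1"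
  shows "(\<Sum>k\<in>A. 1 / real k ^ 2) \<le> 1 / Y"
proof -
  have tel: "(\<Sum>k=Suc Y..N. 1 / real k ^ 2) \<le> 1 / Y - 1 / N" if "Y \<le> N" for N
    using that
  proof (induction N rule: dec_induct)
    case (step N)
    have N: "real N \<ge> 1" using step assms by simp
    have "1 / real (Suc N) ^ 2 \<le> 1 / real N - 1 / real (Suc N)"
    proof -
      have "1 / real (Suc N) ^ 2 \<le> 1 / (real N * real (Suc N))"
        using N by (intro divide_left_mono) (auto simp: power2_eq_square)
      also have "\<dots> = 1 / real N - 1 / real (Suc N)" using N by (simp add: divide_simps)
      finally show ?thesis .
    qed
    thus ?case using step by simp
  qed simp
  define N where "N = Max (insert Y A)"
  have YN: "Y \<le> N" using assms(1) by (simp add: N_def)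
  have "A \<subseteq> {Suc Y..N}" using assms by (auto simp: N_def Suc_le_eq)
  hence "(\<Sum>k\<in>A. 1 / real k ^ 2) \<le> (\<Sum>k=Suc Y..N. 1 / real k ^ 2)"
    by (intro sum_mono2) auto
  also have "\<dots> \<le> 1 / Y - 1 / N" by (rule tel[OF YN])
  also have "\<dots> \<le> 1 / Y" by simp
  finally show ?thesis .
qed

text \<open>The subsets are sorted by their product, which determines them. At most \<open>Y\<close>
  have product up to \<open>Y\<close>, and for these the uniform bound is used; for the others the
  trivial bound decays like an inverse square and sums to \<open>D / Y\<close>. The free
  \<open>Y\<close> is balanced only when the parameters are chosen.\<close>

lemma abs_alternating_subset_sum_le:
  fixes T :: "nat set \<Rightarrow> real" and Y :: nat and K D :: real
  assumes "finite Z" "\<And>p. p \<in> Z \<Longrightarrow> prime p" "Y \<ge> 1" "K \<ge> 0" "D \<ge> 0"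
    and "\<And>L. L \<subseteq> Z \<Longrightarrow> \<bar>T L\<bar> \<le> K"
    and "\<And>L. L \<subseteq> Z \<Longrightarrow> \<bar>T L\<bar> \<le> D / real (\<Prod>L) ^ 2"
  shows "\<bar>\<Sum>L\<in>Pow Z. (-1) ^ card L * T L\<bar> \<le> real Y * K + D / real Y"
proof -
  have inj: "inj_on \<Prod> (Pow Z)"
  proof (rule inj_onI)
    fix L M assume LM: "L \<in> Pow Z" "M \<in> Pow Z" "\<Prod>L = \<Prod>M"
    have fin: "finite L" "finite M" using LM finite_subset[OF _ assms(1)] by auto
    have "L = prime_factors (\<Prod>L)"
      by (rule prime_factors_prod_primes(1)[OF fin(1), symmetric]) (use LM assms(2) in auto)
    also have "\<dots> = prime_factors (\<Prod>M)" by (simp only: LM(3))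
    also have "\<dots> = M"
      by (rule prime_factors_prod_primes(1)[OF fin(2)]) (use LM assms(2) in auto)
    finally show "L = M" .
  qed
  have pos: "\<Prod>L > 0" if "L \<in> Pow Z" for L
    by (intro prod_pos) (use that assms(2) in \<open>blast intro: prime_gt_0_nat\<close>)
  define A where "A = {L\<in>Pow Z. \<Prod>L \<le> Y}"
  define B where "B = {L\<in>Pow Z. Y < \<Prod>L}"
  have fin: "finite A" "finite B" using assms(1) by (auto simp: A_def B_def)
  have "\<bar>\<Sum>L\<in>Pow Z. (-1) ^ card L * T L\<bar> \<le> (\<Sum>L\<in>Pow Z. \<bar>T L\<bar>)"
    by (rule order.trans[OF sum_abs]) (simp add: abs_mult)
  also have "(\<Sum>L\<in>Pow Z. \<bar>T L\<bar>) = (\<Sum>L\<in>A \<union> B. \<bar>T L\<bar>)"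
    by (rule sum.cong) (auto simp: A_def B_def)
  also have "(\<Sum>L\<in>A \<union> B. \<bar>T L\<bar>) = (\<Sum>L\<in>A. \<bar>T L\<bar>) + (\<Sum>L\<in>B. \<bar>T L\<bar>)"
    using fin by (intro sum.union_disjoint) (auto simp: A_def B_def)
  also have "(\<Sum>L\<in>A. \<bar>T L\<bar>) \<le> (\<Sum>L\<in>A. K)"
    using assms(6) by (intro sum_mono) (auto simp: A_def)
  also have "\<dots> = card (\<Prod> ` A) * K"
    using inj by (subst card_image) (auto simp: A_def inj_on_def)
  also have "\<dots> \<le> card {1..Y} * K"
  proof -
    have "\<Prod> ` A \<subseteq> {1..Y}" using pos by (auto simp: A_def Suc_le_eq)
    hence "card (\<Prod> ` A) \<le> card {1..Y}" by (intro card_mono) auto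
    thus ?thesis using assms(4) by (intro mult_right_mono) auto
  qed
  also have "(\<Sum>L\<in>B. \<bar>T L\<bar>) \<le> (\<Sum>L\<in>B. D / real (\<Prod>L) ^ 2)"
    using assms(7) by (intro sum_mono) (auto simp: B_def simp del: of_nat_prod)
  also have "\<dots> = (\<Sum>k\<in>\<Prod> ` B. D / real k ^ 2)"
    using inj by (subst sum.reindex) (auto simp: B_def inj_on_def)
  also have "\<dots> = D * (\<Sum>k\<in>\<Prod> ` B. 1 / real k ^ 2)"
    by (simp add: sum_distrib_left)
  also have "\<dots> \<le> D * (1 / Y)"
    using assms fin by (intro mult_left_mono sum_inverse_squares_le) (auto simp: B_def)
  finally show ?thesis by simp
qed

section \<open>The squarefree sieve over the family\<close>

definition sqfree_family :: "real \<Rightarrow> int set" where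
  "sqfree_family D = {m. D / 2 < real_of_int m \<and> real_of_int m \<le> D \<and> odd m \<and> squarefree m}"

definition odd_primes_upto :: "real \<Rightarrow> nat set" where
  "odd_primes_upto D = {p. prime p \<and> 2 < p \<and> real p \<le> D}"

text \<open>Main term for the size of the family: the interval (D/2, D] holds about D/4 odd
  integers, and each odd prime removes the proportion 1/p^2. It is kept as a finite product; later
  only its lower bound D/8 matters.\<close>

definition family_density :: "real \<Rightarrow> real" where
  "family_density D = D / 4 * (\<Prod>p\<in>odd_primes_upto D. 1 - 1 / real p ^ 2)"

lemma finite_odd_primes_upto [simp]: "finite (odd_primes_upto D)"
proof (rule finite_subset)
  show "odd_primes_upto D \<subseteq> {..nat \<lfloor>D\<rfloor>}"
    by (auto simp: odd_primes_upto_def le_nat_iff le_floor_iff)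
qed simp

lemma odd_primes_uptoD: "p \<in> odd_primes_upto D \<Longrightarrow> prime p \<and> 2 < p"
  by (simp add: odd_primes_upto_def)

lemma sqfree_family_subset: "sqfree_family D \<subseteq> {\<lfloor>D / 2\<rfloor><..\<lfloor>D\<rfloor>}"
  by (auto simp: sqfree_family_def floor_less_iff le_floor_iff)

lemma finite_sqfree_family [simp]: "finite (sqfree_family D)"
  using sqfree_family_subset by (rule finite_subset) simp

lemma squarefree_odd_iff:
  fixes m :: int and D :: real
  assumes "0 < m" "real_of_int m \<le> D" "odd m"
  shows "squarefree m \<longleftrightarrow> \<not> (\<exists>p\<in>odd_primes_upto D. int p ^ 2 dvd m)"
proof
  assume sq: "squarefree m"
  show "\<not> (\<exists>p\<in>odd_primes_upto D. int p ^ 2 dvd m)"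
  proof
    assume "\<exists>p\<in>odd_primes_upto D. int p ^ 2 dvd m"
    then obtain p where "p \<in> odd_primes_upto D" "int p ^ 2 dvd m" by blast
    hence "int p dvd 1" "2 < p" using squarefreeD[OF sq, of "int p"] odd_primes_uptoD[of p D] by blast+
    thus False by simp
  qed
next
  assume no: "\<not> (\<exists>p\<in>odd_primes_upto D. int p ^ 2 dvd m)"
  show "squarefree m"
  proof (rule ccontr)
    assume "\<not> squarefree m"
    then obtain y where y: "y ^ 2 dvd m" "\<not> y dvd 1" by (auto simp: squarefree_def)
    have "nat \<bar>y\<bar> \<noteq> 1" using y by auto
    then obtain p where p: "prime p" "p dvd nat \<bar>y\<bar>" using prime_factor_nat by blast
    have "int p dvd int (nat \<bar>y\<bar>)" using p(2) by (simp only: int_dvd_int_iff)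
    hence "int p dvd y" by simp
    hence p2: "int p ^ 2 dvd m" using y(1) dvd_power_same dvd_trans by blast
    have "p \<noteq> 2" using p2 assms(3) by (auto dest: dvd_trans[of 2 4 m])
    hence "2 < p" using prime_ge_2_nat[OF p(1)] by simp
    moreover have "real p \<le> D"
    proof -
      have "int p ^ 2 \<le> m" using p2 assms(1) by (rule zdvd_imp_le)
      moreover have "int p \<le> int p ^ 2" using prime_gt_0_nat[OF p(1)] by (simp add: power2_eq_square)
      ultimately show ?thesis using assms(2) by linarith
    qed
    ultimately show False using no p p2 by (auto simp: odd_primes_upto_def)
  qed
qed

lemma sum_sqfree_family:
  fixes D :: real
  assumes "D > 0"
  shows "(\<Sum>m\<in>sqfree_family D. F m) = (\<Sum>m\<in>{\<lfloor>D/2\<rfloor><..\<lfloor>D\<rfloor>}.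
     if \<exists>p\<in>odd_primes_upto D. int p ^ 2 dvd m then 0 else (if odd m then F m else (0::real)))"
proof -
  have "(\<Sum>m\<in>sqfree_family D. F m) = (\<Sum>m\<in>{\<lfloor>D/2\<rfloor><..\<lfloor>D\<rfloor>}. if m \<in> sqfree_family D then F m else 0)"
    using sqfree_family_subset[of D] by (simp add: sum.inter_restrict[symmetric] inf_absorb2)
  also have "\<dots> = (\<Sum>m\<in>{\<lfloor>D/2\<rfloor><..\<lfloor>D\<rfloor>}.
     if \<exists>p\<in>odd_primes_upto D. int p ^ 2 dvd m then 0 else (if odd m then F m else 0))"
  proof (intro sum.cong refl)
    fix m assume "m \<in> {\<lfloor>D/2\<rfloor><..\<lfloor>D\<rfloor>}"
    hence m: "D / 2 < real_of_int m" "real_of_int m \<le> D" by (auto simp: floor_less_iff le_floor_iff)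
    hence "m > 0" using assms by (smt (verit) half_gt_zero of_int_0_less_iff)
    show "(if m \<in> sqfree_family D then F m else 0) =
        (if \<exists>p\<in>odd_primes_upto D. int p ^ 2 dvd m then 0 else (if odd m then F m else 0))"
      using squarefree_odd_iff[OF \<open>m > 0\<close> m(2)] m by (auto simp: sqfree_family_def)
  qed
  finally show ?thesis .
qed

lemma card_multiples_le:
  fixes e :: nat and D :: real
  assumes "e > 0" "D \<ge> 0"
  shows "real (card {m. m \<in> {\<lfloor>D/2\<rfloor><..\<lfloor>D\<rfloor>} \<and> int e dvd m}) \<le> D / e"
    and "\<bar>real (card {m. m \<in> {\<lfloor>D/2\<rfloor><..\<lfloor>D\<rfloor>} \<and> int e dvd m}) - D / (2 * real e)\<bar> \<le> 1"
proof -
  have "{m. m \<in> {\<lfloor>D/2\<rfloor><..\<lfloor>D\<rfloor>} \<and> int e dvd m} = (*) (int e) ` {\<lfloor>D/2\<rfloor> div int e<..\<lfloor>D\<rfloor> div int e}"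
    using assms by (intro multiples_in_interval) simp
  hence "card {m. m \<in> {\<lfloor>D/2\<rfloor><..\<lfloor>D\<rfloor>} \<and> int e dvd m} = card {\<lfloor>D/2\<rfloor> div int e<..\<lfloor>D\<rfloor> div int e}"
    using assms by (simp add: card_image inj_on_def)
  also have "\<dots> = nat (\<lfloor>D / e\<rfloor> - \<lfloor>D / 2 / e\<rfloor>)"
    by (simp only: card_greaterThanAtMost_int floor_divide_real_eq_div[OF of_nat_0_le_iff, symmetric] of_int_of_nat_eq)
  finally have eq: "card {m. m \<in> {\<lfloor>D/2\<rfloor><..\<lfloor>D\<rfloor>} \<and> int e dvd m} = nat (\<lfloor>D / e\<rfloor> - \<lfloor>D / 2 / e\<rfloor>)" .
  have "\<lfloor>D / 2 / e\<rfloor> \<le> \<lfloor>D / e\<rfloor>" using assms by (intro floor_mono divide_right_mono) auto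
  hence eq2: "real (card {m. m \<in> {\<lfloor>D/2\<rfloor><..\<lfloor>D\<rfloor>} \<and> int e dvd m}) = \<lfloor>D / e\<rfloor> - \<lfloor>D / 2 / e\<rfloor>"
    unfolding eq by simp
  have "0 \<le> \<lfloor>D / 2 / e\<rfloor>" using assms by simp
  thus "real (card {m. m \<in> {\<lfloor>D/2\<rfloor><..\<lfloor>D\<rfloor>} \<and> int e dvd m}) \<le> D / e"
    unfolding eq2 by linarith
  have "D / e - D / 2 / e = D / (2 * real e)" by (simp add: field_simps)
  thus "\<bar>real (card {m. m \<in> {\<lfloor>D/2\<rfloor><..\<lfloor>D\<rfloor>} \<and> int e dvd m}) - D / (2 * real e)\<bar> \<le> 1"
    unfolding eq2 by linarith
qed

lemma prod_int_power2: "prod (\<lambda>p. int p ^ 2) L = int ((\<Prod>L) ^ 2)"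
  by (simp add: prod_power_distrib)

text \<open>After the sieve by squares l^2, multiplicativity takes 8 l^2 out of the symbol. Oddness
  of \<open>m\<close> is imposed by subtracting the even terms, so two Polya-Vinogradov sums remain,
  whence the factor 2. Large \<open>l\<close> are treated trivially.\<close>

lemma average_kronecker_nonsquare:
  fixes n Y :: nat and D :: real
  assumes n: "odd n" "\<nexists>k. n = k ^ 2" and D: "D \<ge> 1" and Y: "Y \<ge> 1"
  shows "\<bar>\<Sum>m\<in>sqfree_family D. real_of_int (kronecker (8 * m) n)\<bar> \<le> real Y * (2 * sqrt n * (1 + ln n)) + D / real Y"
proof -
  have n0: "n > 0" using n by (cases n) auto
  define I where "I = {\<lfloor>D/2\<rfloor><..\<lfloor>D\<rfloor>}"
  define F where "F = (\<lambda>m. if odd m then real_of_int (kronecker (8 * m) n) else 0)"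
  have F1: "\<bar>F m\<bar> \<le> 1" for m using kronecker_values[of "8*m" n] by (auto simp: F_def)
  let ?Z = "odd_primes_upto D"
  have "(\<Sum>m\<in>sqfree_family D. real_of_int (kronecker (8 * m) n)) =
      (\<Sum>m\<in>I. if \<exists>p\<in>?Z. int p ^ 2 dvd m then 0 else F m)"
    unfolding I_def F_def by (subst sum_sqfree_family) (use D in auto)
  also have "\<dots> = (\<Sum>L\<in>Pow ?Z. (-1) ^ card L * (\<Sum>m | m \<in> I \<and> prod (\<lambda>p. int p ^ 2) L dvd m. F m))"
    by (intro inclusion_exclusion) (auto simp: I_def dest!: odd_primes_uptoD intro!: primes_coprime)
  also have "\<bar>\<dots>\<bar> \<le> real Y * (2 * sqrt n * (1 + ln n)) + D / real Y"
  proof (rule abs_alternating_subset_sum_le)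
    fix L assume L: "L \<subseteq> ?Z"
    define l where "l = \<Prod>L"
    have finL: "finite L" using finite_subset[OF L finite_odd_primes_upto] .
    have prL: "prime p \<and> 2 < p" if "p \<in> L" for p using that L odd_primes_uptoD by blast
    have l0: "l > 0" and pfl: "prime_factors l = L"
      using prime_factors_prod_primes[of L] finL prL by (auto simp: l_def)
    have oddl: "odd l"
    proof
      assume "even l"
      hence "2 \<in> prime_factors l" using l0 by (simp add: prime_factors_dvd)
      hence "2 \<in> L" using pfl by simp
      thus False using prL[of 2] by simp
    qed
    have e: "prod (\<lambda>p. int p ^ 2) L = int (l ^ 2)" by (simp only: prod_int_power2 l_def)
    have "\<bar>\<Sum>m | m \<in> I \<and> int (l ^ 2) dvd m. F m\<bar> \<le> (\<Sum>m | m \<in> I \<and> int (l ^ 2) dvd m. 1)"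
      by (intro order.trans[OF sum_abs sum_mono] F1)
    also have "\<dots> \<le> D / real (l ^ 2)"
      using card_multiples_le(1)[of "l ^ 2" D] l0 D by (simp add: I_def del: of_nat_power)
    finally show "\<bar>\<Sum>m | m \<in> I \<and> prod (\<lambda>p. int p ^ 2) L dvd m. F m\<bar> \<le> D / real (\<Prod>L) ^ 2"
      by (simp only: e l_def of_nat_power)
    define a where "a = \<lfloor>D/2\<rfloor> div int (l ^ 2)"
    define b where "b = \<lfloor>D\<rfloor> div int (l ^ 2)"
    let ?k = "\<lambda>m. real_of_int (kronecker m n)"
    have "(\<Sum>m | m \<in> I \<and> int (l ^ 2) dvd m. F m) = (\<Sum>m\<in>{a<..b}. F (int (l ^ 2) * m))"
      unfolding I_def a_def b_def using l0 by (intro sum_multiples_in_interval) simp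
    also have "\<dots> = (\<Sum>m\<in>{a<..b}. ?k (8 * int (l^2)) * (?k m - (if 2 dvd m then ?k m else 0)))"
    proof (intro sum.cong refl)
      fix m
      have "kronecker (8 * (int (l ^ 2) * m)) n = kronecker (8 * int (l^2)) n * kronecker m n"
        using kronecker_mult_left[OF n(1), of "8 * int (l^2)" m] by (simp add: mult.assoc)
      thus "F (int (l ^ 2) * m) = ?k (8 * int (l^2)) * (?k m - (if 2 dvd m then ?k m else 0))"
        using oddl by (auto simp: F_def)
    qed
    also have "\<dots> = ?k (8 * int (l^2)) * ((\<Sum>m\<in>{a<..b}. ?k m) - (\<Sum>m\<in>{a<..b}. if 2 dvd m then ?k m else 0))"
      by (simp only: sum_distrib_left[symmetric] sum_subtractf)
    also have "(\<Sum>m\<in>{a<..b}. if 2 dvd m then ?k m else 0) = (\<Sum>m | m \<in> {a<..b} \<and> 2 dvd m. ?k m)"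
      by (simp only: sum.inter_filter[OF finite_greaterThanAtMost_int])
    also have "\<dots> = (\<Sum>m\<in>{a div 2<..b div 2}. ?k (2 * m))"
      by (rule sum_multiples_in_interval) simp
    also have "\<dots> = ?k 2 * (\<Sum>m\<in>{a div 2<..b div 2}. ?k m)"
      by (simp add: kronecker_mult_left[OF n(1)] sum_distrib_left)
    finally have eq: "(\<Sum>m | m \<in> I \<and> int (l ^ 2) dvd m. F m) =
        ?k (8 * int (l^2)) * ((\<Sum>m\<in>{a<..b}. ?k m) - ?k 2 * (\<Sum>m\<in>{a div 2<..b div 2}. ?k m))" .
    have k1: "\<bar>?k m\<bar> \<le> 1" for m using kronecker_values[of m n] by auto
    have "\<bar>\<Sum>m | m \<in> I \<and> int (l ^ 2) dvd m. F m\<bar> \<le>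
        1 * (\<bar>\<Sum>m\<in>{a<..b}. ?k m\<bar> + 1 * \<bar>\<Sum>m\<in>{a div 2<..b div 2}. ?k m\<bar>)"
      unfolding eq abs_mult
    proof (intro mult_mono k1)
      have "\<bar>?k 2 * (\<Sum>m\<in>{a div 2<..b div 2}. ?k m)\<bar> \<le> 1 * \<bar>\<Sum>m\<in>{a div 2<..b div 2}. ?k m\<bar>"
        unfolding abs_mult by (intro mult_right_mono k1) auto
      thus "\<bar>(\<Sum>m\<in>{a<..b}. ?k m) - ?k 2 * (\<Sum>m\<in>{a div 2<..b div 2}. ?k m)\<bar>
         \<le> \<bar>\<Sum>m\<in>{a<..b}. ?k m\<bar> + 1 * \<bar>\<Sum>m\<in>{a div 2<..b div 2}. ?k m\<bar>" by linarith
    qed auto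
    also have "\<dots> \<le> 1 * (sqrt n * (1 + ln n) + 1 * (sqrt n * (1 + ln n)))"
      by (intro mult_left_mono add_mono polya_vinogradov n) auto
    finally show "\<bar>\<Sum>m | m \<in> I \<and> prod (\<lambda>p. int p ^ 2) L dvd m. F m\<bar> \<le> 2 * sqrt n * (1 + ln n)"
      by (simp add: e del: of_nat_power)
  qed (use Y D n0 in \<open>auto dest: odd_primes_uptoD\<close>)
  finally show ?thesis .
qed

text \<open>For a square modulus the symbol is the indicator of being prime to \<open>k\<close>, so
  this is a pure sieve count. A prime dividing \<open>k\<close> has local density 1 - 1/p = (1 -
  1/p^2) * p/(p + 1); relative to the density of the family the factor p/(p + 1) survives.\<close>

lemma average_kronecker_square:
  fixes k Y :: nat and D :: real
  assumes n: "odd k" and D: "D \<ge> 1" and Y: "Y \<ge> 1" and pf: "prime_factors k \<subseteq> odd_primes_upto D"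
  shows "\<bar>(\<Sum>m\<in>sqfree_family D. real_of_int (kronecker (8 * m) (k^2)))
     - family_density D * (\<Prod>p\<in>prime_factors k. p / (p + 1))\<bar> \<le> real Y * (2 * real k) + D / real Y"
proof -
  have k0: "k > 0" using n by (cases k) auto
  define I where "I = {\<lfloor>D/2\<rfloor><..\<lfloor>D\<rfloor>}"
  have finI: "finite I" by (simp add: I_def)
  \<comment> \<open>Two kinds of moduli: primes in \<open>Q\<close>, including 2 for oddness, must
    not divide \<open>m\<close> at all; primes in \<open>Z\<close> must not divide it twice. At the
    primes of \<open>Q\<close> squarefreeness is then automatic.\<close>
  define Q where "Q = insert 2 (prime_factors k)"
  define Z where "Z = odd_primes_upto D - prime_factors k"
  have finQ: "finite Q" and finZ: "finite Z" by (auto simp: Q_def Z_def)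
  have prQ: "prime p" if "p \<in> Q" for p using that by (auto simp: Q_def)
  have prZ: "prime p" if "p \<in> Z" for p using that odd_primes_uptoD by (auto simp: Z_def)
  have QZ: "Q \<inter> Z = {}" using odd_primes_uptoD by (fastforce simp: Q_def Z_def)
  have kr: "kronecker (8 * m) (k^2) = (if \<exists>p\<in>prime_factors k. int p dvd m then 0 else 1)" for m
  proof -
    have "kronecker (8 * m) (k^2) = kronecker (8*m) k ^ 2"
      using kronecker_mult_right[OF k0 k0] by (simp add: power2_eq_square)
    also have "\<dots> = (if coprime (8 * m) (int k) then 1 else 0)"
      using kronecker_values[of "8*m" k] kronecker_eq_0_iff[OF n, of "8*m"] by auto
    also have "coprime (8 * m) (int k) \<longleftrightarrow> \<not> (\<exists>p\<in>prime_factors k. int p dvd m)"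
    proof -
      have "coprime 8 (int k)" using n coprime_power_left_iff[of 2 3 "int k"] by simp
      hence "coprime (8 * m) (int k) \<longleftrightarrow> coprime m (int k)" by simp
      also have "\<dots> \<longleftrightarrow> \<not> (\<exists>p\<in>prime_factors k. int p dvd m)"
      proof -
        have "kronecker m k = 0 \<longleftrightarrow> (\<exists>p\<in>prime_factors k. int p dvd m)"
        proof -
          have "kronecker_prime m p ^ multiplicity p k = 0 \<longleftrightarrow> int p dvd m" if "p \<in> prime_factors k" for p
            using odd_prime_factor[OF n that] that
            by (auto simp: kronecker_prime_def Legendre_eq_0_iff prime_factors_multiplicity)
          thus ?thesis using k0 by (simp add: kronecker_def)
        qed
        thus ?thesis using kronecker_eq_0_iff[OF n, of m] by blast
      qed
      finally show ?thesis .
    qed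
    finally show ?thesis by auto
  qed
  define F where "F = (\<lambda>m. if \<exists>p\<in>Q. int p dvd m then 0 else (1::real))"
  define cnt where "cnt = (\<lambda>L. \<Sum>m | m \<in> I \<and> prod (\<lambda>p. int p ^ 2) L dvd m. F m)"
  define \<delta> where "\<delta> = (\<Prod>p\<in>Q. 1 - 1 / real p)"
  define dens where "dens = (\<lambda>L. D / 2 * \<delta> / real (\<Prod>L) ^ 2)"
  have "(\<Sum>m\<in>sqfree_family D. real_of_int (kronecker (8 * m) (k^2))) =
      (\<Sum>m\<in>I. if \<exists>p\<in>Z. int p ^ 2 dvd m then 0 else F m)"
  proof -
    have "(\<Sum>m\<in>sqfree_family D. real_of_int (kronecker (8 * m) (k^2))) =
       (\<Sum>m\<in>I. if \<exists>p\<in>odd_primes_upto D. int p ^ 2 dvd m then 0 else (if odd m then real_of_int (kronecker (8 * m) (k^2)) else 0))"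
      using D by (subst sum_sqfree_family) (auto simp: I_def)
    also have "\<dots> = (\<Sum>m\<in>I. if \<exists>p\<in>Z. int p ^ 2 dvd m then 0 else F m)"
    proof (intro sum.cong refl)
      fix m
      have "int p dvd m" if "int p ^ 2 dvd m" for p :: nat
        using that by (metis dvd_mult_left power2_eq_square)
      thus "(if \<exists>p\<in>odd_primes_upto D. int p ^ 2 dvd m then 0 else (if odd m then real_of_int (kronecker (8 * m) (k^2)) else 0))
         = (if \<exists>p\<in>Z. int p ^ 2 dvd m then 0 else F m)"
        unfolding kr F_def Q_def Z_def by auto
    qed
    finally show ?thesis .
  qed
  also have "\<dots> = (\<Sum>L\<in>Pow Z. (-1) ^ card L * cnt L)"
    unfolding cnt_def using finZ finI
    by (intro inclusion_exclusion) (auto dest!: prZ intro!: primes_coprime)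
  finally have 1: "(\<Sum>m\<in>sqfree_family D. real_of_int (kronecker (8 * m) (k^2))) = (\<Sum>L\<in>Pow Z. (-1) ^ card L * cnt L)" .
  have 2: "family_density D * (\<Prod>p\<in>prime_factors k. p / (p + 1)) = (\<Sum>L\<in>Pow Z. (-1) ^ card L * dens L)"
  proof -
    have "(\<Sum>L\<in>Pow Z. (-1) ^ card L * dens L) = D / 2 * \<delta> * (\<Sum>L\<in>Pow Z. (-1) ^ card L * (\<Prod>p\<in>L. 1 / real p ^ 2) * (\<Prod>p\<in>Z-L. 1))"
      unfolding sum_distrib_left dens_def
      by (intro sum.cong refl) (simp add: prod_dividef prod_power_distrib)
    also have "\<dots> = D / 2 * \<delta> * (\<Prod>p\<in>Z. 1 - 1 / real p ^ 2)"
      by (simp only: prod_diff_conv_sum[OF finZ])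
    also have "\<delta> = 1 / 2 * (\<Prod>p\<in>prime_factors k. 1 - 1 / real p)"
    proof -
      have "2 \<notin> prime_factors k" using n by auto
      thus ?thesis by (simp add: \<delta>_def Q_def)
    qed
    also have "(\<Prod>p\<in>prime_factors k. 1 - 1 / real p)
        = (\<Prod>p\<in>prime_factors k. 1 - 1 / real p ^ 2) * (\<Prod>p\<in>prime_factors k. p / (p + 1))"
      unfolding prod.distrib[symmetric]
    proof (intro prod.cong refl)
      fix p assume "p \<in> prime_factors k"
      hence "real p > 0" by (auto simp: prime_gt_0_nat in_prime_factors_imp_prime)
      hence "(1 + 1 / real p) * (p / (p + 1)) = 1" by (simp add: divide_simps)
      moreover have "1 - 1 / real p ^ 2 = (1 - 1 / real p) * (1 + 1 / real p)"
        by (simp add: algebra_simps power2_eq_square)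
      ultimately show "1 - 1 / real p = (1 - 1 / real p ^ 2) * (p / (p + 1))"
        by (simp only: mult.assoc mult_1_right)
    qed
    also have "D / 2 * (1 / 2 * ((\<Prod>p\<in>prime_factors k. 1 - 1 / real p ^ 2) * (\<Prod>p\<in>prime_factors k. p / (p + 1)))) * (\<Prod>p\<in>Z. 1 - 1 / real p ^ 2)
       = D / 4 * ((\<Prod>p\<in>prime_factors k. 1 - 1 / real p ^ 2) * (\<Prod>p\<in>Z. 1 - 1 / real p ^ 2)) * (\<Prod>p\<in>prime_factors k. p / (p + 1))"
      by (simp add: mult_ac)
    also have "(\<Prod>p\<in>prime_factors k. 1 - 1 / real p ^ 2) * (\<Prod>p\<in>Z. 1 - 1 / real p ^ 2) = (\<Prod>p\<in>odd_primes_upto D. 1 - 1 / real p ^ 2)"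
      unfolding Z_def using prod.subset_diff[OF pf finite_odd_primes_upto, of "\<lambda>p. 1 - 1 / real p ^ 2"] by (simp add: mult.commute)
    finally show ?thesis by (simp add: family_density_def)
  qed
  have d01: "0 \<le> \<delta>" "\<delta> \<le> 1"
  proof -
    have q01: "0 \<le> 1 - 1 / real p \<and> 1 - 1 / real p \<le> 1" if "p \<in> Q" for p
      using prime_ge_1_nat[OF prQ[OF that]] by (auto simp: field_simps)
    show "0 \<le> \<delta>" unfolding \<delta>_def by (rule prod_nonneg) (use q01 in blast)
    show "\<delta> \<le> 1" unfolding \<delta>_def by (rule prod_le_1) (rule q01)
  qed
  have "\<bar>(\<Sum>m\<in>sqfree_family D. real_of_int (kronecker (8 * m) (k^2)))
     - family_density D * (\<Prod>p\<in>prime_factors k. p / (p + 1))\<bar> = \<bar>\<Sum>L\<in>Pow Z. (-1) ^ card L * (cnt L - dens L)\<bar>"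
    unfolding 1 2 by (simp add: sum_subtractf right_diff_distrib)
  also have "\<dots> \<le> real Y * (2 * real k) + D / real Y"
  proof (rule abs_alternating_subset_sum_le)
    fix L assume L: "L \<subseteq> Z"
    have finL: "finite L" using L finite_subset finZ by auto
    have prL: "prime p" if "p \<in> L" for p using that L prZ by blast
    define l where "l = \<Prod>L"
    have l0: "l > 0" unfolding l_def by (rule prod_pos) (use prL in \<open>blast intro: prime_gt_0_nat\<close>)
    have e: "prod (\<lambda>p. int p ^ 2) L = int (l ^ 2)" by (simp only: prod_int_power2 l_def)
    have F01: "0 \<le> F m" "F m \<le> 1" for m by (auto simp: F_def)
    have c0: "0 \<le> cnt L" unfolding cnt_def by (intro sum_nonneg F01)
    have "cnt L \<le> (\<Sum>m | m \<in> I \<and> int (l ^ 2) dvd m. 1)"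
      unfolding cnt_def e by (intro sum_mono F01)
    also have "\<dots> \<le> D / real (l ^ 2)"
      using card_multiples_le(1)[of "l ^ 2" D] l0 D by (simp add: I_def del: of_nat_power)
    finally have c1: "cnt L \<le> D / real (\<Prod>L) ^ 2" by (simp only: l_def of_nat_power)
    have "0 \<le> dens L" using D d01 by (simp add: dens_def)
    moreover have "dens L \<le> D / real (\<Prod>L) ^ 2"
    proof -
      have "D / 2 * \<delta> \<le> D * 1" using D d01 by (intro mult_mono) auto
      thus ?thesis unfolding dens_def by (intro divide_right_mono) auto
    qed
    ultimately show "\<bar>cnt L - dens L\<bar> \<le> D / real (\<Prod>L) ^ 2" using c0 c1 by linarith
    have "cnt L = (\<Sum>m\<in>{m\<in>I. int (l^2) dvd m}. if \<exists>p\<in>Q. int p dvd m then 0 else 1)"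
      unfolding cnt_def e F_def by simp
    also have "\<dots> = (\<Sum>K\<in>Pow Q. (-1) ^ card K * (\<Sum>m | m \<in> {m\<in>I. int (l^2) dvd m} \<and> prod int K dvd m. 1))"
      using finQ finI by (intro inclusion_exclusion) (auto dest!: prQ intro!: primes_coprime)
    also have "\<dots> = (\<Sum>K\<in>Pow Q. (-1) ^ card K * real (card {m. m \<in> I \<and> int (\<Prod>K * l ^ 2) dvd m}))"
    proof (intro sum.cong refl)
      fix K assume K: "K \<in> Pow Q"
      have finK: "finite K" using K finQ finite_subset by auto
      have "coprime (\<Prod>K) (l ^ 2)"
      proof -
        have "coprime p q" if "p \<in> K" "q \<in> L" for p q
          using that K L QZ prQ prL by (intro primes_coprime) auto
        hence "coprime (\<Prod>K) (\<Prod>L)" by (intro prod_coprime_left prod_coprime_right)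
        thus ?thesis by (simp add: l_def)
      qed
      moreover have e2: "prod int K = int (\<Prod>K)" by simp
      ultimately have cop: "coprime (prod int K) (int (l^2))" by (simp only: coprime_int_iff)
      have e3: "int (\<Prod>K * l ^ 2) = prod int K * int (l^2)" by (simp only: e2 of_nat_mult)
      have "int (\<Prod>K * l ^ 2) dvd m \<longleftrightarrow> int (l^2) dvd m \<and> prod int K dvd m" for m
        unfolding e3 using cop by (meson divides_mult dvd_mult_left dvd_mult_right)
      hence "{m. m \<in> {m\<in>I. int (l^2) dvd m} \<and> prod int K dvd m} = {m. m \<in> I \<and> int (\<Prod>K * l ^ 2) dvd m}"
        by blast
      thus "(-1) ^ card K * (\<Sum>m | m \<in> {m\<in>I. int (l^2) dvd m} \<and> prod int K dvd m. 1)
          = (-1) ^ card K * real (card {m. m \<in> I \<and> int (\<Prod>K * l ^ 2) dvd m})" by simp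
    qed
    finally have cnt_eq: "cnt L = (\<Sum>K\<in>Pow Q. (-1) ^ card K * real (card {m. m \<in> I \<and> int (\<Prod>K * l ^ 2) dvd m}))" .
    have dens_eq: "dens L = (\<Sum>K\<in>Pow Q. (-1) ^ card K * (D / (2 * real (\<Prod>K * l ^ 2))))"
    proof -
      have "\<delta> = (\<Sum>K\<in>Pow Q. (-1) ^ card K * (\<Prod>p\<in>K. 1 / real p) * (\<Prod>p\<in>Q-K. 1))"
        unfolding \<delta>_def by (rule prod_diff_conv_sum[OF finQ])
      hence "dens L = (\<Sum>K\<in>Pow Q. D / 2 * ((-1) ^ card K * (\<Prod>p\<in>K. 1 / real p)) / real l ^ 2)"
        by (simp add: dens_def l_def sum_distrib_left sum_divide_distrib)
      also have "\<dots> = (\<Sum>K\<in>Pow Q. (-1) ^ card K * (D / (2 * real (\<Prod>K * l ^ 2))))"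
        by (intro sum.cong refl) (simp add: prod_dividef mult_ac)
      finally show ?thesis .
    qed
    have "\<bar>cnt L - dens L\<bar> = \<bar>\<Sum>K\<in>Pow Q. (-1) ^ card K * (real (card {m. m \<in> I \<and> int (\<Prod>K * l ^ 2) dvd m}) - D / (2 * real (\<Prod>K * l ^ 2)))\<bar>"
      unfolding cnt_eq dens_eq by (simp add: sum_subtractf right_diff_distrib)
    also have "\<dots> \<le> (\<Sum>K\<in>Pow Q. 1)"
    proof (rule order.trans[OF sum_abs sum_mono])
      fix K assume K: "K \<in> Pow Q"
      have "\<Prod>K > 0" by (rule prod_pos) (use K prQ in \<open>blast intro: prime_gt_0_nat\<close>)
      hence "\<bar>real (card {m. m \<in> I \<and> int (\<Prod>K * l ^ 2) dvd m}) - D / (2 * real (\<Prod>K * l ^ 2))\<bar> \<le> 1"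
        using card_multiples_le(2)[of "\<Prod>K * l ^ 2" D] l0 D unfolding I_def by simp
      thus "\<bar>(-1) ^ card K * (real (card {m. m \<in> I \<and> int (\<Prod>K * l ^ 2) dvd m}) - D / (2 * real (\<Prod>K * l ^ 2)))\<bar> \<le> 1"
        by (simp only: abs_mult power_abs abs_minus_cancel abs_one power_one mult_1_left)
    qed
    also have "\<dots> = 2 ^ card Q" using finQ by (simp add: card_Pow)
    \<comment> \<open>Each of the 2^|Q| counts of multiples is off by at most 1, and
      \<open>k\<close> is at least the product of its primes, hence at least 2 to their
      number.\<close>
    also have "\<dots> \<le> 2 * real k"
    proof -
      have "card Q \<le> Suc (card (prime_factors k))" unfolding Q_def by (rule card_insert_le_m1) auto
      hence "(2::nat) ^ card Q \<le> 2 ^ Suc (card (prime_factors k))" by (intro power_increasing) auto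
      also have "\<dots> \<le> 2 * \<Prod>(prime_factors k)"
        using two_power_card_le_prod_primes[of "prime_factors k"] by auto
      also have "\<Prod>(prime_factors k) \<le> k"
      proof -
        have "\<Prod>(prime_factors k) dvd k" by (intro prod_primes_dvd) auto
        thus ?thesis using k0 by (rule dvd_imp_le)
      qed
      finally have "2 ^ card Q \<le> 2 * k" by simp
      thus ?thesis by (metis of_nat_le_iff of_nat_mult of_nat_numeral of_nat_power)
    qed
    finally show "\<bar>cnt L - dens L\<bar> \<le> 2 * real k" .
  qed (use Y D finZ prZ in auto)
  finally show ?thesis .
qed

text \<open>Over all integers from 2 to \<open>N\<close> the product telescopes to (N + 1)/(2 N);
  passing to a subset only drops factors that are at most 1.\<close>

lemma prod_one_minus_inverse_square_ge:
  assumes "finite A" "\<And>k. k \<in> A \<Longrightarrow> (2::nat) \<le> k"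
  shows "(\<Prod>k\<in>A. 1 - 1 / real k ^ 2) \<ge> 1 / 2"
proof -
  have tel: "(\<Prod>k=2..N. 1 - 1 / real k ^ 2) = (N + 1) / (2 * N)" if "1 \<le> N" for N :: nat
    using that
  proof (induction N rule: dec_induct)
    case (step N)
    have alg: "(x + 1) / (2 * x) * (1 - 1 / (x + 1) ^ 2) = (x + 2) / (2 * (x + 1))" if "x > 0" for x :: real
      using that by (simp add: divide_simps power2_eq_square) (simp add: algebra_simps)
    have "(\<Prod>k=2..Suc N. 1 - 1 / real k ^ 2) = (real N + 1) / (2 * real N) * (1 - 1 / (real N + 1) ^ 2)"
      using step by (simp add: mult.commute add.commute)
    also have "\<dots> = (real N + 2) / (2 * (real N + 1))" using step by (intro alg) simp
    finally show ?case by (simp add: add.commute)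
  qed simp
  define N where "N = Max (insert 1 A)"
  have N: "1 \<le> N" "A \<subseteq> {2..N}" using assms by (auto simp: N_def)
  have f01: "0 \<le> 1 - 1 / real k ^ 2" "1 - 1 / real k ^ 2 \<le> 1" if "2 \<le> k" for k
  proof -
    have "1 / real k ^ 2 \<le> 1 / 1"
      using that by (intro divide_left_mono) (auto intro: one_le_power)
    thus "0 \<le> 1 - 1 / real k ^ 2" by simp
  qed auto
  have "1 / 2 \<le> (N + 1) / (2 * real N)" using N by (simp add: field_simps)
  also have "\<dots> = (\<Prod>k=2..N. 1 - 1 / real k ^ 2)" using tel N by simp
  also have "\<dots> = (\<Prod>k\<in>{2..N} - A. 1 - 1 / real k ^ 2) * (\<Prod>k\<in>A. 1 - 1 / real k ^ 2)"
    using N by (intro prod.subset_diff) auto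
  also have "\<dots> \<le> 1 * (\<Prod>k\<in>A. 1 - 1 / real k ^ 2)"
  proof (rule mult_right_mono)
    show "(\<Prod>k\<in>{2..N} - A. 1 - 1 / real k ^ 2) \<le> 1"
      by (rule prod_le_1) (intro conjI f01; simp)
    show "0 \<le> (\<Prod>k\<in>A. 1 - 1 / real k ^ 2)"
      by (rule prod_nonneg) (intro f01 assms)
  qed
  finally show ?thesis by simp
qed

lemma family_density_ge: "D \<ge> 0 \<Longrightarrow> family_density D \<ge> D / 8"
  using prod_one_minus_inverse_square_ge[of "odd_primes_upto D"] odd_primes_uptoD[of _ D]
    mult_left_mono[of "1/2" "\<Prod>p\<in>odd_primes_upto D. 1 - 1 / real p ^ 2" "D/4"]
  by (fastforce simp: family_density_def)

text \<open>The square case fits into the error of the nonsquare one because there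
  \<open>k = sqrt n\<close>. The main term appears exactly at squares, as it would for independent
  symmetric signs.\<close>

lemma average_kronecker:
  fixes n Y :: nat and D :: real
  assumes n: "odd n" and D: "D \<ge> 1" and Y: "Y \<ge> 1" and pf: "prime_factors n \<subseteq> odd_primes_upto D"
  shows "\<bar>(\<Sum>m\<in>sqfree_family D. real_of_int (kronecker (8 * m) n))
     - family_density D * (if \<exists>k. n = k ^ 2 then \<Prod>p\<in>prime_factors n. p / (p + 1) else 0)\<bar>
     \<le> real Y * (2 * sqrt n * (1 + ln n)) + D / real Y"
proof (cases "\<exists>k. n = k ^ 2")
  case True
  then obtain k where k: "n = k ^ 2" by blast
  have "k > 0" "odd k" using n k by (cases k; auto)+
  have "prime_factors n = prime_factors k" using k by (simp add: prime_factors_power)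
  hence "\<bar>(\<Sum>m\<in>sqfree_family D. real_of_int (kronecker (8 * m) n))
     - family_density D * (if \<exists>k. n = k ^ 2 then \<Prod>p\<in>prime_factors n. p / (p + 1) else 0)\<bar> \<le> real Y * (2 * real k) + D / real Y"
    using average_kronecker_square[OF \<open>odd k\<close> D Y] pf True k by simp
  also have "Y * (2 * real k) \<le> Y * (2 * sqrt n * (1 + ln n))"
  proof -
    have "2 * real k * 1 \<le> 2 * sqrt n * (1 + ln n)"
      using \<open>k > 0\<close> by (intro mult_mono) (auto simp: k)
    thus ?thesis by (intro mult_left_mono) auto
  qed
  finally show ?thesis by simp
qed (use average_kronecker_nonsquare[OF n _ D Y] in simp)

section \<open>The random model\<close>

text \<open>\<open>sign_weight\<close> is the limiting distribution of \<open>\<chi>\<^sub>d(p)\<close> for \<open>d = 8 m\<close>, \<open>m\<close> odd and squarefree;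
  \<open>expect\<close> is the expectation when the values at the primes in \<open>Q\<close> are independent.\<close>

definition vanish_prob :: "nat \<Rightarrow> real" where
  "vanish_prob p = (if p = 2 then 1 else 1 / (real p + 1))"

definition sign_weight :: "nat \<Rightarrow> real \<Rightarrow> real" where
  "sign_weight p v = (if v = 0 then vanish_prob p else (1 - vanish_prob p) / 2)"

definition sign_patterns :: "nat set \<Rightarrow> (nat \<Rightarrow> real) set" where
  "sign_patterns Q = PiE Q (\<lambda>_. {-1, 0, 1})"

definition expect :: "nat set \<Rightarrow> ((nat \<Rightarrow> real) \<Rightarrow> real) \<Rightarrow> real" where
  "expect Q F = (\<Sum>f\<in>sign_patterns Q. (\<Prod>p\<in>Q. sign_weight p (f p)) * F f)"

definition char_value :: "(nat \<Rightarrow> real) \<Rightarrow> nat \<Rightarrow> real" where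
  "char_value f n = (\<Prod>p\<in>prime_factors n. f p ^ multiplicity p n)"

lemma vanish_prob_bounds: "0 \<le> vanish_prob p" "vanish_prob p \<le> 1"
  by (auto simp: vanish_prob_def)

lemma finite_sign_patterns [simp]: "finite Q \<Longrightarrow> finite (sign_patterns Q)"
  unfolding sign_patterns_def by (intro finite_PiE) auto

lemma sign_patternsD: "f \<in> sign_patterns Q \<Longrightarrow> p \<in> Q \<Longrightarrow> f p \<in> {-1, 0, 1}"
  unfolding sign_patterns_def by (rule PiE_mem)

lemma expect_add: "expect Q (\<lambda>f. F f + G f) = expect Q F + expect Q G"
  by (simp add: expect_def distrib_left sum.distrib)

lemma expect_diff: "expect Q (\<lambda>f. F f - G f) = expect Q F - expect Q G"
  by (simp add: expect_def right_diff_distrib sum_subtractf)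

lemma expect_cmult: "expect Q (\<lambda>f. c * F f) = c * expect Q F"
  by (simp add: expect_def sum_distrib_left mult_ac)

lemma expect_sum: "expect Q (\<lambda>f. \<Sum>i\<in>A. F i f) = (\<Sum>i\<in>A. expect Q (F i))"
  unfolding expect_def sum_distrib_left by (rule sum.swap)

lemma expect_cong: "(\<And>f. f \<in> sign_patterns Q \<Longrightarrow> F f = G f) \<Longrightarrow> expect Q F = expect Q G"
  unfolding expect_def by (intro sum.cong refl) simp

lemma expect_prod:
  assumes "finite Q"
  shows "expect Q (\<lambda>f. \<Prod>p\<in>Q. g p (f p))
       = (\<Prod>p\<in>Q. vanish_prob p * g p 0 + (1 - vanish_prob p) / 2 * (g p 1 + g p (-1)))"
proof -
  have "expect Q (\<lambda>f. \<Prod>p\<in>Q. g p (f p)) = (\<Sum>f\<in>PiE Q (\<lambda>_. {-1, 0, 1}). \<Prod>p\<in>Q. sign_weight p (f p) * g p (f p))"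
    by (simp add: expect_def sign_patterns_def prod.distrib)
  also have "\<dots> = (\<Prod>p\<in>Q. \<Sum>v\<in>{-1, 0, 1}. sign_weight p v * g p v)"
    using assms by (intro prod_sum_PiE[symmetric]) auto
  also have "\<dots> = (\<Prod>p\<in>Q. vanish_prob p * g p 0 + (1 - vanish_prob p) / 2 * (g p 1 + g p (-1)))"
    by (intro prod.cong refl) (simp add: sign_weight_def distrib_left)
  finally show ?thesis .
qed

lemma char_value_eq_prod:
  assumes "n > 0" "finite Q" "prime_factors n \<subseteq> Q" "\<And>p. p \<in> Q \<Longrightarrow> prime p"
  shows "char_value f n = (\<Prod>p\<in>Q. f p ^ multiplicity p n)"
  unfolding char_value_def
proof (rule prod.mono_neutral_left[OF assms(2,3)], safe)
  fix p assume p: "p \<in> Q" "p \<notin># prime_factorization n"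
  have "prime p" using p assms by blast
  hence "\<not> p dvd n" using p assms(1) by (auto simp: prime_factors_dvd)
  thus "f p ^ multiplicity p n = 1" by (simp add: not_dvd_imp_multiplicity_0)
qed

lemma char_value_1 [simp]: "char_value f (Suc 0) = 1"
  by (simp add: char_value_def)

lemma char_value_mult:
  assumes "m > 0" "n > 0"
  shows "char_value f (m * n) = char_value f m * char_value f n"
proof -
  let ?P = "prime_factors m \<union> prime_factors n"
  have P: "finite ?P" "\<And>p. p \<in> ?P \<Longrightarrow> prime p" by auto
  have 0: "prime_factors (m * n) = ?P" using assms by (simp add: prime_factors_product)
  have 1: "multiplicity p (m * n) = multiplicity p m + multiplicity p n" if "p \<in> ?P" for p
    using that assms by (intro prime_elem_multiplicity_mult_distrib) auto
  have "char_value f (m * n) = (\<Prod>p\<in>?P. f p ^ multiplicity p (m * n))"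
    by (simp only: char_value_def 0)
  also have "\<dots> = (\<Prod>p\<in>?P. f p ^ multiplicity p m * f p ^ multiplicity p n)"
    by (intro prod.cong refl) (simp add: 1 power_add)
  also have "\<dots> = char_value f m * char_value f n"
    unfolding prod.distrib
    using char_value_eq_prod[of m ?P f] char_value_eq_prod[of n ?P f] assms P by simp
  finally show ?thesis .
qed

lemma char_value_prime: "prime p \<Longrightarrow> char_value f p = f p"
  by (simp add: char_value_def prime_factorization_prime prime_gt_0_nat)

lemma char_value_kronecker:
  "n > 0 \<Longrightarrow> char_value (\<lambda>p. real_of_int (kronecker_prime d p)) n = real_of_int (kronecker d n)"
  by (simp add: char_value_def kronecker_def)

text \<open>The mean of \<open>char_value f n\<close> against the product of the 1 - t p * f p, when
  \<open>b p = t p * (1 - vanish_prob p)\<close>: an odd power of \<open>f p\<close> then has mean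
  \<open>- b p\<close>, a positive even power \<open>1 - vanish_prob p\<close>. Only the parities of
  the exponents matter.\<close>

definition tilted_coeff :: "(nat \<Rightarrow> real) \<Rightarrow> nat \<Rightarrow> real" where
  "tilted_coeff b n = (\<Prod>p\<in>prime_factors n. if odd (multiplicity p n) then - b p else 1 - vanish_prob p)"

lemma tilted_coeff_eq_prod:
  assumes "n > 0" "finite Q" "prime_factors n \<subseteq> Q" "\<And>p. p \<in> Q \<Longrightarrow> prime p"
  shows "tilted_coeff b n = (\<Prod>p\<in>Q. if multiplicity p n = 0 then 1 else
     if odd (multiplicity p n) then - b p else 1 - vanish_prob p)"
proof -
  have "(\<Prod>p\<in>Q. if multiplicity p n = 0 then 1 else
     if odd (multiplicity p n) then - b p else 1 - vanish_prob p) =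
     (\<Prod>p\<in>prime_factors n. if multiplicity p n = 0 then 1 else
     if odd (multiplicity p n) then - b p else 1 - vanish_prob p)"
  proof (rule prod.mono_neutral_right[OF assms(2,3)], safe)
    fix p assume p: "p \<in> Q" "p \<notin># prime_factorization n"
    have "prime p" using p assms by blast
    hence "\<not> p dvd n" using p assms(1) by (auto simp: prime_factors_dvd)
    thus "(if multiplicity p n = 0 then 1 else
     if odd (multiplicity p n) then - b p else 1 - vanish_prob p) = 1" by (simp add: not_dvd_imp_multiplicity_0)
  qed
  also have "\<dots> = tilted_coeff b n"
    unfolding tilted_coeff_def by (intro prod.cong refl) (auto simp: prime_factors_multiplicity)
  finally show ?thesis by simp
qed

lemma tilted_coeff_mult_coprime:
  assumes "m > 0" "n > 0" "coprime m n"
  shows "tilted_coeff b (m * n) = tilted_coeff b m * tilted_coeff b n"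
proof -
  have disj: "prime_factors m \<inter> prime_factors n = {}"
  proof (rule ccontr)
    assume "prime_factors m \<inter> prime_factors n \<noteq> {}"
    then obtain p where "p \<in> prime_factors m" "p \<in> prime_factors n" by blast
    hence "prime p" "p dvd m" "p dvd n" by auto
    thus False using assms(3) not_coprimeI not_prime_unit by blast
  qed
  have m1: "multiplicity p (m * n) = multiplicity p m" if "p \<in> prime_factors m" for p
  proof -
    have "\<not> p dvd n" using that disj assms by (auto simp: prime_factors_dvd)
    thus ?thesis using that assms
      by (simp add: prime_elem_multiplicity_mult_distrib not_dvd_imp_multiplicity_0 in_prime_factors_imp_prime)
  qed
  have m2: "multiplicity p (m * n) = multiplicity p n" if "p \<in> prime_factors n" for p
  proof -
    have "\<not> p dvd m" using that disj assms by (auto simp: prime_factors_dvd)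
    thus ?thesis using that assms
      by (simp add: prime_elem_multiplicity_mult_distrib not_dvd_imp_multiplicity_0 in_prime_factors_imp_prime)
  qed
  have "tilted_coeff b (m * n) = (\<Prod>p\<in>prime_factors m \<union> prime_factors n.
      if odd (multiplicity p (m * n)) then - b p else 1 - vanish_prob p)"
    unfolding tilted_coeff_def using assms by (simp add: prime_factors_product)
  also have "\<dots> = (\<Prod>p\<in>prime_factors m. if odd (multiplicity p (m * n)) then - b p else 1 - vanish_prob p) *
      (\<Prod>p\<in>prime_factors n. if odd (multiplicity p (m * n)) then - b p else 1 - vanish_prob p)"
    using disj by (intro prod.union_disjoint) auto
  also have "(\<Prod>p\<in>prime_factors m. if odd (multiplicity p (m * n)) then - b p else 1 - vanish_prob p) = tilted_coeff b m"
    unfolding tilted_coeff_def by (intro prod.cong refl) (simp add: m1)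
  also have "(\<Prod>p\<in>prime_factors n. if odd (multiplicity p (m * n)) then - b p else 1 - vanish_prob p) = tilted_coeff b n"
    unfolding tilted_coeff_def by (intro prod.cong refl) (simp add: m2)
  finally show ?thesis .
qed

lemma tilted_coeff_1 [simp]: "tilted_coeff b (Suc 0) = 1"
  by (simp add: tilted_coeff_def)

lemma tilted_coeff_prime_power:
  assumes "prime p" "k > 0"
  shows "tilted_coeff b (p ^ k) = (if odd k then - b p else 1 - vanish_prob p)"
  using assms by (simp add: tilted_coeff_def prime_factors_power prime_factorization_prime)

lemma tilted_coeff_eq_0:
  assumes "n > 0" "prime p" "odd (multiplicity p n)" "b p = 0"
  shows "tilted_coeff b n = 0"
proof -
  have "p \<in> prime_factors n" using assms by (auto simp: prime_factors_multiplicity intro: odd_pos)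
  thus ?thesis unfolding tilted_coeff_def using assms by (intro prod_zero) auto
qed

text \<open>Independence gives one factor per prime, and by the symmetry of the sign only the part
  of 1 - t p * f p of matching parity survives.\<close>

lemma expect_tilted:
  assumes Q: "finite Q" "\<And>p. p \<in> Q \<Longrightarrow> prime p" and n: "n > 0" "prime_factors n \<subseteq> Q"
  shows "expect Q (\<lambda>f. (\<Prod>p\<in>Q. 1 - t p * f p) * char_value f n)
       = tilted_coeff (\<lambda>p. t p * (1 - vanish_prob p)) n"
proof -
  have tc: "tilted_coeff (\<lambda>p. t p * (1 - vanish_prob p)) n = (\<Prod>p\<in>Q. if multiplicity p n = 0 then 1 else
     if odd (multiplicity p n) then - (t p * (1 - vanish_prob p)) else 1 - vanish_prob p)"
    by (rule tilted_coeff_eq_prod[OF n(1) Q(1) n(2) Q(2)])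
  have "expect Q (\<lambda>f. (\<Prod>p\<in>Q. 1 - t p * f p) * char_value f n)
      = expect Q (\<lambda>f. \<Prod>p\<in>Q. (1 - t p * f p) * f p ^ multiplicity p n)"
    by (simp add: char_value_eq_prod[OF n(1) Q(1) n(2) Q(2)] prod.distrib)
  also have "\<dots> = (\<Prod>p\<in>Q. vanish_prob p * ((1 - t p * 0) * 0 ^ multiplicity p n) +
      (1 - vanish_prob p) / 2 * ((1 - t p * 1) * 1 ^ multiplicity p n + (1 - t p * (-1)) * (-1) ^ multiplicity p n))"
    by (rule expect_prod[OF Q(1)])
  also have "\<dots> = tilted_coeff (\<lambda>p. t p * (1 - vanish_prob p)) n"
    unfolding tc
  proof (intro prod.cong refl)
    fix p
    show "vanish_prob p * ((1 - t p * 0) * 0 ^ multiplicity p n) +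
      (1 - vanish_prob p) / 2 * ((1 - t p * 1) * 1 ^ multiplicity p n + (1 - t p * (-1)) * (-1) ^ multiplicity p n) =
      (if multiplicity p n = 0 then 1 else
     if odd (multiplicity p n) then - (t p * (1 - vanish_prob p)) else 1 - vanish_prob p)"
      by (cases "multiplicity p n = 0"; cases "even (multiplicity p n)") (simp_all add: zero_power algebra_simps diff_divide_distrib)
  qed
  finally show ?thesis .
qed

text \<open>Without a tilt a prime of odd exponent has mean zero, so only squares survive, with the
  same weight as in the family average.\<close>

lemma tilted_coeff_0:
  assumes "n > 0"
  shows "tilted_coeff (\<lambda>_. 0) n = (if \<exists>k. n = k ^ 2 then \<Prod>p\<in>prime_factors n. 1 - vanish_prob p else 0)"
proof (cases "\<exists>p\<in>prime_factors n. odd (multiplicity p n)")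
  case True
  then obtain p where p: "p \<in> prime_factors n" "odd (multiplicity p n)" by blast
  have "tilted_coeff (\<lambda>_. 0) n = 0"
    unfolding tilted_coeff_def using p by (intro prod_zero) auto
  moreover have "\<nexists>k. n = k ^ 2"
  proof
    assume "\<exists>k. n = k ^ 2"
    then obtain k where k: "n = k ^ 2" by blast
    hence "k \<noteq> 0" using assms by (cases k) auto
    hence "multiplicity p n = 2 * multiplicity p k"
      using p k by (simp add: prime_elem_multiplicity_power_distrib in_prime_factors_imp_prime)
    thus False using p by simp
  qed
  ultimately show ?thesis by simp
next
  case False
  hence "n = (\<Prod>p\<in>prime_factors n. p ^ (multiplicity p n div 2)) ^ 2"
    using assms by (intro square_if_even_multiplicities) auto
  moreover have "tilted_coeff (\<lambda>_. 0) n = (\<Prod>p\<in>prime_factors n. 1 - vanish_prob p)"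
    unfolding tilted_coeff_def using False by (intro prod.cong refl) auto
  ultimately show ?thesis by metis
qed

section \<open>Transfer of Dirichlet polynomials from the family to the model\<close>

lemma expect_char_value:
  assumes "finite Q" "\<And>p. p \<in> Q \<Longrightarrow> prime p" "n > 0" "prime_factors n \<subseteq> Q"
  shows "expect Q (\<lambda>f. char_value f n) = tilted_coeff (\<lambda>_. 0) n"
  using expect_tilted[OF assms, of "\<lambda>_. 0"] by simp

text \<open>\<open>C\<close> bounds the sum of the absolute values of the coefficients and
  \<open>X\<close> the frequencies. The inductive form carries both bounds through sums and products
  without extracting coefficients; terms of equal frequency are not collected.\<close>

inductive dirichlet_poly :: "nat set \<Rightarrow> ((nat \<Rightarrow> real) \<Rightarrow> real) \<Rightarrow> real \<Rightarrow> real \<Rightarrow> bool" for Q where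
  single: "1 \<le> n \<Longrightarrow> real n \<le> X \<Longrightarrow> prime_factors n \<subseteq> Q \<Longrightarrow> \<bar>c\<bar> \<le> C
    \<Longrightarrow> dirichlet_poly Q (\<lambda>f. c * char_value f n) C X"
| add: "dirichlet_poly Q F C X \<Longrightarrow> dirichlet_poly Q G C' X
    \<Longrightarrow> dirichlet_poly Q (\<lambda>f. F f + G f) (C + C') X"

lemma dirichlet_poly_mono:
  assumes "dirichlet_poly Q F C X" "C \<le> C'" "X \<le> X'"
  shows "dirichlet_poly Q F C' X'"
  using assms
proof (induction arbitrary: C' rule: dirichlet_poly.induct)
  case (add F C1 X G C2)
  have "dirichlet_poly Q (\<lambda>f. F f + G f) (C1 + (C' - C1)) X'"
    using add by (intro dirichlet_poly.add) auto
  thus ?case by simp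
qed (auto intro: dirichlet_poly.single)

lemma dirichlet_poly_const: "1 \<le> X \<Longrightarrow> dirichlet_poly Q (\<lambda>f. c) \<bar>c\<bar> X"
  using dirichlet_poly.single[of 1 X Q c "\<bar>c\<bar>"] by simp

lemma dirichlet_poly_sum:
  assumes "finite A" "1 \<le> X" "\<And>i. i \<in> A \<Longrightarrow> dirichlet_poly Q (F i) (C i) X"
  shows "dirichlet_poly Q (\<lambda>f. \<Sum>i\<in>A. F i f) (\<Sum>i\<in>A. C i) X"
  using assms(1,3)
proof (induction A rule: finite_induct)
  case empty
  show ?case using dirichlet_poly_const[OF assms(2), of Q 0] by simp
next
  case (insert i A)
  thus ?case by (simp add: dirichlet_poly.add)
qed

lemma dirichlet_poly_mult:
  assumes "dirichlet_poly Q F C X" "dirichlet_poly Q G C' X'"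
  shows "dirichlet_poly Q (\<lambda>f. F f * G f) (C * C') (X * X')"
  using assms(1)
proof (induction rule: dirichlet_poly.induct)
  case (single m X c C)
  show ?case using assms(2)
  proof (induction rule: dirichlet_poly.induct)
    case (single n X' d C')
    have "dirichlet_poly Q (\<lambda>f. (c * d) * char_value f (m * n)) (C * C') (X * X')"
    proof (rule dirichlet_poly.single)
      show "1 \<le> m * n" using single \<open>1 \<le> m\<close> by simp
      show "real (m * n) \<le> X * X'" using single \<open>1 \<le> m\<close> \<open>real m \<le> X\<close> by (auto intro!: mult_mono)
      show "prime_factors (m * n) \<subseteq> Q"
        using single \<open>1 \<le> m\<close> \<open>prime_factors m \<subseteq> Q\<close> by (simp add: prime_factors_product)
      show "\<bar>c * d\<bar> \<le> C * C'" using single \<open>\<bar>c\<bar> \<le> C\<close> by (auto simp: abs_mult intro!: mult_mono)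
    qed
    moreover have "(\<lambda>f. (c * d) * char_value f (m * n)) = (\<lambda>f. c * char_value f m * (d * char_value f n))"
      using single \<open>1 \<le> m\<close> by (simp add: char_value_mult fun_eq_iff)
    ultimately show ?case by simp
  next
    case (add F C1 X' G C2)
    thus ?case using dirichlet_poly.add by (simp add: distrib_left)
  qed
next
  case (add F C1 X G' C2)
  thus ?case using dirichlet_poly.add by (simp add: distrib_right)
qed

definition family_error :: "real \<Rightarrow> nat \<Rightarrow> real \<Rightarrow> real" where
  "family_error D Y X = real Y * (2 * sqrt X * (1 + ln X)) + D / real Y"

lemma family_error_mono:
  assumes "1 \<le> X" "X \<le> X'"
  shows "family_error D Y X \<le> family_error D Y X'"
proof -
  have "sqrt X * (1 + ln X) \<le> sqrt X' * (1 + ln X')"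
    using assms by (intro mult_mono) auto
  hence "real Y * (2 * (sqrt X * (1 + ln X))) \<le> real Y * (2 * (sqrt X' * (1 + ln X')))"
    by (intro mult_left_mono) auto
  thus ?thesis by (simp add: family_error_def mult.assoc)
qed

text \<open>Average and expectation are linear, so it suffices to treat one frequency; each
  contributes its coefficient times the common error.\<close>

lemma average_dirichlet_poly:
  assumes "dirichlet_poly Q F C X" and Q: "finite Q" "Q \<subseteq> insert 2 (odd_primes_upto D)"
    and D: "D \<ge> 1" and Y: "Y \<ge> 1"
  shows "\<bar>(\<Sum>m\<in>sqfree_family D. F (\<lambda>p. real_of_int (kronecker_prime (8 * m) p)))
     - family_density D * expect Q F\<bar> \<le> C * family_error D Y X"
  using assms(1)
proof (induction rule: dirichlet_poly.induct)
  case (single n X c C)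
  have prQ: "prime p" if "p \<in> Q" for p using that Q(2) odd_primes_uptoD[of p D] by auto
  let ?\<chi> = "\<lambda>m p. real_of_int (kronecker_prime (8 * m) p)"
  have n0: "n > 0" using single by simp
  have err0: "0 \<le> family_error D Y X" using single D by (auto simp: family_error_def)
  have E: "expect Q (\<lambda>f. char_value f n) = tilted_coeff (\<lambda>_. 0) n"
    using Q prQ n0 single by (intro expect_char_value) auto
  have "\<bar>(\<Sum>m\<in>sqfree_family D. char_value (?\<chi> m) n) - family_density D * expect Q (\<lambda>f. char_value f n)\<bar> \<le> family_error D Y X"
  proof (cases "odd n")
    case True
    have sub: "prime_factors n \<subseteq> odd_primes_upto D"
    proof
      fix p assume p: "p \<in> prime_factors n"
      hence "p \<in> insert 2 (odd_primes_upto D)" using single Q by blast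
      moreover have "p \<noteq> 2" using odd_prime_factor(2)[OF True p] by simp
      ultimately show "p \<in> odd_primes_upto D" by blast
    qed
    \<comment> \<open>Among squarefree integers the proportion prime to \<open>p\<close> is p/(p +
      1). This agreement is the origin of the value 1/(p + 1) of \<open>vanish_prob\<close>.\<close>
    have "(\<Prod>p\<in>prime_factors n. 1 - vanish_prob p) = (\<Prod>p\<in>prime_factors n. p / (p + 1))"
    proof (intro prod.cong refl)
      fix p assume "p \<in> prime_factors n"
      hence "2 < p" by (rule odd_prime_factor(2)[OF True])
      thus "1 - vanish_prob p = p / (p + 1)" by (simp add: vanish_prob_def field_simps)
    qed
    hence "\<bar>(\<Sum>m\<in>sqfree_family D. char_value (?\<chi> m) n) - family_density D * expect Q (\<lambda>f. char_value f n)\<bar>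
       \<le> family_error D Y n"
      using average_kronecker[OF True D Y sub] n0
      unfolding E family_error_def by (simp only: char_value_kronecker tilted_coeff_0)
    also have "\<dots> \<le> family_error D Y X" using single by (intro family_error_mono) auto
    finally show ?thesis .
  next
    case False
    \<comment> \<open>Even frequencies vanish on both sides: the symbol of 8 m at 2 is 0, and
      \<open>vanish_prob 2 = 1\<close>.\<close>
    hence 2: "2 \<in> prime_factors n" using n0 by (simp add: prime_factors_dvd)
    have "tilted_coeff (\<lambda>_. 0) n = 0"
      unfolding tilted_coeff_def using 2 by (intro prod_zero) (auto intro!: bexI[of _ 2] simp: vanish_prob_def)
    moreover have "char_value (?\<chi> m) n = 0" for m
    proof -
      have "multiplicity 2 n > 0" using 2 by (simp add: prime_factors_multiplicity)
      thus ?thesis unfolding char_value_def using 2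
        by (intro prod_zero) (auto intro!: bexI[of _ 2] simp: kronecker_prime_def)
    qed
    ultimately show ?thesis using E err0 by simp
  qed
  note this
  moreover have "(\<Sum>m\<in>sqfree_family D. c * char_value (?\<chi> m) n) - family_density D * expect Q (\<lambda>f. c * char_value f n)
     = c * ((\<Sum>m\<in>sqfree_family D. char_value (?\<chi> m) n) - family_density D * expect Q (\<lambda>f. char_value f n))"
    by (simp add: expect_cmult sum_distrib_left algebra_simps)
  ultimately show ?case using single err0 by (auto simp: abs_mult intro!: mult_mono)
next
  case (add F C X G C')
  let ?\<chi> = "\<lambda>m p. real_of_int (kronecker_prime (8 * m) p)"
  have "(\<Sum>m\<in>sqfree_family D. F (?\<chi> m) + G (?\<chi> m)) - family_density D * expect Q (\<lambda>f. F f + G f)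
     = ((\<Sum>m\<in>sqfree_family D. F (?\<chi> m)) - family_density D * expect Q F)
     + ((\<Sum>m\<in>sqfree_family D. G (?\<chi> m)) - family_density D * expect Q G)"
    by (simp add: expect_add sum.distrib algebra_simps)
  thus ?case using add.IH by (simp add: distrib_right)
qed

section \<open>Sums of tilted coefficients\<close>

text \<open>The squares up to \<open>w\<close>, each weighted by the inverse of its root: what the
  factor zeta(1 + 2z) contributes to a tilted sum.\<close>

definition sq_harm :: "real \<Rightarrow> real" where
  "sq_harm w = (\<Sum>k | 1 \<le> k \<and> real k ^ 2 \<le> w. 1 / real k)"

lemma sq_harm_set_eq:
  assumes "0 \<le> w"
  shows "{k. 1 \<le> k \<and> real k ^ 2 \<le> w} = {1..nat \<lfloor>sqrt w\<rfloor>}"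
proof -
  have iff: "real k ^ 2 \<le> w \<longleftrightarrow> k \<le> nat \<lfloor>sqrt w\<rfloor>" for k
  proof -
    have "real k ^ 2 \<le> w \<longleftrightarrow> real k \<le> sqrt w"
      using assms by (metis of_nat_0_le_iff real_le_lsqrt real_le_rsqrt real_sqrt_le_iff real_sqrt_unique)
    also have "\<dots> \<longleftrightarrow> k \<le> nat \<lfloor>sqrt w\<rfloor>" using assms by (simp add: le_nat_iff le_floor_iff)
    finally show ?thesis .
  qed
  show ?thesis by (rule Set.set_eqI) (simp only: mem_Collect_eq atLeastAtMost_iff iff)
qed

text \<open>For \<open>w \<ge> 1\<close> this is the expansion of the harmonic numbers; for
  \<open>w < 1\<close> the sum is empty and the power absorbs the logarithm. It has to hold for all
  \<open>w > 0\<close>, as it is applied at X / N with N possibly larger than X. The exponent -1/4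
  is a compromise: with -1/2 the Euler product in the error would contain the terms vanish_prob p /
  p * p, whose sum over the primes diverges.\<close>

lemma sq_harm_approx:
  assumes "0 < w"
  shows "\<bar>sq_harm w - (ln w / 2 + euler_mascheroni)\<bar> \<le> 4 * w powr (-1/4)"
proof -
  define m where "m = nat \<lfloor>sqrt w\<rfloor>"
  have sq: "sq_harm w = harm m"
    unfolding sq_harm_def m_def harm_def using assms by (subst sq_harm_set_eq) (auto simp: inverse_eq_divide)
  have em: "0 < (euler_mascheroni::real)" "(euler_mascheroni::real) < 1"
    using euler_mascheroni_pos euler_mascheroni_less_13_over_22 by auto
  show ?thesis
  proof (cases "1 \<le> w")
    case True
    hence s1: "1 \<le> sqrt w" by simp
    have m: "m \<ge> 1" "real m \<le> sqrt w" "sqrt w < real m + 1"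
      using s1 by (auto simp: m_def le_nat_iff le_floor_iff)
    have "ln (sqrt w) = ln w / 2" using assms by (simp add: ln_sqrt)
    moreover have "ln (sqrt w) \<le> ln (real (Suc m))" using m s1 by (subst ln_le_cancel_iff) auto
    moreover have "ln (real (Suc m)) \<le> ln (sqrt w) + 1 / m"
    proof -
      have "ln (real (Suc m) / m) \<le> real (Suc m) / m - 1" using m by (intro ln_le_minus_one) auto
      hence "ln (real (Suc m)) - ln m \<le> 1 / m" using m by (simp add: ln_div field_simps)
      moreover have "ln m \<le> ln (sqrt w)" using m assms by (subst ln_le_cancel_iff) auto
      ultimately show ?thesis by linarith
    qed
    moreover have "harm m - ln (real (Suc m)) \<le> euler_mascheroni"
      "euler_mascheroni \<le> harm m - ln (real (Suc m)) + 1 / m"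
    proof -
      have "0 \<le> inverse (real (2 * (m + 1)))" by simp
      moreover have "inverse (real (2 * m)) \<le> 1 / m" using m by (simp add: field_simps)
      ultimately show "harm m - ln (real (Suc m)) \<le> euler_mascheroni"
        "euler_mascheroni \<le> harm m - ln (real (Suc m)) + 1 / m"
        using euler_mascheroni_bounds[OF m(1)] unfolding atLeastAtMost_iff by linarith+
    qed
    ultimately have "\<bar>sq_harm w - (ln w / 2 + euler_mascheroni)\<bar> \<le> 1 / m"
      unfolding sq abs_le_iff by linarith
    also have "\<dots> \<le> 2 / sqrt w"
    proof -
      have m1: "1 \<le> real m" using m(1) by simp
      have "sqrt w \<le> 2 * real m" using m(3) m1 by linarith
      moreover have "0 < 2 * real m * sqrt w" using m1 s1 by (intro mult_pos_pos) linarith+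
      ultimately have "2 / (2 * real m) \<le> 2 / sqrt w" by (intro divide_left_mono) simp_all
      thus ?thesis by simp
    qed
    also have "\<dots> = 2 * w powr (-1/2)" using assms by (simp add: powr_minus_divide powr_half_sqrt)
    also have "\<dots> \<le> 4 * w powr (-1/4)"
    proof -
      have "w powr (-1/2) \<le> w powr (-1/4)" using True by (intro powr_mono) auto
      moreover have "0 \<le> w powr (-1/4)" by simp
      ultimately show ?thesis by linarith
    qed
    finally show ?thesis .
  next
    case False
    hence "m = 0" using assms by (simp add: m_def floor_eq_iff)
    hence 0: "sq_harm w = 0" by (simp add: sq harm_def)
    \<comment> \<open>In terms of \<open>t\<close> the logarithm is ln w = -4 ln t, and ln t \<le> t
      - 1 gives the bound.\<close>
    define t where "t = w powr (-1/4)"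
    have t: "t > 0" "ln t = - ln w / 4" using assms by (auto simp: t_def ln_powr)
    have "ln t \<le> t - 1" using t by (intro ln_le_minus_one)
    moreover have "ln w \<le> 0" using False assms by simp
    ultimately show ?thesis unfolding 0 t_def[symmetric] abs_le_iff using t em by linarith
  qed
qed

definition local_coeff :: "(nat \<Rightarrow> real) \<Rightarrow> nat \<Rightarrow> nat \<Rightarrow> real" where
  "local_coeff b p j = (if j = 0 then 1 else if j = 1 then - (b p / sqrt p) else - (vanish_prob p / p))"

lemma inverse_sqrt_power_even: "p > 0 \<Longrightarrow> (1 / sqrt (real p)) ^ (2 * j) = 1 / real p ^ j"
  by (simp add: power_mult power_divide)

lemma sqrt_prod: "sqrt (prod f A) = (\<Prod>x\<in>A. sqrt (f x))"
  by (induction A rule: infinite_finite_induct) (simp_all add: real_sqrt_mult)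

text \<open>Locally at \<open>p\<close> the Dirichlet series of \<open>tilted_coeff b n / sqrt n\<close> is
  \<open>(\<Sum>j. p\<^sup>-\<^sup>j T\<^sup>2\<^sup>j) * (1 - b p T / sqrt p - vanish_prob p T\<^sup>2 / p)\<close>; the first factor belongs to the squares.\<close>

lemma tilted_coeff_convolution:
  fixes n X :: nat
  assumes Q: "finite Q" "\<And>p. p \<in> Q \<Longrightarrow> prime p" and n: "1 \<le> n" "n \<le> X" "prime_factors n \<subseteq> Q"
  shows "tilted_coeff b n / sqrt (real n) = (\<Sum>g\<in>PiE Q (\<lambda>_. {0, 1, 2}). (\<Prod>p\<in>Q. local_coeff b p (g p)) *
     (\<Sum>k=1..X. if (\<Prod>p\<in>Q. p ^ g p) * k ^ 2 = n then 1 / real k else 0))"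
proof -
  define v where "v = (\<lambda>p. multiplicity p n)"
  \<comment> \<open>Exponents that the second local factor may contribute at \<open>p\<close>: at
    most 2, at most \<open>v p\<close>, and of the parity of \<open>v p\<close>, so that a square
    accounts for the rest.\<close>
  define A where "A = (\<lambda>p. if v p = 0 then {0} else if odd (v p) then {1} else {0, 2::nat})"
  have p0: "p > 0" if "p \<in> Q" for p using Q(2)[OF that] prime_gt_0_nat by auto
  have Asub: "A p \<subseteq> {0, 1, 2}" for p by (auto simp: A_def)
  have Ale: "j \<le> v p \<and> even (v p - j)" if "j \<in> A p" for p j
    using that by (auto simp: A_def split: if_splits)
  have nprod: "n = (\<Prod>p\<in>Q. p ^ v p)"
  proof -
    have "n = (\<Prod>p\<in>prime_factors n. p ^ v p)"
      using n unfolding v_def by (subst prime_factorization_nat[symmetric]) auto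
    also have "\<dots> = (\<Prod>p\<in>Q. p ^ v p)"
    proof (rule prod.mono_neutral_left[OF Q(1) n(3)], safe)
      fix p assume p: "p \<in> Q" "p \<notin># prime_factorization n"
      hence "\<not> p dvd n" using n Q(2)[of p] by (auto simp: prime_factors_dvd)
      thus "p ^ v p = 1" by (simp add: v_def not_dvd_imp_multiplicity_0)
    qed
    finally show ?thesis .
  qed
  \<comment> \<open>For given \<open>g\<close> the equation determines \<open>k\<close>, and it is
    solvable exactly when every \<open>g p\<close> is admissible.\<close>
  have inner: "(\<Sum>k=1..X. if (\<Prod>p\<in>Q. p ^ g p) * k ^ 2 = n then 1 / real k else 0)
      = (if g \<in> PiE Q A then \<Prod>p\<in>Q. (1 / sqrt p) ^ (v p - g p) else 0)"
    if g: "g \<in> PiE Q (\<lambda>_. {0, 1, 2})" for g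
  proof (cases "g \<in> PiE Q A")
    case True
    define k0 where "k0 = (\<Prod>p\<in>Q. p ^ ((v p - g p) div 2))"
    have gp: "g p \<le> v p" "2 * ((v p - g p) div 2) = v p - g p" if "p \<in> Q" for p
      using Ale[of "g p" p] True that by (auto simp: PiE_iff)
    have k0: "(\<Prod>p\<in>Q. p ^ g p) * k0 ^ 2 = n"
    proof -
      have "(\<Prod>p\<in>Q. p ^ g p) * k0 ^ 2 = (\<Prod>p\<in>Q. p ^ g p * (p ^ ((v p - g p) div 2)) ^ 2)"
        by (simp add: k0_def prod.distrib prod_power_distrib)
      also have "\<dots> = (\<Prod>p\<in>Q. p ^ v p)"
      proof (intro prod.cong refl)
        fix p assume "p \<in> Q"
        hence "p ^ g p * (p ^ ((v p - g p) div 2)) ^ 2 = p ^ (g p + (v p - g p))"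
          unfolding power_mult[symmetric] power_add[symmetric] using gp(2)[of p] by (simp add: mult.commute)
        thus "p ^ g p * (p ^ ((v p - g p) div 2)) ^ 2 = p ^ v p" using gp(1)[OF \<open>p \<in> Q\<close>] by simp
      qed
      finally show ?thesis using nprod by simp
    qed
    have N0: "(\<Prod>p\<in>Q. p ^ g p) > 0" using p0 by (intro prod_pos) auto
    have k00: "k0 > 0" using p0 unfolding k0_def by (intro prod_pos) auto
    have "k0 \<le> n"
    proof -
      have "1 * (k0 * 1) \<le> (\<Prod>p\<in>Q. p ^ g p) * (k0 * k0)"
        using N0 k00 by (intro mult_mono) auto
      also have "\<dots> = n" using k0 by (simp only: power2_eq_square)
      finally show ?thesis by simp
    qed
    hence k0X: "k0 \<in> {1..X}" using n k00 by auto
    have uniq: "k = k0" if "(\<Prod>p\<in>Q. p ^ g p) * k ^ 2 = n" for k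
    proof -
      have "(\<Prod>p\<in>Q. p ^ g p) * k ^ 2 = (\<Prod>p\<in>Q. p ^ g p) * k0 ^ 2" using that k0 by simp
      hence "k ^ 2 = k0 ^ 2" using N0 by simp
      thus ?thesis by simp
    qed
    have "(\<Sum>k=1..X. if (\<Prod>p\<in>Q. p ^ g p) * k ^ 2 = n then 1 / real k else 0) = (\<Sum>k=1..X. if k = k0 then 1 / real k else 0)"
    proof (intro sum.cong refl)
      fix k
      have "(\<Prod>p\<in>Q. p ^ g p) * k ^ 2 = n \<longleftrightarrow> k = k0" using uniq[of k] k0 by blast
      thus "(if (\<Prod>p\<in>Q. p ^ g p) * k ^ 2 = n then 1 / real k else 0) = (if k = k0 then 1 / real k else 0)"
        by (simp only:)
    qed
    also have "\<dots> = 1 / real k0" using k0X by simp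
    also have "\<dots> = (\<Prod>p\<in>Q. 1 / real p ^ ((v p - g p) div 2))" by (simp add: k0_def prod_dividef)
    also have "\<dots> = (\<Prod>p\<in>Q. (1 / sqrt p) ^ (v p - g p))"
    proof (intro prod.cong refl)
      fix p assume "p \<in> Q"
      thus "1 / real p ^ ((v p - g p) div 2) = (1 / sqrt p) ^ (v p - g p)"
        using inverse_sqrt_power_even[OF p0, of p "(v p - g p) div 2"] gp(2)[of p] by simp
    qed
    finally show ?thesis using True by simp
  next
    case False
    have "\<not> (\<Prod>p\<in>Q. p ^ g p) * k ^ 2 = n" for k
    proof
      assume k: "(\<Prod>p\<in>Q. p ^ g p) * k ^ 2 = n"
      have "k \<noteq> 0" using k n by (cases k) auto
      have "g p \<in> A p" if p: "p \<in> Q" for p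
      proof -
        have pp: "prime p" using Q p by auto
        have "(\<Prod>p\<in>Q. p ^ g p) \<noteq> 0" using p0 Q(1) by auto
        hence "v p = multiplicity p (\<Prod>p\<in>Q. p ^ g p) + multiplicity p (k ^ 2)"
          unfolding v_def k[symmetric] using pp \<open>k \<noteq> 0\<close> by (intro prime_elem_multiplicity_mult_distrib) auto
        also have "multiplicity p (\<Prod>p\<in>Q. p ^ g p) = g p"
          using multiplicity_prod_prime_powers[of Q p g] Q pp p by auto
        also have "multiplicity p (k ^ 2) = 2 * multiplicity p k"
          using pp \<open>k \<noteq> 0\<close> by (simp add: prime_elem_multiplicity_power_distrib)
        finally have "v p = g p + 2 * multiplicity p k" .
        moreover have "g p \<in> {0, 1, 2}" using g p by (auto simp: PiE_iff)
        ultimately show ?thesis by (auto simp: A_def)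
      qed
      hence "g \<in> PiE Q A" using g by (auto simp: PiE_iff)
      thus False using False by blast
    qed
    thus ?thesis using False by simp
  qed
  have "(\<Sum>g\<in>PiE Q (\<lambda>_. {0, 1, 2}). (\<Prod>p\<in>Q. local_coeff b p (g p)) *
     (\<Sum>k=1..X. if (\<Prod>p\<in>Q. p ^ g p) * k ^ 2 = n then 1 / real k else 0))
    = (\<Sum>g\<in>PiE Q (\<lambda>_. {0, 1, 2}). if g \<in> PiE Q A then (\<Prod>p\<in>Q. local_coeff b p (g p) * (1 / sqrt p) ^ (v p - g p)) else 0)"
  proof (intro sum.cong refl)
    fix g assume g: "g \<in> PiE Q (\<lambda>_. {0, 1, 2::nat})"
    show "(\<Prod>p\<in>Q. local_coeff b p (g p)) * (\<Sum>k=1..X. if (\<Prod>p\<in>Q. p ^ g p) * k ^ 2 = n then 1 / real k else 0)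
      = (if g \<in> PiE Q A then (\<Prod>p\<in>Q. local_coeff b p (g p) * (1 / sqrt p) ^ (v p - g p)) else 0)"
      unfolding inner[OF g] by (simp add: prod.distrib)
  qed
  also have "\<dots> = (\<Sum>g\<in>PiE Q A. \<Prod>p\<in>Q. local_coeff b p (g p) * (1 / sqrt p) ^ (v p - g p))"
  proof -
    have "PiE Q A \<subseteq> PiE Q (\<lambda>_. {0, 1, 2})" using Asub by (intro PiE_mono) auto
    moreover have "finite (PiE Q (\<lambda>_. {0, 1, 2::nat}))" using Q by (intro finite_PiE) auto
    ultimately show ?thesis by (simp add: sum.If_cases Int_absorb1)
  qed
  also have "\<dots> = (\<Prod>p\<in>Q. \<Sum>j\<in>A p. local_coeff b p j * (1 / sqrt p) ^ (v p - j))"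
    using Q by (intro prod_sum_PiE[symmetric]) (auto simp: A_def)
  also have "\<dots> = (\<Prod>p\<in>Q. (if v p = 0 then 1 else if odd (v p) then - b p else 1 - vanish_prob p) * (1 / sqrt p) ^ v p)"
  proof (intro prod.cong refl)
    fix p assume p: "p \<in> Q"
    define s where "s = 1 / sqrt (real p)"
    have s2: "1 / real p = s ^ 2" using p0[OF p] by (simp add: s_def power_divide)
    have "local_coeff b p 2 = - (vanish_prob p * (1 / real p))" by (simp add: local_coeff_def)
    hence lc: "local_coeff b p (Suc 0) = - (b p * s)" "local_coeff b p 2 = - (vanish_prob p * s ^ 2)" "local_coeff b p 0 = 1"
      unfolding s2 by (simp_all add: local_coeff_def s_def)
    consider "v p = 0" | m where "v p = Suc (2 * m)" | m where "v p = 2 * Suc m"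
    proof (cases "even (v p)")
      case True
      then obtain m where "v p = 2 * m" by (elim evenE)
      thus ?thesis using that(1,3) by (cases m) auto
    next
      case False
      then obtain m where "v p = 2 * m + 1" by (elim oddE)
      thus ?thesis using that(2)[of m] by simp
    qed
    thus "(\<Sum>j\<in>A p. local_coeff b p j * (1 / sqrt p) ^ (v p - j)) =
        (if v p = 0 then 1 else if odd (v p) then - b p else 1 - vanish_prob p) * (1 / sqrt p) ^ v p"
      unfolding s_def[symmetric]
    proof cases
      case 1
      thus "(\<Sum>j\<in>A p. local_coeff b p j * s ^ (v p - j)) = (if v p = 0 then 1 else if odd (v p) then - b p else 1 - vanish_prob p) * s ^ v p"
        by (simp add: A_def lc)
    next
      case 2
      thus "(\<Sum>j\<in>A p. local_coeff b p j * s ^ (v p - j)) = (if v p = 0 then 1 else if odd (v p) then - b p else 1 - vanish_prob p) * s ^ v p"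
        using lc(1) by (simp add: A_def)
    next
      case 3
      have "A p = {0, 2}" using 3 by (simp add: A_def)
      hence "(\<Sum>j\<in>A p. local_coeff b p j * s ^ (v p - j)) = s ^ (2 * Suc m) + (- (vanish_prob p * s ^ 2)) * s ^ (2 * m)"
        using 3 by (simp add: lc)
      also have "\<dots> = (1 - vanish_prob p) * s ^ (2 * Suc m)"
      proof -
        have "s ^ (2 * Suc m) = s ^ 2 * s ^ (2 * m)" by (simp only: power_add[symmetric]) simp
        thus ?thesis by (simp only:) (simp add: algebra_simps)
      qed
      finally show "(\<Sum>j\<in>A p. local_coeff b p j * s ^ (v p - j)) = (if v p = 0 then 1 else if odd (v p) then - b p else 1 - vanish_prob p) * s ^ v p"
        using 3 by simp
    qed
  qed
  also have "\<dots> = tilted_coeff b n * (\<Prod>p\<in>Q. (1 / sqrt p) ^ v p)"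
    unfolding prod.distrib v_def using tilted_coeff_eq_prod[of n Q b] n Q by simp
  also have "(\<Prod>p\<in>Q. (1 / sqrt p) ^ v p) = 1 / sqrt n"
  proof -
    have "sqrt (real n) = (\<Prod>p\<in>Q. sqrt p ^ v p)"
      by (subst nprod) (simp add: sqrt_prod real_sqrt_power)
    thus ?thesis by (simp add: prod_dividef power_divide)
  qed
  finally show ?thesis by simp
qed

text \<open>After exchanging the summations, each choice \<open>g\<close> of exponents leaves a
  harmonic sum over the squares up to X divided by the product of the \<open>p ^ g p\<close>. The
  sum over all \<open>n\<close> thus becomes a sum over the terms of a finite Euler product.\<close>

lemma tilted_sum_identity:
  fixes X :: nat
  assumes Q: "finite Q" "\<And>p. p \<in> Q \<Longrightarrow> prime p" and X: "\<And>n. 1 \<le> n \<Longrightarrow> n \<le> X \<Longrightarrow> prime_factors n \<subseteq> Q"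
  shows "(\<Sum>n=1..X. tilted_coeff b n / sqrt (real n)) =
     (\<Sum>g\<in>PiE Q (\<lambda>_. {0, 1, 2}). (\<Prod>p\<in>Q. local_coeff b p (g p)) * sq_harm (real X / (\<Prod>p\<in>Q. real p ^ g p)))"
proof -
  have p0: "p > 0" if "p \<in> Q" for p using Q(2)[OF that] prime_gt_0_nat by auto
  have "(\<Sum>n=1..X. tilted_coeff b n / sqrt (real n)) = (\<Sum>n=1..X. \<Sum>g\<in>PiE Q (\<lambda>_. {0, 1, 2}). (\<Prod>p\<in>Q. local_coeff b p (g p)) *
     (\<Sum>k=1..X. if (\<Prod>p\<in>Q. p ^ g p) * k ^ 2 = n then 1 / real k else 0))"
    by (intro sum.cong refl tilted_coeff_convolution Q X) auto
  also have "\<dots> = (\<Sum>g\<in>PiE Q (\<lambda>_. {0, 1, 2}). (\<Prod>p\<in>Q. local_coeff b p (g p)) *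
     (\<Sum>n=1..X. \<Sum>k=1..X. if (\<Prod>p\<in>Q. p ^ g p) * k ^ 2 = n then 1 / real k else 0))"
    by (subst sum.swap) (simp only: sum_distrib_left)
  also have "\<dots> = (\<Sum>g\<in>PiE Q (\<lambda>_. {0, 1, 2}). (\<Prod>p\<in>Q. local_coeff b p (g p)) * sq_harm (real X / (\<Prod>p\<in>Q. real p ^ g p)))"
  proof (intro sum.cong refl arg_cong2[where f = "(*)"])
    fix g
    define N where "N = (\<Prod>p\<in>Q. p ^ g p)"
    have N0: "N > 0" unfolding N_def using p0 by (intro prod_pos) auto
    have "(\<Sum>n=1..X. \<Sum>k=1..X. if N * k ^ 2 = n then 1 / real k else 0)
        = (\<Sum>k=1..X. \<Sum>n=1..X. if N * k ^ 2 = n then 1 / real k else 0)"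
      by (rule sum.swap)
    also have "\<dots> = (\<Sum>k=1..X. if N * k ^ 2 \<le> X then 1 / real k else 0)"
    proof (intro sum.cong refl)
      fix k assume "k \<in> {1..X}"
      hence "1 \<le> N * k ^ 2" using N0 by simp
      thus "(\<Sum>n=1..X. if N * k ^ 2 = n then 1 / real k else 0) = (if N * k ^ 2 \<le> X then 1 / real k else 0)"
        by simp
    qed
    also have "\<dots> = (\<Sum>k\<in>{k\<in>{1..X}. N * k ^ 2 \<le> X}. 1 / real k)"
      by (rule sum.inter_filter[symmetric]) simp
    also have "{k\<in>{1..X}. N * k ^ 2 \<le> X} = {k. 1 \<le> k \<and> real k ^ 2 \<le> real X / real N}"
    proof -
      have iff: "N * k ^ 2 \<le> X \<longleftrightarrow> real k ^ 2 \<le> real X / real N" for k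
      proof -
        have "N * k ^ 2 \<le> X \<longleftrightarrow> real (N * k ^ 2) \<le> real X" by (simp only: of_nat_le_iff)
        thus ?thesis using N0 by (simp add: field_simps)
      qed
      moreover have "k \<le> X" if "N * k ^ 2 \<le> X" for k
      proof -
        have "k \<le> k ^ 2" by (simp add: power2_eq_square)
        also have "\<dots> \<le> N * k ^ 2" using N0 by simp
        finally show ?thesis using that by simp
      qed
      ultimately show ?thesis by auto
    qed
    finally show "(\<Sum>n=1..X. \<Sum>k=1..X. if (\<Prod>p\<in>Q. p ^ g p) * k ^ 2 = n then 1 / real k else 0) = sq_harm (real X / (\<Prod>p\<in>Q. real p ^ g p))"
      by (simp only: N_def sq_harm_def of_nat_prod of_nat_power)
  qed
  finally show ?thesis .
qed

text \<open>Insert the expansion of \<open>sq_harm\<close>. Its constant term is multiplied by the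
  Euler product of the factors 1 - \<alpha> - \<beta>, which the condition on \<open>b\<close> keeps
  in [0, 1]; the logarithm of the product of the \<open>p ^ g p\<close> produces a derivative of
  that Euler product; for the remainder, absolute values are taken in every factor. Cancellation is
  thus retained everywhere except in the last term, which carries a negative power of
  \<open>X\<close>.\<close>

lemma tilted_sum_bound:
  fixes X :: nat
  assumes Q: "finite Q" "\<And>p. p \<in> Q \<Longrightarrow> prime p" and pf: "\<And>n. 1 \<le> n \<Longrightarrow> n \<le> X \<Longrightarrow> prime_factors n \<subseteq> Q"
    and X: "X \<ge> 1" and b: "\<And>p. p \<in> Q \<Longrightarrow> 0 \<le> b p" "\<And>p. p \<in> Q \<Longrightarrow> b p / sqrt (real p) + vanish_prob p / real p \<le> 1"
  shows "\<bar>\<Sum>n=1..X. tilted_coeff b n / sqrt (real n)\<bar> \<le> ln (real X) / 2 + 1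
      + (\<Sum>p\<in>Q. (b p / sqrt (real p) + 2 * (vanish_prob p / real p)) * ln (real p))
      + 4 * real X powr (-1/4) * (\<Prod>p\<in>Q. 1 + b p / sqrt (real p) * real p powr (1/4) + vanish_prob p / real p * real p powr (1/2))"
proof -
  define \<Gamma> where "\<Gamma> = PiE Q (\<lambda>_. {0, 1, 2::nat})"
  define c where "c = (\<lambda>g. \<Prod>p\<in>Q. local_coeff b p (g p))"
  define N where "N = (\<lambda>g. \<Prod>p\<in>Q. p ^ g p)"
  define \<alpha> where "\<alpha> = (\<lambda>p. b p / sqrt (real p))"
  define \<beta> where "\<beta> = (\<lambda>p. vanish_prob p / real p)"
  define err where "err = (\<lambda>w. sq_harm w - (ln w / 2 + euler_mascheroni))"
  have p0: "p > 0" if "p \<in> Q" for p using Q(2)[OF that] prime_gt_0_nat by auto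
  have \<alpha>0: "0 \<le> \<alpha> p" and \<beta>0: "0 \<le> \<beta> p" and \<alpha>\<beta>: "\<alpha> p + \<beta> p \<le> 1" if "p \<in> Q" for p
    using b[OF that] vanish_prob_bounds[of p] by (auto simp: \<alpha>_def \<beta>_def)
  have N0: "N g > 0" for g unfolding N_def using p0 by (intro prod_pos) auto
  have lnN: "ln (real (N g)) = (\<Sum>p\<in>Q. real (g p) * ln (real p))" for g
  proof -
    have "ln (real (N g)) = ln (\<Prod>p\<in>Q. real p ^ g p)" by (simp add: N_def)
    also have "\<dots> = (\<Sum>p\<in>Q. ln (real p ^ g p))" using p0 Q(1) by (intro ln_prod) auto
    also have "\<dots> = (\<Sum>p\<in>Q. real (g p) * ln (real p))"
      using p0 by (intro sum.cong refl) (simp add: ln_realpow)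
    finally show ?thesis .
  qed
  have PiE_prod: "(\<Sum>g\<in>\<Gamma>. \<Prod>p\<in>Q. h p (g p)) = (\<Prod>p\<in>Q. h p 0 + h p 1 + h p 2)" for h :: "nat \<Rightarrow> nat \<Rightarrow> real"
    unfolding \<Gamma>_def using Q(1) by (subst prod_sum_PiE[symmetric]) (auto simp: add.assoc)
  have lc: "local_coeff b p 0 = 1" "local_coeff b p 1 = - \<alpha> p" "local_coeff b p (Suc 0) = - \<alpha> p" "local_coeff b p 2 = - \<beta> p" for p
    by (auto simp: local_coeff_def \<alpha>_def \<beta>_def)
  have "(\<Sum>n=1..X. tilted_coeff b n / sqrt (real n)) = (\<Sum>g\<in>\<Gamma>. c g * sq_harm (real X / real (N g)))"
    unfolding \<Gamma>_def c_def N_def of_nat_prod of_nat_power by (rule tilted_sum_identity[OF Q pf])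
  also have "\<dots> = (\<Sum>g\<in>\<Gamma>. c g * (ln (real X) / 2 + euler_mascheroni) - c g * (ln (real (N g)) / 2) + c g * err (real X / real (N g)))"
  proof (intro sum.cong refl)
    fix g
    have "ln (real X / real (N g)) = ln (real X) - ln (real (N g))" using N0[of g] X by (simp add: ln_div)
    hence "sq_harm (real X / real (N g)) = ln (real X) / 2 + euler_mascheroni - ln (real (N g)) / 2 + err (real X / real (N g))"
      by (simp add: err_def diff_divide_distrib)
    hence "c g * sq_harm (real X / real (N g)) = c g * (ln (real X) / 2 + euler_mascheroni - ln (real (N g)) / 2 + err (real X / real (N g)))"
      by (simp only:)
    thus "c g * sq_harm (real X / real (N g)) = c g * (ln (real X) / 2 + euler_mascheroni) - c g * (ln (real (N g)) / 2) + c g * err (real X / real (N g))"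
      by (simp only: distrib_left right_diff_distrib)
  qed
  also have "\<dots> = (\<Sum>g\<in>\<Gamma>. c g) * (ln (real X) / 2 + euler_mascheroni) - (\<Sum>g\<in>\<Gamma>. c g * ln (real (N g))) / 2 + (\<Sum>g\<in>\<Gamma>. c g * err (real X / real (N g)))"
    by (simp only: sum.distrib sum_subtractf sum_distrib_right[symmetric] times_divide_eq_right sum_divide_distrib[symmetric])
  finally have eq: "(\<Sum>n=1..X. tilted_coeff b n / sqrt (real n)) =
      (\<Sum>g\<in>\<Gamma>. c g) * (ln (real X) / 2 + euler_mascheroni) - (\<Sum>g\<in>\<Gamma>. c g * ln (real (N g))) / 2 + (\<Sum>g\<in>\<Gamma>. c g * err (real X / real (N g)))" .
  have s01: "0 \<le> 1 - \<alpha> p - \<beta> p \<and> 1 - \<alpha> p - \<beta> p \<le> 1" if "p \<in> Q" for p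
    using \<alpha>0[OF that] \<beta>0[OF that] \<alpha>\<beta>[OF that] by linarith
  have "(\<Sum>g\<in>\<Gamma>. c g) = (\<Prod>p\<in>Q. 1 - \<alpha> p - \<beta> p)"
    unfolding c_def by (subst PiE_prod) (simp add: lc)
  moreover have "0 \<le> (\<Prod>p\<in>Q. 1 - \<alpha> p - \<beta> p)" by (rule prod_nonneg) (use s01 in blast)
  moreover have "(\<Prod>p\<in>Q. 1 - \<alpha> p - \<beta> p) \<le> 1" by (rule prod_le_1) (rule s01)
  ultimately have sum_c: "0 \<le> (\<Sum>g\<in>\<Gamma>. c g)" "(\<Sum>g\<in>\<Gamma>. c g) \<le> 1" by auto
  have em: "0 < (euler_mascheroni::real)" "(euler_mascheroni::real) < 1"
    using euler_mascheroni_pos euler_mascheroni_less_13_over_22 by auto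
  have t1: "\<bar>(\<Sum>g\<in>\<Gamma>. c g) * (ln (real X) / 2 + euler_mascheroni)\<bar> \<le> 1 * (ln (real X) / 2 + 1)"
    unfolding abs_mult using sum_c em X by (intro mult_mono) auto
  \<comment> \<open>Weighting by \<open>g q * ln q\<close> differentiates the Euler product at
    \<open>q\<close> alone; the other local factors keep their values in [0, 1].\<close>
  have t2: "\<bar>\<Sum>g\<in>\<Gamma>. c g * ln (real (N g))\<bar> \<le> (\<Sum>q\<in>Q. (\<alpha> q + 2 * \<beta> q) * ln (real q))"
  proof -
    have "(\<Sum>g\<in>\<Gamma>. c g * ln (real (N g))) = (\<Sum>g\<in>\<Gamma>. \<Sum>q\<in>Q. c g * (real (g q) * ln (real q)))"
      by (simp add: lnN sum_distrib_left)
    also have "\<dots> = (\<Sum>q\<in>Q. \<Sum>g\<in>\<Gamma>. c g * (real (g q) * ln (real q)))" by (rule sum.swap)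
    also have "\<bar>\<dots>\<bar> \<le> (\<Sum>q\<in>Q. (\<alpha> q + 2 * \<beta> q) * ln (real q))"
    proof (rule order.trans[OF sum_abs sum_mono])
      fix q assume q: "q \<in> Q"
      have lnq: "0 \<le> ln (real q)" using p0[OF q] by simp
      have "(\<Sum>g\<in>\<Gamma>. c g * (real (g q) * ln (real q))) =
          (\<Sum>g\<in>\<Gamma>. \<Prod>p\<in>Q. local_coeff b p (g p) * (if p = q then real (g p) * ln (real p) else 1))"
        unfolding c_def prod.distrib using Q(1) q by simp
      also have "\<dots> = (\<Prod>p\<in>Q. if p = q then - ((\<alpha> p + 2 * \<beta> p) * ln (real p)) else 1 - \<alpha> p - \<beta> p)"
        unfolding PiE_prod[where h = "\<lambda>p j. local_coeff b p j * (if p = q then real j * ln (real p) else 1)"]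
        by (intro prod.cong refl) (simp add: lc algebra_simps)
      also have "\<dots> = - ((\<alpha> q + 2 * \<beta> q) * ln (real q)) * (\<Prod>p\<in>Q - {q}. 1 - \<alpha> p - \<beta> p)"
        using Q(1) q by (subst prod.remove[of _ q]) (auto intro!: prod.cong)
      finally have "\<bar>\<Sum>g\<in>\<Gamma>. c g * (real (g q) * ln (real q))\<bar> = ((\<alpha> q + 2 * \<beta> q) * ln (real q)) * \<bar>\<Prod>p\<in>Q - {q}. 1 - \<alpha> p - \<beta> p\<bar>"
        using \<alpha>0[OF q] \<beta>0[OF q] lnq by (simp add: abs_mult)
      also have "\<bar>\<Prod>p\<in>Q - {q}. 1 - \<alpha> p - \<beta> p\<bar> \<le> 1"
      proof -
        have "0 \<le> (\<Prod>p\<in>Q - {q}. 1 - \<alpha> p - \<beta> p)" by (rule prod_nonneg) (use s01 in blast)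
        moreover have "(\<Prod>p\<in>Q - {q}. 1 - \<alpha> p - \<beta> p) \<le> 1" by (rule prod_le_1) (use s01 in blast)
        ultimately show ?thesis by simp
      qed
      finally show "\<bar>\<Sum>g\<in>\<Gamma>. c g * (real (g q) * ln (real q))\<bar> \<le> (\<alpha> q + 2 * \<beta> q) * ln (real q)"
        using \<alpha>0[OF q] \<beta>0[OF q] lnq by (simp add: mult_left_mono)
    qed
    finally show ?thesis .
  qed
  have t3: "\<bar>\<Sum>g\<in>\<Gamma>. c g * err (real X / real (N g))\<bar> \<le> 4 * real X powr (-1/4) * (\<Prod>p\<in>Q. 1 + \<alpha> p * real p powr (1/4) + \<beta> p * real p powr (1/2))"
  proof -
    have "\<bar>\<Sum>g\<in>\<Gamma>. c g * err (real X / real (N g))\<bar> \<le> (\<Sum>g\<in>\<Gamma>. \<bar>c g\<bar> * (4 * real X powr (-1/4) * real (N g) powr (1/4)))"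
    proof (rule order.trans[OF sum_abs sum_mono])
      fix g
      have "\<bar>err (real X / real (N g))\<bar> \<le> 4 * (real X / real (N g)) powr (-1/4)"
        unfolding err_def using N0[of g] X by (intro sq_harm_approx) simp
      also have "(real X / real (N g)) powr (-1/4) = real X powr (-1/4) * real (N g) powr (1/4)"
      proof -
        have "real (N g) powr (-1/4) = 1 / real (N g) powr (1/4)"
          using powr_minus_divide[of "real (N g)" "1/4"] by simp
        thus ?thesis by (subst powr_divide) simp_all
      qed
      finally show "\<bar>c g * err (real X / real (N g))\<bar> \<le> \<bar>c g\<bar> * (4 * real X powr (-1/4) * real (N g) powr (1/4))"
        by (simp add: abs_mult mult_left_mono)
    qed
    also have "\<dots> = 4 * real X powr (-1/4) * (\<Sum>g\<in>\<Gamma>. \<Prod>p\<in>Q. \<bar>local_coeff b p (g p)\<bar> * (real p ^ g p) powr (1/4))"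
      unfolding sum_distrib_left
    proof (intro sum.cong refl)
      fix g
      have "real (N g) powr (1/4) = (\<Prod>p\<in>Q. (real p ^ g p) powr (1/4))"
        unfolding N_def using Q(1) by (induction Q rule: finite_induct) (simp_all add: powr_mult prod_nonneg)
      thus "\<bar>c g\<bar> * (4 * real X powr (-1/4) * real (N g) powr (1/4)) =
          4 * real X powr (-1/4) * (\<Prod>p\<in>Q. \<bar>local_coeff b p (g p)\<bar> * (real p ^ g p) powr (1/4))"
        by (simp add: c_def abs_prod prod.distrib mult_ac)
    qed
    also have "(\<Sum>g\<in>\<Gamma>. \<Prod>p\<in>Q. \<bar>local_coeff b p (g p)\<bar> * (real p ^ g p) powr (1/4))
      = (\<Prod>p\<in>Q. 1 + \<alpha> p * real p powr (1/4) + \<beta> p * real p powr (1/2))"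
      unfolding PiE_prod[where h = "\<lambda>p j. \<bar>local_coeff b p j\<bar> * (real p ^ j) powr (1/4)"]
    proof (intro prod.cong refl)
      fix p assume p: "p \<in> Q"
      have "(real p ^ 2) powr (1/4) = real p powr (1/2)"
      proof -
        have "(real p ^ 2) powr (1/4) = (real p powr 2) powr (1/4)" using p0[OF p] by simp
        also have "\<dots> = real p powr (2 * (1/4))" by (rule powr_powr)
        finally show ?thesis by simp
      qed
      thus "\<bar>local_coeff b p 0\<bar> * (real p ^ 0) powr (1/4) + \<bar>local_coeff b p 1\<bar> * (real p ^ 1) powr (1/4) +
          \<bar>local_coeff b p 2\<bar> * (real p ^ 2) powr (1/4) = 1 + \<alpha> p * real p powr (1/4) + \<beta> p * real p powr (1/2)"
        unfolding lc using \<alpha>0[OF p] \<beta>0[OF p] by simp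
    qed
    finally show ?thesis .
  qed
  have nn: "0 \<le> (\<Sum>q\<in>Q. (\<alpha> q + 2 * \<beta> q) * ln (real q))"
    using \<alpha>0 \<beta>0 p0 by (intro sum_nonneg mult_nonneg_nonneg) (auto simp: Suc_le_eq)
  have gen: "\<bar>x - y / 2 + z\<bar> \<le> A + B + C" if "\<bar>x\<bar> \<le> 1 * A" "\<bar>y\<bar> \<le> B" "\<bar>z\<bar> \<le> C" "0 \<le> B" for x y z A B C :: real
    using that by linarith
  show ?thesis
    unfolding eq using gen[OF t1 t2 t3 nn] unfolding \<alpha>_def \<beta>_def .
qed

section \<open>Smooth cutoffs, primes in short ranges, interpolation\<close>

lemma sum_by_parts_from_1:
  fixes c \<psi> :: "nat \<Rightarrow> real"
  shows "(\<Sum>n=1..N. c n * \<psi> n) = (\<Sum>n=1..N. c n) * \<psi> (Suc N) + (\<Sum>n=1..N. (\<psi> n - \<psi> (Suc n)) * (\<Sum>i=1..n. c i))"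
  by (induction N) (simp_all add: algebra_simps)

text \<open>The derivative is continuous, hence bounded on [0, 3]; beyond 2 the function vanishes,
  so any argument may be replaced by its minimum with 3.\<close>

lemma smooth_cutoff_lipschitz:
  fixes \<phi> :: "real \<Rightarrow> real"
  assumes "smooth_real_on {0..} \<phi>" "\<And>x. x > 2 \<Longrightarrow> \<phi> x = 0"
  shows "\<exists>L\<ge>0. \<forall>x\<ge>0. \<forall>y\<ge>0. \<bar>\<phi> x - \<phi> y\<bar> \<le> L * \<bar>x - y\<bar>"
proof -
  obtain g where g: "\<And>x. x \<ge> 0 \<Longrightarrow> g 0 x = \<phi> x"
    "\<And>k x. x \<ge> 0 \<Longrightarrow> (g k has_real_derivative g (Suc k) x) (at x within {0..})"
    using assms(1) unfolding smooth_real_on_def by (metis atLeast_iff)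
  have "continuous_on {0..3} (g (Suc 0))"
  proof (rule continuous_on_subset[of "{0..}"])
    show "continuous_on {0..} (g (Suc 0))"
      unfolding continuous_on_eq_continuous_within
    proof
      fix x :: real assume "x \<in> {0..}"
      hence "(g (Suc 0) has_real_derivative g (Suc (Suc 0)) x) (at x within {0..})" using g(2) by simp
      thus "continuous (at x within {0..}) (g (Suc 0))" by (rule DERIV_continuous)
    qed
  qed auto
  hence "compact (g (Suc 0) ` {0..3})" by (intro compact_continuous_image) auto
  then obtain L where L: "\<And>y. y \<in> g (Suc 0) ` {0..3} \<Longrightarrow> norm y \<le> L"
    using compact_imp_bounded bounded_iff by meson
  have L0: "L \<ge> 0" using L[of "g (Suc 0) 0"] by (auto intro: order.trans[OF norm_ge_zero])
  have lip: "\<bar>\<phi> x - \<phi> y\<bar> \<le> L * \<bar>x - y\<bar>" if "x \<in> {0..3}" "y \<in> {0..3}" for x y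
  proof -
    have "norm (g 0 x - g 0 y) \<le> L * norm (x - y)"
    proof (rule field_differentiable_bound[where S = "{0..3}" and f' = "g (Suc 0)"])
      fix z :: real assume z: "z \<in> {0..3}"
      show "(g 0 has_field_derivative g (Suc 0) z) (at z within {0..3})"
        by (rule has_field_derivative_subset[OF g(2)[of z 0]]) (use z in auto)
      show "norm (g (Suc 0) z) \<le> L" using L z by blast
    qed (use that in auto)
    thus ?thesis using g(1)[of x] g(1)[of y] that by auto
  qed
  have "\<bar>\<phi> x - \<phi> y\<bar> \<le> L * \<bar>x - y\<bar>" if "0 \<le> x" "0 \<le> y" for x y
  proof -
    have red: "\<phi> z = \<phi> (min z 3)" for z
      using assms(2)[of z] assms(2)[of 3] by (cases "z \<le> 3") (auto simp: min_def)
    have "\<bar>\<phi> x - \<phi> y\<bar> = \<bar>\<phi> (min x 3) - \<phi> (min y 3)\<bar>" using red[of x] red[of y] by simp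
    also have "\<dots> \<le> L * \<bar>min x 3 - min y 3\<bar>" using that by (intro lip) auto
    also have "\<dots> \<le> L * \<bar>x - y\<bar>" using L0 by (intro mult_left_mono) auto
    finally show ?thesis .
  qed
  thus ?thesis using L0 by blast
qed

text \<open>The cutoff is constant below \<epsilon> u, so partial summation gives weight zero to
  partial sums of that length. This admits estimates that are good only for \<open>n\<close> of the
  order of \<open>u\<close>. The boundary term vanishes because N + 1 exceeds 2 u.\<close>

lemma abs_cutoff_sum_le:
  fixes \<phi> :: "real \<Rightarrow> real" and c :: "nat \<Rightarrow> real" and u M \<epsilon> L :: real
  assumes lip: "\<And>x y. 0 \<le> x \<Longrightarrow> 0 \<le> y \<Longrightarrow> \<bar>\<phi> x - \<phi> y\<bar> \<le> L * \<bar>x - y\<bar>" and L: "0 \<le> L"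
    and one: "\<And>x. 0 \<le> x \<Longrightarrow> x < \<epsilon> \<Longrightarrow> \<phi> x = 1" and zero: "\<And>x. x > 2 \<Longrightarrow> \<phi> x = 0"
    and u: "u > 0" and M: "0 \<le> M"
    and bound: "\<And>n::nat. \<epsilon> * u \<le> real n + 1 \<Longrightarrow> real n \<le> 2 * u \<Longrightarrow> \<bar>\<Sum>i=1..n. c i\<bar> \<le> M"
  shows "\<bar>\<Sum>n=1..nat \<lfloor>2 * u\<rfloor>. c n * \<phi> (real n / u)\<bar> \<le> 2 * L * M"
proof -
  define N where "N = nat \<lfloor>2 * u\<rfloor>"
  define \<psi> where "\<psi> = (\<lambda>n. \<phi> (real n / u))"
  have N: "real N \<le> 2 * u" "2 * u < real N + 1" using u by (auto simp: N_def)
  have "\<psi> (Suc N) = 0" unfolding \<psi>_def using N u by (intro zero) (simp add: field_simps)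
  hence "(\<Sum>n=1..N. c n * \<psi> n) = (\<Sum>n=1..N. (\<psi> n - \<psi> (Suc n)) * (\<Sum>i=1..n. c i))"
    by (subst sum_by_parts_from_1) simp
  also have "\<bar>\<dots>\<bar> \<le> (\<Sum>n=1..N. L / u * M)"
  proof (rule order.trans[OF sum_abs sum_mono])
    fix n assume n: "n \<in> {1..N}"
    show "\<bar>(\<psi> n - \<psi> (Suc n)) * (\<Sum>i=1..n. c i)\<bar> \<le> L / u * M"
    proof (cases "\<epsilon> * u \<le> real n + 1")
      case True
      have "\<bar>\<psi> n - \<psi> (Suc n)\<bar> \<le> L * \<bar>real n / u - real (Suc n) / u\<bar>"
        unfolding \<psi>_def using u by (intro lip) auto
      also have "real n / u - real (Suc n) / u = - (1 / u)" by (simp add: diff_divide_distrib[symmetric])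
      finally have "\<bar>\<psi> n - \<psi> (Suc n)\<bar> \<le> L / u" using u by simp
      moreover have "\<bar>\<Sum>i=1..n. c i\<bar> \<le> M" using n N True by (intro bound) auto
      ultimately show ?thesis unfolding abs_mult using L u by (intro mult_mono) auto
    next
      case False
      hence "real (Suc n) / u < \<epsilon>" using u by (simp add: field_simps)
      moreover have "real n / u \<le> real (Suc n) / u" using u by (intro divide_right_mono) auto
      ultimately have "\<psi> n = 1" "\<psi> (Suc n) = 1" unfolding \<psi>_def using u by (auto intro!: one)
      thus ?thesis using L u M by simp
    qed
  qed
  also have "\<dots> = real N * (L / u * M)" by simp
  also have "\<dots> \<le> (2 * u) * (L / u * M)" using N L u M by (intro mult_right_mono) auto
  also have "\<dots> = 2 * L * M" using u by simp
  finally show ?thesis by (simp only: N_def \<psi>_def)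
qed

section \<open>Reciprocals of primes\<close>

lemma sum_inverse_primes_block:
  fixes y z :: real
  assumes "1 < y" "y \<le> z"
  shows "(ln (z / y) - 6) / ln z \<le> (\<Sum>p::nat | prime p \<and> y < p \<and> p \<le> z. 1 / real p)"
    and "(\<Sum>p::nat | prime p \<and> y < p \<and> p \<le> z. 1 / real p) \<le> (ln (z / y) + 6) / ln y"
proof -
  let ?A = "{p::nat. prime p \<and> y < p \<and> p \<le> z}"
  have "(\<Sum>p\<in>?A. ln (real p) / p) \<le> (\<Sum>p\<in>?A. ln z * (1 / real p))"
  proof (intro sum_mono)
    fix p assume p: "p \<in> ?A"
    hence "ln (real p) \<le> ln z" using assms by (subst ln_le_cancel_iff) auto
    thus "ln (real p) / p \<le> ln z * (1 / real p)" by (simp add: divide_right_mono)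
  qed
  hence "ln (z / y) - 6 \<le> ln z * (\<Sum>p\<in>?A. 1 / real p)"
    using mertens_interval(1)[of y z] assms by (simp add: sum_distrib_left)
  thus "(ln (z / y) - 6) / ln z \<le> (\<Sum>p\<in>?A. 1 / real p)"
    using assms by (simp add: pos_divide_le_eq mult.commute)
  have "(\<Sum>p\<in>?A. ln y * (1 / real p)) \<le> (\<Sum>p\<in>?A. ln (real p) / p)"
  proof (intro sum_mono)
    fix p assume p: "p \<in> ?A"
    hence "ln y \<le> ln (real p)" using assms by (subst ln_le_cancel_iff) auto
    thus "ln y * (1 / real p) \<le> ln (real p) / p" by (simp add: divide_right_mono)
  qed
  hence "ln y * (\<Sum>p\<in>?A. 1 / real p) \<le> ln (z / y) + 6"
    using mertens_interval(2)[of y z] assms by (simp add: sum_distrib_left)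
  thus "(\<Sum>p\<in>?A. 1 / real p) \<le> (ln (z / y) + 6) / ln y"
    using assms by (simp add: pos_le_divide_eq mult.commute)
qed

lemma finite_primes_between [simp]: "finite {p::nat. prime p \<and> y < real p \<and> real p \<le> z}"
  by (rule finite_subset[of _ "{..nat \<lfloor>z\<rfloor>}"]) (auto simp: le_nat_iff le_floor_iff)

text \<open>A block from Y to Z = Y^4 contributes at least 3/4 - 6 / ln Z, which is at least 1/2 as
  soon as ln Z \<ge> 24. Starting at exp 24 also leaves out the prime 2.\<close>

lemma sum_inverse_odd_primes_unbounded:
  "real i / 2 \<le> (\<Sum>p::nat | prime p \<and> exp 24 < real p \<and> real p \<le> exp (24 * 4 ^ i). 1 / real p)"
proof (induction i)
  case (Suc i)
  define Y where "Y = exp (24 * 4 ^ i :: real)"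
  define Z where "Z = exp (24 * 4 ^ Suc i :: real)"
  let ?A = "{p::nat. prime p \<and> exp 24 < real p \<and> real p \<le> Y}"
  let ?B = "{p::nat. prime p \<and> Y < real p \<and> real p \<le> Z}"
  have e: "(1::real) \<le> 4 ^ i" by simp
  have yz: "exp 24 \<le> Y" "1 < Y" "Y \<le> Z" using e by (auto simp: Y_def Z_def)
  have "1 / 2 \<le> (ln (Z / Y) - 6) / ln Z"
    unfolding Y_def Z_def using e by (simp add: ln_div field_simps) (use e in linarith)
  also have "\<dots> \<le> (\<Sum>p\<in>?B. 1 / real p)" by (rule sum_inverse_primes_block(1)[OF yz(2,3)])
  finally have "real (Suc i) / 2 \<le> (\<Sum>p\<in>?A. 1 / real p) + (\<Sum>p\<in>?B. 1 / real p)"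
    using Suc unfolding Y_def by simp
  also have "\<dots> = (\<Sum>p\<in>?A \<union> ?B. 1 / real p)" by (rule sum.union_disjoint[symmetric]) auto
  also have "?A \<union> ?B = {p::nat. prime p \<and> exp 24 < real p \<and> real p \<le> Z}" using yz by auto
  finally show ?case unfolding Z_def .
qed (simp add: sum_nonneg)

section \<open>Interpolation at equally spaced nodes\<close>

lemma coeff_prod_linear_le:
  fixes J :: real
  assumes "finite A" "0 \<le> J"
  shows "\<bar>Polynomial.coeff (\<Prod>k\<in>A. [:- real k, J:]) j\<bar> \<le> (\<Prod>k\<in>A. J + real k)"
  using assms(1)
proof (induction A arbitrary: j rule: finite_induct)
  case empty
  show ?case by (cases j) auto
next
  case (insert k A)
  let ?q = "\<Prod>k\<in>A. [:- real k, J:]"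
  have P0: "0 \<le> (\<Prod>k\<in>A. J + real k)" using assms(2) by (intro prod_nonneg) auto
  have "Polynomial.coeff ([:- real k, J:] * ?q) j = - real k * Polynomial.coeff ?q j + J * (case j of 0 \<Rightarrow> 0 | Suc i \<Rightarrow> Polynomial.coeff ?q i)"
    by (cases j) (simp_all add: coeff_pCons)
  also have "\<bar>\<dots>\<bar> \<le> real k * (\<Prod>k\<in>A. J + real k) + J * (\<Prod>k\<in>A. J + real k)"
  proof (rule order.trans[OF abs_triangle_ineq add_mono])
    show "\<bar>- real k * Polynomial.coeff ?q j\<bar> \<le> real k * (\<Prod>k\<in>A. J + real k)"
      unfolding abs_mult using insert.IH[of j] by (intro mult_mono) auto
    have "\<bar>case j of 0 \<Rightarrow> 0 | Suc i \<Rightarrow> Polynomial.coeff ?q i\<bar> \<le> (\<Prod>k\<in>A. J + real k)"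
      using insert.IH P0 by (cases j) auto
    thus "\<bar>J * (case j of 0 \<Rightarrow> 0 | Suc i \<Rightarrow> Polynomial.coeff ?q i)\<bar> \<le> J * (\<Prod>k\<in>A. J + real k)"
      unfolding abs_mult using assms(2) by (intro mult_mono) auto
  qed
  finally show ?case using insert by (simp add: algebra_simps)
qed

lemma power_self_over_fact_le: "real J ^ J / fact J \<le> 3 ^ J"
proof (cases "J = 0")
  case False
  have "real J ^ J = exp (real J * ln (real J))" using False by (simp add: exp_of_nat_mult)
  also have "\<dots> \<le> exp (real J + ln (fact J))" using ln_fact_ge[of J] by simp
  also have "\<dots> = exp 1 ^ J * fact J" by (simp add: exp_add exp_of_nat_mult[symmetric])
  also have "\<dots> \<le> 3 ^ J * fact J" using exp_le by (intro mult_right_mono power_mono) auto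
  finally show ?thesis by (simp add: field_simps)
qed simp

text \<open>Lagrange interpolation at the nodes \<open>i / J\<close>.\<close>

lemma coeff_le_of_bounded_at_nodes:
  fixes P :: "real poly" and K :: real
  assumes J: "J > 0" and deg: "degree P \<le> J" and K: "\<And>i. i \<le> J \<Longrightarrow> \<bar>poly P (real i / real J)\<bar> \<le> K"
  shows "\<bar>Polynomial.coeff P j\<bar> \<le> 24 ^ J * K"
proof -
  \<comment> \<open>Each factor is scaled by \<open>J\<close>, which turns the nodes into integers;
    the denominators become, up to sign, i! (J - i)!.\<close>
  define num where "num = (\<lambda>i. \<Prod>k\<in>{..J} - {i}. [:- real k, real J:])"
  define den where "den = (\<lambda>i. \<Prod>k\<in>{..J} - {i}. real i - real k)"
  define Lg where "Lg = (\<Sum>i\<le>J. Polynomial.smult (poly P (real i / real J) / den i) (num i))"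
  have K0: "0 \<le> K" using K[of 0] by linarith
  have den_abs: "\<bar>den i\<bar> = fact i * fact (J - i)" if "i \<le> J" for i
  proof -
    have "{..J} - {i} = {..<i} \<union> {i<..J}" using that by auto
    hence "\<bar>den i\<bar> = (\<Prod>k\<in>{..<i} \<union> {i<..J}. \<bar>real i - real k\<bar>)"
      by (simp add: den_def abs_prod)
    also have "\<dots> = (\<Prod>k\<in>{..<i}. \<bar>real i - real k\<bar>) * (\<Prod>k\<in>{i<..J}. \<bar>real i - real k\<bar>)"
      by (intro prod.union_disjoint) auto
    also have "(\<Prod>k\<in>{..<i}. \<bar>real i - real k\<bar>) = (\<Prod>k\<in>{1..i}. real k)"
      by (rule prod.reindex_bij_witness[of _ "\<lambda>k. i - k" "\<lambda>k. i - k"]) (auto simp: of_nat_diff)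
    also have "\<dots> = fact i" by (simp add: fact_prod)
    also have "(\<Prod>k\<in>{i<..J}. \<bar>real i - real k\<bar>) = (\<Prod>k\<in>{1..J - i}. real k)"
      by (rule prod.reindex_bij_witness[of _ "\<lambda>k. i + k" "\<lambda>k. k - i"]) (auto simp: of_nat_diff)
    also have "\<dots> = fact (J - i)" by (simp add: fact_prod)
    finally show ?thesis .
  qed
  have degnum: "degree (num i) \<le> J" if "i \<le> J" for i
  proof -
    have "degree (num i) \<le> (\<Sum>k\<in>{..J} - {i}. degree [:- real k, real J:])"
      unfolding num_def by (rule order.trans[OF degree_prod_sum_le]) (auto simp: o_def)
    also have "\<dots> \<le> (\<Sum>k\<in>{..J} - {i}. 1)" by (intro sum_mono) auto
    also have "\<dots> = J" using that by simp
    finally show ?thesis .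
  qed
  have "P = Lg"
  proof (rule poly_eqI_degree[of "(\<lambda>i. real i / real J) ` {..J}"])
    have card: "card ((\<lambda>i. real i / real J) ` {..J}) = J + 1"
      using J by (subst card_image) (auto simp: inj_on_def)
    show "degree P < card ((\<lambda>i. real i / real J) ` {..J})" using deg card by simp
    have "degree Lg \<le> J" unfolding Lg_def
      by (rule degree_sum_le) (simp, rule order.trans[OF Polynomial.degree_smult_le degnum], simp)
    thus "degree Lg < card ((\<lambda>i. real i / real J) ` {..J})" using card by simp
    fix x assume "x \<in> (\<lambda>i. real i / real J) ` {..J}"
    then obtain i where i: "i \<le> J" "x = real i / real J" by auto
    have num0: "poly (num l) x = 0" if "l \<le> J" "l \<noteq> i" for l
    proof -
      have "poly (num l) x = (\<Prod>k\<in>{..J} - {l}. real i - real k)"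
        unfolding num_def using J i by (simp add: poly_prod)
      also have "\<dots> = 0" using i that by (intro prod_zero) auto
      finally show ?thesis .
    qed
    have numi: "poly (num i) x = den i"
      unfolding num_def den_def using J i by (simp add: poly_prod)
    have "den i \<noteq> 0" using den_abs[OF i(1)] by auto
    have "poly Lg x = (\<Sum>l\<le>J. poly P (real l / real J) / den l * poly (num l) x)"
      by (simp add: Lg_def poly_sum)
    also have "\<dots> = (\<Sum>l\<in>{i}. poly P (real l / real J) / den l * poly (num l) x)"
      using i num0 by (intro sum.mono_neutral_right) auto
    also have "\<dots> = poly P x" using numi i \<open>den i \<noteq> 0\<close> by simp
    finally show "poly P x = poly Lg x" by simp
  qed
  hence "Polynomial.coeff P j = Polynomial.coeff Lg j" by (rule arg_cong)
  hence "\<bar>Polynomial.coeff P j\<bar> = \<bar>\<Sum>i\<le>J. poly P (real i / real J) / den i * Polynomial.coeff (num i) j\<bar>"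
    by (simp add: Lg_def Polynomial.coeff_sum)
  also have "\<dots> \<le> (\<Sum>i\<le>J. K * 12 ^ J)"
  proof (rule order.trans[OF sum_abs sum_mono])
    fix i assume "i \<in> {..J}"
    hence i: "i \<le> J" by simp
    have "\<bar>Polynomial.coeff (num i) j\<bar> \<le> (\<Prod>k\<in>{..J} - {i}. real J + real k)"
      unfolding num_def by (rule coeff_prod_linear_le) auto
    also have "\<dots> \<le> (\<Prod>k\<in>{..J} - {i}. 2 * real J)" by (intro prod_mono) auto
    also have "\<dots> = (2 * real J) ^ J" using i by simp
    finally have n: "\<bar>Polynomial.coeff (num i) j\<bar> \<le> (2 * real J) ^ J" .
    have "\<bar>poly P (real i / real J) / den i * Polynomial.coeff (num i) j\<bar> = \<bar>poly P (real i / real J)\<bar> * (\<bar>Polynomial.coeff (num i) j\<bar> / (fact i * fact (J - i)))"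
      using den_abs[OF i] by (simp add: abs_mult abs_divide)
    also have "\<dots> \<le> K * ((2 * real J) ^ J / (fact i * fact (J - i)))"
      using K[OF i] n K0 by (intro mult_mono divide_right_mono) auto
    \<comment> \<open>The losses are 2^J from the coefficients, 3^J from J^J / J! and 2^J from the
      binomial coefficient; the J + 1 nodes cost another 2^J, in all 24^J.\<close>
    also have "(2 * real J) ^ J / (fact i * fact (J - i)) = 2 ^ J * (real J ^ J / fact J) * real (J choose i)"
      using binomial_fact[OF i, where ?'a = real] by (simp add: power_mult_distrib)
    also have "K * \<dots> \<le> K * (2 ^ J * 3 ^ J * 2 ^ J)"
    proof (intro mult_left_mono mult_mono power_self_over_fact_le K0)
      have "J choose i \<le> 2 ^ J" by (rule binomial_le_pow2)
      thus "real (J choose i) \<le> 2 ^ J" by (metis of_nat_le_iff of_nat_numeral of_nat_power)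
    qed auto
    also have "(2::real) ^ J * 3 ^ J * 2 ^ J = 12 ^ J" by (simp add: power_mult_distrib[symmetric])
    finally show "\<bar>poly P (real i / real J) / den i * Polynomial.coeff (num i) j\<bar> \<le> K * 12 ^ J" .
  qed
  also have "\<dots> = real (J + 1) * (K * 12 ^ J)" by simp
  also have "\<dots> \<le> 2 ^ J * (K * 12 ^ J)"
  proof (intro mult_right_mono)
    have "J + 1 \<le> 2 ^ J" by (induction J) auto
    thus "real (J + 1) \<le> 2 ^ J" by (metis of_nat_le_iff of_nat_numeral of_nat_power)
  qed (use K0 in auto)
  also have "\<dots> = 24 ^ J * K" by (simp add: power_mult_distrib[symmetric])
  finally show ?thesis .
qed

section \<open>Elementary symmetric sums\<close>

definition elem_sym :: "('a \<Rightarrow> real) \<Rightarrow> 'a set \<Rightarrow> nat \<Rightarrow> real" where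
  "elem_sym y A j = (\<Sum>S | S \<subseteq> A \<and> card S = j. \<Prod>p\<in>S. y p)"

text \<open>Count the sets of size j + 1 with a marked element in two ways: by the set, or by the
  set left after removing the mark.\<close>

lemma elem_sym_Suc:
  assumes "finite A"
  shows "real (Suc j) * elem_sym y A (Suc j) = (\<Sum>S | S \<subseteq> A \<and> card S = j. (\<Prod>p\<in>S. y p) * (\<Sum>p\<in>A - S. y p))"
proof -
  have fin: "finite S" if "S \<subseteq> A" for S using that assms finite_subset by auto
  have finP: "finite {S. S \<subseteq> A \<and> card S = i}" for i
    by (rule finite_subset[of _ "Pow A"]) (use assms in auto)
  have "real (Suc j) * elem_sym y A (Suc j) = (\<Sum>T | T \<subseteq> A \<and> card T = Suc j. \<Sum>p\<in>T. \<Prod>q\<in>T. y q)"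
    unfolding elem_sym_def sum_distrib_left by (intro sum.cong refl) auto
  also have "\<dots> = (\<Sum>(T, p)\<in>Sigma {T. T \<subseteq> A \<and> card T = Suc j} (\<lambda>T. T). \<Prod>q\<in>T. y q)"
    using finP fin by (subst sum.Sigma) auto
  also have "\<dots> = (\<Sum>(S, p)\<in>Sigma {S. S \<subseteq> A \<and> card S = j} (\<lambda>S. A - S). (\<Prod>q\<in>S. y q) * y p)"
  proof (rule sum.reindex_bij_witness[of _ "\<lambda>(S, p). (insert p S, p)" "\<lambda>(T, p). (T - {p}, p)"])
    fix a assume "a \<in> Sigma {T. T \<subseteq> A \<and> card T = Suc j} (\<lambda>T. T)"
    then obtain T p where a: "a = (T, p)" "T \<subseteq> A" "card T = Suc j" "p \<in> T" by auto
    have fT: "finite T" using fin a by auto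
    show "(case case a of (T, p) \<Rightarrow> (T - {p}, p) of (S, p) \<Rightarrow> (insert p S, p)) = a" using a by auto
    show "(case a of (T, p) \<Rightarrow> (T - {p}, p)) \<in> Sigma {S. S \<subseteq> A \<and> card S = j} (\<lambda>S. A - S)"
      using a fT by auto
    show "(case case a of (T, p) \<Rightarrow> (T - {p}, p) of (S, p) \<Rightarrow> prod y S * y p) = (case a of (T, p) \<Rightarrow> prod y T)"
      using a fT by (simp add: prod.remove[of T p] mult.commute)
  next
    fix b assume "b \<in> Sigma {S. S \<subseteq> A \<and> card S = j} (\<lambda>S. A - S)"
    then obtain S p where b: "b = (S, p)" "S \<subseteq> A" "card S = j" "p \<in> A" "p \<notin> S" by auto
    have fS: "finite S" using fin b by auto
    show "(case case b of (S, p) \<Rightarrow> (insert p S, p) of (T, p) \<Rightarrow> (T - {p}, p)) = b" using b by auto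
    show "(case b of (S, p) \<Rightarrow> (insert p S, p)) \<in> Sigma {T. T \<subseteq> A \<and> card T = Suc j} (\<lambda>T. T)"
      using b fS by auto
  qed
  also have "\<dots> = (\<Sum>S | S \<subseteq> A \<and> card S = j. \<Sum>p\<in>A - S. (\<Prod>q\<in>S. y q) * y p)"
    using finP assms by (subst sum.Sigma) auto
  finally show ?thesis by (simp add: sum_distrib_left)
qed

text \<open>In the recursion the next element is summed over the complement of the \<open>j\<close>
  already chosen. These carry at most j \<delta>, so at least half of the total remains at every
  step.\<close>

lemma elem_sym_ge:
  assumes A: "finite A" "\<And>p. p \<in> A \<Longrightarrow> 0 \<le> y p \<and> y p \<le> \<delta>" and j: "real j * \<delta> \<le> sum y A / 2"
  shows "(sum y A / 2) ^ j / fact j \<le> elem_sym y A j"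
  using j
proof (induction j)
  case 0
  have "card S = 0 \<longleftrightarrow> S = {}" if "S \<subseteq> A" for S
    using card_0_eq[OF finite_subset[OF that A(1)]] by simp
  hence "{S. S \<subseteq> A \<and> card S = 0} = {{}}" by auto
  thus ?case by (simp add: elem_sym_def)
next
  case (Suc j)
  have fin: "finite S" if "S \<subseteq> A" for S using that A(1) finite_subset by auto
  have Y0: "0 \<le> sum y A" using A(2) by (intro sum_nonneg) auto
  show ?case
  proof (cases "A = {} \<or> \<delta> < 0")
    case True
    have "sum y A = 0"
    proof -
      have "A = {}" using True A(2) by (metis all_not_in_conv not_le order.trans)
      thus ?thesis by simp
    qed
    moreover have "0 \<le> elem_sym y A (Suc j)"
      unfolding elem_sym_def using A(2) by (intro sum_nonneg prod_nonneg) auto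
    ultimately show ?thesis by simp
  next
    case False
    hence d0: "0 \<le> \<delta>" by simp
    have "real j * \<delta> \<le> sum y A / 2" using Suc.prems d0 by (simp add: algebra_simps)
    note IH = Suc.IH[OF this]
    have "(sum y A / 2) ^ Suc j / fact j = (sum y A / 2) * ((sum y A / 2) ^ j / fact j)" by simp
    also have "\<dots> \<le> (sum y A / 2) * elem_sym y A j" using Y0 IH by (intro mult_left_mono) auto
    also have "\<dots> = (\<Sum>S | S \<subseteq> A \<and> card S = j. (\<Prod>p\<in>S. y p) * (sum y A / 2))"
      by (simp add: elem_sym_def sum_distrib_left mult.commute)
    also have "\<dots> \<le> (\<Sum>S | S \<subseteq> A \<and> card S = j. (\<Prod>p\<in>S. y p) * (\<Sum>p\<in>A - S. y p))"
    proof (intro sum_mono mult_left_mono)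
      fix S assume "S \<in> {S. S \<subseteq> A \<and> card S = j}"
      hence S: "S \<subseteq> A" "card S = j" by auto
      have "sum y S \<le> (\<Sum>p\<in>S. \<delta>)" using A(2) S by (intro sum_mono) auto
      also have "\<dots> = real j * \<delta>" using S by simp
      also have "\<dots> \<le> sum y A / 2" by fact
      finally show "sum y A / 2 \<le> (\<Sum>p\<in>A - S. y p)"
        using sum_diff[OF A(1) S(1), of y] by linarith
      show "0 \<le> (\<Prod>p\<in>S. y p)" using A(2) S by (intro prod_nonneg) auto
    qed
    also have "\<dots> = real (Suc j) * elem_sym y A (Suc j)" by (rule elem_sym_Suc[OF A(1), symmetric])
    finally have "(sum y A / 2) ^ Suc j / fact j / real (Suc j) \<le> real (Suc j) * elem_sym y A (Suc j) / real (Suc j)"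
      by (rule divide_right_mono) simp
    moreover have "(sum y A / 2) ^ Suc j / fact j / real (Suc j) = (sum y A / 2) ^ Suc j / fact (Suc j)"
      by (simp only: fact_Suc divide_divide_eq_left of_nat_mult) (simp add: mult.commute)
    moreover have "real (Suc j) * elem_sym y A (Suc j) / real (Suc j) = elem_sym y A (Suc j)" by simp
    ultimately show ?thesis by (simp only:)
  qed
qed

section \<open>Large values at small arguments\<close>

text \<open>The mean \<Phi>(u) of the cut-off sum at length \<open>u\<close> under the tilt
  \<open>b\<close>. The range ends at 2 u, beyond which the cutoff vanishes.\<close>

definition smoothed_sum :: "(nat \<Rightarrow> real) \<Rightarrow> (real \<Rightarrow> real) \<Rightarrow> real \<Rightarrow> real" where
  "smoothed_sum b \<phi> u = (\<Sum>n=1..nat \<lfloor>2 * u\<rfloor>. tilted_coeff b n / sqrt (real n) * \<phi> (real n / u))"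

lemma tilted_coeff_prime_mult:
  assumes "prime p" "n > 0" "\<not> p dvd n"
  shows "tilted_coeff b (p * n) = - b p * tilted_coeff b n"
    and "tilted_coeff b (p ^ 2 * n) = (1 - vanish_prob p) * tilted_coeff b n"
proof -
  have cop: "coprime p n" using assms prime_imp_coprime by blast
  show "tilted_coeff b (p * n) = - b p * tilted_coeff b n"
    using tilted_coeff_mult_coprime[OF _ assms(2) cop, of b] tilted_coeff_prime_power[OF assms(1), of 1 b]
      prime_gt_0_nat[OF assms(1)] by simp
  have "coprime (p ^ 2) n" using cop by simp
  thus "tilted_coeff b (p ^ 2 * n) = (1 - vanish_prob p) * tilted_coeff b n"
    using tilted_coeff_mult_coprime[OF _ assms(2), of "p ^ 2" b] tilted_coeff_prime_power[OF assms(1), of 2 b]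
      prime_gt_0_nat[OF assms(1)] by simp
qed

lemma sum_multiples_nat:
  fixes F :: "nat \<Rightarrow> real"
  assumes "p > 0"
  shows "(\<Sum>n | n \<in> {1..N} \<and> p dvd n. F n) = (\<Sum>n=1..N div p. F (p * n))"
proof (rule sum.reindex_bij_witness[of _ "\<lambda>n. p * n" "\<lambda>n. n div p"])
  fix n assume "n \<in> {n. n \<in> {1..N} \<and> p dvd n}"
  then obtain k where k: "n = p * k" "1 \<le> p * k" "p * k \<le> N" by auto
  have "k \<noteq> 0" using k by (cases k) auto
  moreover have "k \<le> N div p" using k assms by (simp add: less_eq_div_iff_mult_less_eq mult.commute)
  ultimately show "n div p \<in> {1..N div p}" using k assms by simp
  show "p * (n div p) = n" using k assms by simp
  thus "F (p * (n div p)) = F n" by simp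
next
  fix n assume n: "n \<in> {1..N div p}"
  thus "p * n div p = n" using assms by simp
  have "p * n \<le> N" using n assms by (simp add: less_eq_div_iff_mult_less_eq mult.commute)
  thus "p * n \<in> {n. n \<in> {1..N} \<and> p dvd n}" using n assms by simp
qed

text \<open>Expand the square. Primes of \<open>T\<close> carry no tilt, so only terms in which each
  occurs to an even power survive. A linear term forces \<open>p\<close> to divide \<open>n\<close>
  and so leaves a sum of length N div p; a mixed term would force p q to divide \<open>n\<close>,
  which p q > N forbids; the diagonal terms reproduce the original sum.\<close>

lemma expect_resonated:
  fixes e c t :: "nat \<Rightarrow> real" and N :: nat
  assumes Q: "finite Q" "\<And>p. p \<in> Q \<Longrightarrow> prime p" and pf: "\<And>n. 1 \<le> n \<Longrightarrow> n \<le> N \<Longrightarrow> prime_factors n \<subseteq> Q"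
    and T: "T \<subseteq> Q" "\<And>p. p \<in> T \<Longrightarrow> t p = 0" "\<And>p q. p \<in> T \<Longrightarrow> q \<in> T \<Longrightarrow> N < p * q"
  shows "expect Q (\<lambda>f. (\<Prod>p\<in>Q. 1 - t p * f p) * ((1 - (\<Sum>p\<in>T. c p * f p)) ^ 2 * (\<Sum>n=1..N. e n * char_value f n)))
     = (1 + (\<Sum>p\<in>T. c p ^ 2 * (1 - vanish_prob p))) * (\<Sum>n=1..N. e n * tilted_coeff (\<lambda>p. t p * (1 - vanish_prob p)) n)
       - 2 * (\<Sum>p\<in>T. c p * (1 - vanish_prob p) * (\<Sum>n=1..N div p. e (p * n) * tilted_coeff (\<lambda>p. t p * (1 - vanish_prob p)) n))"
proof -
  define b where "b = (\<lambda>p. t p * (1 - vanish_prob p))"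
  define W where "W = (\<lambda>f::nat \<Rightarrow> real. \<Prod>p\<in>Q. 1 - t p * f p)"
  have finT: "finite T" using T(1) Q(1) finite_subset by blast
  have prT: "prime p" if "p \<in> T" for p using that T(1) Q(2) by blast
  have b0: "b p = 0" if "p \<in> T" for p using T(2)[OF that] by (simp add: b_def)
  have EW: "expect Q (\<lambda>f. W f * char_value f n) = tilted_coeff b n" if "n > 0" "prime_factors n \<subseteq> Q" for n
    unfolding W_def b_def by (rule expect_tilted[OF Q that])
  have pfp: "prime_factors (p * n) \<subseteq> Q" if "p \<in> T" "n > 0" "prime_factors n \<subseteq> Q" for p n
    using that prT[OF that(1)] T(1) prime_gt_0_nat
    by (subst prime_factors_product) (auto simp: prime_factorization_prime)
  have pT0: "p > 0" if "p \<in> T" for p using prT[OF that] prime_gt_0_nat by blast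
  have "(\<lambda>f. W f * ((1 - (\<Sum>p\<in>T. c p * f p)) ^ 2 * (\<Sum>n=1..N. e n * char_value f n)))
     = (\<lambda>f. (\<Sum>n=1..N. e n * (W f * char_value f n))
         - 2 * (\<Sum>p\<in>T. \<Sum>n=1..N. c p * e n * (W f * char_value f (p * n)))
         + (\<Sum>p\<in>T. \<Sum>q\<in>T. \<Sum>n=1..N. c p * c q * e n * (W f * char_value f (p * (q * n)))))"
  proof
    fix f :: "nat \<Rightarrow> real"
    define s where "s = (\<Sum>p\<in>T. c p * f p)"
    define S where "S = (\<Sum>n=1..N. e n * char_value f n)"
    have cv: "char_value f (p * n) = f p * char_value f n" if "p \<in> T" "n > 0" for p n
      using that pT0 prT by (simp add: char_value_mult char_value_prime)
    have 1: "(\<Sum>n=1..N. e n * (W f * char_value f n)) = W f * S"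
      by (simp add: S_def sum_distrib_left mult_ac)
    have 2: "(\<Sum>p\<in>T. \<Sum>n=1..N. c p * e n * (W f * char_value f (p * n))) = W f * (s * S)"
    proof -
      have "(\<Sum>p\<in>T. \<Sum>n=1..N. c p * e n * (W f * char_value f (p * n)))
          = (\<Sum>p\<in>T. \<Sum>n=1..N. W f * ((c p * f p) * (e n * char_value f n)))"
        by (intro sum.cong refl) (simp add: cv mult_ac)
      also have "\<dots> = W f * (s * S)" unfolding s_def S_def sum_product by (simp only: sum_distrib_left)
      finally show ?thesis .
    qed
    have 3: "(\<Sum>p\<in>T. \<Sum>q\<in>T. \<Sum>n=1..N. c p * c q * e n * (W f * char_value f (p * (q * n)))) = W f * (s * (s * S))"
    proof -
      have "(\<Sum>p\<in>T. \<Sum>q\<in>T. \<Sum>n=1..N. c p * c q * e n * (W f * char_value f (p * (q * n))))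
          = (\<Sum>p\<in>T. \<Sum>q\<in>T. \<Sum>n=1..N. W f * ((c p * f p) * ((c q * f q) * (e n * char_value f n))))"
        by (intro sum.cong refl) (simp add: cv pT0 mult_ac)
      also have "\<dots> = W f * (s * (s * S))"
        unfolding s_def S_def sum_product by (simp only: sum_distrib_left)
      finally show ?thesis .
    qed
    show "W f * ((1 - (\<Sum>p\<in>T. c p * f p)) ^ 2 * (\<Sum>n=1..N. e n * char_value f n)) = (\<Sum>n=1..N. e n * (W f * char_value f n))
         - 2 * (\<Sum>p\<in>T. \<Sum>n=1..N. c p * e n * (W f * char_value f (p * n)))
         + (\<Sum>p\<in>T. \<Sum>q\<in>T. \<Sum>n=1..N. c p * c q * e n * (W f * char_value f (p * (q * n))))"
      unfolding 1 2 3 unfolding s_def[symmetric] S_def[symmetric] by (simp add: power2_eq_square algebra_simps)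
  qed
  hence "expect Q (\<lambda>f. W f * ((1 - (\<Sum>p\<in>T. c p * f p)) ^ 2 * (\<Sum>n=1..N. e n * char_value f n)))
    = (\<Sum>n=1..N. e n * expect Q (\<lambda>f. W f * char_value f n))
         - 2 * (\<Sum>p\<in>T. \<Sum>n=1..N. c p * e n * expect Q (\<lambda>f. W f * char_value f (p * n)))
         + (\<Sum>p\<in>T. \<Sum>q\<in>T. \<Sum>n=1..N. c p * c q * e n * expect Q (\<lambda>f. W f * char_value f (p * (q * n))))"
    by (simp only: expect_add expect_diff expect_cmult expect_sum)
  also have "\<dots> = (\<Sum>n=1..N. e n * tilted_coeff b n)
         - 2 * (\<Sum>p\<in>T. \<Sum>n=1..N. c p * e n * tilted_coeff b (p * n))
         + (\<Sum>p\<in>T. \<Sum>q\<in>T. \<Sum>n=1..N. c p * c q * e n * tilted_coeff b (p * (q * n)))"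
  proof -
    have 1: "expect Q (\<lambda>f. W f * char_value f n) = tilted_coeff b n" if "n \<in> {1..N}" for n
      using that by (intro EW pf) auto
    have 2: "expect Q (\<lambda>f. W f * char_value f (p * n)) = tilted_coeff b (p * n)" if "p \<in> T" "n \<in> {1..N}" for p n
      using that pT0[of p] by (intro EW pfp pf) auto
    have 3: "expect Q (\<lambda>f. W f * char_value f (p * (q * n))) = tilted_coeff b (p * (q * n))"
      if "p \<in> T" "q \<in> T" "n \<in> {1..N}" for p q n
      using that pT0[of p] pT0[of q] by (intro EW pfp pf) auto
    show ?thesis by (simp only: 1 2 3 cong: sum.cong)
  qed
  also have "(\<Sum>p\<in>T. \<Sum>n=1..N. c p * e n * tilted_coeff b (p * n))
      = (\<Sum>p\<in>T. c p * (1 - vanish_prob p) * (\<Sum>n=1..N div p. e (p * n) * tilted_coeff b n))"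
  proof (intro sum.cong refl)
    fix p assume p: "p \<in> T"
    have "(\<Sum>n=1..N. c p * e n * tilted_coeff b (p * n)) = (\<Sum>n | n \<in> {1..N} \<and> p dvd n. c p * e n * tilted_coeff b (p * n))"
    proof (rule sum.mono_neutral_right)
      show "\<forall>n\<in>{1..N} - {n. n \<in> {1..N} \<and> p dvd n}. c p * e n * tilted_coeff b (p * n) = 0"
        using tilted_coeff_prime_mult(1)[OF prT[OF p]] b0[OF p] by auto
    qed auto
    also have "\<dots> = (\<Sum>n=1..N div p. c p * e (p * n) * tilted_coeff b (p * (p * n)))"
      by (rule sum_multiples_nat[OF pT0[OF p]])
    also have "\<dots> = (\<Sum>n=1..N div p. c p * e (p * n) * ((1 - vanish_prob p) * tilted_coeff b n))"
    proof (intro sum.cong refl)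
      fix n assume n: "n \<in> {1..N div p}"
      have "n < p"
      proof (rule ccontr)
        assume "\<not> n < p"
        hence "p * p \<le> p * n" by simp
        also have "\<dots> \<le> N" using n pT0[OF p] by (simp add: less_eq_div_iff_mult_less_eq mult.commute)
        finally show False using T(3)[OF p p] by simp
      qed
      hence "\<not> p dvd n" using n by (auto dest: dvd_imp_le)
      hence "tilted_coeff b (p ^ 2 * n) = (1 - vanish_prob p) * tilted_coeff b n"
        using n by (intro tilted_coeff_prime_mult(2) prT p) auto
      thus "c p * e (p * n) * tilted_coeff b (p * (p * n)) = c p * e (p * n) * ((1 - vanish_prob p) * tilted_coeff b n)"
        by (simp add: power2_eq_square mult.assoc)
    qed
    also have "\<dots> = c p * (1 - vanish_prob p) * (\<Sum>n=1..N div p. e (p * n) * tilted_coeff b n)"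
      by (simp add: sum_distrib_left mult_ac)
    finally show "(\<Sum>n=1..N. c p * e n * tilted_coeff b (p * n)) = \<dots>" .
  qed
  also have "(\<Sum>p\<in>T. \<Sum>q\<in>T. \<Sum>n=1..N. c p * c q * e n * tilted_coeff b (p * (q * n)))
     = (\<Sum>p\<in>T. c p ^ 2 * (1 - vanish_prob p)) * (\<Sum>n=1..N. e n * tilted_coeff b n)"
  proof -
    \<comment> \<open>If \<open>p\<close> divides \<open>n\<close> then it does so exactly once, as
      p^2 > N, and both sides vanish: an odd power of an untilted prime has mean zero.\<close>
    have diag: "tilted_coeff b (p * (p * n)) = (1 - vanish_prob p) * tilted_coeff b n" if p: "p \<in> T" and n: "n \<in> {1..N}" for p n
    proof (cases "p dvd n")
      case False
      thus ?thesis using tilted_coeff_prime_mult(2)[OF prT[OF p], of n b] n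
        by (simp add: power2_eq_square mult.assoc)
    next
      case True
      then obtain k where k: "n = p * k" by blast
      have k0: "k > 0" using n k by (cases k) auto
      have "\<not> p dvd k"
      proof
        assume "p dvd k"
        hence "p \<le> k" using k0 by (rule dvd_imp_le)
        hence "p * p \<le> N" using n k by (metis atLeastAtMost_iff le_trans mult_le_mono2)
        thus False using T(3)[OF p p] by simp
      qed
      hence mk: "multiplicity p k = 0" by (rule not_dvd_imp_multiplicity_0)
      have mp: "multiplicity p (p * m) = Suc (multiplicity p m)" if "m > 0" for m
        using prT[OF p] that pT0[OF p] by (simp add: prime_elem_multiplicity_mult_distrib multiplicity_prime)
      have "odd (multiplicity p n)" "odd (multiplicity p (p * (p * n)))"
        using mk k0 pT0[OF p] by (simp_all add: k mp)
      hence "tilted_coeff b n = 0" "tilted_coeff b (p * (p * n)) = 0"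
        using tilted_coeff_eq_0 prT[OF p] b0[OF p] n pT0[OF p] by auto
      thus ?thesis by simp
    qed
    have off: "tilted_coeff b (p * (q * n)) = 0" if pq: "p \<in> T" "q \<in> T" "p \<noteq> q" and n: "n \<in> {1..N}" for p q n
    proof -
      have "\<not> p dvd n \<or> \<not> q dvd n"
      proof (rule ccontr)
        assume "\<not> ?thesis"
        hence "p dvd n" "q dvd n" by auto
        hence "p * q dvd n" using primes_coprime[OF prT prT pq(3)] pq by (intro divides_mult) auto
        hence "p * q \<le> n" using n by (intro dvd_imp_le) auto
        thus False using T(3)[OF pq(1,2)] n by simp
      qed
      moreover have "tilted_coeff b (p * (q * n)) = 0" if pq: "p \<in> T" "q \<in> T" "p \<noteq> q" "\<not> p dvd n" for p q
      proof -
        have "\<not> p dvd q" using pq prT primes_dvd_imp_eq by blast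
        hence "\<not> p dvd q * n" using pq prT prime_dvd_mult_iff by blast
        thus ?thesis using tilted_coeff_prime_mult(1)[OF prT[OF pq(1)], of "q * n" b] b0[OF pq(1)] n pT0[OF pq(2)] by simp
      qed
      moreover have "p * (q * n) = q * (p * n)" by simp
      ultimately show ?thesis using pq by metis
    qed
    have "(\<Sum>p\<in>T. \<Sum>q\<in>T. \<Sum>n=1..N. c p * c q * e n * tilted_coeff b (p * (q * n)))
        = (\<Sum>p\<in>T. \<Sum>q\<in>T. if q = p then (\<Sum>n=1..N. c p * c p * e n * ((1 - vanish_prob p) * tilted_coeff b n)) else 0)"
    proof (intro sum.cong refl)
      fix p q assume "p \<in> T" "q \<in> T"
      thus "(\<Sum>n=1..N. c p * c q * e n * tilted_coeff b (p * (q * n)))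
         = (if q = p then (\<Sum>n=1..N. c p * c p * e n * ((1 - vanish_prob p) * tilted_coeff b n)) else 0)"
        by (cases "q = p") (auto simp: diag off)
    qed
    also have "\<dots> = (\<Sum>p\<in>T. \<Sum>n=1..N. c p * c p * e n * ((1 - vanish_prob p) * tilted_coeff b n))"
      using finT by simp
    also have "\<dots> = (\<Sum>p\<in>T. c p ^ 2 * (1 - vanish_prob p)) * (\<Sum>n=1..N. e n * tilted_coeff b n)"
      unfolding sum_product by (intro sum.cong refl) (simp add: power2_eq_square mult_ac)
    finally show ?thesis .
  qed
  finally show ?thesis unfolding W_def b_def by (simp add: algebra_simps)
qed

text \<open>The primes of the squarefree part: \<open>n\<close> is their product times a square.
  Their number is the degree in which a tilt enters the coefficient at \<open>n\<close>.\<close>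

definition odd_part :: "nat \<Rightarrow> nat set" where
  "odd_part n = {p\<in>prime_factors n. odd (multiplicity p n)}"

lemma finite_odd_part [simp]: "finite (odd_part n)"
  by (simp add: odd_part_def)

text \<open>Exactly the primes of odd exponent contribute a factor \<kappa>. Hence a smoothed sum is
  a polynomial in \<kappa>, graded by the number of these primes.\<close>

lemma tilted_coeff_scale:
  "tilted_coeff (\<lambda>p. \<kappa> * b p) n = \<kappa> ^ card (odd_part n) * tilted_coeff b n"
proof -
  have "tilted_coeff (\<lambda>p. \<kappa> * b p) n = (\<Prod>p\<in>prime_factors n. (if odd (multiplicity p n) then \<kappa> else 1) *
      (if odd (multiplicity p n) then - b p else 1 - vanish_prob p))"
    unfolding tilted_coeff_def by (intro prod.cong refl) auto
  also have "\<dots> = (\<Prod>p\<in>prime_factors n. if odd (multiplicity p n) then \<kappa> else 1) * tilted_coeff b n"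
    by (simp add: prod.distrib tilted_coeff_def)
  also have "(\<Prod>p\<in>prime_factors n. if odd (multiplicity p n) then \<kappa> else 1) = \<kappa> ^ card (odd_part n)"
    unfolding odd_part_def by (simp add: prod.inter_filter[symmetric])
  finally show ?thesis .
qed

lemma prod_odd_part_times_square:
  assumes "n > 0"
  shows "\<Prod>(odd_part n) * (\<Prod>p\<in>prime_factors n. p ^ (multiplicity p n div 2)) ^ 2 = n"
proof -
  have "\<Prod>(odd_part n) = (\<Prod>p\<in>prime_factors n. if odd (multiplicity p n) then p else 1)"
    unfolding odd_part_def by (simp add: prod.inter_filter)
  hence "\<Prod>(odd_part n) * (\<Prod>p\<in>prime_factors n. p ^ (multiplicity p n div 2)) ^ 2
     = (\<Prod>p\<in>prime_factors n. (if odd (multiplicity p n) then p else 1) * (p ^ (multiplicity p n div 2)) ^ 2)"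
    by (simp add: prod.distrib prod_power_distrib)
  also have "\<dots> = (\<Prod>p\<in>prime_factors n. p ^ multiplicity p n)"
  proof (intro prod.cong refl)
    fix p
    show "(if odd (multiplicity p n) then p else 1) * (p ^ (multiplicity p n div 2)) ^ 2 = p ^ multiplicity p n"
    proof (cases "odd (multiplicity p n)")
      case True
      then obtain m where "multiplicity p n = 2 * m + 1" by (elim oddE)
      thus ?thesis by (simp add: power_mult[symmetric] mult.commute)
    next
      case False
      hence "even (multiplicity p n)" by simp
      then obtain m where "multiplicity p n = 2 * m" by (elim evenE)
      thus ?thesis by (simp add: power_mult[symmetric] mult.commute)
    qed
  qed
  also have "\<dots> = n" using assms by (subst prime_factorization_nat[symmetric]) auto
  finally show ?thesis .
qed

lemma prime_factors_squarefree_times_square: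
  assumes "finite S" "\<And>p. p \<in> S \<Longrightarrow> prime p" "k > 0"
  shows "odd_part (\<Prod>S * k ^ 2) = S" "prime_factors (\<Prod>S * k ^ 2) = S \<union> prime_factors k"
proof -
  have S: "prime_factors (\<Prod>S) = S" "\<Prod>S > 0" using prime_factors_prod_primes[OF assms(1,2)] by auto
  show pf: "prime_factors (\<Prod>S * k ^ 2) = S \<union> prime_factors k"
    using S assms(3) by (subst prime_factors_product) (auto simp: prime_factors_power)
  have mult: "multiplicity p (\<Prod>S * k ^ 2) = (if p \<in> S then 1 else 0) + 2 * multiplicity p k" if "prime p" for p
  proof -
    have "multiplicity p (\<Prod>S * k ^ 2) = multiplicity p (\<Prod>S) + multiplicity p (k ^ 2)"
      using that S assms(3) by (intro prime_elem_multiplicity_mult_distrib) auto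
    also have "multiplicity p (\<Prod>S) = (if p \<in> S then 1 else 0)"
      using multiplicity_prod_prime_powers[OF assms(1,2) that, of "\<lambda>_. 1"] by simp
    also have "multiplicity p (k ^ 2) = 2 * multiplicity p k"
      using that assms(3) by (simp add: prime_elem_multiplicity_power_distrib)
    finally show ?thesis .
  qed
  have "p \<in> odd_part (\<Prod>S * k ^ 2) \<longleftrightarrow> p \<in> S" for p
  proof
    assume "p \<in> odd_part (\<Prod>S * k ^ 2)"
    hence "prime p" "odd (multiplicity p (\<Prod>S * k ^ 2))" by (auto simp: odd_part_def)
    thus "p \<in> S" using mult by (auto split: if_splits)
  next
    assume p: "p \<in> S"
    hence "odd (multiplicity p (\<Prod>S * k ^ 2))" using mult[OF assms(2)[OF p]] by simp
    thus "p \<in> odd_part (\<Prod>S * k ^ 2)" using p unfolding odd_part_def pf by simp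
  qed
  thus "odd_part (\<Prod>S * k ^ 2) = S" by blast
qed

text \<open>Every \<open>n\<close> is uniquely the product of a set of primes and a square; the root
  of the square collects the exponents halved and rounded down.\<close>

lemma sum_by_odd_part:
  fixes F :: "nat \<Rightarrow> real"
  assumes "finite A" "\<And>p. p \<in> A \<Longrightarrow> prime p"
  shows "(\<Sum>n | n \<in> {1..N} \<and> odd_part n \<subseteq> A \<and> card (odd_part n) = j. F n)
     = (\<Sum>S | S \<subseteq> A \<and> card S = j. \<Sum>k | 1 \<le> k \<and> \<Prod>S * k ^ 2 \<le> N. F (\<Prod>S * k ^ 2))"
proof -
  let ?r = "\<lambda>n. \<Prod>p\<in>prime_factors n. p ^ (multiplicity p n div 2)"
  have S: "finite S" "\<And>p. p \<in> S \<Longrightarrow> prime p" "\<Prod>S > 0" if "S \<subseteq> A" for S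
  proof -
    show "finite S" using that assms(1) finite_subset by blast
    show "prime p" if "p \<in> S" for p using that \<open>S \<subseteq> A\<close> assms(2) by blast
    thus "\<Prod>S > 0" by (intro prod_pos) (blast intro: prime_gt_0_nat)
  qed
  have fink: "finite {k. 1 \<le> k \<and> \<Prod>S * k ^ 2 \<le> N}" if "S \<subseteq> A" for S
  proof (rule finite_subset[of _ "{..N}"])
    show "{k. 1 \<le> k \<and> \<Prod>S * k ^ 2 \<le> N} \<subseteq> {..N}"
    proof
      fix k assume "k \<in> {k. 1 \<le> k \<and> \<Prod>S * k ^ 2 \<le> N}"
      moreover have "k \<le> k ^ 2" by (simp add: power2_eq_square)
      moreover have "1 * k ^ 2 \<le> \<Prod>S * k ^ 2" using S(3)[OF that] by (intro mult_right_mono) auto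
      ultimately show "k \<in> {..N}" unfolding atMost_iff mem_Collect_eq by linarith
    qed
  qed simp
  have finS: "finite {S. S \<subseteq> A \<and> card S = j}" by (rule finite_subset[of _ "Pow A"]) (use assms in auto)
  have "(\<Sum>n | n \<in> {1..N} \<and> odd_part n \<subseteq> A \<and> card (odd_part n) = j. F n)
     = (\<Sum>(S, k)\<in>Sigma {S. S \<subseteq> A \<and> card S = j} (\<lambda>S. {k. 1 \<le> k \<and> \<Prod>S * k ^ 2 \<le> N}). F (\<Prod>S * k ^ 2))"
  proof (rule sum.reindex_bij_witness[of _ "\<lambda>(S, k). \<Prod>S * k ^ 2" "\<lambda>n. (odd_part n, ?r n)"])
    fix n assume n: "n \<in> {n. n \<in> {1..N} \<and> odd_part n \<subseteq> A \<and> card (odd_part n) = j}"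
    hence n0: "n > 0" by simp
    note eq = prod_odd_part_times_square[OF n0]
    have "?r n \<noteq> 0"
    proof
      assume "?r n = 0"
      hence "n = 0" using eq by simp
      thus False using n0 by simp
    qed
    hence "1 \<le> ?r n" by linarith
    moreover have "\<Prod>(odd_part n) * (?r n) ^ 2 \<le> N" unfolding eq using n by simp
    moreover have "odd_part n \<subseteq> A" "card (odd_part n) = j" using n by auto
    ultimately show "(odd_part n, ?r n) \<in> Sigma {S. S \<subseteq> A \<and> card S = j} (\<lambda>S. {k. 1 \<le> k \<and> \<Prod>S * k ^ 2 \<le> N})"
      by blast
    show "(case (odd_part n, ?r n) of (S, k) \<Rightarrow> \<Prod>S * k ^ 2) = n" using eq by simp
    show "(case (odd_part n, ?r n) of (S, k) \<Rightarrow> F (\<Prod>S * k ^ 2)) = F n" using eq by simp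
  next
    fix a assume "a \<in> Sigma {S. S \<subseteq> A \<and> card S = j} (\<lambda>S. {k. 1 \<le> k \<and> \<Prod>S * k ^ 2 \<le> N})"
    then obtain Sa k where a: "a = (Sa, k)" "Sa \<subseteq> A" "card Sa = j" "1 \<le> k" "\<Prod>Sa * k ^ 2 \<le> N" by auto
    have k0: "k > 0" using a by simp
    have op: "odd_part (\<Prod>Sa * k ^ 2) = Sa"
      by (rule prime_factors_squarefree_times_square(1)[OF S(1)[OF a(2)] S(2)[OF a(2)] k0])
    have n0: "\<Prod>Sa * k ^ 2 > 0" using S(3)[OF a(2)] k0 by simp
    have "\<Prod>Sa * (?r (\<Prod>Sa * k ^ 2)) ^ 2 = \<Prod>Sa * k ^ 2"
      using prod_odd_part_times_square[OF n0] unfolding op .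
    hence "(?r (\<Prod>Sa * k ^ 2)) ^ 2 = k ^ 2" using S(3)[OF a(2)] by simp
    hence "?r (\<Prod>Sa * k ^ 2) = k" by simp
    thus "(odd_part (case a of (S, k) \<Rightarrow> \<Prod>S * k ^ 2), ?r (case a of (S, k) \<Rightarrow> \<Prod>S * k ^ 2)) = a"
      using a op by simp
    show "(case a of (S, k) \<Rightarrow> \<Prod>S * k ^ 2) \<in> {n. n \<in> {1..N} \<and> odd_part n \<subseteq> A \<and> card (odd_part n) = j}"
      using a op n0 by simp
  qed
  also have "\<dots> = (\<Sum>S | S \<subseteq> A \<and> card S = j. \<Sum>k | 1 \<le> k \<and> \<Prod>S * k ^ 2 \<le> N. F (\<Prod>S * k ^ 2))"
    using finS fink by (subst sum.Sigma) auto
  finally show ?thesis .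
qed

text \<open>Between \<epsilon> and 2 the sign of the cutoff is unknown, but only \<open>k\<close> in
  a bounded ratio are concerned and they contribute at most C sqrt(2/\<epsilon>). Below \<epsilon>
  the cutoff is 1, and already the prime \<open>k\<close> give a divergent sum. The weights
  \<open>h\<close> will be products of 1 - vanish_prob p; the threshold \<open>V\<close> has to be
  uniform in them.\<close>

lemma cutoff_square_sum_ge_1:
  fixes \<phi> :: "real \<Rightarrow> real" and C \<epsilon> :: real
  assumes C: "\<And>x. 0 \<le> x \<Longrightarrow> \<bar>\<phi> x\<bar> \<le> C" and \<epsilon>: "0 < \<epsilon>" "\<epsilon> \<le> 2"
    and one: "\<And>x. 0 \<le> x \<Longrightarrow> x < \<epsilon> \<Longrightarrow> \<phi> x = 1"
  shows "\<exists>V>0. \<forall>v\<ge>V. \<forall>h :: nat \<Rightarrow> real. (\<forall>k\<ge>1. 0 \<le> h k \<and> h k \<le> 1) \<longrightarrow> (\<forall>p. prime p \<longrightarrow> 2 < p \<longrightarrow> 3 / 4 \<le> h p) \<longrightarrow>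
    1 \<le> (\<Sum>k | 1 \<le> k \<and> real k ^ 2 \<le> 2 * v. h k / real k * \<phi> (real k ^ 2 / v))"
proof -
  have C0: "0 \<le> C" using C[of 0] by linarith
  \<comment> \<open>Primes weigh at least 3/4 and \<open>i\<close> blocks sum to at least i / 2, so
    3 i / 8 has to reach C sqrt(2/\<epsilon>) + 1.\<close>
  define i where "i = nat \<lceil>8 / 3 * (C * sqrt (2 / \<epsilon>) + 1)\<rceil>"
  have i: "8 / 3 * (C * sqrt (2 / \<epsilon>) + 1) \<le> real i" unfolding i_def by linarith
  define E where "E = exp (24 * 4 ^ i :: real)"
  \<comment> \<open>Makes E^2 < \<epsilon> V, so that all primes up to \<open>E\<close> lie where
    the cutoff is 1.\<close>
  define V where "V = (E ^ 2 + 1) / \<epsilon>"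
  have V0: "V > 0" using \<epsilon> by (simp add: V_def add_nonneg_pos)
  have "1 \<le> (\<Sum>k | 1 \<le> k \<and> real k ^ 2 \<le> 2 * v. h k / real k * \<phi> (real k ^ 2 / v))"
    if v: "v \<ge> V" and h: "\<forall>k\<ge>1. 0 \<le> h k \<and> h k \<le> 1" "\<forall>p. prime p \<longrightarrow> 2 < p \<longrightarrow> 3 / 4 \<le> h p" for v and h :: "nat \<Rightarrow> real"
  proof -
    have v0: "v > 0" using v V0 by linarith
    define A where "A = {k::nat. 1 \<le> k \<and> real k ^ 2 < \<epsilon> * v}"
    define B where "B = {k::nat. 1 \<le> k \<and> \<epsilon> * v \<le> real k ^ 2 \<and> real k ^ 2 \<le> 2 * v}"
    have sub: "{k::nat. 1 \<le> k \<and> real k ^ 2 \<le> 2 * v} \<subseteq> {1..nat \<lfloor>sqrt (2 * v)\<rfloor>}"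
      using sq_harm_set_eq[of "2 * v"] v0 by simp
    have AB: "{k::nat. 1 \<le> k \<and> real k ^ 2 \<le> 2 * v} = A \<union> B"
    proof -
      have "\<epsilon> * v \<le> 2 * v" using \<epsilon> v0 by simp
      thus ?thesis by (auto simp: A_def B_def)
    qed
    have fin: "finite A" "finite B" using finite_subset[OF sub] unfolding AB by auto
    have "(\<Sum>k | 1 \<le> k \<and> real k ^ 2 \<le> 2 * v. h k / real k * \<phi> (real k ^ 2 / v))
       = (\<Sum>k\<in>A. h k / real k * \<phi> (real k ^ 2 / v)) + (\<Sum>k\<in>B. h k / real k * \<phi> (real k ^ 2 / v))"
      unfolding AB using fin by (intro sum.union_disjoint) (auto simp: A_def B_def)
    moreover have "(\<Sum>k\<in>A. h k / real k * \<phi> (real k ^ 2 / v)) \<ge> C * sqrt (2 / \<epsilon>) + 1"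
    proof -
      let ?P = "{p::nat. prime p \<and> exp 24 < real p \<and> real p \<le> E}"
      have e2: "(2::real) < exp 24" using exp_ge_add_one_self[of "24::real"] by linarith
      have PA: "?P \<subseteq> A"
      proof
        fix p assume p: "p \<in> ?P"
        have "real p ^ 2 \<le> E ^ 2" using p by (intro power_mono) auto
        also have "\<dots> < \<epsilon> * V" using \<epsilon> by (simp add: V_def)
        also have "\<dots> \<le> \<epsilon> * v" using v \<epsilon> by simp
        finally show "p \<in> A" using p prime_ge_1_nat by (auto simp: A_def)
      qed
      have "C * sqrt (2 / \<epsilon>) + 1 \<le> 3 / 4 * (real i / 2)" using i by simp
      also have "\<dots> \<le> 3 / 4 * (\<Sum>p\<in>?P. 1 / real p)"
        unfolding E_def using sum_inverse_odd_primes_unbounded[of i] by (intro mult_left_mono) auto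
      also have "\<dots> = (\<Sum>p\<in>?P. 3 / 4 / real p)" by (simp add: sum_distrib_left)
      also have "\<dots> \<le> (\<Sum>p\<in>?P. h p / real p)"
      proof (intro sum_mono divide_right_mono)
        fix p assume p: "p \<in> ?P"
        hence "2 < p" using e2 by (simp flip: of_nat_less_iff)
        thus "3 / 4 \<le> h p" using h(2) p by blast
      qed auto
      also have "\<dots> \<le> (\<Sum>k\<in>A. h k / real k)"
        using h(1) fin PA by (intro sum_mono2) (auto simp: A_def)
      also have "\<dots> = (\<Sum>k\<in>A. h k / real k * \<phi> (real k ^ 2 / v))"
      proof (intro sum.cong refl)
        fix k assume "k \<in> A"
        hence "real k ^ 2 / v < \<epsilon>" using v0 by (simp add: A_def pos_divide_less_eq)
        hence "\<phi> (real k ^ 2 / v) = 1" using v0 by (intro one) auto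
        thus "h k / real k = h k / real k * \<phi> (real k ^ 2 / v)" by simp
      qed
      finally show ?thesis .
    qed
    moreover have "\<bar>\<Sum>k\<in>B. h k / real k * \<phi> (real k ^ 2 / v)\<bar> \<le> C * sqrt (2 / \<epsilon>)"
    proof -
      have ev: "0 < sqrt (\<epsilon> * v)" using \<epsilon> v0 by simp
      have "\<bar>\<Sum>k\<in>B. h k / real k * \<phi> (real k ^ 2 / v)\<bar> \<le> (\<Sum>k\<in>B. 1 / sqrt (\<epsilon> * v) * C)"
      proof (rule order.trans[OF sum_abs sum_mono])
        fix k assume k: "k \<in> B"
        hence "sqrt (\<epsilon> * v) \<le> real k" by (intro real_le_lsqrt) (auto simp: B_def)
        moreover have hk: "0 \<le> h k" "h k \<le> 1" using h(1) k by (auto simp: B_def)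
        ultimately have "h k / real k \<le> 1 / sqrt (\<epsilon> * v)" using ev by (intro frac_le) auto
        moreover have "0 \<le> h k / real k" using hk by simp
        moreover have "\<bar>\<phi> (real k ^ 2 / v)\<bar> \<le> C" using v0 by (intro C) auto
        ultimately show "\<bar>h k / real k * \<phi> (real k ^ 2 / v)\<bar> \<le> 1 / sqrt (\<epsilon> * v) * C"
          unfolding abs_mult using ev by (intro mult_mono) auto
      qed
      also have "\<dots> = real (card B) * (1 / sqrt (\<epsilon> * v) * C)" by simp
      also have "\<dots> \<le> sqrt (2 * v) * (1 / sqrt (\<epsilon> * v) * C)"
      proof (intro mult_right_mono)
        have "card B \<le> card {1..nat \<lfloor>sqrt (2 * v)\<rfloor>}" using sub unfolding AB by (intro card_mono) auto
        hence "real (card B) \<le> real (nat \<lfloor>sqrt (2 * v)\<rfloor>)" by simp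
        also have "\<dots> \<le> sqrt (2 * v)" using v0 by simp
        finally show "real (card B) \<le> sqrt (2 * v)" .
      qed (use C0 ev in auto)
      also have "\<dots> = C * sqrt (2 / \<epsilon>)" using v0 \<epsilon> by (simp add: real_sqrt_mult real_sqrt_divide)
      finally show ?thesis .
    qed
    ultimately show ?thesis by linarith
  qed
  thus ?thesis using V0 by blast
qed

text \<open>In \<kappa> the smoothed sum is a polynomial of degree at most \<open>J\<close>, because
  more than \<open>J\<close> primes above \<open>P\<^sub>1\<close> have product beyond 2 u. Its
  coefficient of degree \<open>j\<close> has sign (-1)^j and is at least the elementary symmetric
  sum: for each set of \<open>j\<close> primes the remaining sum over squares has length at least
  \<open>V\<close> and so is at least 1. Interpolation carries the size of the coefficient to a
  node.\<close>

lemma exists_node_smoothed_sum_large: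
  fixes \<phi> :: "real \<Rightarrow> real" and a :: "nat \<Rightarrow> real" and u V P\<^sub>1 P\<^sub>2 :: real and J j :: nat
  assumes A: "finite A" "\<And>p. p \<in> A \<Longrightarrow> prime p \<and> P\<^sub>1 < real p \<and> real p \<le> P\<^sub>2"
    and a: "\<And>p. p \<in> A \<Longrightarrow> 0 \<le> a p" "\<And>p. p \<notin> A \<Longrightarrow> a p = 0"
    and P: "1 \<le> P\<^sub>1" and u: "2 * u < P\<^sub>1 ^ (J + 1)" "P\<^sub>2 ^ j * V \<le> u" and J: "0 < J" and V: "V > 0" and P2: "P\<^sub>2 > 0"
    and psi: "\<forall>v\<ge>V. \<forall>h :: nat \<Rightarrow> real. (\<forall>k\<ge>1. 0 \<le> h k \<and> h k \<le> 1) \<longrightarrow> (\<forall>p. prime p \<longrightarrow> 2 < p \<longrightarrow> 3 / 4 \<le> h p) \<longrightarrow>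
    1 \<le> (\<Sum>k | 1 \<le> k \<and> real k ^ 2 \<le> 2 * v. h k / real k * \<phi> (real k ^ 2 / v))"
  shows "\<exists>i\<le>J. elem_sym (\<lambda>p. a p / sqrt (real p)) A j / 24 ^ J \<le> \<bar>smoothed_sum (\<lambda>p. real i / real J * a p) \<phi> u\<bar>"
proof (rule ccontr)
  assume no: "\<not> ?thesis"
  define e where "e = elem_sym (\<lambda>p. a p / sqrt (real p)) A j"
  define N where "N = nat \<lfloor>2 * u\<rfloor>"
  define \<psi> where "\<psi> = (\<lambda>n. tilted_coeff a n / sqrt (real n) * \<phi> (real n / u))"
  define cf where "cf = (\<lambda>i. \<Sum>n | n \<in> {1..N} \<and> card (odd_part n) = i. \<psi> n)"
  define Pol where "Pol = (\<Sum>i\<le>J. Polynomial.monom (cf i) i)"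
  have u0: "u > 0"
  proof -
    have "0 < P\<^sub>2 ^ j * V" using P2 V by simp
    thus ?thesis using u by linarith
  qed
  have zero: "tilted_coeff a n = 0" if n: "n \<in> {1..N}" and sub: "\<not> (odd_part n \<subseteq> A)" for n
  proof -
    obtain p where p: "p \<in> odd_part n" "p \<notin> A" using sub by blast
    thus ?thesis using n a(2)[of p] by (intro tilted_coeff_eq_0[of n p]) (auto simp: odd_part_def)
  qed
  have small: "card (odd_part n) \<le> J" if n: "n \<in> {1..N}" "odd_part n \<subseteq> A" for n
  proof (rule ccontr)
    assume "\<not> card (odd_part n) \<le> J"
    hence "P\<^sub>1 ^ (J + 1) \<le> P\<^sub>1 ^ card (odd_part n)" using P by (intro power_increasing) auto
    also have "\<dots> = (\<Prod>p\<in>odd_part n. P\<^sub>1)" by simp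
    also have "\<dots> \<le> (\<Prod>p\<in>odd_part n. real p)" using n A(2) P by (intro prod_mono) (auto intro: less_imp_le)
    also have "\<dots> = real (\<Prod>(odd_part n))" by simp
    also have "\<dots> \<le> real n"
    proof -
      have n0: "n > 0" using n by simp
      have "\<Prod>(odd_part n) dvd n" using prod_odd_part_times_square[OF n0] by (metis dvd_triv_left)
      thus ?thesis using n0 by (simp only: of_nat_le_iff dvd_imp_le)
    qed
    also have "\<dots> \<le> 2 * u" using n u0 by (simp add: N_def le_nat_iff le_floor_iff)
    finally show False using u by linarith
  qed
  have poly: "poly Pol \<kappa> = smoothed_sum (\<lambda>p. \<kappa> * a p) \<phi> u" for \<kappa>
  proof -
    have "smoothed_sum (\<lambda>p. \<kappa> * a p) \<phi> u = (\<Sum>n=1..N. \<kappa> ^ card (odd_part n) * \<psi> n)"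
      unfolding smoothed_sum_def N_def[symmetric] \<psi>_def tilted_coeff_scale by (simp add: mult_ac)
    also have "\<dots> = (\<Sum>n | n \<in> {1..N} \<and> card (odd_part n) \<le> J. \<kappa> ^ card (odd_part n) * \<psi> n)"
    proof (rule sum.mono_neutral_right)
      show "\<forall>n\<in>{1..N} - {n. n \<in> {1..N} \<and> card (odd_part n) \<le> J}. \<kappa> ^ card (odd_part n) * \<psi> n = 0"
        using zero small unfolding \<psi>_def by fastforce
    qed auto
    also have "\<dots> = (\<Sum>i\<le>J. \<Sum>n | n \<in> {n. n \<in> {1..N} \<and> card (odd_part n) \<le> J} \<and> card (odd_part n) = i. \<kappa> ^ card (odd_part n) * \<psi> n)"
      by (rule sum.group[symmetric]) auto
    also have "\<dots> = (\<Sum>i\<le>J. \<kappa> ^ i * cf i)"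
      unfolding cf_def sum_distrib_left by (intro sum.cong refl) auto
    also have "\<dots> = poly Pol \<kappa>" by (simp add: Pol_def poly_sum poly_monom mult.commute)
    finally show ?thesis by simp
  qed
  \<comment> \<open>For j > J either no set of \<open>j\<close> primes exists and the claim is
    trivial, or u divided by the j-th power of \<open>P\<^sub>2\<close> is below 1/2; then the sum
    in \<open>psi\<close> would be empty and yet at least 1.\<close>
  have j_le_J: "j \<le> J"
  proof (rule ccontr)
    assume "\<not> j \<le> J"
    show False
    proof (cases "A = {}")
      case True
      hence "e = 0"
      proof -
        have "{S. S \<subseteq> A \<and> card S = j} = {}" using True \<open>\<not> j \<le> J\<close> by auto
        thus ?thesis unfolding e_def elem_sym_def by (simp only: sum.empty)
      qed
      thus False using no unfolding e_def by (auto intro!: exI[of _ 0])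
    next
      case False
      have "e = 0" if "\<not> (\<exists>S. S \<subseteq> A \<and> card S = j)"
        unfolding e_def elem_sym_def using that by (intro sum.neutral) auto
      moreover have "\<not> (\<exists>S. S \<subseteq> A \<and> card S = j)"
      proof
        assume "\<exists>S. S \<subseteq> A \<and> card S = j"
        have "P\<^sub>1 \<le> P\<^sub>2" using False A(2) by (meson all_not_in_conv less_imp_le order.trans)
        hence "P\<^sub>1 ^ j \<le> P\<^sub>2 ^ j" using P by (intro power_mono) auto
        moreover have "P\<^sub>1 ^ (J + 1) \<le> P\<^sub>1 ^ j" using P \<open>\<not> j \<le> J\<close> by (intro power_increasing) auto
        moreover have "V \<le> u / P\<^sub>2 ^ j" using u(2) P2 by (simp add: pos_le_divide_eq mult.commute)
        ultimately have "2 * u < P\<^sub>2 ^ j" using u by linarith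
        hence v: "u / P\<^sub>2 ^ j < 1 / 2" using P2 by (simp add: pos_divide_less_eq)
        hence "{k::nat. 1 \<le> k \<and> real k ^ 2 \<le> 2 * (u / P\<^sub>2 ^ j)} = {}"
        proof -
          have "\<not> real k ^ 2 \<le> 2 * (u / P\<^sub>2 ^ j)" if "1 \<le> k" for k :: nat
          proof -
            have "1 \<le> real k ^ 2" using that by (simp add: one_le_power)
            thus ?thesis using v by linarith
          qed
          thus ?thesis by auto
        qed
        moreover have "1 \<le> (\<Sum>k | 1 \<le> k \<and> real k ^ 2 \<le> 2 * (u / P\<^sub>2 ^ j). 1 / real k * \<phi> (real k ^ 2 / (u / P\<^sub>2 ^ j)))"
          using psi[rule_format, of "u / P\<^sub>2 ^ j" "\<lambda>_. 1"] \<open>V \<le> u / P\<^sub>2 ^ j\<close> by simp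
        ultimately show False by (simp only: sum.empty)
      qed
      ultimately have "e = 0" by blast
      thus False using no unfolding e_def by (auto intro!: exI[of _ 0])
    qed
  qed
  have "Polynomial.coeff Pol j = cf j" using j_le_J
    by (simp add: Pol_def Polynomial.coeff_sum)
  moreover have "\<bar>Polynomial.coeff Pol j\<bar> < e"
  proof -
    define K where "K = Max ((\<lambda>i. \<bar>poly Pol (real i / real J)\<bar>) ` {..J})"
    have K: "\<bar>poly Pol (real i / real J)\<bar> \<le> K" if "i \<le> J" for i
      unfolding K_def using that by (intro Max_ge) auto
    have "K \<in> (\<lambda>i. \<bar>poly Pol (real i / real J)\<bar>) ` {..J}" unfolding K_def by (intro Max_in) auto
    then obtain i where i: "i \<le> J" "K = \<bar>poly Pol (real i / real J)\<bar>" by auto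
    have "\<not> e / 24 ^ J \<le> \<bar>smoothed_sum (\<lambda>p. real i / real J * a p) \<phi> u\<bar>"
      using no i(1) unfolding e_def by blast
    hence "K < e / 24 ^ J" using i(2) unfolding poly by linarith
    moreover have "degree Pol \<le> J" unfolding Pol_def
      by (rule degree_sum_le) (auto intro: order.trans[OF degree_monom_le])
    ultimately have "\<bar>Polynomial.coeff Pol j\<bar> \<le> 24 ^ J * K" "24 ^ J * K < e"
      using coeff_le_of_bounded_at_nodes[OF J _ K, of j] by (auto simp: field_simps)
    thus ?thesis by linarith
  qed
  moreover have "e \<le> (-1) ^ j * cf j"
  proof -
    have "cf j = (\<Sum>n | n \<in> {1..N} \<and> odd_part n \<subseteq> A \<and> card (odd_part n) = j. \<psi> n)"
      unfolding cf_def using zero by (intro sum.mono_neutral_right) (auto simp: \<psi>_def)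
    also have "\<dots> = (\<Sum>S | S \<subseteq> A \<and> card S = j. \<Sum>k | 1 \<le> k \<and> \<Prod>S * k ^ 2 \<le> N. \<psi> (\<Prod>S * k ^ 2))"
      using A by (intro sum_by_odd_part) auto
    finally have "(-1) ^ j * cf j = (\<Sum>S | S \<subseteq> A \<and> card S = j. (-1) ^ j * (\<Sum>k | 1 \<le> k \<and> \<Prod>S * k ^ 2 \<le> N. \<psi> (\<Prod>S * k ^ 2)))"
      by (simp add: sum_distrib_left)
    also have "\<dots> \<ge> e"
      unfolding e_def elem_sym_def
    proof (intro sum_mono)
      fix S assume "S \<in> {S. S \<subseteq> A \<and> card S = j}"
      hence S: "S \<subseteq> A" "card S = j" by auto
      have finS: "finite S" using S(1) A(1) finite_subset by blast
      have prS: "prime p" if "p \<in> S" for p using that S A by blast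
      have s0: "\<Prod>S > 0" by (rule prod_pos) (use prS in \<open>blast intro: prime_gt_0_nat\<close>)
      define s where "s = real (\<Prod>S)"
      have spos: "s > 0" using s0 by (simp only: s_def of_nat_0_less_iff)
      define v where "v = u / s"
      \<comment> \<open>Primes of \<open>S\<close> keep an odd exponent whatever \<open>k\<close>
        is; only the other primes of \<open>k\<close> contribute a factor 1 - vanish_prob p.\<close>
      define h where "h = (\<lambda>k. \<Prod>p\<in>prime_factors k - S. 1 - vanish_prob p)"
      have term_eq: "(-1) ^ j * \<psi> (\<Prod>S * k ^ 2) = (\<Prod>p\<in>S. a p / sqrt (real p)) * (h k / real k * \<phi> (real k ^ 2 / v))"
        if k: "1 \<le> k" for k
      proof -
        have k0: "k > 0" using k by simp
        have pf: "odd_part (\<Prod>S * k ^ 2) = S" "prime_factors (\<Prod>S * k ^ 2) = S \<union> prime_factors k"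
          by (rule prime_factors_squarefree_times_square; use finS prS k0 in blast)+
        have "tilted_coeff a (\<Prod>S * k ^ 2) = (\<Prod>p\<in>S \<union> (prime_factors k - S). if p \<in> odd_part (\<Prod>S * k ^ 2) then - a p else 1 - vanish_prob p)"
          unfolding tilted_coeff_def pf(2) by (intro prod.cong) (auto simp: odd_part_def pf(2))
        also have "\<dots> = (\<Prod>p\<in>S. - a p) * h k"
          unfolding pf(1) h_def using finS by (subst prod.union_disjoint) auto
        also have "(\<Prod>p\<in>S. - a p) = (-1) ^ j * (\<Prod>p\<in>S. a p)" using S by (simp add: prod_uminus)
        finally have tc: "tilted_coeff a (\<Prod>S * k ^ 2) = (-1) ^ j * (\<Prod>p\<in>S. a p) * h k" .
        have "sqrt (real (\<Prod>S * k ^ 2)) = sqrt s * real k" by (simp add: s_def real_sqrt_mult)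
        moreover have "real (\<Prod>S * k ^ 2) / u = real k ^ 2 / v" using spos by (simp add: v_def s_def mult.commute)
        moreover have "sqrt s = (\<Prod>p\<in>S. sqrt (real p))" by (simp add: s_def sqrt_prod)
        moreover have "(-1::real) ^ j * (-1) ^ j = 1" by (simp add: power_mult_distrib[symmetric])
        ultimately show ?thesis unfolding \<psi>_def tc by (simp add: prod_dividef)
      qed
      have set_eq: "{k. 1 \<le> k \<and> \<Prod>S * k ^ 2 \<le> N} = {k. 1 \<le> k \<and> real k ^ 2 \<le> 2 * v}"
      proof -
        have "\<Prod>S * k ^ 2 \<le> N \<longleftrightarrow> real k ^ 2 \<le> 2 * v" for k
        proof -
          have "\<Prod>S * k ^ 2 \<le> N \<longleftrightarrow> real (\<Prod>S * k ^ 2) \<le> 2 * u"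
            using u0 unfolding N_def by (simp add: le_nat_iff le_floor_iff)
          also have "\<dots> \<longleftrightarrow> s * real k ^ 2 \<le> 2 * u" by (simp add: s_def)
          also have "\<dots> \<longleftrightarrow> real k ^ 2 \<le> 2 * v" using spos by (simp add: v_def field_simps)
          finally show ?thesis .
        qed
        thus ?thesis by simp
      qed
      have "(-1) ^ j * (\<Sum>k | 1 \<le> k \<and> \<Prod>S * k ^ 2 \<le> N. \<psi> (\<Prod>S * k ^ 2))
         = (\<Prod>p\<in>S. a p / sqrt (real p)) * (\<Sum>k | 1 \<le> k \<and> real k ^ 2 \<le> 2 * v. h k / real k * \<phi> (real k ^ 2 / v))"
        unfolding set_eq sum_distrib_left by (intro sum.cong refl) (simp add: term_eq)
      moreover have "1 \<le> (\<Sum>k | 1 \<le> k \<and> real k ^ 2 \<le> 2 * v. h k / real k * \<phi> (real k ^ 2 / v))"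
      proof (rule psi[rule_format])
        have "s \<le> P\<^sub>2 ^ j"
        proof -
          have "s = (\<Prod>p\<in>S. real p)" by (simp add: s_def)
          also have "\<dots> \<le> (\<Prod>p\<in>S. P\<^sub>2)" using S A(2) by (intro prod_mono) auto
          finally show ?thesis using S by simp
        qed
        hence "s * V \<le> P\<^sub>2 ^ j * V" using V by (intro mult_right_mono) auto
        hence "s * V \<le> u" using u by linarith
        thus "V \<le> v" using spos by (simp add: v_def pos_le_divide_eq mult.commute)
        show "0 \<le> h k \<and> h k \<le> 1" for k
          unfolding h_def vanish_prob_def by (auto intro!: prod_nonneg prod_le_1)
        fix p :: nat assume p: "prime p" "2 < p"
        have "3 / 4 \<le> 1 - vanish_prob p" using p by (simp add: vanish_prob_def field_simps)
        thus "3 / 4 \<le> h p" using p unfolding h_def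
          by (cases "p \<in> S") (simp_all add: prime_factorization_prime insert_Diff_if)
      qed
      moreover have "0 \<le> (\<Prod>p\<in>S. a p / sqrt (real p))" using S a(1) by (intro prod_nonneg) auto
      ultimately show "(\<Prod>p\<in>S. a p / sqrt (real p)) \<le> (-1) ^ j * (\<Sum>k | 1 \<le> k \<and> \<Prod>S * k ^ 2 \<le> N. \<psi> (\<Prod>S * k ^ 2))"
        using mult_left_mono[of 1] by fastforce
    qed
    finally show ?thesis .
  qed
  ultimately have "e \<le> (-1) ^ j * Polynomial.coeff Pol j" "\<bar>Polynomial.coeff Pol j\<bar> < e" by simp_all
  moreover have "(-1) ^ j * Polynomial.coeff Pol j \<le> \<bar>Polynomial.coeff Pol j\<bar>"
    using abs_ge_self[of "(-1) ^ j * Polynomial.coeff Pol j"] by (simp add: abs_mult power_abs)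
  ultimately show False by linarith
qed

section \<open>Truncating the resonator\<close>

text \<open>\<open>majorant Q F G\<close>: the coefficients of the Dirichlet polynomial \<open>F\<close> are dominated by those of \<open>G\<close>.
  This is not a pointwise inequality, but it survives products and, since every \<open>char_value\<close> has nonnegative
  expectation, it bounds \<open>expect Q F\<close> by \<open>expect Q G\<close>.\<close>

inductive majorant :: "nat set \<Rightarrow> ((nat \<Rightarrow> real) \<Rightarrow> real) \<Rightarrow> ((nat \<Rightarrow> real) \<Rightarrow> real) \<Rightarrow> bool" for Q where
  single: "1 \<le> n \<Longrightarrow> prime_factors n \<subseteq> Q \<Longrightarrow> \<bar>c\<bar> \<le> C
    \<Longrightarrow> majorant Q (\<lambda>f. c * char_value f n) (\<lambda>f. C * char_value f n)"
| add: "majorant Q F F' \<Longrightarrow> majorant Q G G' \<Longrightarrow> majorant Q (\<lambda>f. F f + G f) (\<lambda>f. F' f + G' f)"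

lemma majorant_const: "\<bar>c\<bar> \<le> C \<Longrightarrow> majorant Q (\<lambda>f. c) (\<lambda>f. C)"
  using majorant.single[of 1 Q c C] by simp

lemma majorant_prime: "prime p \<Longrightarrow> p \<in> Q \<Longrightarrow> \<bar>c\<bar> \<le> C \<Longrightarrow> majorant Q (\<lambda>f. c * f p) (\<lambda>f. C * f p)"
  using majorant.single[of p Q c C] prime_ge_1_nat[of p] by (simp add: char_value_prime prime_factorization_prime)

lemma majorant_sum:
  assumes "finite A" "\<And>i. i \<in> A \<Longrightarrow> majorant Q (F i) (G i)"
  shows "majorant Q (\<lambda>f. \<Sum>i\<in>A. F i f) (\<lambda>f. \<Sum>i\<in>A. G i f)"
  using assms
proof (induction A rule: finite_induct)
  case empty
  show ?case using majorant_const[of 0 0 Q] by simp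
next
  case (insert i A)
  thus ?case by (simp add: majorant.add)
qed

lemma majorant_mult:
  assumes "majorant Q F F'" "majorant Q G G'"
  shows "majorant Q (\<lambda>f. F f * G f) (\<lambda>f. F' f * G' f)"
  using assms(1)
proof (induction rule: majorant.induct)
  case (single m c C)
  show ?case using assms(2)
  proof (induction rule: majorant.induct)
    case (single n d C')
    have "majorant Q (\<lambda>f. (c * d) * char_value f (m * n)) (\<lambda>f. (C * C') * char_value f (m * n))"
    proof (rule majorant.single)
      show "1 \<le> m * n" using single \<open>1 \<le> m\<close> by simp
      show "prime_factors (m * n) \<subseteq> Q"
        using single \<open>1 \<le> m\<close> \<open>prime_factors m \<subseteq> Q\<close> by (subst prime_factors_product) auto
      show "\<bar>c * d\<bar> \<le> C * C'" using single \<open>\<bar>c\<bar> \<le> C\<close> by (auto simp: abs_mult intro!: mult_mono)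
    qed
    moreover have "char_value f (m * n) = char_value f m * char_value f n" for f
      using single \<open>1 \<le> m\<close> by (intro char_value_mult) auto
    ultimately show ?case by (simp add: mult_ac)
  next
    case (add F1 F1' G1 G1')
    thus ?case using majorant.add by (simp add: distrib_left)
  qed
next
  case (add F1 F1' G1 G1')
  thus ?case using majorant.add by (simp add: distrib_right)
qed

lemma tilted_coeff_0_nonneg: "0 \<le> tilted_coeff (\<lambda>_. 0) n"
  unfolding tilted_coeff_def using vanish_prob_bounds by (intro prod_nonneg) auto

lemma majorant_expect:
  assumes "majorant Q F G" and Q: "finite Q" "\<And>p. p \<in> Q \<Longrightarrow> prime p"
  shows "\<bar>expect Q F\<bar> \<le> expect Q G"
  using assms(1)
proof (induction rule: majorant.induct)
  case (single n c C)
  have "0 \<le> expect Q (\<lambda>f. char_value f n)"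
    using expect_char_value[OF Q, of n] single tilted_coeff_0_nonneg by simp
  thus ?case using single by (auto simp: expect_cmult abs_mult intro!: mult_right_mono)
next
  case (add F F' G G')
  thus ?case unfolding expect_add by linarith
qed

text \<open>A formal variable records the degree in the values \<open>f p\<close>, so the k-th
  coefficient is the homogeneous part of degree \<open>k\<close>. The square of \<open>f p\<close>
  counts as degree 2, so that a part of degree \<open>k\<close> over primes up to Z has frequencies
  at most Z^k.\<close>

definition graded_part :: "(nat \<Rightarrow> real) \<Rightarrow> (nat \<Rightarrow> real) \<Rightarrow> nat set \<Rightarrow> nat \<Rightarrow> (nat \<Rightarrow> real) \<Rightarrow> real" where
  "graded_part \<alpha> \<beta> P k f = Polynomial.coeff (\<Prod>p\<in>P. [:1, \<alpha> p * f p, \<beta> p * f p ^ 2:]) k"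

lemma graded_part_empty: "graded_part \<alpha> \<beta> {} k f = (if k = 0 then 1 else 0)"
  by (simp add: graded_part_def)

lemma graded_part_insert:
  assumes "finite P" "p \<notin> P"
  shows "graded_part \<alpha> \<beta> (insert p P) k f = graded_part \<alpha> \<beta> P k f
     + (if k \<ge> 1 then \<alpha> p * f p * graded_part \<alpha> \<beta> P (k - 1) f else 0)
     + (if k \<ge> 2 then \<beta> p * f p * (f p * graded_part \<alpha> \<beta> P (k - 2) f) else 0)"
  using assms by (cases k) (auto simp: graded_part_def coeff_pCons power2_eq_square split: nat.split)

lemma sum_graded_part:
  assumes "finite P" "2 * card P \<le> n"
  shows "(\<Sum>k\<le>n. graded_part \<alpha> \<beta> P k f * z ^ k) = (\<Prod>p\<in>P. 1 + \<alpha> p * z * f p + \<beta> p * z ^ 2 * f p ^ 2)"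
proof -
  let ?A = "\<Prod>p\<in>P. [:1, \<alpha> p * f p, \<beta> p * f p ^ 2:]"
  have "degree ?A \<le> (\<Sum>p\<in>P. degree [:1, \<alpha> p * f p, \<beta> p * f p ^ 2:])"
    using degree_prod_sum_le[OF assms(1), of "\<lambda>p. [:1, \<alpha> p * f p, \<beta> p * f p ^ 2:]"] by (simp add: o_def)
  also have "\<dots> \<le> (\<Sum>p\<in>P. 2)" by (intro sum_mono) auto
  also have "\<dots> \<le> n" using assms by simp
  finally have deg: "degree ?A \<le> n" .
  have "(\<Sum>k\<le>n. Polynomial.coeff ?A k * z ^ k) = (\<Sum>k\<le>degree ?A. Polynomial.coeff ?A k * z ^ k)"
    using deg by (intro sum.mono_neutral_right) (auto simp: coeff_eq_0)
  also have "\<dots> = poly ?A z" by (simp add: poly_altdef)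
  also have "\<dots> = (\<Prod>p\<in>P. 1 + \<alpha> p * z * f p + \<beta> p * z ^ 2 * f p ^ 2)"
    by (simp add: poly_prod algebra_simps power2_eq_square)
  finally show ?thesis by (simp add: graded_part_def)
qed

lemma majorant_graded_part:
  assumes "finite P" "P \<subseteq> Q" "\<And>p. p \<in> Q \<Longrightarrow> prime p"
  shows "majorant Q (graded_part \<alpha> \<beta> P k) (graded_part (\<lambda>p. \<bar>\<alpha> p\<bar>) (\<lambda>p. \<bar>\<beta> p\<bar>) P k)"
  using assms(1,2)
proof (induction P arbitrary: k rule: finite_induct)
  case empty
  show ?case unfolding graded_part_empty[abs_def] by (intro majorant_const) auto
next
  case (insert p P)
  have z: "majorant Q (\<lambda>f. 0) (\<lambda>f. 0)" by (rule majorant_const) simp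
  have p: "prime p" "p \<in> Q" using insert.prems assms(3) by auto
  have IH: "majorant Q (graded_part \<alpha> \<beta> P k) (graded_part (\<lambda>p. \<bar>\<alpha> p\<bar>) (\<lambda>p. \<bar>\<beta> p\<bar>) P k)" for k
    using insert.IH insert.prems by simp
  have 1: "majorant Q (\<lambda>f. if k \<ge> 1 then \<alpha> p * f p * graded_part \<alpha> \<beta> P (k - 1) f else 0)
     (\<lambda>f. if k \<ge> 1 then \<bar>\<alpha> p\<bar> * f p * graded_part (\<lambda>p. \<bar>\<alpha> p\<bar>) (\<lambda>p. \<bar>\<beta> p\<bar>) P (k - 1) f else 0)"
    using z majorant_mult[OF majorant_prime[OF p order.refl] IH] by (cases "k \<ge> 1") auto
  have pp: "majorant Q (\<lambda>f. f p) (\<lambda>f. f p)" using majorant_prime[OF p, of 1 1] by simp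
  have 2: "majorant Q (\<lambda>f. if k \<ge> 2 then \<beta> p * f p * (f p * graded_part \<alpha> \<beta> P (k - 2) f) else 0)
     (\<lambda>f. if k \<ge> 2 then \<bar>\<beta> p\<bar> * f p * (f p * graded_part (\<lambda>p. \<bar>\<alpha> p\<bar>) (\<lambda>p. \<bar>\<beta> p\<bar>) P (k - 2) f) else 0)"
    using z majorant_mult[OF majorant_prime[OF p order.refl] majorant_mult[OF pp IH]] by (cases "k \<ge> 2") auto
  show ?case
    unfolding graded_part_insert[OF insert.hyps, abs_def] by (intro majorant.add IH 1 2)
qed

text \<open>Rankin's trick for coefficients: in a polynomial with nonnegative coefficients the part
  of degree \<open>k\<close> is at most the value at any \<open>z > 0\<close> divided by z^k. The
  choice of \<open>z\<close> is left open; later it is the reciprocal of a bound for |P|.\<close>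

lemma dirichlet_poly_graded_part:
  assumes P: "finite P" "P \<subseteq> Q" "\<And>p. p \<in> P \<Longrightarrow> prime p \<and> real p \<le> Z"
    and Z: "1 \<le> Z" and z: "0 < z" and small: "\<And>p. p \<in> P \<Longrightarrow> \<bar>\<alpha> p\<bar> \<le> 1 \<and> \<bar>\<beta> p\<bar> \<le> 1"
  shows "dirichlet_poly Q (graded_part \<alpha> \<beta> P k) ((1 + z + z ^ 2) ^ card P / z ^ k) (Z ^ k)"
  using P(1,2,3) small
proof (induction P arbitrary: k rule: finite_induct)
  case empty
  have 1: "1 \<le> Z ^ k" using Z by simp
  have 2: "\<bar>if k = 0 then 1 else 0 :: real\<bar> \<le> 1 / z ^ k" using z by simp
  show ?case using dirichlet_poly_mono[OF dirichlet_poly_const[OF 1, of Q "if k = 0 then 1 else 0"] 2 order.refl]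
    unfolding graded_part_empty[abs_def] by simp
next
  case (insert p P)
  define C where "C = (\<lambda>k. (1 + z + z ^ 2) ^ card P / z ^ k)"
  have C0: "0 \<le> C k" for k using z by (simp add: C_def)
  have IH: "dirichlet_poly Q (graded_part \<alpha> \<beta> P k) (C k) (Z ^ k)" for k
    unfolding C_def using insert by simp
  have p: "prime p" "p \<in> Q" "real p \<le> Z" "\<bar>\<alpha> p\<bar> \<le> 1" "\<bar>\<beta> p\<bar> \<le> 1" using insert.prems by auto
  have p1: "1 \<le> p" by (rule prime_ge_1_nat[OF p(1)])
  have Zk: "1 \<le> Z ^ k" using Z by simp
  have lin: "dirichlet_poly Q (\<lambda>f. c * f p) 1 Z" if "\<bar>c\<bar> \<le> 1" for c
    using dirichlet_poly.single[OF p1 p(3), of Q c 1] p that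
    by (simp add: char_value_prime prime_factorization_prime)
  have z0: "dirichlet_poly Q (\<lambda>f. 0) c (Z ^ k)" if "0 \<le> c" for c
    using dirichlet_poly_mono[OF dirichlet_poly_const[OF Zk, of Q 0], of c] that by simp
  have 1: "dirichlet_poly Q (\<lambda>f. if k \<ge> 1 then \<alpha> p * f p * graded_part \<alpha> \<beta> P (k - 1) f else 0) (z * C k) (Z ^ k)"
  proof (cases k)
    case 0
    thus ?thesis using z0[of "z * C k"] z C0[of k] by simp
  next
    case (Suc l)
    have "z * C k = C l" using z by (simp add: C_def Suc)
    thus ?thesis using dirichlet_poly_mult[OF lin[OF p(4)] IH[of l]] by (simp add: Suc)
  qed
  have 2: "dirichlet_poly Q (\<lambda>f. if k \<ge> 2 then \<beta> p * f p * (f p * graded_part \<alpha> \<beta> P (k - 2) f) else 0) (z ^ 2 * C k) (Z ^ k)"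
  proof (cases "k \<ge> 2")
    case False
    thus ?thesis using z0[of "z ^ 2 * C k"] z C0[of k] by simp
  next
    case True
    then obtain l where l: "k = Suc (Suc l)" by (metis Suc_diff_Suc add_2_eq_Suc le_add_diff_inverse)
    have "z ^ 2 * C k = C l" using z by (simp add: C_def l power2_eq_square)
    thus ?thesis using dirichlet_poly_mult[OF lin[OF p(5)] dirichlet_poly_mult[OF lin[of 1] IH[of l]]]
      by (simp add: l)
  qed
  have "dirichlet_poly Q (graded_part \<alpha> \<beta> (insert p P) k) (C k + z * C k + z ^ 2 * C k) (Z ^ k)"
    unfolding graded_part_insert[OF insert.hyps, abs_def] by (intro dirichlet_poly.add IH 1 2)
  also have "C k + z * C k + z ^ 2 * C k = (1 + z + z ^ 2) ^ card (insert p P) / z ^ k"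
    using insert.hyps by (simp add: C_def add_divide_distrib distrib_right)
  finally show ?case .
qed

text \<open>A discarded pair of degrees has k + l \<ge> J, so a weight 2^(k + l) / 2^J only enlarges
  its contribution to the majorant. Summed over all pairs, the weights turn into the square of the
  full product with the degree variable set to 2, whence the factors 2 and 4.\<close>

lemma expect_truncation_le:
  assumes Q: "finite Q" "\<And>p. p \<in> Q \<Longrightarrow> prime p" and P: "P \<subseteq> Q" and FG: "majorant Q F G"
  shows "\<bar>expect Q (\<lambda>f. ((\<Prod>p\<in>P. 1 + \<alpha> p * f p + \<beta> p * f p ^ 2) ^ 2 - (\<Sum>k\<le>J. graded_part \<alpha> \<beta> P k f) ^ 2) * F f)\<bar>
     \<le> expect Q (\<lambda>f. (\<Prod>p\<in>P. 1 + 2 * \<bar>\<alpha> p\<bar> * f p + 4 * \<bar>\<beta> p\<bar> * f p ^ 2) ^ 2 * G f) / 2 ^ J"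
proof -
  have finP: "finite P" using P Q(1) finite_subset by blast
  define n where "n = 2 * card P + J"
  define r where "r = graded_part \<alpha> \<beta> P"
  define s where "s = graded_part (\<lambda>p. \<bar>\<alpha> p\<bar>) (\<lambda>p. \<bar>\<beta> p\<bar>) P"
  define I where "I = (\<lambda>k l. if k \<le> J \<and> l \<le> J then 0 else 1 :: real)"
  have full: "(\<Prod>p\<in>P. 1 + \<alpha> p * f p + \<beta> p * f p ^ 2) = (\<Sum>k\<le>n. r k f)" for f
    using sum_graded_part[OF finP, of n \<alpha> \<beta> f 1] by (simp add: r_def n_def)
  have plus: "(\<Prod>p\<in>P. 1 + 2 * \<bar>\<alpha> p\<bar> * f p + 4 * \<bar>\<beta> p\<bar> * f p ^ 2) = (\<Sum>k\<le>n. 2 ^ k * s k f)" for f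
    using sum_graded_part[OF finP, of n "\<lambda>p. \<bar>\<alpha> p\<bar>" "\<lambda>p. \<bar>\<beta> p\<bar>" f 2] by (simp add: s_def n_def mult_ac)
  have rs: "majorant Q (\<lambda>f. r k f * r l f * F f) (\<lambda>f. s k f * s l f * G f)" for k l
    unfolding r_def s_def by (intro majorant_mult majorant_graded_part FG finP P Q(2))
  have diff: "((\<Sum>k\<le>n. r k f) ^ 2 - (\<Sum>k\<le>J. r k f) ^ 2) * F f = (\<Sum>k\<le>n. \<Sum>l\<le>n. I k l * (r k f * r l f * F f))" for f
  proof -
    have trunc: "(\<Sum>k\<le>J. r k f) = (\<Sum>k\<le>n. if k \<le> J then r k f else 0)"
      by (rule sum.mono_neutral_cong_left) (auto simp: n_def)
    have "(\<Sum>k\<le>n. r k f) ^ 2 - (\<Sum>k\<le>J. r k f) ^ 2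
        = (\<Sum>k\<le>n. \<Sum>l\<le>n. r k f * r l f - (if k \<le> J then r k f else 0) * (if l \<le> J then r l f else 0))"
      unfolding trunc power2_eq_square sum_product by (simp only: sum_subtractf)
    also have "\<dots> = (\<Sum>k\<le>n. \<Sum>l\<le>n. I k l * (r k f * r l f))"
      by (intro sum.cong refl) (auto simp: I_def)
    finally show ?thesis by (simp add: sum_distrib_right mult.assoc)
  qed
  have "\<bar>expect Q (\<lambda>f. ((\<Sum>k\<le>n. r k f) ^ 2 - (\<Sum>k\<le>J. r k f) ^ 2) * F f)\<bar>
      = \<bar>\<Sum>k\<le>n. \<Sum>l\<le>n. I k l * expect Q (\<lambda>f. r k f * r l f * F f)\<bar>"
    by (simp only: diff expect_sum expect_cmult)
  also have "\<dots> \<le> (\<Sum>k\<le>n. \<Sum>l\<le>n. \<bar>I k l * expect Q (\<lambda>f. r k f * r l f * F f)\<bar>)"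
    by (rule order.trans[OF sum_abs sum_mono[OF sum_abs]])
  also have "\<dots> \<le> (\<Sum>k\<le>n. \<Sum>l\<le>n. 2 ^ k * 2 ^ l / 2 ^ J * expect Q (\<lambda>f. s k f * s l f * G f))"
  proof (intro sum_mono)
    fix k l
    have E: "\<bar>expect Q (\<lambda>f. r k f * r l f * F f)\<bar> \<le> expect Q (\<lambda>f. s k f * s l f * G f)"
      by (rule majorant_expect[OF rs Q])
    have "\<bar>I k l\<bar> \<le> 2 ^ k * 2 ^ l / 2 ^ J"
    proof (cases "k \<le> J \<and> l \<le> J")
      case False
      hence "J \<le> k + l" by linarith
      hence "(2::real) ^ J \<le> 2 ^ k * 2 ^ l" unfolding power_add[symmetric] by (intro power_increasing) auto
      thus ?thesis using False by (simp add: I_def)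
    qed (simp add: I_def)
    thus "\<bar>I k l * expect Q (\<lambda>f. r k f * r l f * F f)\<bar> \<le> 2 ^ k * 2 ^ l / 2 ^ J * expect Q (\<lambda>f. s k f * s l f * G f)"
      unfolding abs_mult using E by (intro mult_mono) auto
  qed
  also have "\<dots> = (\<Sum>k\<le>n. \<Sum>l\<le>n. 2 ^ k * 2 ^ l * expect Q (\<lambda>f. s k f * s l f * G f)) / 2 ^ J"
    by (simp add: sum_divide_distrib)
  also have "(\<Sum>k\<le>n. \<Sum>l\<le>n. 2 ^ k * 2 ^ l * expect Q (\<lambda>f. s k f * s l f * G f))
      = expect Q (\<lambda>f. (\<Sum>k\<le>n. 2 ^ k * s k f) ^ 2 * G f)"
  proof -
    have "(\<Sum>k\<le>n. 2 ^ k * s k f) ^ 2 * G f = (\<Sum>k\<le>n. \<Sum>l\<le>n. 2 ^ k * 2 ^ l * (s k f * s l f * G f))" for f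
      unfolding power2_eq_square sum_product unfolding sum_distrib_right by (intro sum.cong refl) simp
    thus ?thesis by (simp only: expect_sum expect_cmult)
  qed
  finally show ?thesis unfolding full plus r_def .
qed

text \<open>Prime by prime: against an odd power of \<open>f p\<close> the square has mean
  proportional to 2 u (1 + v), against a positive even power to (1 + v)^2 + u^2, and each is at most
  (1 + v)^2 + u^2 times the corresponding mean of 1 + 2 u f p. The square is thereby replaced by a
  linear tilt, for which \<open>expect_resonated\<close> is available.\<close>

lemma expect_square_le_tilted:
  assumes FG: "majorant Q F G" and Q: "finite Q" "\<And>p. p \<in> Q \<Longrightarrow> prime p" and P: "P \<subseteq> Q"
    and u: "\<And>p. p \<in> P \<Longrightarrow> 0 \<le> u p" "\<And>p. p \<notin> P \<Longrightarrow> u p = 0" and v: "\<And>p. p \<in> P \<Longrightarrow> 0 \<le> v p"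
  shows "expect Q (\<lambda>f. (\<Prod>p\<in>P. 1 + u p * f p + v p * f p ^ 2) ^ 2 * G f)
     \<le> (\<Prod>p\<in>P. (1 + v p) ^ 2 + u p ^ 2) * expect Q (\<lambda>f. (\<Prod>p\<in>Q. 1 - (- 2 * u p) * f p) * G f)"
  using FG
proof (induction rule: majorant.induct)
  case (single n c C)
  define v' where "v' = (\<lambda>p. if p \<in> P then v p else 0)"
  have v': "0 \<le> v' p" "0 \<le> u p" for p using v u[of p] by (cases "p \<in> P"; auto simp: v'_def)+
  have C0: "0 \<le> C" using single by linarith
  have n0: "n > 0" using single by simp
  have PQ: "(\<Prod>p\<in>P. g p) = (\<Prod>p\<in>Q. g p)" if "\<And>p. p \<notin> P \<Longrightarrow> g p = (1::real)" for g
    using P Q(1) that by (intro prod.mono_neutral_left) auto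
  have V: "(\<Prod>p\<in>P. 1 + u p * f p + v p * f p ^ 2) = (\<Prod>p\<in>Q. 1 + u p * f p + v' p * f p ^ 2)" for f
    by (subst PQ[symmetric]) (auto simp: v'_def u)
  have A: "(\<Prod>p\<in>P. (1 + v p) ^ 2 + u p ^ 2) = (\<Prod>p\<in>Q. (1 + v' p) ^ 2 + u p ^ 2)"
    by (subst PQ[symmetric]) (auto simp: v'_def u)
  have "expect Q (\<lambda>f. (\<Prod>p\<in>P. 1 + u p * f p + v p * f p ^ 2) ^ 2 * char_value f n)
     = expect Q (\<lambda>f. \<Prod>p\<in>Q. (1 + u p * f p + v' p * f p ^ 2) ^ 2 * f p ^ multiplicity p n)"
    unfolding V by (simp only: char_value_eq_prod[OF n0 Q(1) single(2) Q(2)] prod.distrib prod_power_distrib)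
  also have "\<dots> = (\<Prod>p\<in>Q. vanish_prob p * ((1 + u p * 0 + v' p * 0 ^ 2) ^ 2 * 0 ^ multiplicity p n) +
      (1 - vanish_prob p) / 2 * ((1 + u p * 1 + v' p * 1 ^ 2) ^ 2 * 1 ^ multiplicity p n
        + (1 + u p * (-1) + v' p * (-1) ^ 2) ^ 2 * (-1) ^ multiplicity p n))"
    by (rule expect_prod[OF Q(1)])
  also have "\<dots> \<le> (\<Prod>p\<in>Q. ((1 + v' p) ^ 2 + u p ^ 2) * (if multiplicity p n = 0 then 1 else
     if odd (multiplicity p n) then - ((- 2 * u p) * (1 - vanish_prob p)) else 1 - vanish_prob p))"
  proof (intro prod_mono conjI)
    fix p assume "p \<in> Q"
    define z where "z = vanish_prob p"
    have z: "0 \<le> z" "z \<le> 1" using vanish_prob_bounds by (auto simp: z_def)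
    have two: "(1 + u p + v' p) ^ 2 + (1 - u p + v' p) ^ 2 = 2 * ((1 + v' p) ^ 2 + u p ^ 2)"
      by (simp add: power2_eq_square algebra_simps)
    have A1: "1 \<le> (1 + v' p) ^ 2 + u p ^ 2"
      using one_le_power[of "1 + v' p" 2] v'[of p] zero_le_power2[of "u p"] by linarith
    have "0 \<le> (1 - z) / 2 * ((1 + u p + v' p) ^ 2 + (1 - u p + v' p) ^ 2 * (-1) ^ multiplicity p n)"
    proof (intro mult_nonneg_nonneg)
      have "\<bar>1 - u p + v' p\<bar> \<le> \<bar>1 + u p + v' p\<bar>" using v'[of p] by linarith
      hence "(1 - u p + v' p) ^ 2 \<le> (1 + u p + v' p) ^ 2" by (simp add: abs_le_square_iff)
      thus "0 \<le> (1 + u p + v' p) ^ 2 + (1 - u p + v' p) ^ 2 * (-1) ^ multiplicity p n"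
        by (cases "even (multiplicity p n)") auto
    qed (use z in auto)
    moreover have "0 \<le> z * ((1 + u p * 0 + v' p * 0 ^ 2) ^ 2 * 0 ^ multiplicity p n)"
      using z by simp
    ultimately show "0 \<le> vanish_prob p * ((1 + u p * 0 + v' p * 0 ^ 2) ^ 2 * 0 ^ multiplicity p n) +
      (1 - vanish_prob p) / 2 * ((1 + u p * 1 + v' p * 1 ^ 2) ^ 2 * 1 ^ multiplicity p n
        + (1 + u p * (-1) + v' p * (-1) ^ 2) ^ 2 * (-1) ^ multiplicity p n)"
      unfolding z_def[symmetric] by simp
    show "vanish_prob p * ((1 + u p * 0 + v' p * 0 ^ 2) ^ 2 * 0 ^ multiplicity p n) +
      (1 - vanish_prob p) / 2 * ((1 + u p * 1 + v' p * 1 ^ 2) ^ 2 * 1 ^ multiplicity p n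
        + (1 + u p * (-1) + v' p * (-1) ^ 2) ^ 2 * (-1) ^ multiplicity p n)
      \<le> ((1 + v' p) ^ 2 + u p ^ 2) * (if multiplicity p n = 0 then 1 else
     if odd (multiplicity p n) then - ((- 2 * u p) * (1 - vanish_prob p)) else 1 - vanish_prob p)"
      unfolding z_def[symmetric]
    proof (cases "multiplicity p n = 0")
      case True
      have "z * 1 \<le> z * ((1 + v' p) ^ 2 + u p ^ 2)" using A1 z by (intro mult_left_mono)
      hence "z + (1 - z) / 2 * ((1 + u p + v' p) ^ 2 + (1 - u p + v' p) ^ 2) \<le> (1 + v' p) ^ 2 + u p ^ 2"
        unfolding two by (simp add: field_simps)
      thus "z * ((1 + u p * 0 + v' p * 0 ^ 2) ^ 2 * 0 ^ multiplicity p n) +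
      (1 - z) / 2 * ((1 + u p * 1 + v' p * 1 ^ 2) ^ 2 * 1 ^ multiplicity p n
        + (1 + u p * (-1) + v' p * (-1) ^ 2) ^ 2 * (-1) ^ multiplicity p n)
      \<le> ((1 + v' p) ^ 2 + u p ^ 2) * (if multiplicity p n = 0 then 1 else
     if odd (multiplicity p n) then - ((- 2 * u p) * (1 - z)) else 1 - z)"
        using True by simp
    next
      case False
      hence zp: "(0::real) ^ multiplicity p n = 0" by (simp add: zero_power)
      show "z * ((1 + u p * 0 + v' p * 0 ^ 2) ^ 2 * 0 ^ multiplicity p n) +
      (1 - z) / 2 * ((1 + u p * 1 + v' p * 1 ^ 2) ^ 2 * 1 ^ multiplicity p n
        + (1 + u p * (-1) + v' p * (-1) ^ 2) ^ 2 * (-1) ^ multiplicity p n)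
      \<le> ((1 + v' p) ^ 2 + u p ^ 2) * (if multiplicity p n = 0 then 1 else
     if odd (multiplicity p n) then - ((- 2 * u p) * (1 - z)) else 1 - z)"
      proof (cases "odd (multiplicity p n)")
        case True
        have "1 + v' p \<le> (1 + v' p) ^ 2 + u p ^ 2"
        proof -
          have "1 + v' p \<le> (1 + v' p) ^ 2" using v'[of p] by (intro self_le_power) auto
          thus ?thesis using zero_le_power2[of "u p"] by linarith
        qed
        hence "(1 - z) * (2 * u p) * (1 + v' p) \<le> (1 - z) * (2 * u p) * ((1 + v' p) ^ 2 + u p ^ 2)"
          using z v'[of p] by (intro mult_left_mono) auto
        moreover have "(1 - z) / 2 * ((1 + u p + v' p) ^ 2 - (1 - u p + v' p) ^ 2) = (1 - z) * (2 * u p) * (1 + v' p)"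
          by (simp add: power2_eq_square field_simps)
        ultimately show ?thesis unfolding zp using True False by (simp add: mult_ac)
      next
        case ev: False
        show ?thesis unfolding zp using ev False by (simp add: two) (simp add: algebra_simps)
      qed
    qed
  qed
  also have "\<dots> = (\<Prod>p\<in>Q. (1 + v' p) ^ 2 + u p ^ 2) * expect Q (\<lambda>f. (\<Prod>p\<in>Q. 1 - (- 2 * u p) * f p) * char_value f n)"
  proof -
    have "expect Q (\<lambda>f. (\<Prod>p\<in>Q. 1 - (- 2 * u p) * f p) * char_value f n) = tilted_coeff (\<lambda>p. (- 2 * u p) * (1 - vanish_prob p)) n"
      by (rule expect_tilted[OF Q n0 single(2)])
    also have "\<dots> = (\<Prod>p\<in>Q. if multiplicity p n = 0 then 1 else
     if odd (multiplicity p n) then - ((- 2 * u p) * (1 - vanish_prob p)) else 1 - vanish_prob p)"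
      by (rule tilted_coeff_eq_prod[OF n0 Q(1) single(2) Q(2)])
    finally show ?thesis by (simp only: prod.distrib)
  qed
  finally have "C * expect Q (\<lambda>f. (\<Prod>p\<in>P. 1 + u p * f p + v p * f p ^ 2) ^ 2 * char_value f n)
    \<le> C * ((\<Prod>p\<in>P. (1 + v p) ^ 2 + u p ^ 2) * expect Q (\<lambda>f. (\<Prod>p\<in>Q. 1 - (- 2 * u p) * f p) * char_value f n))"
    unfolding A using C0 by (intro mult_left_mono)
  thus ?case unfolding mult.left_commute[of _ C] expect_cmult .
next
  case (add F F' G G')
  thus ?case by (simp only: distrib_left expect_add)
qed

lemma tilted_coeff_neg_bounds:
  assumes "\<And>p. 0 \<le> b p"
  shows "0 \<le> tilted_coeff (\<lambda>p. - b p) n" "tilted_coeff (\<lambda>p. - b p) n \<le> (\<Prod>p\<in>odd_part n. b p)"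
proof -
  show "0 \<le> tilted_coeff (\<lambda>p. - b p) n"
    unfolding tilted_coeff_def using assms vanish_prob_bounds by (intro prod_nonneg) auto
  have "tilted_coeff (\<lambda>p. - b p) n \<le> (\<Prod>p\<in>prime_factors n. if odd (multiplicity p n) then b p else 1)"
    unfolding tilted_coeff_def using assms vanish_prob_bounds by (intro prod_mono) auto
  also have "\<dots> = (\<Prod>p\<in>odd_part n. b p)" unfolding odd_part_def by (simp add: prod.inter_filter)
  finally show "tilted_coeff (\<lambda>p. - b p) n \<le> (\<Prod>p\<in>odd_part n. b p)" .
qed

lemma harm_le_ln: "N \<ge> 1 \<Longrightarrow> (\<Sum>k=1..N. 1 / real k) \<le> 1 + ln (real N)"
proof (induction N rule: nat_induct_at_least)
  case (Suc n)
  have "ln (real n / real (Suc n)) \<le> real n / real (Suc n) - 1"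
    using Suc by (intro ln_le_minus_one) auto
  hence "1 / real (Suc n) \<le> ln (real (Suc n)) - ln (real n)"
    using Suc by (simp add: ln_div field_simps)
  thus ?case using Suc by simp
qed simp

text \<open>With all signs positive, write \<open>n\<close> as a product over a set of primes times
  a square: the sum is dominated by a sum over subsets of \<open>P\<close> times a harmonic sum. It
  enters an error term only, so no cancellation is sought.\<close>

lemma sum_tilted_neg_le:
  assumes P: "finite P" "\<And>p. p \<in> P \<Longrightarrow> prime p" and b: "\<And>p. 0 \<le> b p" "\<And>p. p \<notin> P \<Longrightarrow> b p = 0" and N: "N \<ge> 1"
  shows "(\<Sum>n=1..N. tilted_coeff (\<lambda>p. - b p) n / sqrt (real n)) \<le> (\<Prod>p\<in>P. 1 + b p / sqrt (real p)) * (1 + ln (real N))"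
proof -
  define F where "F = (\<lambda>n. (\<Prod>p\<in>odd_part n. b p) / sqrt (real n))"
  have F0: "0 \<le> F n" for n unfolding F_def using b by (intro divide_nonneg_nonneg prod_nonneg) auto
  have S: "finite S" "\<And>p. p \<in> S \<Longrightarrow> prime p" if "S \<subseteq> P" for S
    using that P finite_subset by blast+
  have "(\<Sum>n=1..N. tilted_coeff (\<lambda>p. - b p) n / sqrt (real n)) \<le> (\<Sum>n=1..N. F n)"
    unfolding F_def using tilted_coeff_neg_bounds(2)[OF b(1)] by (intro sum_mono divide_right_mono) auto
  also have "\<dots> = (\<Sum>n | n \<in> {1..N} \<and> odd_part n \<subseteq> P. F n)"
  proof (rule sum.mono_neutral_right)
    show "\<forall>n\<in>{1..N} - {n. n \<in> {1..N} \<and> odd_part n \<subseteq> P}. F n = 0"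
    proof
      fix n assume "n \<in> {1..N} - {n. n \<in> {1..N} \<and> odd_part n \<subseteq> P}"
      then obtain p where "p \<in> odd_part n" "p \<notin> P" by blast
      hence "(\<Prod>p\<in>odd_part n. b p) = 0" using b(2) by (intro prod_zero) auto
      thus "F n = 0" by (simp add: F_def)
    qed
  qed auto
  also have "\<dots> = (\<Sum>j\<le>card P. \<Sum>n | n \<in> {n. n \<in> {1..N} \<and> odd_part n \<subseteq> P} \<and> card (odd_part n) = j. F n)"
    using P(1) by (intro sum.group[symmetric]) (auto intro: card_mono)
  also have "\<dots> = (\<Sum>j\<le>card P. \<Sum>n | n \<in> {1..N} \<and> odd_part n \<subseteq> P \<and> card (odd_part n) = j. F n)"
    by (simp add: conj_assoc)
  also have "\<dots> = (\<Sum>j\<le>card P. \<Sum>S | S \<subseteq> P \<and> card S = j. \<Sum>k | 1 \<le> k \<and> \<Prod>S * k ^ 2 \<le> N. F (\<Prod>S * k ^ 2))"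
    by (intro sum.cong refl sum_by_odd_part P)
  also have "\<dots> = (\<Sum>S\<in>Pow P. \<Sum>k | 1 \<le> k \<and> \<Prod>S * k ^ 2 \<le> N. F (\<Prod>S * k ^ 2))"
  proof -
    have "(\<Sum>j\<le>card P. \<Sum>S | S \<subseteq> P \<and> card S = j. \<Sum>k | 1 \<le> k \<and> \<Prod>S * k ^ 2 \<le> N. F (\<Prod>S * k ^ 2))
      = (\<Sum>j\<le>card P. \<Sum>S | S \<in> Pow P \<and> card S = j. \<Sum>k | 1 \<le> k \<and> \<Prod>S * k ^ 2 \<le> N. F (\<Prod>S * k ^ 2))"
      by simp
    also have "\<dots> = (\<Sum>S\<in>Pow P. \<Sum>k | 1 \<le> k \<and> \<Prod>S * k ^ 2 \<le> N. F (\<Prod>S * k ^ 2))"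
      using P(1) by (intro sum.group) (auto intro: card_mono)
    finally show ?thesis .
  qed
  also have "\<dots> \<le> (\<Sum>S\<in>Pow P. (\<Prod>p\<in>S. b p / sqrt (real p)) * (1 + ln (real N)))"
  proof (intro sum_mono)
    fix S assume "S \<in> Pow P"
    hence SP: "S \<subseteq> P" by simp
    have s0: "\<Prod>S > 0" by (rule prod_pos) (use S(2)[OF SP] in \<open>blast intro: prime_gt_0_nat\<close>)
    have w0: "0 \<le> (\<Prod>p\<in>S. b p / sqrt (real p))" using b by (intro prod_nonneg) auto
    have "(\<Sum>k | 1 \<le> k \<and> \<Prod>S * k ^ 2 \<le> N. F (\<Prod>S * k ^ 2))
      = (\<Sum>k | 1 \<le> k \<and> \<Prod>S * k ^ 2 \<le> N. (\<Prod>p\<in>S. b p / sqrt (real p)) * (1 / real k))"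
    proof (intro sum.cong refl)
      fix k assume "k \<in> {k. 1 \<le> k \<and> \<Prod>S * k ^ 2 \<le> N}"
      hence k: "k > 0" by simp
      have "odd_part (\<Prod>S * k ^ 2) = S"
        by (rule prime_factors_squarefree_times_square(1)) (use S[OF SP] k in blast)+
      thus "F (\<Prod>S * k ^ 2) = (\<Prod>p\<in>S. b p / sqrt (real p)) * (1 / real k)"
        unfolding F_def by (simp add: prod_dividef real_sqrt_mult sqrt_prod)
    qed
    also have "\<dots> \<le> (\<Sum>k=1..N. (\<Prod>p\<in>S. b p / sqrt (real p)) * (1 / real k))"
    proof (intro sum_mono2)
      show "{k. 1 \<le> k \<and> \<Prod>S * k ^ 2 \<le> N} \<subseteq> {1..N}"
      proof
        fix k assume k: "k \<in> {k. 1 \<le> k \<and> \<Prod>S * k ^ 2 \<le> N}"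
        moreover have "k \<le> k ^ 2" by (simp add: power2_eq_square)
        moreover have "1 * k ^ 2 \<le> \<Prod>S * k ^ 2" using s0 by (intro mult_right_mono) auto
        ultimately show "k \<in> {1..N}" unfolding atLeastAtMost_iff mem_Collect_eq by linarith
      qed
    qed (use w0 in auto)
    also have "\<dots> = (\<Prod>p\<in>S. b p / sqrt (real p)) * (\<Sum>k=1..N. 1 / real k)" by (simp add: sum_distrib_left)
    also have "\<dots> \<le> (\<Prod>p\<in>S. b p / sqrt (real p)) * (1 + ln (real N))"
      by (rule mult_left_mono[OF harm_le_ln[OF N] w0])
    finally show "(\<Sum>k | 1 \<le> k \<and> \<Prod>S * k ^ 2 \<le> N. F (\<Prod>S * k ^ 2)) \<le> \<dots>" .
  qed
  also have "\<dots> = (\<Prod>p\<in>P. 1 + b p / sqrt (real p)) * (1 + ln (real N))"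
    using prod_add[OF P(1), of "\<lambda>p. b p / sqrt (real p)" "\<lambda>_. 1"] by (simp add: sum_distrib_right add.commute)
  finally show ?thesis .
qed

text \<open>On {-1, 0, 1} every function is a quadratic polynomial, and this one takes the values
  sqrt (1 - t x). Its linear coefficient is of order t and the quadratic one of order t^2, so the
  cost of truncation is governed by the sum of the t^2.\<close>

lemma square_root_factor:
  fixes t :: real
  assumes "0 \<le> t" "t \<le> 1"
  defines "\<rho> \<equiv> (sqrt (1 + t) - sqrt (1 - t)) / 2" and "\<tau> \<equiv> (sqrt (1 + t) + sqrt (1 - t)) / 2 - 1"
  shows "x \<in> {-1, 0, 1} \<Longrightarrow> (1 + (- \<rho>) * x + \<tau> * x ^ 2) ^ 2 = 1 - t * x"
    and "\<bar>- \<rho>\<bar> \<le> t" and "\<bar>\<tau>\<bar> \<le> t ^ 2 / 2"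
proof -
  define A where "A = sqrt (1 + t)"
  define B where "B = sqrt (1 - t)"
  have A: "A ^ 2 = 1 + t" "0 \<le> A" "1 \<le> A" using assms by (auto simp: A_def)
  have B: "B ^ 2 = 1 - t" "0 \<le> B" "B \<le> 1" using assms by (auto simp: B_def)
  have \<rho>: "\<rho> = (A - B) / 2" and \<tau>: "\<tau> = (A + B) / 2 - 1" by (simp_all add: \<rho>_def \<tau>_def A_def B_def)
  show "(1 + (- \<rho>) * x + \<tau> * x ^ 2) ^ 2 = 1 - t * x" if "x \<in> {-1, 0, 1}"
  proof -
    have "1 + (- \<rho>) * 1 + \<tau> * 1 ^ 2 = B" "1 + (- \<rho>) * (-1) + \<tau> * (-1) ^ 2 = A"
      unfolding \<rho> \<tau> by (simp_all add: field_simps)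
    thus ?thesis using that A B by auto
  qed
  have AB: "(A - B) * (A + B) = 2 * t" using A B by (simp add: algebra_simps power2_eq_square)
  have "(A - B) * 1 \<le> (A - B) * (A + B)" using A B by (intro mult_left_mono) auto
  thus "\<bar>- \<rho>\<bar> \<le> t" unfolding \<rho> AB using A B by simp
  define s where "s = (A + B) / 2"
  \<comment> \<open>The product of the two roots is sqrt (1 - t^2), and a number in [0, 1] is at
    most its square root.\<close>
  have prod: "1 - t ^ 2 \<le> A * B"
  proof -
    have "A * B = sqrt (1 - t ^ 2)" by (simp add: A_def B_def real_sqrt_mult[symmetric] algebra_simps power2_eq_square)
    moreover have "1 - t ^ 2 \<le> sqrt (1 - t ^ 2)"
    proof (rule real_le_rsqrt)
      have t2: "0 \<le> 1 - t ^ 2" "1 - t ^ 2 \<le> 1" using assms by (simp_all add: power_le_one)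
      have "(1 - t ^ 2) * (1 - t ^ 2) \<le> (1 - t ^ 2) * 1" using t2 by (intro mult_left_mono) auto
      thus "(1 - t ^ 2) ^ 2 \<le> 1 - t ^ 2" by (simp add: power2_eq_square)
    qed
    ultimately show ?thesis by simp
  qed
  have s2: "s ^ 2 = (1 + A * B) / 2" using A B by (simp add: s_def power2_eq_square field_simps)
  have s1: "s \<le> 1"
  proof (rule power2_le_imp_le)
    have "0 \<le> (A - B) ^ 2" by simp
    hence "A * B \<le> 1" using A B by (simp add: power2_diff)
    thus "s ^ 2 \<le> 1 ^ 2" unfolding s2 by simp
  qed simp
  have "s * s \<le> s * 1" using s1 A B by (intro mult_left_mono) (auto simp: s_def)
  hence "s ^ 2 \<le> s" by (simp add: power2_eq_square)
  moreover have "\<tau> = s - 1" by (simp add: \<tau> s_def)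
  ultimately have "\<bar>\<tau>\<bar> \<le> 1 - s ^ 2" using s1 by simp
  also have "\<dots> = (1 - A * B) / 2" by (simp add: s2 field_simps)
  also have "\<dots> \<le> t ^ 2 / 2" using prod by simp
  finally show "\<bar>\<tau>\<bar> \<le> t ^ 2 / 2" .
qed

text \<open>On sign patterns the tilt is the square of a product of quadratic polynomials; the
  square of a truncation of that product stays nonnegative. The discarded part is bounded through a
  majorant in which all terms are positive; that majorant is again a resonated expectation, now with
  a tilt of opposite sign. The two exponentials are its cost and 2^J is the gain.\<close>

lemma resonator_truncation:
  fixes t c e :: "nat \<Rightarrow> real" and N J :: nat and K :: real
  assumes Q: "finite Q" "\<And>p. p \<in> Q \<Longrightarrow> prime p" and pf: "\<And>n. 1 \<le> n \<Longrightarrow> n \<le> N \<Longrightarrow> prime_factors n \<subseteq> Q" and N: "N \<ge> 1"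
    and T: "T \<subseteq> Q" "T \<inter> P = {}" "\<And>p q. p \<in> T \<Longrightarrow> q \<in> T \<Longrightarrow> N < p * q"
    and P: "P \<subseteq> Q" and t: "\<And>p. p \<in> P \<Longrightarrow> 0 \<le> t p \<and> t p \<le> 1" "\<And>p. p \<notin> P \<Longrightarrow> t p = 0"
    and c: "\<And>p. p \<in> T \<Longrightarrow> \<bar>c p\<bar> \<le> 1 / sqrt (real p)" and e: "\<And>n. 1 \<le> n \<Longrightarrow> n \<le> N \<Longrightarrow> \<bar>e n\<bar> \<le> K / sqrt (real n)"
  shows "\<exists>\<alpha> \<beta>. (\<forall>p\<in>P. \<bar>\<alpha> p\<bar> \<le> 1 \<and> \<bar>\<beta> p\<bar> \<le> 1) \<and>
     expect Q (\<lambda>f. (\<Sum>k\<le>J. graded_part \<alpha> \<beta> P k f) ^ 2 * ((1 - (\<Sum>p\<in>T. c p * f p)) ^ 2 * (\<Sum>n=1..N. e n * char_value f n)))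
     - expect Q (\<lambda>f. (\<Prod>p\<in>Q. 1 - t p * f p) * ((1 - (\<Sum>p\<in>T. c p * f p)) ^ 2 * (\<Sum>n=1..N. e n * char_value f n)))
     \<le> exp (\<Sum>p\<in>P. 12 * t p ^ 2) * (K * (1 + 3 * (\<Sum>p\<in>T. 1 / real p))
         * (exp (\<Sum>p\<in>P. 4 * t p / sqrt (real p)) * (1 + ln (real N)))) / 2 ^ J"
proof -
  define \<alpha> where "\<alpha> = (\<lambda>p. - ((sqrt (1 + t p) - sqrt (1 - t p)) / 2))"
  define \<beta> where "\<beta> = (\<lambda>p. (sqrt (1 + t p) + sqrt (1 - t p)) / 2 - 1)"
  have fin: "finite P" "finite T" using P T(1) Q(1) finite_subset by blast+
  have prP: "prime p" if "p \<in> P" for p using that P Q(2) by blast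
  have prT: "prime p" if "p \<in> T" for p using that T(1) Q(2) by blast
  have \<alpha>: "\<bar>\<alpha> p\<bar> \<le> t p" if "p \<in> P" for p
    using square_root_factor(2)[of "t p"] t(1)[OF that] by (simp add: \<alpha>_def)
  have \<beta>: "\<bar>\<beta> p\<bar> \<le> t p ^ 2 / 2" if "p \<in> P" for p
    using square_root_factor(3)[of "t p"] t(1)[OF that] by (simp add: \<beta>_def)
  have off: "\<alpha> p = 0" if "p \<notin> P" for p using t(2)[OF that] by (simp add: \<alpha>_def)
  have W: "(\<Prod>p\<in>Q. 1 - t p * f p) = (\<Prod>p\<in>P. 1 + \<alpha> p * f p + \<beta> p * f p ^ 2) ^ 2" if f: "f \<in> sign_patterns Q" for f
  proof -
    have "(\<Prod>p\<in>Q. 1 - t p * f p) = (\<Prod>p\<in>P. 1 - t p * f p)"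
      using P Q(1) t(2) by (intro prod.mono_neutral_right) auto
    also have "\<dots> = (\<Prod>p\<in>P. (1 + \<alpha> p * f p + \<beta> p * f p ^ 2) ^ 2)"
    proof (intro prod.cong refl)
      fix p assume p: "p \<in> P"
      have "f p \<in> {-1, 0, 1}" using sign_patternsD[OF f] p P by blast
      thus "1 - t p * f p = (1 + \<alpha> p * f p + \<beta> p * f p ^ 2) ^ 2"
        using square_root_factor(1)[of "t p" "f p"] t(1)[OF p] unfolding \<alpha>_def \<beta>_def by simp
    qed
    finally show ?thesis by (simp only: prod_power_distrib)
  qed
  define F where "F = (\<lambda>f. (1 - (\<Sum>p\<in>T. c p * f p)) ^ 2 * (\<Sum>n=1..N. e n * char_value f n))"
  \<comment> \<open>With the coefficients - |c p| the factor becomes 1 + sum of |c p| f p, which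
    majorises the one in \<open>F\<close>, while the shape required by
    \<open>expect_resonated\<close> is kept.\<close>
  define G where "G = (\<lambda>f. (1 - (\<Sum>p\<in>T. (- \<bar>c p\<bar>) * f p)) ^ 2 * (\<Sum>n=1..N. \<bar>e n\<bar> * char_value f n))"
  have FG: "majorant Q F G"
  proof -
    have B: "majorant Q (\<lambda>f. 1 - (\<Sum>p\<in>T. c p * f p)) (\<lambda>f. 1 - (\<Sum>p\<in>T. (- \<bar>c p\<bar>) * f p))"
    proof -
      have "majorant Q (\<lambda>f. 1 + (\<Sum>p\<in>T. (- c p) * f p)) (\<lambda>f. 1 + (\<Sum>p\<in>T. \<bar>c p\<bar> * f p))"
        using T(1) by (intro majorant.add majorant_const majorant_sum majorant_prime prT fin) auto
      thus ?thesis by (simp add: sum_negf)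
    qed
    show ?thesis unfolding F_def G_def power2_eq_square
      by (intro majorant_mult B majorant_sum majorant.single pf) auto
  qed
  define E where "E = expect Q (\<lambda>f. (\<Sum>k\<le>J. graded_part \<alpha> \<beta> P k f) ^ 2 * F f) - expect Q (\<lambda>f. (\<Prod>p\<in>Q. 1 - t p * f p) * F f)"
  define u where "u = (\<lambda>p. 2 * \<bar>\<alpha> p\<bar>)"
  define v where "v = (\<lambda>p. 4 * \<bar>\<beta> p\<bar>)"
  define b where "b = (\<lambda>p. 2 * u p * (1 - vanish_prob p))"
  have uT: "- 2 * u p = 0" if "p \<in> T" for p
  proof -
    have "p \<notin> P" using that T(2) by blast
    thus ?thesis by (simp add: u_def off)
  qed
  define S where "S = (\<Prod>p\<in>P. 1 + b p / sqrt (real p)) * (1 + ln (real N))"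
  define w where "w = (\<Sum>p\<in>T. 1 / real p)"
  have b0: "0 \<le> b p" for p unfolding b_def u_def using vanish_prob_bounds[of p] by simp
  have K0: "0 \<le> K" using e[of 1] N by simp
  have w0: "0 \<le> w" unfolding w_def by (intro sum_nonneg) auto
  have tcb: "tilted_coeff (\<lambda>p. - 2 * u p * (1 - vanish_prob p)) = tilted_coeff (\<lambda>p. - b p)" by (simp add: b_def)
  have "- E = expect Q (\<lambda>f. (\<Prod>p\<in>Q. 1 - t p * f p) * F f) - expect Q (\<lambda>f. (\<Sum>k\<le>J. graded_part \<alpha> \<beta> P k f) ^ 2 * F f)"
    by (simp add: E_def)
  also have "\<dots> = expect Q (\<lambda>f. ((\<Prod>p\<in>P. 1 + \<alpha> p * f p + \<beta> p * f p ^ 2) ^ 2 - (\<Sum>k\<le>J. graded_part \<alpha> \<beta> P k f) ^ 2) * F f)"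
    unfolding expect_diff[symmetric] by (rule expect_cong) (simp add: W left_diff_distrib)
  finally have "E \<le> expect Q (\<lambda>f. (\<Prod>p\<in>P. 1 + u p * f p + v p * f p ^ 2) ^ 2 * G f) / 2 ^ J"
    using expect_truncation_le[OF Q P FG, of \<alpha> \<beta> J] unfolding u_def v_def by linarith
  also have "\<dots> \<le> (\<Prod>p\<in>P. (1 + v p) ^ 2 + u p ^ 2) * expect Q (\<lambda>f. (\<Prod>p\<in>Q. 1 - (- 2 * u p) * f p) * G f) / 2 ^ J"
    by (intro divide_right_mono expect_square_le_tilted[OF FG Q P]) (auto simp: u_def v_def off)
  also have "expect Q (\<lambda>f. (\<Prod>p\<in>Q. 1 - (- 2 * u p) * f p) * G f)
      = (1 + (\<Sum>p\<in>T. (- \<bar>c p\<bar>) ^ 2 * (1 - vanish_prob p))) * (\<Sum>n=1..N. \<bar>e n\<bar> * tilted_coeff (\<lambda>p. - b p) n)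
       - 2 * (\<Sum>p\<in>T. (- \<bar>c p\<bar>) * (1 - vanish_prob p) * (\<Sum>n=1..N div p. \<bar>e (p * n)\<bar> * tilted_coeff (\<lambda>p. - b p) n))"
    unfolding G_def tcb[symmetric] by (rule expect_resonated[OF Q pf T(1) uT T(3)])
  also have "\<dots> \<le> (1 + w) * (K * S) + 2 * (w * (K * S))"
  proof -
    have tc0: "0 \<le> tilted_coeff (\<lambda>p. - b p) n" for n by (rule tilted_coeff_neg_bounds(1)[OF b0])
    have S: "(\<Sum>n=1..N. tilted_coeff (\<lambda>p. - b p) n / sqrt (real n)) \<le> S"
      unfolding S_def by (rule sum_tilted_neg_le[OF fin(1) prP b0 _ N]) (auto simp: b_def u_def off)
    have T1: "(\<Sum>n=1..N. \<bar>e n\<bar> * tilted_coeff (\<lambda>p. - b p) n) \<le> K * S"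
    proof -
      have "(\<Sum>n=1..N. \<bar>e n\<bar> * tilted_coeff (\<lambda>p. - b p) n) \<le> (\<Sum>n=1..N. K / sqrt (real n) * tilted_coeff (\<lambda>p. - b p) n)"
        using e tc0 by (intro sum_mono mult_right_mono) auto
      also have "\<dots> = K * (\<Sum>n=1..N. tilted_coeff (\<lambda>p. - b p) n / sqrt (real n))" by (simp add: sum_distrib_left)
      also have "\<dots> \<le> K * S" using S K0 by (rule mult_left_mono)
      finally show ?thesis .
    qed
    have c2: "(\<Sum>p\<in>T. (- \<bar>c p\<bar>) ^ 2 * (1 - vanish_prob p)) \<le> w"
      unfolding w_def
    proof (rule sum_mono)
      fix p assume p: "p \<in> T"
      have "\<bar>c p\<bar> ^ 2 \<le> (1 / sqrt (real p)) ^ 2" using c[OF p] by (intro power_mono) auto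
      hence "(- \<bar>c p\<bar>) ^ 2 * (1 - vanish_prob p) \<le> 1 / real p * 1"
        using vanish_prob_bounds[of p] by (intro mult_mono) (auto simp: power_divide)
      thus "(- \<bar>c p\<bar>) ^ 2 * (1 - vanish_prob p) \<le> 1 / real p" by simp
    qed
    have KS0: "0 \<le> K * S"
    proof -
      have "0 \<le> (\<Sum>n=1..N. \<bar>e n\<bar> * tilted_coeff (\<lambda>p. - b p) n)" using tc0 by (intro sum_nonneg) auto
      thus ?thesis using T1 by linarith
    qed
    have "(1 + (\<Sum>p\<in>T. (- \<bar>c p\<bar>) ^ 2 * (1 - vanish_prob p))) * (\<Sum>n=1..N. \<bar>e n\<bar> * tilted_coeff (\<lambda>p. - b p) n) \<le> (1 + w) * (K * S)"
      using c2 T1 tc0 w0 by (intro mult_mono) (auto intro!: sum_nonneg)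
    moreover have "(\<Sum>p\<in>T. \<bar>c p\<bar> * (1 - vanish_prob p) * (\<Sum>n=1..N div p. \<bar>e (p * n)\<bar> * tilted_coeff (\<lambda>p. - b p) n)) \<le> w * (K * S)"
      unfolding w_def sum_distrib_right
    proof (rule sum_mono)
      fix p assume p: "p \<in> T"
      have p0: "p > 0" using prT[OF p] prime_gt_0_nat by blast
      have "(\<Sum>n=1..N div p. \<bar>e (p * n)\<bar> * tilted_coeff (\<lambda>p. - b p) n)
         \<le> (\<Sum>n=1..N div p. K / sqrt (real (p * n)) * tilted_coeff (\<lambda>p. - b p) n)"
      proof (intro sum_mono mult_right_mono tc0 e)
        fix n assume n: "n \<in> {1..N div p}"
        thus "1 \<le> p * n" using p0 by simp
        show "p * n \<le> N" using n p0 by (simp add: less_eq_div_iff_mult_less_eq mult.commute)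
      qed
      also have "\<dots> = K / sqrt (real p) * (\<Sum>n=1..N div p. tilted_coeff (\<lambda>p. - b p) n / sqrt (real n))"
        by (simp add: sum_distrib_left real_sqrt_mult)
      also have "\<dots> \<le> K / sqrt (real p) * S"
      proof (intro mult_left_mono order.trans[OF _ S] sum_mono2)
        show "{1..N div p} \<subseteq> {1..N}" by (auto intro: order.trans[OF _ div_le_dividend])
      qed (use tc0 K0 in auto)
      finally have "(1 - vanish_prob p) * (\<Sum>n=1..N div p. \<bar>e (p * n)\<bar> * tilted_coeff (\<lambda>p. - b p) n) \<le> 1 * (K / sqrt (real p) * S)"
        using vanish_prob_bounds[of p] tc0 by (intro mult_mono) (auto intro!: sum_nonneg)
      hence "\<bar>c p\<bar> * ((1 - vanish_prob p) * (\<Sum>n=1..N div p. \<bar>e (p * n)\<bar> * tilted_coeff (\<lambda>p. - b p) n)) \<le> 1 / sqrt (real p) * (K / sqrt (real p) * S)"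
        using c[OF p] vanish_prob_bounds[of p] tc0 by (intro mult_mono[of "\<bar>c p\<bar>"]) (auto intro!: sum_nonneg mult_nonneg_nonneg)
      also have "\<dots> = 1 / real p * (K * S)" using p0 by (simp add: field_simps)
      finally show "\<bar>c p\<bar> * (1 - vanish_prob p) * (\<Sum>n=1..N div p. \<bar>e (p * n)\<bar> * tilted_coeff (\<lambda>p. - b p) n) \<le> 1 / real p * (K * S)"
        by (simp only: mult.assoc)
    qed
    ultimately show ?thesis by (simp add: sum_negf)
  qed
  also have "(1 + w) * (K * S) + 2 * (w * (K * S)) = K * (1 + 3 * w) * S" by (simp add: algebra_simps)
  finally have E1: "E \<le> (\<Prod>p\<in>P. (1 + v p) ^ 2 + u p ^ 2) * (K * (1 + 3 * w) * S) / 2 ^ J"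
    by (simp add: divide_right_mono mult_left_mono prod_nonneg)
  \<comment> \<open>The 12 is 4 + 4 + 4, from 2 v, v^2 and u^2, each at most 4 t^2.\<close>
  have A1: "(\<Prod>p\<in>P. (1 + v p) ^ 2 + u p ^ 2) \<le> exp (\<Sum>p\<in>P. 12 * t p ^ 2)"
    unfolding exp_sum[OF fin(1)]
  proof (intro prod_mono conjI)
    fix p assume p: "p \<in> P"
    have "v p \<le> 2 * t p ^ 2" "0 \<le> v p" using \<beta>[OF p] by (auto simp: v_def)
    moreover have "v p ^ 2 \<le> 4 * t p ^ 2"
    proof -
      have "v p ^ 2 \<le> (2 * t p ^ 2) ^ 2" using calculation by (intro power_mono)
      also have "\<dots> = 4 * t p ^ 2 * t p ^ 2" by (simp add: power2_eq_square)
      also have "\<dots> \<le> 4 * t p ^ 2 * 1" using t(1)[OF p] by (intro mult_left_mono) (auto simp: power_le_one)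
      finally show ?thesis by simp
    qed
    moreover have "u p ^ 2 \<le> (2 * t p) ^ 2" using \<alpha>[OF p] unfolding u_def by (intro power_mono) auto
    ultimately have "(1 + v p) ^ 2 + u p ^ 2 \<le> 1 + 12 * t p ^ 2" by (simp add: power2_sum power_mult_distrib)
    also have "\<dots> \<le> exp (12 * t p ^ 2)" by (rule exp_ge_add_one_self)
    finally show "(1 + v p) ^ 2 + u p ^ 2 \<le> exp (12 * t p ^ 2)" .
  qed simp
  have S1: "S \<le> exp (\<Sum>p\<in>P. 4 * t p / sqrt (real p)) * (1 + ln (real N))"
    unfolding S_def exp_sum[OF fin(1)]
  proof (intro mult_right_mono prod_mono conjI)
    fix p assume p: "p \<in> P"
    show "0 \<le> 1 + b p / sqrt (real p)" using b0[of p] by simp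
    have "b p \<le> (4 * t p) * 1"
      unfolding b_def using \<alpha>[OF p] vanish_prob_bounds[of p] t(1)[OF p] unfolding u_def by (intro mult_mono[of "2 * (2 * \<bar>\<alpha> p\<bar>)"]) auto
    hence "1 + b p / sqrt (real p) \<le> 1 + 4 * t p / sqrt (real p)" by (simp add: divide_right_mono)
    also have "\<dots> \<le> exp (4 * t p / sqrt (real p))" by (rule exp_ge_add_one_self)
    finally show "1 + b p / sqrt (real p) \<le> exp (4 * t p / sqrt (real p))" .
  qed (use N in auto)
  have S0: "0 \<le> S" unfolding S_def using b0 N by (intro mult_nonneg_nonneg prod_nonneg) auto
  have "(\<Prod>p\<in>P. (1 + v p) ^ 2 + u p ^ 2) * (K * (1 + 3 * w) * S)
      \<le> exp (\<Sum>p\<in>P. 12 * t p ^ 2) * (K * (1 + 3 * w) * (exp (\<Sum>p\<in>P. 4 * t p / sqrt (real p)) * (1 + ln (real N))))"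
    using A1 S1 S0 K0 w0 by (intro mult_mono) (auto intro!: mult_nonneg_nonneg)
  with E1 have "E \<le> exp (\<Sum>p\<in>P. 12 * t p ^ 2) * (K * (1 + 3 * w) * (exp (\<Sum>p\<in>P. 4 * t p / sqrt (real p)) * (1 + ln (real N)))) / 2 ^ J"
    by (meson divide_right_mono order.trans zero_le_numeral zero_le_power)
  moreover have "\<bar>\<alpha> p\<bar> \<le> 1 \<and> \<bar>\<beta> p\<bar> \<le> 1" if p: "p \<in> P" for p
  proof -
    have "t p ^ 2 \<le> 1" using t(1)[OF p] by (simp add: power_le_one)
    thus ?thesis using \<alpha>[OF p] \<beta>[OF p] t(1)[OF p] by auto
  qed
  ultimately show ?thesis unfolding E_def F_def w_def by blast
qed

section \<open>The resonance inequality\<close>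

lemma sum_inverse_sqrt_le: "(\<Sum>n=1..N. 1 / sqrt (real n)) \<le> 2 * sqrt (real N)"
proof (induction N)
  case (Suc N)
  have "1 / sqrt (real (Suc N)) \<le> 2 * (sqrt (real (Suc N)) - sqrt (real N))"
  proof -
    define A where "A = sqrt (real (Suc N))"
    define B where "B = sqrt (real N)"
    have A: "A > 0" "A ^ 2 = real N + 1" and B: "0 \<le> B" "B ^ 2 = real N" "B \<le> A" by (auto simp: A_def B_def)
    have "(A - B) * (A + B) = 1" using A B by (simp add: algebra_simps power2_eq_square)
    moreover have "(A - B) * (A + B) \<le> (A - B) * (2 * A)" using B by (intro mult_left_mono) auto
    ultimately show ?thesis unfolding A_def[symmetric] B_def[symmetric] using A by (simp add: field_simps)
  qed
  thus ?case using Suc by simp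
qed simp

lemma sum_inverse_three_halves_le: "N \<ge> 1 \<Longrightarrow> (\<Sum>n=1..N. 1 / (real n * sqrt (real n))) \<le> 3 - 2 / sqrt (real N)"
proof (induction N rule: nat_induct_at_least)
  case (Suc n)
  define A where "A = sqrt (real (Suc n))"
  define B where "B = sqrt (real n)"
  have A: "A > 0" "A ^ 2 = real n + 1" and B: "0 < B" "B ^ 2 = real n" "B \<le> A" using Suc by (auto simp: A_def B_def)
  have AB: "(A - B) * (A + B) = 1" using A B by (simp add: algebra_simps power2_eq_square)
  have "(A - B) * (A + B) \<le> (A - B) * (2 * A)" using B by (intro mult_left_mono) auto
  hence d: "1 \<le> 2 * A * (A - B)" using AB by (simp add: mult.commute)
  have "1 / (A ^ 2 * A) \<le> (2 * A * (A - B)) / (A ^ 2 * A)" using d A by (intro divide_right_mono) auto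
  also have "\<dots> = 2 * (A - B) / (A * A)" using A by (simp add: power2_eq_square)
  also have "\<dots> \<le> 2 * (A - B) / (A * B)" using A B by (intro divide_left_mono mult_left_mono mult_pos_pos) auto
  also have "\<dots> = 2 / B - 2 / A" using A B by (simp add: field_simps)
  finally have "1 / (real (Suc n) * sqrt (real (Suc n))) \<le> 2 / sqrt (real n) - 2 / sqrt (real (Suc n))"
    unfolding A_def[symmetric] B_def[symmetric] using A by (simp add: add.commute)
  thus ?case using Suc.IH Suc.hyps by simp
qed simp

text \<open>Fix one valid index for each \<open>p\<close>; the J + 1 classes partition
  \<open>T\<close>, so one of them has at least the average weight.\<close>

lemma pigeonhole_weighted:
  fixes w :: "'a \<Rightarrow> real" and J :: nat
  assumes T: "finite T" and ex: "\<And>p. p \<in> T \<Longrightarrow> \<exists>i\<le>J. R i p"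
  shows "\<exists>i\<le>J. \<exists>S\<subseteq>T. (\<forall>p\<in>S. R i p) \<and> (\<Sum>p\<in>T. w p) / (real J + 1) \<le> (\<Sum>p\<in>S. w p)"
proof (rule ccontr)
  assume no: "\<not> ?thesis"
  obtain g where g: "\<And>p. p \<in> T \<Longrightarrow> g p \<le> J \<and> R (g p) p" using ex by metis
  define W where "W = (\<Sum>p\<in>T. w p)"
  have "W = (\<Sum>i\<le>J. \<Sum>p | p \<in> T \<and> g p = i. w p)"
    unfolding W_def using g T by (intro sum.group[symmetric]) auto
  also have "\<dots> < (\<Sum>i\<le>J. W / (real J + 1))"
  proof (rule sum_strict_mono)
    fix i assume i: "i \<in> {..J}"
    have "{p. p \<in> T \<and> g p = i} \<subseteq> T" "\<forall>p\<in>{p. p \<in> T \<and> g p = i}. R i p" using g by auto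
    hence "\<not> W / (real J + 1) \<le> (\<Sum>p | p \<in> T \<and> g p = i. w p)" using no i unfolding W_def by blast
    thus "(\<Sum>p | p \<in> T \<and> g p = i. w p) < W / (real J + 1)" by linarith
  qed auto
  also have "\<dots> = W" by (simp add: field_simps)
  finally show False by simp
qed

text \<open>The tilted primes are tiny compared with \<open>x\<close>, so the negative power of
  \<open>x\<close> can outweigh the exponential of \<open>P\<^sub>2\<close>^(1/4), and only
  logarithmic terms remain. The condition \<open>loc\<close> keeps the local Euler factors in
  [0, 1], since vanish_prob p / p is at most 1/2.\<close>

lemma smoothed_sum_le:
  fixes \<phi> :: "real \<Rightarrow> real" and b :: "nat \<Rightarrow> real" and L \<epsilon> \<omega> P\<^sub>2 x :: real
  assumes lip: "\<And>x y. 0 \<le> x \<Longrightarrow> 0 \<le> y \<Longrightarrow> \<bar>\<phi> x - \<phi> y\<bar> \<le> L * \<bar>x - y\<bar>" and L: "0 \<le> L" and \<epsilon>: "0 < \<epsilon>"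
    and one: "\<And>x. 0 \<le> x \<Longrightarrow> x < \<epsilon> \<Longrightarrow> \<phi> x = 1" and zero: "\<And>x. x > 2 \<Longrightarrow> \<phi> x = 0"
    and x: "1 \<le> x" and P: "finite P" "\<And>p. p \<in> P \<Longrightarrow> prime p \<and> real p \<le> P\<^sub>2" "(\<Sum>p\<in>P. 1 / real p) \<le> 2" and P2: "1 \<le> P\<^sub>2"
    and b: "\<And>p. 0 \<le> b p" "\<And>p. p \<in> P \<Longrightarrow> b p \<le> \<omega> / sqrt (real p)" "\<And>p. p \<notin> P \<Longrightarrow> b p = 0"
    and \<omega>: "0 \<le> \<omega>" and loc: "\<And>p. p \<in> P \<Longrightarrow> \<omega> / real p \<le> 1 / 2"
  shows "\<bar>smoothed_sum b \<phi> x\<bar> \<le> 2 * L * (ln (2 * x) / 2 + 1 + (2 * \<omega> * ln P\<^sub>2 + 2 * (ln (2 * x) + 2))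
      + 4 * (\<epsilon> * x / 2) powr (-1/4) * exp (2 * \<omega> * P\<^sub>2 powr (1/4) + 6))"
proof -
  define N where "N = nat \<lfloor>2 * x\<rfloor>"
  have N1: "N \<ge> 1" "real N \<le> 2 * x" using x by (auto simp: N_def le_nat_iff le_floor_iff)
  define Q where "Q = {p. prime p \<and> p \<le> N}"
  have Q: "finite Q" "\<And>p. p \<in> Q \<Longrightarrow> prime p" by (auto simp: Q_def)
  have pos: "0 < real p" if "p \<in> Q \<or> p \<in> P" for p using that Q(2) P(2) prime_gt_0_nat by auto
  have lnN: "ln (real N) \<le> ln (2 * x)" using N1 by simp
  have z2: "vanish_prob p \<le> 2 / real p" if "p \<in> Q" for p
    using pos[of p] that by (auto simp: vanish_prob_def field_simps)
  have bsum: "(\<Sum>p\<in>Q. b p / sqrt (real p) * g p) \<le> (\<Sum>p\<in>P. \<omega> / real p * g p)" if g: "\<And>p. p \<in> Q \<union> P \<Longrightarrow> 0 \<le> g p" for g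
  proof -
    have "(\<Sum>p\<in>Q. b p / sqrt (real p) * g p) \<le> (\<Sum>p\<in>Q \<union> P. b p / sqrt (real p) * g p)"
      using Q(1) P(1) b(1) g by (intro sum_mono2) auto
    also have "\<dots> = (\<Sum>p\<in>P. b p / sqrt (real p) * g p)"
      using Q(1) P(1) b(3) by (intro sum.mono_neutral_right) auto
    also have "\<dots> \<le> (\<Sum>p\<in>P. \<omega> / real p * g p)"
    proof (intro sum_mono mult_right_mono)
      fix p assume p: "p \<in> P"
      have "b p / sqrt (real p) \<le> \<omega> / sqrt (real p) / sqrt (real p)" using b(2)[OF p] by (intro divide_right_mono) auto
      thus "b p / sqrt (real p) \<le> \<omega> / real p" by simp
    qed (use g in auto)
    finally show ?thesis .
  qed
  define B1 where "B1 = (\<Sum>p\<in>Q. (b p / sqrt (real p) + 2 * (vanish_prob p / real p)) * ln (real p))"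
  define B2 where "B2 = (\<Prod>p\<in>Q. 1 + b p / sqrt (real p) * real p powr (1/4) + vanish_prob p / real p * real p powr (1/2))"
  have B1: "B1 \<le> 2 * \<omega> * ln P\<^sub>2 + 2 * (ln (2 * x) + 2)"
  proof -
    have "B1 = (\<Sum>p\<in>Q. b p / sqrt (real p) * ln (real p)) + (\<Sum>p\<in>Q. 2 * (vanish_prob p / real p) * ln (real p))"
      by (simp add: B1_def distrib_right sum.distrib)
    also have "(\<Sum>p\<in>Q. b p / sqrt (real p) * ln (real p)) \<le> (\<Sum>p\<in>P. \<omega> / real p * ln (real p))"
    proof (rule bsum)
      fix p assume "p \<in> Q \<union> P"
      thus "0 \<le> ln (real p)" using pos[of p] by auto
    qed
    also have "\<dots> \<le> (\<Sum>p\<in>P. \<omega> / real p * ln P\<^sub>2)"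
    proof (intro sum_mono mult_left_mono)
      fix p assume p: "p \<in> P"
      have "0 < real p" "real p \<le> P\<^sub>2" using pos[of p] P(2)[OF p] p by auto
      thus "ln (real p) \<le> ln P\<^sub>2" by simp
    qed (use \<omega> in auto)
    also have "\<dots> = \<omega> * ln P\<^sub>2 * (\<Sum>p\<in>P. 1 / real p)" by (simp add: sum_distrib_left)
    also have "\<dots> \<le> \<omega> * ln P\<^sub>2 * 2" using P(3) \<omega> P2 by (intro mult_left_mono) auto
    also have "(\<Sum>p\<in>Q. 2 * (vanish_prob p / real p) * ln (real p)) \<le> (\<Sum>p\<in>Q. 2 * (ln (real p) / real p))"
    proof (intro sum_mono)
      fix p assume p: "p \<in> Q"
      have "vanish_prob p * (ln (real p) / real p) \<le> 1 * (ln (real p) / real p)"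
        using vanish_prob_bounds[of p] pos[of p] p by (intro mult_right_mono) auto
      thus "2 * (vanish_prob p / real p) * ln (real p) \<le> 2 * (ln (real p) / real p)" by simp
    qed
    also have "\<dots> = 2 * (\<Sum>p | prime p \<and> p \<le> N. ln (real p) / real p)" by (simp add: Q_def sum_distrib_left)
    also have "\<dots> \<le> 2 * (ln (real N) + ln 4)" using mertens_upper[OF N1(1)] by simp
    also have "\<dots> \<le> 2 * (ln (2 * x) + 2)"
    proof -
      have "ln (4::real) = 2 * ln 2" using ln_realpow[of 2 2] by simp
      moreover have "ln (2::real) \<le> 1" using ln_le_minus_one[of "2::real"] by simp
      ultimately show ?thesis using lnN by simp
    qed
    finally show ?thesis by (simp add: mult_ac)
  qed
  have B2: "0 \<le> B2" "B2 \<le> exp (2 * \<omega> * P\<^sub>2 powr (1/4) + 6)"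
  proof -
    show "0 \<le> B2" unfolding B2_def using b(1) vanish_prob_bounds by (intro prod_nonneg) auto
    have "B2 \<le> (\<Prod>p\<in>Q. exp (b p / sqrt (real p) * real p powr (1/4) + vanish_prob p / real p * real p powr (1/2)))"
      unfolding B2_def
    proof (intro prod_mono conjI)
      fix p
      show "0 \<le> 1 + b p / sqrt (real p) * real p powr (1/4) + vanish_prob p / real p * real p powr (1/2)"
        using b(1)[of p] vanish_prob_bounds[of p] by simp
      show "1 + b p / sqrt (real p) * real p powr (1/4) + vanish_prob p / real p * real p powr (1/2)
         \<le> exp (b p / sqrt (real p) * real p powr (1/4) + vanish_prob p / real p * real p powr (1/2))"
        unfolding add.assoc by (rule exp_ge_add_one_self)
    qed
    also have "\<dots> = exp ((\<Sum>p\<in>Q. b p / sqrt (real p) * real p powr (1/4)) + (\<Sum>p\<in>Q. vanish_prob p / real p * real p powr (1/2)))"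
      using Q(1) by (simp add: exp_sum[symmetric] sum.distrib)
    also have "\<dots> \<le> exp (2 * \<omega> * P\<^sub>2 powr (1/4) + 6)"
    proof (subst exp_le_cancel_iff, rule add_mono)
      have "(\<Sum>p\<in>Q. b p / sqrt (real p) * real p powr (1/4)) \<le> (\<Sum>p\<in>P. \<omega> / real p * real p powr (1/4))"
        by (rule bsum) simp
      also have "\<dots> \<le> (\<Sum>p\<in>P. \<omega> / real p * P\<^sub>2 powr (1/4))"
        using P(2) \<omega> by (intro sum_mono mult_left_mono powr_mono2) auto
      also have "\<dots> = \<omega> * P\<^sub>2 powr (1/4) * (\<Sum>p\<in>P. 1 / real p)" by (simp add: sum_distrib_left)
      also have "\<dots> \<le> \<omega> * P\<^sub>2 powr (1/4) * 2" using P(3) \<omega> by (intro mult_left_mono) auto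
      finally show "(\<Sum>p\<in>Q. b p / sqrt (real p) * real p powr (1/4)) \<le> 2 * \<omega> * P\<^sub>2 powr (1/4)" by simp
      have "(\<Sum>p\<in>Q. vanish_prob p / real p * real p powr (1/2)) \<le> (\<Sum>p\<in>Q. 2 * (1 / (real p * sqrt (real p))))"
      proof (intro sum_mono)
        fix p assume p: "p \<in> Q"
        have "vanish_prob p / real p * real p powr (1/2) \<le> 2 / real p / real p * real p powr (1/2)"
          using z2[OF p] by (intro mult_right_mono divide_right_mono) auto
        also have "\<dots> = 2 * (1 / (real p * sqrt (real p)))"
        proof -
          define r where "r = sqrt (real p)"
          have r: "r > 0" "real p = r * r" using pos[of p] p by (auto simp: r_def)
          have "real p powr (1/2) = r" using pos[of p] p by (simp add: r_def powr_half_sqrt)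
          thus ?thesis unfolding r_def[symmetric] using r by (simp add: field_simps)
        qed
        finally show "vanish_prob p / real p * real p powr (1/2) \<le> 2 * (1 / (real p * sqrt (real p)))" .
      qed
      also have "\<dots> \<le> (\<Sum>n=1..N. 2 * (1 / (real n * sqrt (real n))))"
        by (intro sum_mono2) (auto simp: Q_def dest: prime_ge_1_nat)
      also have "\<dots> = 2 * (\<Sum>n=1..N. 1 / (real n * sqrt (real n)))" by (simp only: sum_distrib_left)
      also have "\<dots> \<le> 2 * 3"
      proof (rule mult_left_mono)
        show "(\<Sum>n=1..N. 1 / (real n * sqrt (real n))) \<le> 3"
          using sum_inverse_three_halves_le[OF N1(1)] by (rule order.trans) simp
      qed simp
      finally show "(\<Sum>p\<in>Q. vanish_prob p / real p * real p powr (1/2)) \<le> 6" by simp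
    qed
    finally show "B2 \<le> exp (2 * \<omega> * P\<^sub>2 powr (1/4) + 6)" .
  qed
  define M where "M = ln (2 * x) / 2 + 1 + (2 * \<omega> * ln P\<^sub>2 + 2 * (ln (2 * x) + 2))
      + 4 * (\<epsilon> * x / 2) powr (-1/4) * exp (2 * \<omega> * P\<^sub>2 powr (1/4) + 6)"
  have M0: "0 \<le> M" unfolding M_def using x \<omega> P2 by (intro add_nonneg_nonneg mult_nonneg_nonneg) auto
  have "\<bar>\<Sum>n=1..nat \<lfloor>2 * x\<rfloor>. tilted_coeff b n / sqrt (real n) * \<phi> (real n / x)\<bar> \<le> 2 * L * M"
  proof (rule abs_cutoff_sum_le[OF lip L one zero _ M0])
    fix n :: nat assume n: "\<epsilon> * x \<le> real n + 1" "real n \<le> 2 * x"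
    show "\<bar>\<Sum>i=1..n. tilted_coeff b i / sqrt (real i)\<bar> \<le> M"
    proof (cases "n = 0")
      case False
      hence n1: "n \<ge> 1" by simp
      have nN: "n \<le> N" using n(2) x by (simp add: N_def le_nat_iff le_floor_iff)
      have "\<bar>\<Sum>i=1..n. tilted_coeff b i / sqrt (real i)\<bar> \<le> ln (real n) / 2 + 1 + B1 + 4 * real n powr (-1/4) * B2"
        unfolding B1_def B2_def
      proof (rule tilted_sum_bound[OF Q _ n1 b(1)])
        fix i assume i: "1 \<le> i" "i \<le> n"
        show "prime_factors i \<subseteq> Q"
        proof
          fix p assume p: "p \<in> prime_factors i"
          hence "p \<le> i" using i by (intro dvd_imp_le) auto
          thus "p \<in> Q" using p i nN by (auto simp: Q_def)
        qed
      next
        fix p assume p: "p \<in> Q"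
        have p2: "2 \<le> real p" using prime_ge_2_nat[OF Q(2)[OF p]] by simp
        have "vanish_prob p / real p \<le> 1 / 2" using vanish_prob_bounds[of p] p2 by (intro frac_le) auto
        moreover have "b p / sqrt (real p) \<le> 1 / 2"
        proof (cases "p \<in> P")
          case True
          have "b p / sqrt (real p) \<le> \<omega> / sqrt (real p) / sqrt (real p)" using b(2)[OF True] by (intro divide_right_mono) auto
          also have "\<dots> = \<omega> / real p" by simp
          finally show ?thesis using loc[OF True] by linarith
        qed (simp add: b(3))
        ultimately show "b p / sqrt (real p) + vanish_prob p / real p \<le> 1" by linarith
      qed
      also have "\<dots> \<le> M"
      proof -
        have "ln (real n) \<le> ln (2 * x)" using n n1 by simp
        moreover have "4 * real n powr (-1/4) * B2 \<le> 4 * (\<epsilon> * x / 2) powr (-1/4) * exp (2 * \<omega> * P\<^sub>2 powr (1/4) + 6)"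
        proof (intro mult_mono B2 powr_mono2')
          \<comment> \<open>From n \<ge> 1 follows n \<ge> (n + 1)/2, and n + 1 is at least
            \<epsilon> x.\<close>
          show "\<epsilon> * x / 2 \<le> real n" using n n1 by linarith
        qed (use \<epsilon> x in auto)
        ultimately show ?thesis unfolding M_def using B1 by linarith
      qed
      finally show ?thesis .
    qed (use M0 in simp)
  qed (use x in auto)
  thus ?thesis unfolding smoothed_sum_def M_def .
qed

text \<open>By \<open>big\<close> the family average of the truncated resonator times the shifted
  sum is nonnegative. Passing to the expectation costs the averaging error, the last term; passing
  from the truncated to the full tilt costs the middle term; the expectation with the full tilt is
  known exactly, and its linear part has the left-hand side as a lower bound.\<close>

lemma resonance_inequality:
  fixes D x M C Z q :: real and \<phi> :: "real \<Rightarrow> real" and t :: "nat \<Rightarrow> real" and J Y :: nat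
  assumes D: "1 \<le> D" "2 * x \<le> D" and x: "1 \<le> x" and Y: "1 \<le> Y"
    and P: "\<And>p. p \<in> P \<Longrightarrow> prime p \<and> real p \<le> 2 * x \<and> real p \<le> Z" and Z: "1 \<le> Z" and q: "1 \<le> q" "real (card P) \<le> q"
    and T: "\<And>p. p \<in> T \<Longrightarrow> prime p \<and> real p \<le> x" "T \<inter> P = {}" "\<And>p r. p \<in> T \<Longrightarrow> r \<in> T \<Longrightarrow> 2 * x < real p * real r"
    and t: "\<And>p. p \<in> P \<Longrightarrow> 0 \<le> t p \<and> t p \<le> 1" "\<And>p. p \<notin> P \<Longrightarrow> t p = 0"
    and \<phi>: "\<And>y. 0 \<le> y \<Longrightarrow> \<bar>\<phi> y\<bar> \<le> C" and M: "0 \<le> M"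
    and big: "\<And>m. m \<in> sqfree_family D \<Longrightarrow> - M \<le> (\<Sum>n=1..nat \<lfloor>2 * x\<rfloor>. real_of_int (kronecker (8 * m) n) / sqrt (real n) * \<phi> (real n / x))"
  defines "b \<equiv> \<lambda>p. t p * (1 - vanish_prob p)"
  shows "(\<Sum>p\<in>T. \<bar>smoothed_sum b \<phi> (x / real p)\<bar> / real p)
     \<le> (\<bar>smoothed_sum b \<phi> x\<bar> + M) * (1 + (\<Sum>p\<in>T. 1 / real p))
      + exp (\<Sum>p\<in>P. 12 * t p ^ 2) * ((C + M) * (1 + 3 * (\<Sum>p\<in>T. 1 / real p))
         * (exp (\<Sum>p\<in>P. 4 * t p / sqrt (real p)) * (1 + ln (2 * x)))) / 2 ^ J
      + ((real J + 1) * 9 * q ^ J) ^ 2 * (27 * (C + M) * x * sqrt x)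
         * family_error D Y ((Z ^ J) ^ 2 * (2 * x ^ 3)) / (D / 8)"
proof -
  define N where "N = nat \<lfloor>2 * x\<rfloor>"
  have N1: "N \<ge> 1" "real N \<le> 2 * x" using x by (auto simp: N_def le_nat_iff le_floor_iff)
  have leN: "n \<le> N" if "real n \<le> 2 * x" for n using that x by (simp add: N_def le_nat_iff le_floor_iff)
  define Q where "Q = {p. prime p \<and> p \<le> N}"
  have Q: "finite Q" "\<And>p. p \<in> Q \<Longrightarrow> prime p" by (auto simp: Q_def)
  have PQ: "P \<subseteq> Q" using P leN by (auto simp: Q_def)
  have TQ: "T \<subseteq> Q"
  proof
    fix p assume p: "p \<in> T"
    have "real p \<le> 2 * x" using T(1)[OF p] x by linarith
    thus "p \<in> Q" using T(1)[OF p] leN by (auto simp: Q_def)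
  qed
  have fin: "finite P" "finite T" using PQ TQ Q(1) finite_subset by blast+
  have prT: "prime p" if "p \<in> T" for p using T(1)[OF that] by blast
  have pos: "0 < real p" if "p \<in> T" for p using prime_gt_0_nat[OF prT[OF that]] by simp
  have pf: "prime_factors n \<subseteq> Q" if "1 \<le> n" "n \<le> N" for n
  proof
    fix p assume p: "p \<in> prime_factors n"
    hence "p \<le> n" using that by (intro dvd_imp_le) auto
    thus "p \<in> Q" using p that by (auto simp: Q_def)
  qed
  have Tbig: "N < p * r" if "p \<in> T" "r \<in> T" for p r
  proof -
    have "real N < real (p * r)" using T(3)[OF that] N1 by simp
    thus ?thesis by (simp only: of_nat_less_iff)
  qed
  define sm where "sm = smoothed_sum b \<phi>"
  \<comment> \<open>The sign of the sum at length x / p, so that every linear term of the expanded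
    square yields an absolute value.\<close>
  define c where "c = (\<lambda>p. (if 0 \<le> sm (x / real p) then 1 else - 1) / sqrt (real p))"
  \<comment> \<open>The shift \<open>M\<close> is placed in the coefficient at 1, where
    \<open>char_value\<close> is 1, so that the shifted sum is a single Dirichlet
    polynomial.\<close>
  define e where "e = (\<lambda>n::nat. \<phi> (real n / x) / sqrt (real n) + (if n = 1 then M else 0))"
  define w where "w = (\<Sum>p\<in>T. 1 / real p)"
  have w0: "0 \<le> w" unfolding w_def by (intro sum_nonneg) auto
  have C0: "0 \<le> C" using \<phi>[of 0] by linarith
  have c: "\<bar>c p\<bar> \<le> 1 / sqrt (real p)" for p by (simp add: c_def abs_div)
  have e: "\<bar>e n\<bar> \<le> (C + M) / sqrt (real n)" if "1 \<le> n" for n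
  proof -
    have "\<bar>\<phi> (real n / x) / sqrt (real n)\<bar> \<le> C / sqrt (real n)"
      using \<phi>[of "real n / x"] x that by (simp add: abs_div divide_right_mono)
    moreover have "\<bar>if n = 1 then M else 0\<bar> \<le> M / sqrt (real n)" using M that by simp
    ultimately show ?thesis unfolding e_def add_divide_distrib by linarith
  qed
  define F where "F = (\<lambda>f. (1 - (\<Sum>p\<in>T. c p * f p)) ^ 2 * (\<Sum>n=1..N. e n * char_value f n))"
  define TR where "TR = exp (\<Sum>p\<in>P. 12 * t p ^ 2) * ((C + M) * (1 + 3 * w)
         * (exp (\<Sum>p\<in>P. 4 * t p / sqrt (real p)) * (1 + ln (2 * x)))) / 2 ^ J"
  define Er where "Er = ((real J + 1) * 9 * q ^ J) ^ 2 * (27 * (C + M) * x * sqrt x)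
         * family_error D Y ((Z ^ J) ^ 2 * (2 * x ^ 3))"
  have "\<exists>\<alpha> \<beta>. (\<forall>p\<in>P. \<bar>\<alpha> p\<bar> \<le> 1 \<and> \<bar>\<beta> p\<bar> \<le> 1) \<and>
     expect Q (\<lambda>f. (\<Sum>k\<le>J. graded_part \<alpha> \<beta> P k f) ^ 2 * F f) - expect Q (\<lambda>f. (\<Prod>p\<in>Q. 1 - t p * f p) * F f)
       \<le> exp (\<Sum>p\<in>P. 12 * t p ^ 2) * ((C + M) * (1 + 3 * w)
         * (exp (\<Sum>p\<in>P. 4 * t p / sqrt (real p)) * (1 + ln (real N)))) / 2 ^ J"
    unfolding F_def w_def by (rule resonator_truncation[OF Q pf N1(1) TQ T(2) Tbig PQ t c e])
  then obtain \<alpha> \<beta> where ab: "\<forall>p\<in>P. \<bar>\<alpha> p\<bar> \<le> 1 \<and> \<bar>\<beta> p\<bar> \<le> 1"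
    and tr: "expect Q (\<lambda>f. (\<Sum>k\<le>J. graded_part \<alpha> \<beta> P k f) ^ 2 * F f) - expect Q (\<lambda>f. (\<Prod>p\<in>Q. 1 - t p * f p) * F f)
       \<le> exp (\<Sum>p\<in>P. 12 * t p ^ 2) * ((C + M) * (1 + 3 * w)
         * (exp (\<Sum>p\<in>P. 4 * t p / sqrt (real p)) * (1 + ln (real N)))) / 2 ^ J" by blast
  have tr': "expect Q (\<lambda>f. (\<Sum>k\<le>J. graded_part \<alpha> \<beta> P k f) ^ 2 * F f) - expect Q (\<lambda>f. (\<Prod>p\<in>Q. 1 - t p * f p) * F f) \<le> TR"
    unfolding TR_def using N1 C0 M w0
    by (intro order.trans[OF tr] divide_right_mono mult_left_mono) (auto intro!: mult_nonneg_nonneg)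
  have main: "expect Q (\<lambda>f. (\<Prod>p\<in>Q. 1 - t p * f p) * F f)
     = (1 + (\<Sum>p\<in>T. c p ^ 2 * (1 - vanish_prob p))) * (sm x + M) - 2 * (\<Sum>p\<in>T. (1 - vanish_prob p) * (\<bar>sm (x / real p)\<bar> / real p))"
  proof -
    have tT: "t p = 0" if "p \<in> T" for p
    proof -
      have "p \<notin> P" using that T(2) by blast
      thus ?thesis by (rule t(2))
    qed
    have E: "expect Q (\<lambda>f. (\<Prod>p\<in>Q. 1 - t p * f p) * F f)
     = (1 + (\<Sum>p\<in>T. c p ^ 2 * (1 - vanish_prob p))) * (\<Sum>n=1..N. e n * tilted_coeff b n)
       - 2 * (\<Sum>p\<in>T. c p * (1 - vanish_prob p) * (\<Sum>n=1..N div p. e (p * n) * tilted_coeff b n))"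
      unfolding F_def b_def by (rule expect_resonated[OF Q pf TQ tT Tbig])
    have "(\<Sum>n=1..N. e n * tilted_coeff b n) = sm x + (\<Sum>n=1..N. if n = 1 then M else 0)"
      unfolding sm_def smoothed_sum_def N_def[symmetric] sum.distrib[symmetric]
      by (intro sum.cong refl) (auto simp: e_def algebra_simps)
    hence 1: "(\<Sum>n=1..N. e n * tilted_coeff b n) = sm x + M" using N1 by simp
    have 2: "c p * (1 - vanish_prob p) * (\<Sum>n=1..N div p. e (p * n) * tilted_coeff b n)
       = (1 - vanish_prob p) * (\<bar>sm (x / real p)\<bar> / real p)" if p: "p \<in> T" for p
    proof -
      have "N div p = nat \<lfloor>2 * (x / real p)\<rfloor>"
        using floor_divide_real_eq_div[of "int p" "2 * x"] x by (simp add: N_def nat_div_distrib)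
      hence "sm (x / real p) = (\<Sum>n=1..N div p. tilted_coeff b n / sqrt (real n) * \<phi> (real n / (x / real p)))"
        by (simp add: sm_def smoothed_sum_def)
      also have "\<dots> = (\<Sum>n=1..N div p. sqrt (real p) * (e (p * n) * tilted_coeff b n))"
      proof (intro sum.cong refl)
        fix n assume n: "n \<in> {1..N div p}"
        have "p * n \<noteq> 1" using prime_ge_2_nat[OF prT[OF p]] n by (simp add: nat_mult_eq_1_iff)
        hence "e (p * n) = \<phi> (real (p * n) / x) / sqrt (real (p * n))" by (simp only: e_def if_False add_0_right)
        thus "tilted_coeff b n / sqrt (real n) * \<phi> (real n / (x / real p)) = sqrt (real p) * (e (p * n) * tilted_coeff b n)"
          using pos[OF p] by (simp add: real_sqrt_mult mult_ac)
      qed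
      also have "\<dots> = sqrt (real p) * (\<Sum>n=1..N div p. e (p * n) * tilted_coeff b n)" by (simp add: sum_distrib_left)
      finally have "(\<Sum>n=1..N div p. e (p * n) * tilted_coeff b n) = sm (x / real p) / sqrt (real p)"
        using pos[OF p] by (simp add: field_simps)
      moreover have "c p * (sm (x / real p) / sqrt (real p)) = \<bar>sm (x / real p)\<bar> / real p"
        using pos[OF p] by (simp add: c_def)
      ultimately show ?thesis by (metis mult.assoc mult.commute)
    qed
    show ?thesis unfolding E 1 by (simp only: 2 cong: sum.cong)
  qed
  have avg: "- (Er / (D / 8)) \<le> expect Q (\<lambda>f. (\<Sum>k\<le>J. graded_part \<alpha> \<beta> P k f) ^ 2 * F f)"
  proof -
    define R where "R = (\<lambda>f. \<Sum>k\<le>J. graded_part \<alpha> \<beta> P k f)"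
    have dR: "dirichlet_poly Q R ((real J + 1) * 9 * q ^ J) (Z ^ J)"
    proof -
      \<comment> \<open>Rankin's trick with z = 1/q: as |P| \<le> q, the product is at most exp 2
        \<le> 9, so isolating degree \<open>k\<close> costs 9 q^k.\<close>
      have "dirichlet_poly Q (graded_part \<alpha> \<beta> P k) (9 * q ^ J) (Z ^ J)" if k: "k \<le> J" for k
      proof -
        have "dirichlet_poly Q (graded_part \<alpha> \<beta> P k) ((1 + 1 / q + (1 / q) ^ 2) ^ card P / (1 / q) ^ k) (Z ^ k)"
          using P q ab by (intro dirichlet_poly_graded_part fin PQ Z) auto
        moreover have "(1 + 1 / q + (1 / q) ^ 2) ^ card P / (1 / q) ^ k \<le> 9 * q ^ J"
        proof -
          have "(1 / q) ^ 2 \<le> 1 / q" using q by (simp add: power2_eq_square field_simps)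
          hence "1 + 1 / q + (1 / q) ^ 2 \<le> 1 + 2 / q" by simp
          also have "\<dots> \<le> exp (2 / q)" by (rule exp_ge_add_one_self)
          finally have "(1 + 1 / q + (1 / q) ^ 2) ^ card P \<le> exp (2 / q) ^ card P" using q by (intro power_mono) auto
          also have "\<dots> = exp (real (card P) * (2 / q))" by (simp only: exp_of_nat_mult)
          also have "\<dots> \<le> exp 2"
          proof -
            have "real (card P) * (2 / q) \<le> q * (2 / q)" using q by (intro mult_right_mono) auto
            thus ?thesis using q by simp
          qed
          also have "exp 2 = exp (1::real) ^ 2" by (simp add: exp_double[of 1, simplified])
          also have "\<dots> \<le> 3 ^ 2" using exp_le by (intro power_mono) auto
          finally have "(1 + 1 / q + (1 / q) ^ 2) ^ card P * q ^ k \<le> 9 * q ^ J"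
            using q k by (intro mult_mono power_increasing) auto
          thus ?thesis by (simp add: power_divide)
        qed
        moreover have "Z ^ k \<le> Z ^ J" using Z k by (intro power_increasing) auto
        ultimately show ?thesis by (rule dirichlet_poly_mono)
      qed
      hence "dirichlet_poly Q R (\<Sum>k\<le>J. 9 * q ^ J) (Z ^ J)"
        unfolding R_def using Z by (intro dirichlet_poly_sum) auto
      thus ?thesis by (simp add: mult_ac add_ac)
    qed
    have dB: "dirichlet_poly Q (\<lambda>f. 1 - (\<Sum>p\<in>T. c p * f p)) (3 * sqrt x) x"
    proof -
      have single: "dirichlet_poly Q (\<lambda>f. (- c p) * f p) (1 / sqrt (real p)) x" if p: "p \<in> T" for p
      proof -
        have "dirichlet_poly Q (\<lambda>f. (- c p) * char_value f p) (1 / sqrt (real p)) x"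
          using p TQ T(1)[OF p] prime_ge_1_nat[OF prT[OF p]] c[of p]
          by (intro dirichlet_poly.single) (auto simp: prime_factorization_prime)
        thus ?thesis using prT[OF p] by (simp add: char_value_prime)
      qed
      have "dirichlet_poly Q (\<lambda>f. 1 + (\<Sum>p\<in>T. (- c p) * f p)) (\<bar>1\<bar> + (\<Sum>p\<in>T. 1 / sqrt (real p))) x"
        by (intro dirichlet_poly.add dirichlet_poly_const dirichlet_poly_sum x fin single)
      moreover have "\<bar>1\<bar> + (\<Sum>p\<in>T. 1 / sqrt (real p)) \<le> 3 * sqrt x"
      proof -
        have "(\<Sum>p\<in>T. 1 / sqrt (real p)) \<le> (\<Sum>n=1..nat \<lfloor>x\<rfloor>. 1 / sqrt (real n))"
        proof (intro sum_mono2)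
          show "T \<subseteq> {1..nat \<lfloor>x\<rfloor>}" using T(1) x prime_ge_1_nat by (auto simp: le_nat_iff le_floor_iff)
        qed auto
        also have "\<dots> \<le> 2 * sqrt (real (nat \<lfloor>x\<rfloor>))" by (rule sum_inverse_sqrt_le)
        also have "\<dots> \<le> 2 * sqrt x" using x by simp
        finally have "(\<Sum>p\<in>T. 1 / sqrt (real p)) \<le> 2 * sqrt x" .
        moreover have "1 \<le> sqrt x" using x by simp
        ultimately show ?thesis by linarith
      qed
      ultimately have "dirichlet_poly Q (\<lambda>f. 1 + (\<Sum>p\<in>T. (- c p) * f p)) (3 * sqrt x) x"
        using dirichlet_poly_mono by blast
      thus ?thesis by (simp add: sum_negf)
    qed
    have dS: "dirichlet_poly Q (\<lambda>f. \<Sum>n=1..N. e n * char_value f n) (3 * (C + M) * sqrt x) (2 * x)"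
    proof -
      have "dirichlet_poly Q (\<lambda>f. \<Sum>n=1..N. e n * char_value f n) (\<Sum>n=1..N. (C + M) / sqrt (real n)) (2 * x)"
      proof (intro dirichlet_poly_sum dirichlet_poly.single)
        fix n assume n: "n \<in> {1..N}"
        have "real n \<le> real N" using n by simp
        thus "real n \<le> 2 * x" using N1 by linarith
        show "1 \<le> n" "prime_factors n \<subseteq> Q" "\<bar>e n\<bar> \<le> (C + M) / sqrt (real n)" using n pf e by auto
      qed (use x in auto)
      moreover have "(\<Sum>n=1..N. (C + M) / sqrt (real n)) \<le> 3 * (C + M) * sqrt x"
      proof -
        have "(\<Sum>n=1..N. (C + M) / sqrt (real n)) = (C + M) * (\<Sum>n=1..N. 1 / sqrt (real n))"
          by (simp add: sum_distrib_left)
        also have "\<dots> \<le> (C + M) * (2 * sqrt (real N))"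
          using C0 M by (intro mult_left_mono sum_inverse_sqrt_le) auto
        also have "\<dots> \<le> (C + M) * (3 * sqrt x)"
        proof (intro mult_left_mono)
          have "sqrt (real N) \<le> 3 / 2 * sqrt x"
            using N1 x by (intro real_le_lsqrt) (auto simp: power_mult_distrib power2_eq_square)
          thus "2 * sqrt (real N) \<le> 3 * sqrt x" by simp
        qed (use C0 M in auto)
        finally show ?thesis by (simp add: mult_ac)
      qed
      ultimately show ?thesis using dirichlet_poly_mono by blast
    qed
    have dp0: "dirichlet_poly Q (\<lambda>f. (R f * R f) * (((1 - (\<Sum>p\<in>T. c p * f p)) * (1 - (\<Sum>p\<in>T. c p * f p))) * (\<Sum>n=1..N. e n * char_value f n)))
       ((((real J + 1) * 9 * q ^ J) * ((real J + 1) * 9 * q ^ J)) * ((3 * sqrt x * (3 * sqrt x)) * (3 * (C + M) * sqrt x)))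
       ((Z ^ J * Z ^ J) * ((x * x) * (2 * x)))"
      by (intro dirichlet_poly_mult dR dB dS)
    \<comment> \<open>Apart from \<open>R\<close>, the coefficients sum to (3 sqrt x)^2 from the two
      factors \<open>B\<close> times 3 (C + M) sqrt x from the shifted sum, and the frequencies
      reach x * x * 2 x. The exponents 3/2 and 3 decide the range of \<open>a\<close>.\<close>
    have dp: "dirichlet_poly Q (\<lambda>f. R f ^ 2 * F f)
      (((real J + 1) * 9 * q ^ J) ^ 2 * (27 * (C + M) * x * sqrt x)) ((Z ^ J) ^ 2 * (2 * x ^ 3))"
    proof -
      have e1: "(3 * sqrt x * (3 * sqrt x)) * (3 * (C + M) * sqrt x) = 27 * (C + M) * x * sqrt x"
      proof -
        define r where "r = sqrt x"
        have r: "x = r * r" using x by (simp add: r_def)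
        show ?thesis unfolding r_def[symmetric] by (subst r) (simp add: algebra_simps)
      qed
      have e2: "(x * x) * (2 * x) = 2 * x ^ 3" by (simp add: power3_eq_cube)
      show ?thesis using dp0[unfolded e1 e2] unfolding F_def power2_eq_square[symmetric] .
    qed
    have "\<bar>(\<Sum>m\<in>sqfree_family D. R (\<lambda>p. real_of_int (kronecker_prime (8 * m) p)) ^ 2 * F (\<lambda>p. real_of_int (kronecker_prime (8 * m) p)))
     - family_density D * expect Q (\<lambda>f. R f ^ 2 * F f)\<bar> \<le> Er"
      unfolding Er_def
    proof (rule average_dirichlet_poly[OF dp Q(1) _ D(1) Y])
      show "Q \<subseteq> insert 2 (odd_primes_upto D)"
      proof
        fix p assume p: "p \<in> Q"
        have "real p \<le> real N" using p by (simp add: Q_def)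
        hence "real p \<le> D" using N1 D by linarith
        thus "p \<in> insert 2 (odd_primes_upto D)" using p prime_odd_nat[of p] prime_ge_2_nat[of p]
          by (cases "p = 2") (auto simp: Q_def odd_primes_upto_def)
      qed
    qed
    moreover have "0 \<le> (\<Sum>m\<in>sqfree_family D. R (\<lambda>p. real_of_int (kronecker_prime (8 * m) p)) ^ 2 * F (\<lambda>p. real_of_int (kronecker_prime (8 * m) p)))"
    proof (rule sum_nonneg)
      fix m assume m: "m \<in> sqfree_family D"
      let ?f = "\<lambda>p. real_of_int (kronecker_prime (8 * m) p)"
      have "(\<Sum>n=1..N. e n * char_value ?f n) = (\<Sum>n=1..N. real_of_int (kronecker (8 * m) n) / sqrt (real n) * \<phi> (real n / x))
          + (\<Sum>n=1..N. if n = 1 then M else 0)"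
        unfolding sum.distrib[symmetric]
      proof (intro sum.cong refl)
        fix n assume n: "n \<in> {1..N}"
        hence "char_value ?f n = real_of_int (kronecker (8 * m) n)" by (intro char_value_kronecker) auto
        moreover have "char_value ?f 1 = 1" by simp
        ultimately show "e n * char_value ?f n = real_of_int (kronecker (8 * m) n) / sqrt (real n) * \<phi> (real n / x) + (if n = 1 then M else 0)"
          by (cases "n = 1") (auto simp: e_def algebra_simps)
      qed
      also have "(\<Sum>n=1..N. if n = 1 then M else 0) = M" using N1 by simp
      finally have "0 \<le> (\<Sum>n=1..N. e n * char_value ?f n)" using big[OF m] unfolding N_def by linarith
      thus "0 \<le> R ?f ^ 2 * F ?f" unfolding F_def by (intro mult_nonneg_nonneg) auto
    qed
    ultimately have 1: "- Er \<le> family_density D * expect Q (\<lambda>f. R f ^ 2 * F f)" by linarith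
    have H: "D / 8 \<le> family_density D" using D by (intro family_density_ge) auto
    have Er0: "0 \<le> Er"
      using \<open>\<bar>_\<bar> \<le> Er\<close> by linarith
    \<comment> \<open>Only a lower bound for \<open>family_density\<close> is at hand, so a negative
      expectation needs it while a nonnegative one makes the claim trivial.\<close>
    show ?thesis
    proof (cases "0 \<le> expect Q (\<lambda>f. R f ^ 2 * F f)")
      case True
      moreover have "0 \<le> Er / (D / 8)" using Er0 D by simp
      ultimately show ?thesis unfolding R_def by linarith
    next
      case False
      hence "family_density D * expect Q (\<lambda>f. R f ^ 2 * F f) \<le> D / 8 * expect Q (\<lambda>f. R f ^ 2 * F f)"
        using H by (intro mult_right_mono_neg) auto
      hence "- Er \<le> D / 8 * expect Q (\<lambda>f. R f ^ 2 * F f)" using 1 by linarith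
      thus ?thesis using D unfolding R_def by (simp add: field_simps)
    qed
  qed
  have "(1 + (\<Sum>p\<in>T. c p ^ 2 * (1 - vanish_prob p))) * (sm x + M) \<le> (\<bar>sm x\<bar> + M) * (1 + w)"
  proof -
    have "(\<Sum>p\<in>T. c p ^ 2 * (1 - vanish_prob p)) \<le> w"
      unfolding w_def
    proof (rule sum_mono)
      fix p assume p: "p \<in> T"
      have "\<bar>c p\<bar> ^ 2 \<le> (1 / sqrt (real p)) ^ 2" using c[of p] by (intro power_mono) auto
      hence "c p ^ 2 * (1 - vanish_prob p) \<le> 1 / real p * 1"
        using vanish_prob_bounds[of p] by (intro mult_mono) (auto simp: power_divide)
      thus "c p ^ 2 * (1 - vanish_prob p) \<le> 1 / real p" by simp
    qed
    moreover have "0 \<le> (\<Sum>p\<in>T. c p ^ 2 * (1 - vanish_prob p))" using vanish_prob_bounds by (intro sum_nonneg) auto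
    ultimately have "(1 + (\<Sum>p\<in>T. c p ^ 2 * (1 - vanish_prob p))) * (sm x + M) \<le> (1 + w) * (\<bar>sm x\<bar> + M)"
      using M by (intro order.trans[OF mult_left_mono mult_right_mono]) auto
    thus ?thesis by (simp add: mult.commute)
  qed
  moreover have "(\<Sum>p\<in>T. \<bar>sm (x / real p)\<bar> / real p) \<le> 2 * (\<Sum>p\<in>T. (1 - vanish_prob p) * (\<bar>sm (x / real p)\<bar> / real p))"
    unfolding sum_distrib_left
  proof (rule sum_mono)
    fix p assume p: "p \<in> T"
    \<comment> \<open>At 2 the factor 1 - vanish_prob p is 0. For odd \<open>p\<close> it is at
      least 1/2, so the factor 2 in front of the linear terms makes up for it.\<close>
    have "p \<noteq> 2"
    proof
      assume "p = 2"
      hence "2 * x < 2 * 2" "2 \<le> x" using T(1)[OF p] T(3)[OF p p] by auto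
      thus False by linarith
    qed
    hence "vanish_prob p = 1 / (real p + 1)" by (simp add: vanish_prob_def)
    also have "\<dots> \<le> 1 / 2" using prime_ge_2_nat[OF prT[OF p]] by (intro frac_le) auto
    finally have "1 * (\<bar>sm (x / real p)\<bar> / real p) \<le> (2 * (1 - vanish_prob p)) * (\<bar>sm (x / real p)\<bar> / real p)"
      by (intro mult_right_mono) auto
    thus "\<bar>sm (x / real p)\<bar> / real p \<le> 2 * ((1 - vanish_prob p) * (\<bar>sm (x / real p)\<bar> / real p))"
      by (simp only: mult_1 mult.assoc)
  qed
  moreover have "S \<le> B + d + r" if "A \<le> B" "S \<le> 2 * S'" "G - E \<le> d" "E = A - 2 * S'" "- r \<le> G"
    for S B d r A S' E G :: real using that by linarith
  ultimately have "(\<Sum>p\<in>T. \<bar>sm (x / real p)\<bar> / real p) \<le> (\<bar>sm x\<bar> + M) * (1 + w) + TR + Er / (D / 8)"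
    using tr' main avg by blast
  thus ?thesis unfolding sm_def w_def TR_def Er_def .
qed

section \<open>Choice of parameters\<close>

lemma elem_sym_ge_power:
  assumes "finite A" "\<And>p. p \<in> A \<Longrightarrow> 0 \<le> y p \<and> y p \<le> \<delta>" "real j * \<delta> \<le> sum y A / 2" and G: "0 \<le> G" "G * real j \<le> sum y A / 2"
  shows "G ^ j \<le> elem_sym y A j"
proof -
  have f: "fact j \<le> real j ^ j"
    using fact_le_power[of j, where ?'a = real] by simp
  have "G ^ j * fact j \<le> G ^ j * real j ^ j" using f G by (intro mult_left_mono) auto
  also have "\<dots> = (G * real j) ^ j" by (simp add: power_mult_distrib)
  also have "\<dots> \<le> (sum y A / 2) ^ j" using G by (intro power_mono) auto
  finally have "G ^ j \<le> (sum y A / 2) ^ j / fact j" by (simp add: pos_le_divide_eq)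
  also have "\<dots> \<le> elem_sym y A j" by (rule elem_sym_ge[OF assms(1-3)])
  finally show ?thesis .
qed

lemma exp_half_le_2: "exp (1 / 2 :: real) \<le> 2"
proof -
  have "exp (1/2 :: real) ^ 2 = exp 1" by (simp add: power2_eq_square mult_exp_exp)
  also have "\<dots> \<le> 2 ^ 2" using exp_le by simp
  finally show ?thesis by (rule power2_le_imp_le) simp
qed

text \<open>All growth conditions are isolated as inequalities in L = log D, l = log L and s =
  sqrt(L / l), which keeps the argument free of asymptotics. A1 to A3 fix the relative sizes of D, x
  and the two sets of primes; A4 and A5 give the mass of the primes just below x; A6 and A7 bound
  the sum at length x; A8 and A9 are the truncation and averaging errors; A11 to A13 and A15 make
  degrees and thresholds fit; A10 is what is contradicted in the end.\<close>

lemma exists_small_sum_if_bounds: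
  fixes a \<rho> \<theta> V C \<epsilon> L\<^sub>0 L l s :: real and \<phi> :: "real \<Rightarrow> real"
  assumes lip: "\<And>x y. 0 \<le> x \<Longrightarrow> 0 \<le> y \<Longrightarrow> \<bar>\<phi> x - \<phi> y\<bar> \<le> L\<^sub>0 * \<bar>x - y\<bar>" and L0: "0 \<le> L\<^sub>0" and \<epsilon>: "0 < \<epsilon>"
    and one: "\<And>x. 0 \<le> x \<Longrightarrow> x < \<epsilon> \<Longrightarrow> \<phi> x = 1" and zero: "\<And>x. x > 2 \<Longrightarrow> \<phi> x = 0"
    and C: "\<And>y. 0 \<le> y \<Longrightarrow> \<bar>\<phi> y\<bar> \<le> C" and V: "V > 0"
    and psi: "\<forall>v\<ge>V. \<forall>h :: nat \<Rightarrow> real. (\<forall>k\<ge>1. 0 \<le> h k \<and> h k \<le> 1) \<longrightarrow> (\<forall>p. prime p \<longrightarrow> 2 < p \<longrightarrow> 3 / 4 \<le> h p) \<longrightarrow>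
    1 \<le> (\<Sum>k | 1 \<le> k \<and> real k ^ 2 \<le> 2 * v. h k / real k * \<phi> (real k ^ 2 / v))"
    and a: "0 < a" "a < 2 / 9" and \<theta>: "12 * \<theta> = 1 / 2 - 9 * a / 4" and c0: "0 < c0" "c0 = \<theta> / 100"
    and \<rho>: "0 < \<rho>" "sqrt c0 = 16 * 24 ^ 6 * \<rho>" and l: "l = ln L" and s: "s = sqrt (L / l)"
    and L: "12 \<le> l" "6 \<le> L"
    and A1: "2 * exp (a * L) \<le> exp L"
    and A2: "2 * exp (4 * \<rho> * (s * l)) < exp (a * L)"
    and A3: "L ^ 2 * exp (2 * \<rho> * (s * l)) \<le> exp (a * L)"
    and A4: "a + 6 \<le> \<rho> * (s * l)"
    and A5: "3 * \<rho> * (s * l) + 6 \<le> a * L"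
    and A6: "4 * sqrt c0 * (s * l) \<le> L"
    and A7: "(\<epsilon> * exp (a * L) / 2) powr (-1/4) * exp (2 * sqrt c0 * s * sqrt L + 6) \<le> 1"
    and A8: "8 * (C + exp (\<rho> / 6 * s)) * (1 + L) * exp (8 * sqrt c0 * s) \<le> exp (\<theta> / 4 * (L / l))"
    and A9: "17496 * L ^ 2 * (C + exp (\<rho> / 6 * s)) * (12 * L + 7) \<le> exp (6 * \<theta> * L)"
    and A10: "24 ^ 9 * L ^ 2 * (20 * L\<^sub>0 * L + 2 * exp (\<rho> / 6 * s) + 2) < exp (\<rho> / 3 * s - 1)"
    and A11: "2 * \<rho> * s + 4 \<le> L"
    and A12: "V \<le> exp (\<rho> / 3 * (s * l))"
    and A13: "\<theta> * (L / l) + 1 \<le> L"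
    and A15: "\<rho> / 3 * 16 * s \<le> L"
  shows "\<exists>m\<in>sqfree_family (exp L). (\<Sum>n=1..nat \<lfloor>2 * exp (a * L)\<rfloor>. real_of_int (kronecker (8 * m) n) / sqrt (real n) * \<phi> (real n / exp (a * L)))
     \<le> - exp (\<rho> / 6 * s)"
proof (rule ccontr)
  assume no: "\<not> ?thesis"
  define D where "D = exp L"
  define x where "x = exp (a * L)"
  define M where "M = exp (\<rho> / 6 * s)"
  define U where "U = exp (\<rho> * (s * l))"
  define P where "P = {p::nat. prime p \<and> L < real p \<and> real p \<le> L ^ 2}"
  \<comment> \<open>Since U = L^(\<rho> s), this window makes x / p run through the range from U to
    U^2.\<close>
  define T\<^sub>0 where "T\<^sub>0 = {p::nat. prime p \<and> x / U ^ 2 < real p \<and> real p \<le> x / U}"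
  define om where "om = sqrt c0 * s"
  define b where "b = (\<lambda>p. if p \<in> P then om / sqrt (real p) * (1 - vanish_prob p) else 0)"
  \<comment> \<open>The primes of \<open>P\<close> lie between L and L^2. J + 1 of them have product
    above L^(2 \<rho> s + 3), hence above 2 U^2, while \<open>j\<close> of them have product at most
    U^(2/3), which leaves a length U^(1/3) \<ge> V for the square part.\<close>
  define j where "j = nat \<lfloor>\<rho> * s / 3\<rfloor>"
  define J where "J = nat \<lceil>2 * \<rho> * s + 2\<rceil>"
  have L1: "1 < L" "0 < L" using L by auto
  have Lexp: "L = exp l" using L1 by (simp add: l)
  have s0: "0 \<le> s" "s ^ 2 = L / l" using L by (auto simp: s)
  have sl: "0 \<le> s * l" using s0 L by simp
  have \<theta>0: "0 < \<theta>" using c0 by simp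
  have c01: "c0 \<le> 1" using c0 \<theta> a by simp
  have om0: "0 \<le> om" "om ^ 2 = c0 * (L / l)" using c0 s0 by (auto simp: om_def power_mult_distrib)
  have x1: "1 \<le> x" using a L1 by (simp add: x_def)
  have U0: "0 < U" "U ^ 2 = exp (2 * \<rho> * (s * l))" "U ^ 4 = exp (4 * \<rho> * (s * l))"
    by (simp_all add: U_def exp_of_nat_mult[symmetric] mult_ac)
  have finP: "finite P" "finite T\<^sub>0" by (simp_all add: P_def T\<^sub>0_def)
  have P: "prime p \<and> L < real p \<and> real p \<le> L ^ 2" if "p \<in> P" for p using that by (simp add: P_def)
  have om_L: "om \<le> sqrt L"
  proof (rule real_le_rsqrt)
    have "c0 * (L / l) \<le> 1 * (L / 1)" using c0 c01 L by (intro mult_mono divide_left_mono) auto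
    thus "om ^ 2 \<le> L" by (simp add: om0)
  qed
  have om_p: "om / sqrt (real p) \<le> 1" if "p \<in> P" for p
  proof -
    have "sqrt L \<le> sqrt (real p)" using P[OF that] by simp
    hence "om \<le> sqrt (real p)" using om_L by linarith
    thus ?thesis using P[OF that] L1 by (simp add: divide_le_eq_1)
  qed
  have sumP: "1 / 4 \<le> (\<Sum>p\<in>P. 1 / real p)" "(\<Sum>p\<in>P. 1 / real p) \<le> 2"
  proof -
    have 1: "1 < L" "L \<le> L ^ 2" using L1 by (auto intro: self_le_power)
    have ln: "ln (L ^ 2 / L) = l" "ln (L ^ 2) = 2 * l" using L1 by (simp_all add: l power2_eq_square ln_mult)
    have "(l - 6) / (2 * l) \<le> (\<Sum>p\<in>P. 1 / real p)" "(\<Sum>p\<in>P. 1 / real p) \<le> (l + 6) / l"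
      using sum_inverse_primes_block[OF 1] unfolding ln P_def l[symmetric] by auto
    moreover have "1 / 4 \<le> (l - 6) / (2 * l)" using L by (simp add: field_simps)
    moreover have "(l + 6) / l \<le> 2" using L by (simp add: field_simps)
    ultimately show "1 / 4 \<le> (\<Sum>p\<in>P. 1 / real p)" "(\<Sum>p\<in>P. 1 / real p) \<le> 2" by linarith+
  qed
  have b0: "0 \<le> b p" for p using om0 vanish_prob_bounds[of p] by (simp add: b_def)
  have b1: "b p \<le> om / sqrt (real p)" for p
    using om0 vanish_prob_bounds[of p] mult_left_mono[of "1 - vanish_prob p" 1 "om / sqrt (real p)"] by (simp add: b_def)

  have large: "\<exists>i\<le>J. exp (\<rho> / 3 * s - 1) / 24 ^ 9 \<le> \<bar>smoothed_sum (\<lambda>r. real i / real J * b r) \<phi> (x / real p)\<bar>"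
    if p: "p \<in> T\<^sub>0" for p
  proof -
    have j1: "real j \<le> \<rho> * s / 3" "\<rho> * s / 3 < real j + 1"
      using \<rho> s0 by (auto simp: j_def) linarith
    have p0: "0 < real p" using p prime_gt_0_nat by (auto simp: T\<^sub>0_def)
    have u: "U \<le> x / real p" "x / real p < U ^ 2"
      using p p0 U0 by (auto simp: T\<^sub>0_def field_simps)
    have u1: "2 * (x / real p) < L ^ (J + 1)"
    proof -
      have "2 * exp (2 * \<rho> * (s * l)) \<le> exp (3 * l) * exp (2 * \<rho> * (s * l))"
      proof (rule mult_right_mono)
        have "1 + 3 * l \<le> exp (3 * l)" by (rule exp_ge_add_one_self)
        thus "2 \<le> exp (3 * l)" using L by linarith
      qed simp
      also have "\<dots> = exp ((2 * \<rho> * s + 3) * l)" by (simp add: exp_add[symmetric] algebra_simps)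
      also have "\<dots> \<le> exp (real (J + 1) * l)"
      proof -
        have "2 * \<rho> * s + 3 \<le> real (J + 1)" unfolding J_def by linarith
        thus ?thesis using L by simp
      qed
      also have "\<dots> = L ^ (J + 1)" by (simp only: Lexp exp_of_nat_mult)
      finally show ?thesis using u U0 by simp
    qed
    have u2: "(L ^ 2) ^ j * V \<le> x / real p"
    proof -
      have "(L ^ 2) ^ j = exp (real (2 * j) * l)" by (simp only: Lexp exp_of_nat_mult power_mult)
      also have "\<dots> \<le> exp (2 * \<rho> / 3 * (s * l))"
      proof -
        have "2 * real j * l \<le> 2 * (\<rho> * s / 3) * l" using j1 L by (intro mult_right_mono mult_left_mono) auto
        thus ?thesis by (simp add: mult_ac)
      qed
      finally have "(L ^ 2) ^ j * V \<le> exp (2 * \<rho> / 3 * (s * l)) * exp (\<rho> / 3 * (s * l))"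
        using A12 V by (intro mult_mono) auto
      also have "\<dots> = U" by (simp add: U_def exp_add[symmetric] field_simps)
      finally show ?thesis using u by simp
    qed
    have J0: "0 < J"
    proof -
      have "0 \<le> 2 * \<rho> * s" using \<rho> s0 by simp
      hence "2 \<le> real J" unfolding J_def by linarith
      thus ?thesis by simp
    qed
    have "\<exists>i\<le>J. elem_sym (\<lambda>p. b p / sqrt (real p)) P j / 24 ^ J \<le> \<bar>smoothed_sum (\<lambda>r. real i / real J * b r) \<phi> (x / real p)\<bar>"
    proof (rule exists_node_smoothed_sum_large[OF finP(1) P b0 _ _ u1 u2 J0 V _ psi])
      show "b p = 0" if "p \<notin> P" for p using that by (simp add: b_def)
    qed (use L1 in auto)
    moreover have "exp (\<rho> / 3 * s - 1) / 24 ^ 9 \<le> elem_sym (\<lambda>p. b p / sqrt (real p)) P j / 24 ^ J"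
    proof -
      have S: "om / 8 \<le> (\<Sum>p\<in>P. b p / sqrt (real p))"
      proof -
        have "om / 2 * (1 / 4) \<le> om / 2 * (\<Sum>p\<in>P. 1 / real p)" using sumP om0 by (intro mult_left_mono) auto
        also have "\<dots> = (\<Sum>p\<in>P. om / 2 * (1 / real p))" by (simp only: sum_distrib_left)
        also have "\<dots> \<le> (\<Sum>p\<in>P. b p / sqrt (real p))"
        proof (rule sum_mono)
          fix p assume p: "p \<in> P"
          have p2: "2 < real p" using P[OF p] L by linarith
          have "vanish_prob p \<le> 1 / 2" using p2 by (simp add: vanish_prob_def)
          hence "om / real p * (1 / 2) \<le> om / real p * (1 - vanish_prob p)" using om0 by (intro mult_left_mono) auto
          also have "\<dots> = b p / sqrt (real p)" using p by (simp add: b_def)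
          finally show "om / 2 * (1 / real p) \<le> b p / sqrt (real p)" by simp
        qed
        finally show ?thesis by simp
      qed
      \<comment> \<open>The relation between \<open>c0\<close> and \<rho> is made for this: half of
        the lower bound om / 8 for the sum is 24^6 \<rho> s, which is at least 3 * 24^6 * j.\<close>
      have "(3 * 24 ^ 6) ^ j \<le> elem_sym (\<lambda>p. b p / sqrt (real p)) P j"
      proof (rule elem_sym_ge_power[OF finP(1)])
        fix p assume p: "p \<in> P"
        have "b p / sqrt (real p) \<le> om / sqrt (real p) / sqrt (real p)" using b1[of p] by (intro divide_right_mono) auto
        also have "\<dots> = om / real p" by simp
        also have "\<dots> \<le> om / L" using P[OF p] L1 om0 by (intro divide_left_mono) auto
        finally show "0 \<le> b p / sqrt (real p) \<and> b p / sqrt (real p) \<le> om / L" using b0[of p] by simp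
      next
        have "16 * real j \<le> L" using j1 A15 by simp
        hence "real j * (om / L) \<le> om / 16" using L1 om0 mult_left_mono[of "16 * real j" L om] by (simp add: field_simps)
        thus "real j * (om / L) \<le> (\<Sum>p\<in>P. b p / sqrt (real p)) / 2" using S by linarith
        have "3 * 24 ^ 6 * real j \<le> 3 * 24 ^ 6 * (\<rho> * s / 3)" using j1 by (intro mult_left_mono) auto
        also have "\<dots> = om / 16" by (simp add: om_def \<rho>(2))
        finally show "3 * 24 ^ 6 * real j \<le> (\<Sum>p\<in>P. b p / sqrt (real p)) / 2" using S by linarith
      qed simp
      hence "(3 * 24 ^ 6) ^ j / 24 ^ J \<le> elem_sym (\<lambda>p. b p / sqrt (real p)) P j / 24 ^ J" by (intro divide_right_mono) auto
      \<comment> \<open>As J \<le> 6 j + 9, interpolation consumes at most 24^(6 j + 9), leaving 3^j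
        / 24^9.\<close>
      moreover have "exp (\<rho> / 3 * s - 1) / 24 ^ 9 \<le> (3 * 24 ^ 6) ^ j / 24 ^ J"
      proof -
        have "0 \<le> 2 * \<rho> * s" using \<rho> s0 by simp
        hence "real J \<le> 2 * \<rho> * s + 3" unfolding J_def by linarith
        hence "real J < real (6 * j + 9) + 1" using j1 by simp
        hence "J \<le> 6 * j + 9" by linarith
        hence "(24::real) ^ J \<le> 24 ^ (6 * j + 9)" by (intro power_increasing) auto
        hence "(3 * 24 ^ 6) ^ j / (24 ^ (6 * j + 9)) \<le> (3 * 24 ^ 6) ^ j / (24::real) ^ J" by (intro divide_left_mono) auto
        moreover have "(3 * 24 ^ 6) ^ j / (24::real) ^ (6 * j + 9) = 3 ^ j / 24 ^ 9"
          by (simp only: power_mult_distrib power_add power_mult) simp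
        moreover have "exp (\<rho> / 3 * s - 1) \<le> 3 ^ j"
        proof -
          have "exp (\<rho> / 3 * s - 1) \<le> exp (real j * 1)" using j1 by simp
          also have "\<dots> = exp 1 ^ j" by (rule exp_of_nat_mult)
          also have "\<dots> \<le> 3 ^ j" using exp_le by (intro power_mono) auto
          finally show ?thesis .
        qed
        hence "exp (\<rho> / 3 * s - 1) / 24 ^ 9 \<le> 3 ^ j / 24 ^ 9" by (rule divide_right_mono) simp
        ultimately show ?thesis by linarith
      qed
      ultimately show ?thesis by linarith
    qed
    ultimately show ?thesis using order.trans by blast
  qed
  \<comment> \<open>The tilt has to be the same for all primes of the factor \<open>B\<close>.
    Restricting to the primes served by one node costs a factor J + 1 of their mass.\<close>
  obtain i T where iT: "i \<le> J" "T \<subseteq> T\<^sub>0"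
    "\<And>p. p \<in> T \<Longrightarrow> exp (\<rho> / 3 * s - 1) / 24 ^ 9 \<le> \<bar>smoothed_sum (\<lambda>r. real i / real J * b r) \<phi> (x / real p)\<bar>"
    "(\<Sum>p\<in>T\<^sub>0. 1 / real p) / (real J + 1) \<le> (\<Sum>p\<in>T. 1 / real p)"
    using pigeonhole_weighted[OF finP(2) large, of "\<lambda>p. p" "\<lambda>p. 1 / real p"] by blast
  define \<kappa> where "\<kappa> = real i / real J"
  have \<kappa>: "0 \<le> \<kappa>" "\<kappa> \<le> 1" using iT(1) by (auto simp: \<kappa>_def divide_le_eq_1)
  \<comment> \<open>Mertens on a window of logarithmic width \<rho> s l ending below a L. The mass
    is of order s l / L, of which only 1 / L is kept; the upper bound 1 keeps the factors 1 + w
    bounded.\<close>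
  have w0: "1 / L \<le> (\<Sum>p\<in>T\<^sub>0. 1 / real p)" "(\<Sum>p\<in>T\<^sub>0. 1 / real p) \<le> 1"
  proof -
    have x2: "x = exp (a * L)" by (simp add: x_def)
    have ln: "ln (x / U / (x / U ^ 2)) = \<rho> * (s * l)" "ln (x / U) = a * L - \<rho> * (s * l)" "ln (x / U ^ 2) = a * L - 2 * \<rho> * (s * l)"
    proof -
      have "x / U / (x / U ^ 2) = U" using U0(1) x1 by (simp add: power2_eq_square)
      thus "ln (x / U / (x / U ^ 2)) = \<rho> * (s * l)" by (simp add: U_def)
      have "x / U = exp (a * L - \<rho> * (s * l))" by (simp add: x_def U_def exp_diff)
      thus "ln (x / U) = a * L - \<rho> * (s * l)" by simp
      have "x / U ^ 2 = exp (a * L - 2 * \<rho> * (s * l))" unfolding U0(2) by (simp add: x_def exp_diff)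
      thus "ln (x / U ^ 2) = a * L - 2 * \<rho> * (s * l)" by simp
    qed
    have rs: "6 < \<rho> * (s * l)" using A4 a by linarith
    have y1: "1 < x / U ^ 2"
    proof -
      have "0 < a * L - 2 * \<rho> * (s * l)" using A5 rs by simp
      moreover have "x / U ^ 2 = exp (a * L - 2 * \<rho> * (s * l))" unfolding U0(2) by (simp add: x_def exp_diff)
      ultimately show ?thesis by simp
    qed
    have U1: "1 \<le> U" using rs by (simp add: U_def)
    have yz: "x / U ^ 2 \<le> x / U"
    proof -
      have "U * 1 \<le> U * U" using U1 by (intro mult_left_mono) auto
      thus ?thesis using U1 x1 by (intro divide_left_mono) (auto simp: power2_eq_square)
    qed
    have bl: "(\<rho> * (s * l) - 6) / (a * L - \<rho> * (s * l)) \<le> (\<Sum>p\<in>T\<^sub>0. 1 / real p)"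
      "(\<Sum>p\<in>T\<^sub>0. 1 / real p) \<le> (\<rho> * (s * l) + 6) / (a * L - 2 * \<rho> * (s * l))"
      using sum_inverse_primes_block[OF y1 yz] unfolding ln T\<^sub>0_def by auto
    have "1 / L = a / (a * L)" using a by simp
    also have "\<dots> \<le> (\<rho> * (s * l) - 6) / (a * L - \<rho> * (s * l))"
      using A4 A5 rs a by (intro frac_le) auto
    finally show "1 / L \<le> (\<Sum>p\<in>T\<^sub>0. 1 / real p)" using bl(1) by linarith
    have "(\<rho> * (s * l) + 6) / (a * L - 2 * \<rho> * (s * l)) \<le> 1" using A5 rs by (simp add: divide_le_eq_1 mult_ac)
    thus "(\<Sum>p\<in>T\<^sub>0. 1 / real p) \<le> 1" using bl(2) by linarith
  qed
  define w where "w = (\<Sum>p\<in>T. 1 / real p)"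
  have w1: "w \<le> 1" "0 \<le> w"
  proof -
    have "w \<le> (\<Sum>p\<in>T\<^sub>0. 1 / real p)" unfolding w_def using finP iT(2) by (intro sum_mono2) auto
    thus "w \<le> 1" using w0 by linarith
    show "0 \<le> w" unfolding w_def by (intro sum_nonneg) auto
  qed
  define t where "t = (\<lambda>p. if p \<in> P then \<kappa> * (om / sqrt (real p)) else 0)"
  have tb: "(\<lambda>p. t p * (1 - vanish_prob p)) = (\<lambda>p. \<kappa> * b p)" by (auto simp: t_def b_def)
  have t_le: "t p \<le> om / sqrt (real p)" "0 \<le> t p" for p
    using \<kappa> om0 mult_right_mono[of \<kappa> 1 "om / sqrt (real p)"] by (auto simp: t_def)
  \<comment> \<open>The tilted primes are at most L^2, so the exponential is exp(2 om sqrt L + 6),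
    which A7 weighs against the power of x; everything else is linear in L.\<close>
  have sm_x: "\<bar>smoothed_sum (\<lambda>p. \<kappa> * b p) \<phi> x\<bar> \<le> 10 * L\<^sub>0 * L"
  proof -
    have "\<bar>smoothed_sum (\<lambda>p. \<kappa> * b p) \<phi> x\<bar> \<le> 2 * L\<^sub>0 * (ln (2 * x) / 2 + 1 + (2 * om * ln (L ^ 2) + 2 * (ln (2 * x) + 2))
      + 4 * (\<epsilon> * x / 2) powr (-1/4) * exp (2 * om * (L ^ 2) powr (1/4) + 6))"
    proof (rule smoothed_sum_le[OF lip L0 \<epsilon> one zero x1 finP(1) _ sumP(2)])
      show "\<kappa> * b p \<le> om / sqrt (real p)" for p
        using b1[of p] b0[of p] \<kappa> mult_right_mono[of \<kappa> 1 "b p"] by linarith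
      show "om / real p \<le> 1 / 2" if "p \<in> P" for p
      proof -
        have "2 * sqrt L \<le> L"
        proof -
          have "2 \<le> sqrt L" using L by (intro real_le_rsqrt) auto
          hence "2 * sqrt L \<le> sqrt L * sqrt L" using L1 by (intro mult_right_mono) auto
          thus ?thesis using L1 by simp
        qed
        hence "2 * om \<le> real p" using om_L P[OF that] by linarith
        thus ?thesis using P[OF that] L1 by (simp add: field_simps)
      qed
    qed (use P b0 \<kappa> om0 L1 in \<open>auto simp: b_def\<close>)
    also have "\<dots> \<le> 2 * L\<^sub>0 * (5 * L)"
    proof (rule mult_left_mono)
      have ln2x: "ln (2 * x) \<le> L"
      proof -
        have "ln (2 * x) \<le> ln (exp L)" using A1 x1 unfolding x_def by (subst ln_le_cancel_iff) auto
        thus ?thesis by simp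
      qed
      have "2 * om * ln (L ^ 2) = 4 * sqrt c0 * (s * l)" using L1 by (simp add: om_def l ln_realpow)
      hence "2 * om * ln (L ^ 2) \<le> L" using A6 by linarith
      moreover have "(\<epsilon> * x / 2) powr (-1/4) * exp (2 * om * (L ^ 2) powr (1/4) + 6) \<le> 1"
      proof -
        have "L ^ 2 = L powr 2" using L1 by simp
        hence "(L ^ 2) powr (1/4) = L powr (2 * (1/4))" by (simp only: powr_powr)
        also have "2 * (1 / 4) = (1 / 2 :: real)" by simp
        also have "L powr (1/2) = sqrt L" using L1 by (intro powr_half_sqrt) auto
        finally show ?thesis using A7 by (simp add: x_def om_def mult_ac)
      qed
      ultimately show "ln (2 * x) / 2 + 1 + (2 * om * ln (L ^ 2) + 2 * (ln (2 * x) + 2))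
      + 4 * (\<epsilon> * x / 2) powr (-1/4) * exp (2 * om * (L ^ 2) powr (1/4) + 6) \<le> 5 * L"
        using ln2x L unfolding mult.assoc by argo
    qed (use L0 in simp)
    finally show ?thesis by simp
  qed
  \<comment> \<open>A degree of \<theta> L / l keeps (L^2)^Jt below exp(2 \<theta> L), a small power
    of D.\<close>
  define Jt where "Jt = nat \<lfloor>\<theta> * (L / l)\<rfloor>"
  \<comment> \<open>Balances Y x^(3/2) against D / Y: both become exp((1/2 + 3a/4) L), up to small
    powers.\<close>
  define Y where "Y = nat \<lceil>exp ((1 / 2 - 3 * a / 4) * L)\<rceil>"
  have Ll: "0 \<le> \<theta> * (L / l)" using \<theta>0 L by simp
  have Jt: "real Jt \<le> \<theta> * (L / l)" "\<theta> * (L / l) < real Jt + 1"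
    using Ll by (auto simp: Jt_def)
  have C0: "0 \<le> C" using C[of 0] by linarith
  have M0: "0 \<le> M" by (simp add: M_def)
  have ln2x: "ln (2 * x) \<le> L" "0 \<le> ln (2 * x)"
  proof -
    have "ln (2 * x) \<le> ln (exp L)" using A1 x1 unfolding x_def by (subst ln_le_cancel_iff) auto
    thus "ln (2 * x) \<le> L" by simp
    show "0 \<le> ln (2 * x)" using x1 by simp
  qed
  define TR where "TR = exp (\<Sum>p\<in>P. 12 * t p ^ 2) * ((C + M) * (1 + 3 * w)
         * (exp (\<Sum>p\<in>P. 4 * t p / sqrt (real p)) * (1 + ln (2 * x)))) / 2 ^ Jt"
  define ER where "ER = ((real Jt + 1) * 9 * (L ^ 2) ^ Jt) ^ 2 * (27 * (C + M) * x * sqrt x)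
         * family_error D Y (((L ^ 2) ^ Jt) ^ 2 * (2 * x ^ 3)) / (D / 8)"
  have main: "(\<Sum>p\<in>T. \<bar>smoothed_sum (\<lambda>p. \<kappa> * b p) \<phi> (x / real p)\<bar> / real p)
     \<le> (\<bar>smoothed_sum (\<lambda>p. \<kappa> * b p) \<phi> x\<bar> + M) * (1 + w) + TR + ER"
    unfolding w_def TR_def ER_def tb[symmetric]
  proof (rule resonance_inequality)
    show "1 \<le> D" "2 * x \<le> D" "1 \<le> x" using A1 L1 x1 by (auto simp: D_def x_def)
    show "1 \<le> Y"
    proof -
      have "0 < exp ((1 / 2 - 3 * a / 4) * L)" by simp
      thus ?thesis unfolding Y_def by linarith
    qed
    show "prime p \<and> real p \<le> 2 * x \<and> real p \<le> L ^ 2" if "p \<in> P" for p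
    proof -
      have "L ^ 2 * 1 \<le> L ^ 2 * exp (2 * \<rho> * (s * l))" using \<rho> sl by (intro mult_left_mono) auto
      hence "L ^ 2 \<le> x" using A3 by (simp add: x_def)
      thus ?thesis using P[OF that] x1 by linarith
    qed
    show "1 \<le> L ^ 2" using L1 by (simp add: one_le_power)
    thus "1 \<le> L ^ 2" .
    show "real (card P) \<le> L ^ 2"
    proof -
      have "P \<subseteq> {1..nat \<lfloor>L ^ 2\<rfloor>}" using prime_ge_1_nat by (auto simp: P_def le_nat_iff le_floor_iff)
      hence "card P \<le> nat \<lfloor>L ^ 2\<rfloor>" using card_mono[of "{1..nat \<lfloor>L ^ 2\<rfloor>}" P] by simp
      hence "real (card P) \<le> real (nat \<lfloor>L ^ 2\<rfloor>)" by (simp only: of_nat_le_iff)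
      also have "\<dots> \<le> L ^ 2" by simp
      finally show ?thesis .
    qed
    have xU: "2 * x < (x / U ^ 2) ^ 2" "L ^ 2 \<le> x / U ^ 2"
    proof -
      have "2 * U ^ 4 < x" using A2 by (simp add: U0 x_def)
      hence "2 * U ^ 4 * x < x * x" using x1 by (intro mult_strict_right_mono) auto
      thus "2 * x < (x / U ^ 2) ^ 2" using U0(1) by (simp add: field_simps power2_eq_square power4_eq_xxxx)
      show "L ^ 2 \<le> x / U ^ 2" using A3 U0(1) by (simp add: U0(2) x_def pos_le_divide_eq)
    qed
    show "prime p \<and> real p \<le> x" if "p \<in> T" for p
    proof -
      have "x / U \<le> x / 1" using A4 a sl x1 U0 unfolding U_def by (intro divide_left_mono) auto
      thus ?thesis using that iT(2) by (auto simp: T\<^sub>0_def)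
    qed
    have Tge: "x / U ^ 2 < real p" if "p \<in> T" for p using that iT(2) by (auto simp: T\<^sub>0_def)
    show "T \<inter> P = {}"
    proof -
      have "p \<notin> P" if "p \<in> T" for p using Tge[OF that] xU(2) by (auto simp: P_def)
      thus ?thesis by blast
    qed
    show "2 * x < real p * real r" if "p \<in> T" "r \<in> T" for p r
    proof -
      have "(x / U ^ 2) * (x / U ^ 2) \<le> real p * real r"
        using Tge[OF that(1)] Tge[OF that(2)] x1 U0(1) by (intro mult_mono) auto
      thus ?thesis using xU(1) unfolding power2_eq_square[of "x / U ^ 2"] by linarith
    qed
    show "0 \<le> t p \<and> t p \<le> 1" if "p \<in> P" for p using t_le[of p] om_p[OF that] by linarith
    show "t p = 0" if "p \<notin> P" for p using that by (simp add: t_def)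
    show "\<bar>\<phi> y\<bar> \<le> C" if "0 \<le> y" for y by (rule C[OF that])
    show "0 \<le> M" by (rule M0)
    show "- M \<le> (\<Sum>n=1..nat \<lfloor>2 * x\<rfloor>. real_of_int (kronecker (8 * m) n) / sqrt (real n) * \<phi> (real n / x))"
      if "m \<in> sqfree_family D" for m
    proof -
      have "\<not> (\<Sum>n=1..nat \<lfloor>2 * x\<rfloor>. real_of_int (kronecker (8 * m) n) / sqrt (real n) * \<phi> (real n / x)) \<le> - M"
        using no that unfolding x_def M_def D_def by blast
      thus ?thesis by linarith
    qed
  qed
  \<comment> \<open>The sum of the 12 t^2 is at most 24 c0 L / l = 0.24 \<theta> L / l, and A8
    bounds the remaining factors by exp(0.25 \<theta> L / l). The total 0.49 \<theta> L / l is less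
    than half of Jt + 1, and exp(1/2) \<le> 2 turns this into the gain. The denominator 100 in
    \<open>c0\<close> is chosen for this.\<close>
  have TR: "TR \<le> 1"
  proof -
    have e1: "(\<Sum>p\<in>P. 12 * t p ^ 2) \<le> 24 / 100 * \<theta> * (L / l)"
    proof -
      have "(\<Sum>p\<in>P. 12 * t p ^ 2) \<le> (\<Sum>p\<in>P. 12 * om ^ 2 * (1 / real p))"
      proof (rule sum_mono)
        fix p
        have "t p ^ 2 \<le> (om / sqrt (real p)) ^ 2" using t_le[of p] by (intro power_mono)
        thus "12 * t p ^ 2 \<le> 12 * om ^ 2 * (1 / real p)" by (simp add: power_divide)
      qed
      also have "\<dots> = 12 * om ^ 2 * (\<Sum>p\<in>P. 1 / real p)" by (simp only: sum_distrib_left)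
      also have "\<dots> \<le> 12 * om ^ 2 * 2" using sumP by (intro mult_left_mono) auto
      also have "\<dots> = 24 / 100 * \<theta> * (L / l)" by (simp add: om0 c0(2))
      finally show ?thesis .
    qed
    have e2: "(\<Sum>p\<in>P. 4 * t p / sqrt (real p)) \<le> 8 * sqrt c0 * s"
    proof -
      have "(\<Sum>p\<in>P. 4 * t p / sqrt (real p)) \<le> (\<Sum>p\<in>P. 4 * om * (1 / real p))"
      proof (rule sum_mono)
        fix p
        have "4 * t p / sqrt (real p) \<le> 4 * (om / sqrt (real p)) / sqrt (real p)"
          using t_le[of p] by (intro divide_right_mono mult_left_mono) auto
        thus "4 * t p / sqrt (real p) \<le> 4 * om * (1 / real p)" by simp
      qed
      also have "\<dots> = 4 * om * (\<Sum>p\<in>P. 1 / real p)" by (simp only: sum_distrib_left)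
      also have "\<dots> \<le> 4 * om * 2" using sumP om0 by (intro mult_left_mono) auto
      finally show ?thesis by (simp add: om_def)
    qed
    have "exp (\<Sum>p\<in>P. 12 * t p ^ 2) * ((C + M) * (1 + 3 * w) * (exp (\<Sum>p\<in>P. 4 * t p / sqrt (real p)) * (1 + ln (2 * x))))
      \<le> exp (24 / 100 * \<theta> * (L / l)) * ((C + M) * 4 * (exp (8 * sqrt c0 * s) * (1 + L)))"
      using e1 e2 w1 C0 M0 ln2x by (intro mult_mono mult_nonneg_nonneg) auto
    also have "\<dots> = exp (24 / 100 * \<theta> * (L / l)) * (8 * (C + M) * (1 + L) * exp (8 * sqrt c0 * s)) / 2" by (simp add: algebra_simps)
    also have "\<dots> \<le> exp (24 / 100 * \<theta> * (L / l)) * exp (\<theta> / 4 * (L / l)) / 2"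
      using A8 unfolding M_def by (intro divide_right_mono mult_left_mono) auto
    also have "\<dots> = exp (49 / 100 * (\<theta> * (L / l))) / 2" by (simp add: exp_add[symmetric])
    also have "\<dots> \<le> exp (1 / 2 * (real Jt + 1)) / 2"
    proof -
      have "49 / 100 * u \<le> 1 / 2 * (v + 1)" if "u < v + 1" "0 \<le> u" for u v :: real
        using that by argo
      hence "49 / 100 * (\<theta> * (L / l)) \<le> 1 / 2 * (real Jt + 1)" using Jt(2) Ll by blast
      thus ?thesis by (intro divide_right_mono) auto
    qed
    also have "exp (1 / 2 * (real Jt + 1)) = exp (1 / 2) ^ (Jt + 1)"
      by (subst exp_of_nat_mult[symmetric]) (simp add: mult.commute)
    also have "\<dots> / 2 \<le> 2 ^ (Jt + 1) / 2"
      using exp_half_le_2 by (intro divide_right_mono power_mono) auto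
    also have "\<dots> = 2 ^ Jt" by simp
    finally show ?thesis unfolding TR_def by (simp add: divide_le_eq_1)
  qed
  \<comment> \<open>In powers of D: 4\<theta> from the squared coefficients of the resonator, 3a/2
    from the other coefficients, 1/2 + 3a/4 + 2\<theta> from the family error, -1 from the density.
    As 12\<theta> = 1/2 - 9a/4 these add up to -6\<theta>, which by A9 absorbs M and the powers of
    L.\<close>
  have ER: "ER \<le> 1"
  proof -
    define y where "y = 1 / 2 - 3 * a / 4"
    define e where "e = (L ^ 2) ^ Jt"
    have e1: "e \<le> exp (2 * \<theta> * L)" "1 \<le> e"
    proof -
      have "e = exp (real (2 * Jt) * l)" unfolding e_def by (simp only: Lexp exp_of_nat_mult power_mult)
      also have "\<dots> \<le> exp (2 * \<theta> * L)"
      proof -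
        have "2 * real Jt * l \<le> 2 * (\<theta> * (L / l)) * l" using Jt L by (intro mult_right_mono mult_left_mono) auto
        thus ?thesis using L by simp
      qed
      finally show "e \<le> exp (2 * \<theta> * L)" .
      show "1 \<le> e" unfolding e_def using L1 by (simp add: one_le_power)
    qed
    have sq: "exp u ^ 2 = exp (2 * u)" for u :: real by (simp add: exp_double)
    have f1: "((real Jt + 1) * 9 * e) ^ 2 \<le> (L * 9 * exp (2 * \<theta> * L)) ^ 2"
      using Jt A13 e1 L1 by (intro power_mono mult_mono) auto
    have xs: "x * sqrt x = exp (3 / 2 * a * L)"
    proof -
      have "sqrt x = exp (a * L / 2)"
        by (rule real_sqrt_unique) (simp_all add: sq x_def)
      thus ?thesis by (simp add: x_def exp_add[symmetric])
    qed
    have Y: "exp (y * L) \<le> real Y" "real Y \<le> 2 * exp (y * L)"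
    proof -
      have "0 \<le> y * L" using a L1 by (simp add: y_def)
      hence "1 \<le> exp (y * L)" by simp
      thus "exp (y * L) \<le> real Y" "real Y \<le> 2 * exp (y * L)"
        unfolding Y_def y_def[symmetric] by linarith+
    qed
    define X where "X = 2 * exp ((4 * \<theta> + 3 * a) * L)"
    have XX: "1 \<le> e ^ 2 * (2 * x ^ 3)" "e ^ 2 * (2 * x ^ 3) \<le> X"
    proof -
      have "1 * 1 \<le> e ^ 2 * (2 * x ^ 3)" using e1 one_le_power[OF x1, of 3] by (intro mult_mono one_le_power) auto
      thus "1 \<le> e ^ 2 * (2 * x ^ 3)" by simp
      have "e ^ 2 \<le> exp (2 * \<theta> * L) ^ 2" using e1 by (intro power_mono) auto
      hence "e ^ 2 * (2 * x ^ 3) \<le> exp (2 * \<theta> * L) ^ 2 * (2 * x ^ 3)" using x1 by (intro mult_right_mono) auto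
      also have "\<dots> = exp (4 * \<theta> * L) * (2 * exp (3 * (a * L)))"
        by (simp add: sq x_def exp_of_nat_mult[symmetric])
      also have "\<dots> = X" by (simp add: X_def exp_add[symmetric] algebra_simps)
      finally show "e ^ 2 * (2 * x ^ 3) \<le> X" .
    qed
    have X: "sqrt X \<le> 3 / 2 * exp ((2 * \<theta> + 3 / 2 * a) * L)" "1 + ln X \<le> 2 + L"
    proof -
      have "X = 2 * exp ((2 * \<theta> + 3 / 2 * a) * L) ^ 2" unfolding sq X_def by (simp add: algebra_simps)
      thus "sqrt X \<le> 3 / 2 * exp ((2 * \<theta> + 3 / 2 * a) * L)"
        by (intro real_le_lsqrt) (auto simp: power_mult_distrib power2_eq_square)
      have "ln X = ln 2 + (4 * \<theta> + 3 * a) * L" by (simp add: X_def ln_mult)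
      moreover have "(4 * \<theta> + 3 * a) * L \<le> 1 * L" using \<theta> a L1 by (intro mult_right_mono) auto
      moreover have "ln (2::real) \<le> 1" using ln_le_minus_one[of "2::real"] by simp
      ultimately show "1 + ln X \<le> 2 + L" by simp
    qed
    define g where "g = 1 / 2 + 3 * a / 4"
    have FE: "family_error D Y (e ^ 2 * (2 * x ^ 3)) \<le> (12 * L + 7) * exp ((g + 2 * \<theta>) * L)"
    proof -
      have "family_error D Y (e ^ 2 * (2 * x ^ 3)) \<le> family_error D Y X" by (rule family_error_mono[OF XX])
      also have "\<dots> = real Y * (2 * sqrt X * (1 + ln X)) + D / real Y" by (simp add: family_error_def)
      also have "\<dots> \<le> 2 * exp (y * L) * (2 * (3 / 2 * exp ((2 * \<theta> + 3 / 2 * a) * L)) * (2 + L)) + D / exp (y * L)"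
      proof (rule add_mono)
        have X1: "1 \<le> X" using XX by linarith
        have "0 \<le> ln X" using X1 by simp
        thus "real Y * (2 * sqrt X * (1 + ln X)) \<le> 2 * exp (y * L) * (2 * (3 / 2 * exp ((2 * \<theta> + 3 / 2 * a) * L)) * (2 + L))"
          using X X1 Y L1 by (intro mult_mono[of "real Y"] mult_mono[of "2 * sqrt X"] mult_left_mono) auto
        have "0 < real Y" using Y(1) exp_gt_zero[of "y * L"] by linarith
        thus "D / real Y \<le> D / exp (y * L)" using Y(1) by (intro divide_left_mono mult_pos_pos) (auto simp: D_def)
      qed
      also have "2 * exp (y * L) * (2 * (3 / 2 * exp ((2 * \<theta> + 3 / 2 * a) * L)) * (2 + L)) = (6 * L + 12) * exp ((g + 2 * \<theta>) * L)"
      proof -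
        have "exp (y * L) * exp ((2 * \<theta> + 3 / 2 * a) * L) = exp ((g + 2 * \<theta>) * L)"
          by (simp add: exp_add[symmetric] y_def g_def field_simps)
        thus ?thesis by (simp add: field_simps)
      qed
      also have "D / exp (y * L) \<le> exp ((g + 2 * \<theta>) * L)"
      proof -
        have "D / exp (y * L) = exp (g * L)" by (simp add: D_def exp_diff[symmetric] y_def g_def field_simps)
        also have "\<dots> \<le> exp ((g + 2 * \<theta>) * L)" using \<theta>0 L1 by simp
        finally show ?thesis .
      qed
      also have "(6 * L + 12) * exp ((g + 2 * \<theta>) * L) + exp ((g + 2 * \<theta>) * L) = (6 * L + 13) * exp ((g + 2 * \<theta>) * L)"
        by (simp add: algebra_simps)
      also have "\<dots> \<le> (12 * L + 7) * exp ((g + 2 * \<theta>) * L)" using L1 by (intro mult_right_mono) auto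
      finally show ?thesis by simp
    qed
    have "ER = ((real Jt + 1) * 9 * e) ^ 2 * (27 * (C + M) * (x * sqrt x)) * family_error D Y (e ^ 2 * (2 * x ^ 3)) * (8 / D)"
      unfolding ER_def e_def[symmetric] by (simp add: mult.assoc)
    also have "\<dots> \<le> (L * 9 * exp (2 * \<theta> * L)) ^ 2 * (27 * (C + M) * exp (3 / 2 * a * L)) * ((12 * L + 7) * exp ((g + 2 * \<theta>) * L)) * (8 / D)"
      unfolding xs
    proof (intro mult_right_mono mult_mono f1 FE)
      have "0 \<le> ln (e ^ 2 * (2 * x ^ 3))" using XX by simp
      thus "0 \<le> family_error D Y (e ^ 2 * (2 * x ^ 3))" using XX
        unfolding family_error_def by (intro add_nonneg_nonneg mult_nonneg_nonneg divide_nonneg_nonneg) (auto simp: D_def)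
    qed (use C0 M0 in \<open>auto simp: D_def\<close>)
    also have "\<dots> = 17496 * L ^ 2 * (C + M) * (12 * L + 7) * (exp (4 * \<theta> * L) * exp (3 / 2 * a * L) * exp ((g + 2 * \<theta>) * L) * exp (- L))"
    proof -
      have "(L * 9 * u) ^ 2 * (27 * k * v) * (n * z) * (8 * r) = 17496 * L ^ 2 * k * n * (u ^ 2 * v * z * r)"
        for u k v n z r :: real
      proof -
        have "(L * 9 * u) ^ 2 * (27 * k * v) * (n * z) * (8 * r) = (9 ^ 2 * 27 * 8) * (L ^ 2 * k * n * (u ^ 2 * v * z * r))"
          by (simp only: power_mult_distrib mult_ac)
        thus ?thesis by simp
      qed
      moreover have "8 / D = 8 * exp (- L)" by (simp add: D_def exp_minus divide_inverse)
      moreover have "exp (4 * \<theta> * L) = exp (2 * \<theta> * L) ^ 2" unfolding sq by simp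
      ultimately show ?thesis by (simp only:)
    qed
    also have "exp (4 * \<theta> * L) * exp (3 / 2 * a * L) * exp ((g + 2 * \<theta>) * L) * exp (- L) = exp (- (6 * \<theta> * L))"
    proof -
      have "4 * \<theta> * L + 3 / 2 * a * L + (g + 2 * \<theta>) * L + - L = (6 * \<theta> + (3 / 2 * a + g - 1)) * L" by (simp add: algebra_simps)
      also have "3 / 2 * a + g - 1 = - (12 * \<theta>)" unfolding \<theta> g_def by simp
      finally have "4 * \<theta> * L + 3 / 2 * a * L + (g + 2 * \<theta>) * L + - L = - (6 * \<theta> * L)" by (simp add: algebra_simps)
      thus ?thesis by (simp only: exp_add[symmetric])
    qed
    also have "17496 * L ^ 2 * (C + M) * (12 * L + 7) * exp (- (6 * \<theta> * L)) \<le> exp (6 * \<theta> * L) * exp (- (6 * \<theta> * L))"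
      using A9 unfolding M_def by (intro mult_right_mono) auto
    also have "\<dots> = 1" by (simp add: exp_minus)
    finally show ?thesis .
  qed
  \<comment> \<open>Each prime of \<open>T\<close> yields at least this much, and their mass is at
    least 1 / L^2 after the pigeonhole step. Against it stand only terms of order L and M, with M
    the square root of exp(\<rho> s / 3); this contradicts A10.\<close>
  define E\<^sub>0 where "E\<^sub>0 = exp (\<rho> / 3 * s - 1) / 24 ^ 9"
  have E0: "0 < E\<^sub>0" by (simp add: E\<^sub>0_def)
  have "E\<^sub>0 / L ^ 2 \<le> E\<^sub>0 * w"
  proof -
    have J: "0 < real J + 1" "real J + 1 \<le> L"
    proof -
      have "0 \<le> 2 * \<rho> * s" using \<rho> s0 by simp
      thus "real J + 1 \<le> L" using A11 unfolding J_def by linarith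
    qed simp
    have "1 / L / L \<le> (\<Sum>p\<in>T\<^sub>0. 1 / real p) / (real J + 1)"
    proof (rule frac_le)
      show "0 \<le> (\<Sum>p\<in>T\<^sub>0. 1 / real p)" by (intro sum_nonneg) auto
    qed (use w0 J L1 in auto)
    hence "1 / L ^ 2 \<le> w" using iT(4) unfolding w_def by (simp add: power2_eq_square)
    hence "E\<^sub>0 * (1 / L ^ 2) \<le> E\<^sub>0 * w" using E0 by (intro mult_left_mono) auto
    thus ?thesis by simp
  qed
  also have "\<dots> = (\<Sum>p\<in>T. E\<^sub>0 * (1 / real p))" by (simp only: w_def sum_distrib_left)
  also have "\<dots> \<le> (\<Sum>p\<in>T. \<bar>smoothed_sum (\<lambda>p. \<kappa> * b p) \<phi> (x / real p)\<bar> / real p)"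
  proof (rule sum_mono)
    fix p assume "p \<in> T"
    hence "E\<^sub>0 \<le> \<bar>smoothed_sum (\<lambda>p. \<kappa> * b p) \<phi> (x / real p)\<bar>" unfolding E\<^sub>0_def \<kappa>_def by (rule iT(3))
    thus "E\<^sub>0 * (1 / real p) \<le> \<bar>smoothed_sum (\<lambda>p. \<kappa> * b p) \<phi> (x / real p)\<bar> / real p"
      by (simp add: divide_right_mono)
  qed
  also have "\<dots> \<le> (10 * L\<^sub>0 * L + M) * 2 + 1 + 1"
  proof -
    have "(\<bar>smoothed_sum (\<lambda>p. \<kappa> * b p) \<phi> x\<bar> + M) * (1 + w) \<le> (10 * L\<^sub>0 * L + M) * 2"
      using sm_x w1 M0 L0 L1 by (intro mult_mono) auto
    thus ?thesis using main TR ER by linarith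
  qed
  also have "\<dots> = 20 * L\<^sub>0 * L + 2 * M + 2" by simp
  finally have "E\<^sub>0 \<le> L ^ 2 * (20 * L\<^sub>0 * L + 2 * M + 2)" using L1 by (simp add: pos_divide_le_eq mult.commute)
  hence "exp (\<rho> / 3 * s - 1) \<le> 24 ^ 9 * (L ^ 2 * (20 * L\<^sub>0 * L + 2 * M + 2))"
    unfolding E\<^sub>0_def by (subst (asm) pos_divide_le_eq) (simp_all only: mult.commute zero_less_power zero_less_numeral)
  thus False using A10 unfolding M_def by (simp only: mult.assoc)
qed

text \<open>Most conditions compare the separated scales log L, s, s log L, L / log L and L, so
  their constants are immaterial. The same scale stands on both sides in A1, where a < 1 decides,
  and in A10, where \<rho>/6 < \<rho>/3 decides and thus fixes the exponent of M.\<close>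

lemma eventually_exists_small_sum:
  fixes a L\<^sub>0 \<epsilon> \<rho> :: real and \<phi> :: "real \<Rightarrow> real"
  assumes lip: "\<And>x y. 0 \<le> x \<Longrightarrow> 0 \<le> y \<Longrightarrow> \<bar>\<phi> x - \<phi> y\<bar> \<le> L\<^sub>0 * \<bar>x - y\<bar>" and L0: "0 \<le> L\<^sub>0" and \<epsilon>: "0 < \<epsilon>" "\<epsilon> \<le> 2"
    and one: "\<And>x. 0 \<le> x \<Longrightarrow> x < \<epsilon> \<Longrightarrow> \<phi> x = 1" and zero: "\<And>x. x > 2 \<Longrightarrow> \<phi> x = 0"
    and a: "0 < a" "a < 2 / 9" and \<rho>: "\<rho> = sqrt ((1 / 2 - 9 * a / 4) / 1200) / (16 * 24 ^ 6)"
  shows "\<forall>\<^sub>F L in at_top. \<exists>m\<in>sqfree_family (exp L). (\<Sum>n=1..nat \<lfloor>2 * exp (a * L)\<rfloor>.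
     real_of_int (kronecker (8 * m) n) / sqrt (real n) * \<phi> (real n / exp (a * L))) \<le> - exp (\<rho> / 6 * sqrt (L / ln L))"
proof -
  define \<theta> where "\<theta> = (1 / 2 - 9 * a / 4) / 12"
  define c0 where "c0 = \<theta> / 100"
  have \<theta>: "0 < \<theta>" using a by (simp add: \<theta>_def)
  have c0: "0 < c0" using \<theta> by (simp add: c0_def)
  have \<rho>c: "\<rho> = sqrt c0 / (16 * 24 ^ 6)" by (simp add: \<rho> c0_def \<theta>_def)
  have \<rho>0: "0 < \<rho>" "sqrt c0 = 16 * 24 ^ 6 * \<rho>" using c0 by (simp_all add: \<rho>c)
  \<comment> \<open>On [0, 2] the cutoff is compared with its zero at 3, at distance at most
    3.\<close>
  define C where "C = 3 * L\<^sub>0"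
  have C0: "0 \<le> C" using L0 by (simp add: C_def)
  have C: "\<bar>\<phi> y\<bar> \<le> C" if y: "0 \<le> y" for y
  proof (cases "y \<le> 2")
    case True
    have "\<bar>\<phi> y\<bar> \<le> L\<^sub>0 * \<bar>y - 3\<bar>" using lip[of y 3] y zero[of 3] by simp
    also have "\<dots> \<le> L\<^sub>0 * 3" using True y L0 by (intro mult_left_mono) auto
    finally show ?thesis by (simp add: C_def)
  qed (use zero C0 in simp)
  have "\<exists>V>0. \<forall>v\<ge>V. \<forall>h :: nat \<Rightarrow> real. (\<forall>k\<ge>1. 0 \<le> h k \<and> h k \<le> 1) \<longrightarrow> (\<forall>p. prime p \<longrightarrow> 2 < p \<longrightarrow> 3 / 4 \<le> h p) \<longrightarrow>
    1 \<le> (\<Sum>k | 1 \<le> k \<and> real k ^ 2 \<le> 2 * v. h k / real k * \<phi> (real k ^ 2 / v))"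
    by (rule cutoff_square_sum_ge_1[OF C \<epsilon> one])
  then obtain V where V: "V > 0" and psi: "\<forall>v\<ge>V. \<forall>h :: nat \<Rightarrow> real. (\<forall>k\<ge>1. 0 \<le> h k \<and> h k \<le> 1) \<longrightarrow> (\<forall>p. prime p \<longrightarrow> 2 < p \<longrightarrow> 3 / 4 \<le> h p) \<longrightarrow>
    1 \<le> (\<Sum>k | 1 \<le> k \<and> real k ^ 2 \<le> 2 * v. h k / real k * \<phi> (real k ^ 2 / v))"
    by (elim exE conjE)
  have A1: "\<forall>\<^sub>F L in at_top. 2 * exp (a * L) \<le> exp L"
  proof -
    have "0 < 1 - a" using a by simp
    hence "\<forall>\<^sub>F L in at_top. 2 \<le> exp ((1 - a) * L)" by real_asymp
    thus ?thesis by eventually_elim (simp add: left_diff_distrib exp_diff field_simps)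
  qed
  have A2: "\<forall>\<^sub>F L in at_top. 2 * exp (4 * \<rho> * (sqrt (L / ln L) * ln L)) < exp (a * L)"
    using a \<rho>0 by real_asymp
  have A3: "\<forall>\<^sub>F L in at_top. L ^ 2 * exp (2 * \<rho> * (sqrt (L / ln L) * ln L)) \<le> exp (a * L)"
    using a \<rho>0 by real_asymp
  have A4: "\<forall>\<^sub>F L in at_top. a + 6 \<le> \<rho> * (sqrt (L / ln L) * ln L)"
    using \<rho>0 by real_asymp
  have A5: "\<forall>\<^sub>F L in at_top. 3 * \<rho> * (sqrt (L / ln L) * ln L) + 6 \<le> a * L"
    using a \<rho>0 by real_asymp
  have A6: "\<forall>\<^sub>F L in at_top. 4 * sqrt c0 * (sqrt (L / ln L) * ln L) \<le> L"
    using c0 by real_asymp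
  have A7: "\<forall>\<^sub>F L in at_top. (\<epsilon> * exp (a * L) / 2) powr (-1/4) * exp (2 * sqrt c0 * sqrt (L / ln L) * sqrt L + 6) \<le> 1"
    using a \<epsilon> c0 by real_asymp
  have A14: "\<forall>\<^sub>F L::real in at_top. 12 \<le> ln L" "\<forall>\<^sub>F L::real in at_top. 6 \<le> L"
    by real_asymp+
  have A8: "\<forall>\<^sub>F L in at_top. 8 * (C + exp (\<rho> / 6 * sqrt (L / ln L))) * (1 + L) * exp (8 * sqrt c0 * sqrt (L / ln L))
      \<le> exp (\<theta> / 4 * (L / ln L))"
  proof -
    \<comment> \<open>Both exponentials in s are merged into one; it is dominated because s is only
      the square root of L / ln L.\<close>
    define k where "k = \<rho> / 6 + 8 * sqrt c0"
    have k: "0 < k" using \<rho>0 c0 by (simp add: k_def add_pos_pos)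
    have "\<forall>\<^sub>F L in at_top. 8 * (C + 1) * (1 + L) * exp (k * sqrt (L / ln L)) \<le> exp (\<theta> / 4 * (L / ln L))"
      using C0 \<theta> k by real_asymp
    thus ?thesis using A14
    proof eventually_elim
      case (elim L)
      define s where "s = sqrt (L / ln L)"
      have s: "0 \<le> s" using elim by (simp add: s_def)
      have "C * 1 \<le> C * exp (\<rho> / 6 * s)" using C0 \<rho>0 s by (intro mult_left_mono) auto
      hence "C + exp (\<rho> / 6 * s) \<le> (C + 1) * exp (\<rho> / 6 * s)" by (simp add: distrib_right)
      hence "8 * (C + exp (\<rho> / 6 * s)) * (1 + L) * exp (8 * sqrt c0 * s)
          \<le> 8 * ((C + 1) * exp (\<rho> / 6 * s)) * (1 + L) * exp (8 * sqrt c0 * s)"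
        using elim by (intro mult_right_mono mult_left_mono) auto
      also have "\<dots> = 8 * (C + 1) * (1 + L) * (exp (\<rho> / 6 * s) * exp (8 * sqrt c0 * s))" by (simp only: mult_ac)
      also have "exp (\<rho> / 6 * s) * exp (8 * sqrt c0 * s) = exp (k * s)" by (simp add: k_def distrib_right exp_add)
      finally show ?case using elim unfolding s_def by linarith
    qed
  qed
  have A9: "\<forall>\<^sub>F L in at_top. 17496 * L ^ 2 * (C + exp (\<rho> / 6 * sqrt (L / ln L))) * (12 * L + 7) \<le> exp (6 * \<theta> * L)"
    using C0 \<rho>0 \<theta> by real_asymp
  have A10: "\<forall>\<^sub>F L in at_top. 24 ^ 9 * L ^ 2 * (20 * L\<^sub>0 * L + 2 * exp (\<rho> / 6 * sqrt (L / ln L)) + 2) < exp (\<rho> / 3 * sqrt (L / ln L) - 1)"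
    using L0 \<rho>0 by real_asymp
  have A11: "\<forall>\<^sub>F L in at_top. 2 * \<rho> * sqrt (L / ln L) + 4 \<le> L"
    using \<rho>0 by real_asymp
  have A12: "\<forall>\<^sub>F L in at_top. V \<le> exp (\<rho> / 3 * (sqrt (L / ln L) * ln L))"
    using \<rho>0 V by real_asymp
  have A13: "\<forall>\<^sub>F L in at_top. \<theta> * (L / ln L) + 1 \<le> L"
    using \<theta> by real_asymp
  have A15: "\<forall>\<^sub>F L in at_top. \<rho> / 3 * 16 * sqrt (L / ln L) \<le> L"
    using \<rho>0 by real_asymp
  from A1 A2 A3 A4 A5 A6 A7 A8 A9 A10 A11 A12 A13 A14 A15 show ?thesis
  proof eventually_elim
    case (elim L)
    have 12: "12 * \<theta> = 1 / 2 - 9 * a / 4" by (simp add: \<theta>_def)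
    show ?case
      by (rule exists_small_sum_if_bounds[OF lip L0 \<epsilon>(1) one zero C V psi a 12 c0 c0_def \<rho>0 refl refl])
         (use elim in \<open>simp_all only:\<close>)
  qed
qed

text \<open>The even branch of the definition applies to 2 m, which is 2 modulo 4, and squarefree
  because \<open>m\<close> is odd.\<close>

lemma fundamental_discriminant_8_times:
  assumes "odd m" "squarefree m"
  shows "fundamental_discriminant (8 * m)"
proof -
  have "coprime 2 m" using assms(1) by simp
  moreover have "squarefree (2 :: int)" by (rule squarefree_prime) simp
  ultimately have "squarefree (2 * m)" using assms(2) by (simp add: squarefree_mult_coprime)
  moreover have "(2 * m) mod 4 = 2" using assms(1) by presburger
  moreover have "8 * m = 4 * (2 * m)" by simp
  ultimately show ?thesis unfolding fundamental_discriminant_def by blast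
qed

theorem theorem1:
  fixes a :: real
  assumes "0 < a" and "a < 2 / 9"
  shows "\<exists>c>0. \<forall>\<phi> :: real \<Rightarrow> real.
    smooth_real_on {0..} \<phi> \<and>
    (\<exists>\<epsilon>>0. \<forall>x\<in>{0..<\<epsilon>}. \<phi> x = 1) \<and>
    (\<forall>x>2. \<phi> x = 0) \<longrightarrow>
    (\<exists>\<eta> :: real \<Rightarrow> real. (\<eta> \<longlongrightarrow> 0) at_top \<and>
      (\<forall>\<^sub>F D :: real in at_top.
        \<exists>d :: int. fundamental_discriminant d \<and>
          4 * D \<le> \<bar>real_of_int d\<bar> \<and> \<bar>real_of_int d\<bar> \<le> 8 * D \<and>
          (\<Sum>\<^sub>\<infinity>n\<in>{1..}. real_of_int (kronecker d n) / sqrt (real n) * \<phi> (real n / D powr a))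
            \<le> - exp ((c + \<eta> D) * sqrt (ln D / ln (ln D)))))"
proof -
  \<comment> \<open>\<rho> depends on \<open>a\<close> alone, so the constant \<rho>/6, the exponent
    of M, serves all cutoffs at once.\<close>
  define \<rho> where "\<rho> = sqrt ((1 / 2 - 9 * a / 4) / 1200) / (16 * 24 ^ 6)"
  have \<rho>: "0 < \<rho> / 6" using assms by (simp add: \<rho>_def)
  show ?thesis
  proof (rule exI[of _ "\<rho> / 6"], intro conjI allI impI)
    show "0 < \<rho> / 6" by (rule \<rho>)
    fix \<phi> :: "real \<Rightarrow> real"
    assume \<phi>: "smooth_real_on {0..} \<phi> \<and> (\<exists>\<epsilon>>0. \<forall>x\<in>{0..<\<epsilon>}. \<phi> x = 1) \<and> (\<forall>x>2. \<phi> x = 0)"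
    hence zero: "\<And>x. x > 2 \<Longrightarrow> \<phi> x = 0" by blast
    obtain L\<^sub>0 where L0: "0 \<le> L\<^sub>0" and lip: "\<And>x y. 0 \<le> x \<Longrightarrow> 0 \<le> y \<Longrightarrow> \<bar>\<phi> x - \<phi> y\<bar> \<le> L\<^sub>0 * \<bar>x - y\<bar>"
      using smooth_cutoff_lipschitz[of \<phi>] \<phi> by blast
    obtain \<epsilon> where \<epsilon>: "\<epsilon> > 0" "\<forall>x\<in>{0..<\<epsilon>}. \<phi> x = 1" using \<phi> by blast
    have "\<forall>\<^sub>F L in at_top. \<exists>m\<in>sqfree_family (exp L). (\<Sum>n=1..nat \<lfloor>2 * exp (a * L)\<rfloor>.
     real_of_int (kronecker (8 * m) n) / sqrt (real n) * \<phi> (real n / exp (a * L))) \<le> - exp (\<rho> / 6 * sqrt (L / ln L))"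
      using \<epsilon> by (intro eventually_exists_small_sum[OF lip L0 _ _ _ zero assms \<rho>_def, where \<epsilon> = "min \<epsilon> 2"]) auto
    hence ev: "\<forall>\<^sub>F D in at_top. \<exists>m\<in>sqfree_family (exp (ln D)). (\<Sum>n=1..nat \<lfloor>2 * exp (a * ln D)\<rfloor>.
     real_of_int (kronecker (8 * m) n) / sqrt (real n) * \<phi> (real n / exp (a * ln D))) \<le> - exp (\<rho> / 6 * sqrt (ln D / ln (ln D)))"
      by (rule eventually_compose_filterlim[OF _ ln_at_top])
    have "\<forall>\<^sub>F D in at_top. \<exists>d. fundamental_discriminant d \<and>
          4 * D \<le> \<bar>real_of_int d\<bar> \<and> \<bar>real_of_int d\<bar> \<le> 8 * D \<and>
          (\<Sum>\<^sub>\<infinity>n\<in>{1..}. real_of_int (kronecker d n) / sqrt (real n) * \<phi> (real n / D powr a))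
            \<le> - exp ((\<rho> / 6 + 0) * sqrt (ln D / ln (ln D)))"
      using ev eventually_gt_at_top[of 0]
    proof eventually_elim
      case (elim D)
      define x where "x = D powr a"
      have x: "exp (a * ln D) = x" "0 < x" using elim(2) by (auto simp: x_def powr_def)
      obtain m where m: "m \<in> sqfree_family D"
        and le: "(\<Sum>n=1..nat \<lfloor>2 * x\<rfloor>. real_of_int (kronecker (8 * m) n) / sqrt (real n) * \<phi> (real n / x))
           \<le> - exp (\<rho> / 6 * sqrt (ln D / ln (ln D)))"
        using elim unfolding x(1) by auto
      \<comment> \<open>The cutoff vanishes for n > 2 x, so the infinite sum has finite
        support.\<close>
      have "(\<Sum>\<^sub>\<infinity>n\<in>{1..}. real_of_int (kronecker (8 * m) n) / sqrt (real n) * \<phi> (real n / x))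
          = (\<Sum>\<^sub>\<infinity>n\<in>{1..nat \<lfloor>2 * x\<rfloor>}. real_of_int (kronecker (8 * m) n) / sqrt (real n) * \<phi> (real n / x))"
      proof (rule infsum_cong_neutral)
        fix n assume "n \<in> {1..} - {1..nat \<lfloor>2 * x\<rfloor>}"
        hence "\<not> real n \<le> 2 * x" using x(2) by (auto simp: le_nat_iff le_floor_iff)
        hence "2 < real n / x" using x(2) by (simp add: pos_less_divide_eq)
        thus "real_of_int (kronecker (8 * m) n) / sqrt (real n) * \<phi> (real n / x) = 0" by (simp add: zero)
      qed auto
      also have "\<dots> = (\<Sum>n=1..nat \<lfloor>2 * x\<rfloor>. real_of_int (kronecker (8 * m) n) / sqrt (real n) * \<phi> (real n / x))"
        by simp
      finally have "(\<Sum>\<^sub>\<infinity>n\<in>{1..}. real_of_int (kronecker (8 * m) n) / sqrt (real n) * \<phi> (real n / x))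
           \<le> - exp ((\<rho> / 6 + 0) * sqrt (ln D / ln (ln D)))" using le by simp
      moreover have "fundamental_discriminant (8 * m)" "4 * D \<le> \<bar>real_of_int (8 * m)\<bar>" "\<bar>real_of_int (8 * m)\<bar> \<le> 8 * D"
        using m elim(2) by (auto simp: sqfree_family_def intro: fundamental_discriminant_8_times)
      ultimately show ?case unfolding x_def by blast
    qed
    thus "\<exists>\<eta> :: real \<Rightarrow> real. (\<eta> \<longlongrightarrow> 0) at_top \<and>
      (\<forall>\<^sub>F D :: real in at_top.
        \<exists>d :: int. fundamental_discriminant d \<and>
          4 * D \<le> \<bar>real_of_int d\<bar> \<and> \<bar>real_of_int d\<bar> \<le> 8 * D \<and>
          (\<Sum>\<^sub>\<infinity>n\<in>{1..}. real_of_int (kronecker d n) / sqrt (real n) * \<phi> (real n / D powr a))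
            \<le> - exp ((\<rho> / 6 + \<eta> D) * sqrt (ln D / ln (ln D))))"
      \<comment> \<open>The bound holds with the constant \<rho>/6 itself for all large D, so the
        zero function is a witness for \<eta>.\<close>
      by (intro exI[of _ "\<lambda>_. 0"] conjI tendsto_const)
  qed
qed

end
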